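(* Suppose $n=\lfloor \gamma m\rfloor$ for an absolute constant $\gamma\ge 1$, $q:=\gamma^{1/4}$, $N=n+m$, and $p=d/\sqrt{mn}$ with $d=b\log(N)$ for a constant $b>0$ independent of $n,m$. Let $r_2^{\star}:=[(q^{2}+1)\log(1+q^{-2})-1]^{-1}$. Then there exists $\nu>0$ such that the following holds with probability at least $1-N^{-\nu}$ for sufficiently large $N$: (1) (No outlier) If $b>r_2^{\star}$, then $\lambda_1(H)=q+q^{-1}+o(1)$. (2) (Emergence) If $b<r_2^{\star}$, then there exists a $\nu$-dependent constant $\epsilon>0$ such that $\lambda_1(H)>q+q^{-1}+\epsilon$.
   Context: Let $G(n,m,p)$ be the random bipartite Erdős–Rényi graph on vertex set $V_1\cup V_2$ with $V_1=[n]$, $V_2=\{n+1,\dots,n+m\}$, where each edge with one endpoint in $V_1$ and the other in $V_2$ is present independently with probability $p$. Let $\widetilde A\in\{0,1\}^{n\times m}$ be its bi-adjacency matrix (i.i.d. Bernoulli$(p)$ entries), $X=(\widetilde A-\mathbb E\widetilde A)/\sqrt d$, and $H=\begin{bmatrix}0 & X\\ X^{\mathsf T} & 0\end{bmatrix}$ the centered and scaled adjacency matrix, with eigenvalues $\lambda_1(H)\ge\lambda_2(H)\ge\cdots$. The positive eigenvalues of $H$ are the singular values of $X$; the limiting singular value distribution of $X$ (Marčenko–Pastur) has support $[q-q^{-1},\,q+q^{-1}]$. *)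

theory Defs
  imports "HOL-Probability.Probability"
begin

text \<open>Random bipartite Erdos--Renyi graph G(n,m,p), represented by its bi-adjacency
  matrix: entry (i,j) with i < n (vertex i+1 of V1) and j < m (vertex n+j+1 of V2)
  is an independent Bernoulli(p) variable.\<close>
definition bip_ER :: "nat \<Rightarrow> nat \<Rightarrow> real \<Rightarrow> (nat \<times> nat \<Rightarrow> bool) pmf" where
  "bip_ER n m p = Pi_pmf ({..<n} \<times> {..<m}) False (\<lambda>_. bernoulli_pmf p)"

definition centX :: "real \<Rightarrow> real \<Rightarrow> (nat \<times> nat \<Rightarrow> bool) \<Rightarrow> nat \<Rightarrow> nat \<Rightarrow> real" where
  "centX p d A i j = (of_bool (A (i, j)) - p) / sqrt d"

text \<open>H = [[0, X],[X^T, 0]], an (n+m) x (n+m) matrix indexed by 0..n+m-1.\<close>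
definition centH :: "nat \<Rightarrow> real \<Rightarrow> real \<Rightarrow> (nat \<times> nat \<Rightarrow> bool) \<Rightarrow> nat \<Rightarrow> nat \<Rightarrow> real" where
  "centH n p d A i j =
     (if i < n \<and> n \<le> j then centX p d A i (j - n)
      else if n \<le> i \<and> j < n then centX p d A j (i - n)
      else 0)"

definition eigenvalues :: "nat \<Rightarrow> (nat \<Rightarrow> nat \<Rightarrow> real) \<Rightarrow> real set" where
  "eigenvalues N M = {\<mu>. \<exists>v :: nat \<Rightarrow> real. (\<exists>i<N. v i \<noteq> 0) \<and>
        (\<forall>i<N. (\<Sum>j<N. M i j * v j) = \<mu> * v i)}"

definition lambda1 :: "nat \<Rightarrow> (nat \<Rightarrow> nat \<Rightarrow> real) \<Rightarrow> real" where
  "lambda1 N M = Max (eigenvalues N M)"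

end

theory Submission
  imports Defs "HOL-Real_Asymp.Real_Asymp"
begin

text \<open>Upper bound: by an Ihara--Bass argument the quadratic form of \<open>H\<close> is controlled by the degrees as soon
  as a power of the nonbacktracking operator of \<open>s H\<close>, \<open>s < 1\<close>, has small Hilbert--Schmidt norm. Its expectation
  is bounded by a trace expansion with walks of logarithmic length. Vertices of typical degree then contribute at
  most \<open>q + 1/q + o(1)\<close>. The vertices of exceptionally large degree are few and have almost tree-like
  neighbourhoods, where an explicit positive weight certifies the same bound as long as all degrees stay
  below \<open>(1 + q^2) d\<close> in the second part and \<open>(1 + q^(-2)) d\<close> in the first. By Chernoff's bound this holds for
  \<open>b\<close> above the threshold, which is the reciprocal of the rate \<open>rate (1 + q^2) (q^2)\<close>.

  Lower bound: a vertex of degree at least \<open>\<beta> d\<close> in the second part with \<open>b * rate \<beta> (q^2) < 1\<close> exists, and its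
  neighbourhood contains a tree whose arities alternate between \<open>d / q^2\<close> and \<open>q^2 d\<close>. Slowly varying
  radial test functions on this tree give \<open>q + 1/q - o(1)\<close>, and for \<open>\<beta> > 1 + q^2\<close> the root makes a gain that
  beats the boundary term.\<close>

section \<open>The largest eigenvalue as a Rayleigh maximum\<close>

text \<open>For \<open>d\<close> of order log N the degrees do not concentrate, so the exceptional
  vertices need a treatment apart from the bulk. Both bounds meet at the same threshold. In the
  upper bound a vertex of degree D d in the second part, weighted by 1/q and charged only for its
  children, costs D/q, which stays within q + 1/q exactly for D <= 1 + q^2. In the lower bound a
  root of degree \<beta> d joined with optimal amplitude to a profile starting at 1 gains \<beta> /
  (q + 1/q), while the first level loses q for its lost upward edge; the balance is positive exactly
  for \<beta> > 1 + q^2. The critical degree of the first part, 1 + q^(-2), is at least as rare, so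
  the second part decides. In the trace expansion walks are not sorted into isomorphism classes:
  each expected walk weight is compared with the probability of that walk under a process of total
  mass at most 2, so no count of walks is required. All failure exponents are fixed before the
  accuracy \<epsilon>, which a diagonal choice finally turns into an o(1).\<close>

definition bil :: "nat \<Rightarrow> (nat \<Rightarrow> nat \<Rightarrow> real) \<Rightarrow> (nat \<Rightarrow> real) \<Rightarrow> (nat \<Rightarrow> real) \<Rightarrow> real" where
  "bil N M v w = (\<Sum>i<N. \<Sum>j<N. v i * M i j * w j)"

abbreviation qform :: "nat \<Rightarrow> (nat \<Rightarrow> nat \<Rightarrow> real) \<Rightarrow> (nat \<Rightarrow> real) \<Rightarrow> real" where
  "qform N M v \<equiv> bil N M v v"

definition sqn :: "nat \<Rightarrow> (nat \<Rightarrow> real) \<Rightarrow> real" where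
  "sqn N v = (\<Sum>i<N. (v i)\<^sup>2)"

definition symm_upto :: "nat \<Rightarrow> (nat \<Rightarrow> nat \<Rightarrow> real) \<Rightarrow> bool" where
  "symm_upto N M \<longleftrightarrow> (\<forall>i<N. \<forall>j<N. M i j = M j i)"

lemma bil_add: "bil N M (\<lambda>i. v i + u i) w = bil N M v w + bil N M u w"
  "bil N M w (\<lambda>i. v i + u i) = bil N M w v + bil N M w u"
  by (simp_all add: bil_def algebra_simps sum.distrib)

lemma bil_scale: "bil N M (\<lambda>i. c * v i) w = c * bil N M v w"
  "bil N M v (\<lambda>i. c * w i) = c * bil N M v w"
  by (simp_all add: bil_def algebra_simps sum_distrib_left)

lemma bil_commute: "symm_upto N M \<Longrightarrow> bil N M v w = bil N M w v"
  unfolding bil_def symm_upto_def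
  by (subst sum.swap) (intro sum.cong refl; simp add: mult_ac)

lemma bil_unit: "i < N \<Longrightarrow> bil N M (\<lambda>k. of_bool (k = i)) w = (\<Sum>j<N. M i j * w j)"
  unfolding bil_def by (simp add: mult.assoc flip: sum_distrib_left)

lemma sqn_nonneg [simp]: "sqn N v \<ge> 0"
  by (simp add: sqn_def sum_nonneg)

lemma sqn_pos: "i < N \<Longrightarrow> v i \<noteq> 0 \<Longrightarrow> sqn N v > 0"
  unfolding sqn_def by (rule sum_pos2[where i = i]) auto

lemma sqn_scale: "sqn N (\<lambda>i. c * v i) = c\<^sup>2 * sqn N v"
  by (simp add: sqn_def power_mult_distrib sum_distrib_left)

lemma sqn_bil: "sqn N v = bil N (\<lambda>i j. of_bool (i = j)) v v"
  unfolding sqn_def bil_def power2_eq_square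
  by (intro sum.cong refl) (simp add: of_bool_def if_distrib[of "\<lambda>x. _ * x"] if_distrib[of "\<lambda>x. x * _"] cong: if_cong)

text \<open>A zero of a nonnegative form is a minimum, so its first variation in every coordinate
  direction vanishes.\<close>

lemma psd_kernel:
  assumes sym: "symm_upto N M" and psd: "\<And>w. qform N M w \<ge> 0" and zero: "qform N M v = 0"
    and i: "i < N"
  shows "(\<Sum>j<N. M i j * v j) = 0"
proof (rule ccontr)
  define a where "a = (\<Sum>j<N. M i j * v j)"
  define e where "e = (\<lambda>k. of_bool (k = i) :: real)"
  assume "(\<Sum>j<N. M i j * v j) \<noteq> 0"
  hence a: "a \<noteq> 0" by (simp add: a_def)
  have ev: "bil N M e v = a" unfolding e_def a_def by (rule bil_unit[OF i])
  have ve: "bil N M v e = a" using bil_commute[OF sym] ev by metis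
  define c where "c = qform N M e"
  have c0: "c \<ge> 0" using psd by (simp add: c_def)
  have *: "2 * t * a + t\<^sup>2 * c \<ge> 0" for t
  proof -
    have "qform N M (\<lambda>k. v k + t * e k) = 2 * t * a + t\<^sup>2 * c"
      by (simp add: bil_add bil_scale ev ve zero c_def power2_eq_square)
    thus ?thesis using psd by metis
  qed
  \<comment> \<open>Close to the minimiser - a / c of the quadratic in \<open>t\<close>; the
    \<open>+ 1\<close> covers \<open>c = 0\<close>.\<close>
  define t where "t = - a / (c + 1)"
  have ct: "(c + 1) * t = - a" using c0 by (simp add: t_def)
  have "0 \<le> (c + 1) * (2 * t * a + t\<^sup>2 * c)" using *[of t] c0 by (intro mult_nonneg_nonneg) auto
  also have "\<dots> = ((c + 1) * t) * (2 * a + t * c)" by (simp add: algebra_simps power2_eq_square)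
  also have "\<dots> = - (a * (2 * a + t * c))" by (simp only: ct mult_minus_left)
  also have "t * c = - a - t" using ct by (simp add: algebra_simps)
  also have "- (a * (2 * a + (- a - t))) = - a\<^sup>2 + a * t" by (simp add: algebra_simps power2_eq_square)
  also have "a * t = - (a\<^sup>2 / (c + 1))" by (simp add: t_def power2_eq_square)
  finally have "a\<^sup>2 + a\<^sup>2 / (c + 1) \<le> 0" by simp
  moreover have "a\<^sup>2 / (c + 1) \<ge> 0" using c0 by simp
  moreover have "a\<^sup>2 > 0" using a by simp
  ultimately show False by linarith
qed

text \<open>Vectors are functions on all natural numbers. Fixing the coordinates from
  \<open>N\<close> on to 0 confines them to a product of compact sets, so Tychonoff's theorem
  applies in the product topology.\<close>

lemma compact_unit_vectors:
  "compact {v :: nat \<Rightarrow> real. (\<forall>i\<ge>N. v i = 0) \<and> sqn N v = 1}"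
proof -
  let ?S = "\<lambda>i. if i < N then {-1..1::real} else {0}"
  let ?B = "PiE UNIV ?S"
  have "compactin (product_topology (\<lambda>_. euclidean) UNIV) ?B"
    by (subst compactin_PiE) auto
  hence cB: "compact ?B" by (simp add: euclidean_product_topology)
  have "closed {v :: nat \<Rightarrow> real. sqn N v = 1}"
    unfolding sqn_def by (intro closed_Collect_eq continuous_intros continuous_on_product_coordinates)
  hence "compact (?B \<inter> {v. sqn N v = 1})" using cB by (simp add: compact_Int_closed)
  moreover have "?B \<inter> {v. sqn N v = 1} = {v. (\<forall>i\<ge>N. v i = 0) \<and> sqn N v = 1}"
  proof (intro set_eqI iffI)
    fix v :: "nat \<Rightarrow> real"
    assume "v \<in> {v. (\<forall>i\<ge>N. v i = 0) \<and> sqn N v = 1}"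
    hence z: "\<forall>i\<ge>N. v i = 0" and s: "sqn N v = 1" by auto
    have "v i \<in> (if i < N then {-1..1} else {0})" for i
    proof (cases "i < N")
      case True
      have "(v i)\<^sup>2 \<le> sqn N v" unfolding sqn_def using True by (intro member_le_sum) auto
      hence "\<bar>v i\<bar> \<le> 1" using s abs_le_square_iff[of "v i" 1] by simp
      thus ?thesis using True by auto
    qed (use z in auto)
    thus "v \<in> ?B \<inter> {v. sqn N v = 1}" using s by (simp add: PiE_UNIV_domain Pi_def)
  next
    fix v :: "nat \<Rightarrow> real"
    assume v: "v \<in> ?B \<inter> {v. sqn N v = 1}"
    hence "v i \<in> (if i < N then {-1..1} else {0})" for i by (simp add: PiE_UNIV_domain Pi_def)
    hence "v i = 0" if "i \<ge> N" for i using that by (metis linorder_not_less singletonD)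
    thus "v \<in> {v. (\<forall>i\<ge>N. v i = 0) \<and> sqn N v = 1}" using v by simp
  qed
  ultimately show ?thesis by simp
qed

lemma normalise:
  assumes "sqn N v \<noteq> 0"
  defines "u \<equiv> \<lambda>i. if i < N then v i / sqrt (sqn N v) else 0"
  shows "\<forall>i\<ge>N. u i = 0" "sqn N u = 1" "qform N M v = sqn N v * qform N M u"
proof -
  have p: "sqn N v > 0" using assms(1) sqn_nonneg[of N v] by linarith
  show "\<forall>i\<ge>N. u i = 0" by (simp add: u_def)
  have "sqn N u = (\<Sum>i<N. (v i)\<^sup>2 / sqn N v)" unfolding sqn_def[of N u]
    by (intro sum.cong refl) (use p in \<open>simp add: u_def power_divide\<close>)
  also have "\<dots> = sqn N v / sqn N v" by (simp add: sqn_def flip: sum_divide_distrib)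
  finally show "sqn N u = 1" using p by simp
  have "sqn N v * qform N M u = (\<Sum>i<N. \<Sum>j<N. sqn N v * (u i * M i j * u j))"
    by (simp add: bil_def sum_distrib_left)
  also have "\<dots> = qform N M v" unfolding bil_def
  proof (intro sum.cong refl)
    fix i j assume "i \<in> {..<N}" "j \<in> {..<N}"
    moreover have "sqrt (sqn N v) * sqrt (sqn N v) = sqn N v" using p by simp
    ultimately show "sqn N v * (u i * M i j * u j) = v i * M i j * v j"
      using p by (simp add: u_def field_simps)
  qed
  finally show "qform N M v = sqn N v * qform N M u" by simp
qed

lemma qform_zero: "sqn N v = 0 \<Longrightarrow> qform N M v = 0"
  by (simp add: sqn_def bil_def sum_nonneg_eq_0_iff)

text \<open>A maximiser \<open>v\<close> on the unit sphere is a zero of the nonnegative form of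
  \<mu> I - M, and \<open>psd_kernel\<close> makes it an eigenvector.\<close>

lemma rayleigh_max:
  assumes sym: "symm_upto N M" and N: "N > 0"
  obtains \<mu> where "\<mu> \<in> eigenvalues N M" "\<And>w. qform N M w \<le> \<mu> * sqn N w"
proof -
  let ?S = "{v :: nat \<Rightarrow> real. (\<forall>i\<ge>N. v i = 0) \<and> sqn N v = 1}"
  have ne: "?S \<noteq> {}"
  proof -
    have "sqn N (\<lambda>k. of_bool (k = 0)) = 1"
      using N by (simp add: sqn_def power2_eq_square flip: of_bool_conj)
    moreover have "\<forall>i\<ge>N. of_bool (i = 0) = (0 :: real)" using N by simp
    ultimately have "(\<lambda>k. of_bool (k = 0)) \<in> ?S" by simp
    thus ?thesis by (metis empty_iff)
  qed
  have cont: "continuous_on ?S (qform N M)"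
    unfolding bil_def
    by (intro continuous_intros continuous_on_subset[OF continuous_on_product_coordinates]) auto
  from continuous_attains_sup[OF compact_unit_vectors ne cont] obtain v
    where v: "v \<in> ?S" and max: "\<And>u. u \<in> ?S \<Longrightarrow> qform N M u \<le> qform N M v" by blast
  define \<mu> where "\<mu> = qform N M v"
  have le: "qform N M w \<le> \<mu> * sqn N w" for w
  proof (cases "sqn N w = 0")
    case True thus ?thesis by (simp add: qform_zero)
  next
    case False
    note n = normalise[OF False]
    have "qform N M (\<lambda>i. if i < N then w i / sqrt (sqn N w) else 0) \<le> \<mu>"
      unfolding \<mu>_def by (rule max) (use n in auto)
    thus ?thesis unfolding n(3)[of M] by (subst mult.commute) (rule mult_right_mono, auto)
  qed
  let ?M = "\<lambda>i j. \<mu> * of_bool (i = j) - M i j"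
  have q: "qform N ?M w = \<mu> * sqn N w - qform N M w" for w
    unfolding sqn_bil bil_def sum_distrib_left sum_subtractf[symmetric]
    by (intro sum.cong refl) (simp add: algebra_simps)
  have "(\<Sum>j<N. ?M i j * v j) = 0" if "i < N" for i
  proof (rule psd_kernel[OF _ _ _ that])
    show "symm_upto N ?M" using sym by (auto simp: symm_upto_def)
    show "qform N ?M w \<ge> 0" for w using le[of w] by (simp add: q)
    show "qform N ?M v = 0" using v by (simp only: q) (simp add: \<mu>_def)
  qed
  hence "(\<Sum>j<N. M i j * v j) = \<mu> * v i" if "i < N" for i
    using that by (simp add: left_diff_distrib sum_subtractf mult.assoc flip: sum_distrib_left)
  moreover have "\<exists>i<N. v i \<noteq> 0"
  proof (rule ccontr)
    assume "\<not> (\<exists>i<N. v i \<noteq> 0)"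
    hence "sqn N v = 0" by (simp add: sqn_def)
    thus False using v by simp
  qed
  ultimately have "\<mu> \<in> eigenvalues N M" unfolding eigenvalues_def by blast
  thus ?thesis using le that by blast
qed

lemma bil_eigenvector:
  assumes "\<And>i. i < N \<Longrightarrow> (\<Sum>j<N. M i j * v j) = \<mu> * v i"
  shows "bil N M w v = \<mu> * (\<Sum>i<N. w i * v i)"
proof -
  have "bil N M w v = (\<Sum>i<N. w i * (\<Sum>j<N. M i j * v j))"
    by (simp add: bil_def mult.assoc sum_distrib_left)
  also have "\<dots> = (\<Sum>i<N. w i * (\<mu> * v i))"
    by (intro sum.cong refl) (simp add: assms)
  finally show ?thesis by (simp add: sum_distrib_left mult_ac)
qed

lemma eigenvectors_orthogonal:
  assumes "symm_upto N M" "\<mu> \<noteq> \<nu>"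
    and v: "\<And>i. i < N \<Longrightarrow> (\<Sum>j<N. M i j * v j) = \<mu> * v i"
    and w: "\<And>i. i < N \<Longrightarrow> (\<Sum>j<N. M i j * w j) = \<nu> * w i"
  shows "(\<Sum>i<N. v i * w i) = 0"
proof -
  have "bil N M w v = \<mu> * (\<Sum>i<N. v i * w i)"
    by (subst bil_eigenvector[OF v]) (simp_all add: mult_ac)
  moreover have "bil N M v w = \<nu> * (\<Sum>i<N. v i * w i)"
    by (rule bil_eigenvector[OF w])
  ultimately show ?thesis using bil_commute[OF assms(1), of v w] assms(2) by simp
qed

text \<open>Bessel's inequality for the coordinate vectors, summed over all coordinates, bounds the
  number of eigenvalues by the dimension.\<close>

lemma finite_eigenvalues:
  assumes sym: "symm_upto N M"
  shows "finite (eigenvalues N M)"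
proof -
  have "\<forall>\<mu>\<in>eigenvalues N M. \<exists>v. sqn N v = 1 \<and> (\<forall>i<N. (\<Sum>j<N. M i j * v j) = \<mu> * v i)"
  proof
    fix \<mu> assume "\<mu> \<in> eigenvalues N M"
    then obtain v i where v: "i < N" "v i \<noteq> 0" "\<And>i. i < N \<Longrightarrow> (\<Sum>j<N. M i j * v j) = \<mu> * v i"
      unfolding eigenvalues_def by blast
    have p: "sqn N v > 0" using v(1,2) by (rule sqn_pos)
    have "sqn N (\<lambda>i. (1 / sqrt (sqn N v)) * v i) = 1"
      using p by (simp only: sqn_scale) (simp add: power_divide)
    moreover have "(\<Sum>j<N. M i j * ((1 / sqrt (sqn N v)) * v j)) = \<mu> * ((1 / sqrt (sqn N v)) * v i)"
      if "i < N" for i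
    proof -
      have "(\<Sum>j<N. M i j * ((1 / sqrt (sqn N v)) * v j)) = (1 / sqrt (sqn N v)) * (\<Sum>j<N. M i j * v j)"
        unfolding sum_distrib_left by (intro sum.cong refl) (simp add: mult_ac)
      thus ?thesis using v(3)[OF that] by (simp add: mult_ac)
    qed
    ultimately show "\<exists>v. sqn N v = 1 \<and> (\<forall>i<N. (\<Sum>j<N. M i j * v j) = \<mu> * v i)" by blast
  qed
  then obtain u where u1: "\<And>\<mu>. \<mu> \<in> eigenvalues N M \<Longrightarrow> sqn N (u \<mu>) = 1"
    and u2: "\<And>\<mu> i. \<mu> \<in> eigenvalues N M \<Longrightarrow> i < N \<Longrightarrow> (\<Sum>j<N. M i j * u \<mu> j) = \<mu> * u \<mu> i"
    by metis
  have "card F \<le> N" if F: "F \<subseteq> eigenvalues N M" "finite F" for F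
  proof -
    have orth: "(\<Sum>i<N. u \<mu> i * u \<nu> i) = of_bool (\<mu> = \<nu>)" if "\<mu> \<in> F" "\<nu> \<in> F" for \<mu> \<nu>
    proof (cases "\<mu> = \<nu>")
      case True
      thus ?thesis using u1[of \<mu>] that F by (auto simp: sqn_def power2_eq_square)
    next
      case False
      hence "(\<Sum>i<N. u \<mu> i * u \<nu> i) = 0"
        by (intro eigenvectors_orthogonal[OF sym False] u2) (use that F in auto)
      thus ?thesis using False by simp
    qed
    have bessel: "(\<Sum>\<mu>\<in>F. (u \<mu> k)\<^sup>2) \<le> 1" if k: "k < N" for k
    proof -
      define b where "b = (\<Sum>\<mu>\<in>F. (u \<mu> k)\<^sup>2)"
      have s1: "(\<Sum>i<N. of_bool (i = k) * (\<Sum>\<mu>\<in>F. u \<mu> k * u \<mu> i)) = b"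
        using k by (simp add: b_def power2_eq_square)
      have "(\<Sum>i<N. (\<Sum>\<mu>\<in>F. u \<mu> k * u \<mu> i)\<^sup>2)
          = (\<Sum>i<N. \<Sum>\<mu>\<in>F. \<Sum>\<nu>\<in>F. u \<mu> k * u \<nu> k * (u \<mu> i * u \<nu> i))"
        by (simp add: power2_eq_square sum_product mult_ac)
      also have "\<dots> = (\<Sum>\<mu>\<in>F. \<Sum>\<nu>\<in>F. u \<mu> k * u \<nu> k * (\<Sum>i<N. u \<mu> i * u \<nu> i))"
        unfolding sum_distrib_left
        by (subst sum.swap, intro sum.cong refl, subst sum.swap) (rule refl)
      also have "\<dots> = (\<Sum>\<mu>\<in>F. \<Sum>\<nu>\<in>F. u \<mu> k * u \<nu> k * of_bool (\<mu> = \<nu>))"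
        by (intro sum.cong refl) (simp add: orth)
      also have "\<dots> = b" using F by (simp add: b_def power2_eq_square)
      finally have s2: "(\<Sum>i<N. (\<Sum>\<mu>\<in>F. u \<mu> k * u \<mu> i)\<^sup>2) = b" .
      have "0 \<le> (\<Sum>i<N. (of_bool (i = k) - (\<Sum>\<mu>\<in>F. u \<mu> k * u \<mu> i))\<^sup>2)" by (rule sum_nonneg) auto
      also have "\<dots> = (\<Sum>i<N. (of_bool (i = k))\<^sup>2) - 2 * b + b"
        by (simp add: power2_diff sum.distrib sum_subtractf s2 mult.assoc s1 flip: sum_distrib_left)
      also have "(\<Sum>i<N. (of_bool (i = k) :: real)\<^sup>2) = 1"
        using k by (simp add: power2_eq_square flip: of_bool_conj)
      finally show ?thesis by (simp add: b_def)
    qed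
    have "real (card F) = (\<Sum>\<mu>\<in>F. sqn N (u \<mu>))"
      using u1 F(1) by (simp add: subset_iff)
    also have "\<dots> = (\<Sum>k<N. \<Sum>\<mu>\<in>F. (u \<mu> k)\<^sup>2)" unfolding sqn_def by (rule sum.swap)
    also have "\<dots> \<le> (\<Sum>k<N. 1)" by (intro sum_mono bessel) auto
    finally show ?thesis by simp
  qed
  thus ?thesis by (meson finite_if_finite_subsets_card_bdd)
qed

lemma qform_le_lambda1:
  assumes "symm_upto N M" "N > 0"
  shows "qform N M w \<le> lambda1 N M * sqn N w"
proof -
  obtain \<mu> where \<mu>: "\<mu> \<in> eigenvalues N M" "\<And>w. qform N M w \<le> \<mu> * sqn N w"
    using rayleigh_max[OF assms] by blast
  have "\<mu> \<le> lambda1 N M" unfolding lambda1_def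
    using finite_eigenvalues[OF assms(1)] \<mu>(1) by (rule Max_ge)
  thus ?thesis using \<mu>(2)[of w] by (meson mult_right_mono order_trans sqn_nonneg)
qed

lemma lambda1_le:
  assumes "symm_upto N M" "N > 0" "\<And>w. qform N M w \<le> c * sqn N w"
  shows "lambda1 N M \<le> c"
proof -
  have ne: "eigenvalues N M \<noteq> {}" using rayleigh_max[OF assms(1,2)] by blast
  have "\<mu> \<le> c" if "\<mu> \<in> eigenvalues N M" for \<mu>
  proof -
    from that obtain v i where v: "i < N" "v i \<noteq> 0" "\<And>i. i < N \<Longrightarrow> (\<Sum>j<N. M i j * v j) = \<mu> * v i"
      unfolding eigenvalues_def by blast
    have "qform N M v = \<mu> * sqn N v"
      by (subst bil_eigenvector[OF v(3)]) (simp_all add: sqn_def power2_eq_square)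
    hence "\<mu> * sqn N v \<le> c * sqn N v" using assms(3)[of v] by simp
    thus ?thesis using sqn_pos[of i N v] v(1,2) by simp
  qed
  thus ?thesis unfolding lambda1_def using finite_eigenvalues[OF assms(1)] ne by simp
qed

section \<open>The Ihara--Bass argument\<close>

text \<open>The weighted Ihara-Bass matrix (a deformed Laplacian) at spectral parameter 1. For
  symmetric weights below 1 in modulus it is singular only if the nonbacktracking operator has
  eigenvalue 1.\<close>

definition ib_matrix :: "nat \<Rightarrow> (nat \<Rightarrow> nat \<Rightarrow> real) \<Rightarrow> nat \<Rightarrow> nat \<Rightarrow> real" where
  "ib_matrix N r x y = of_bool (x = y) * (1 + (\<Sum>z<N. (r x z)\<^sup>2 / (1 - (r x z)\<^sup>2))) - r x y / (1 - (r x y)\<^sup>2)"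

text \<open>An eigenvector of the nonbacktracking operator for eigenvalue 1. It lives on all ordered
  pairs instead of the directed edges; pairs of weight 0 force \<open>g\<close> to vanish
  there.\<close>

definition nb_fixpoint :: "nat \<Rightarrow> (nat \<Rightarrow> nat \<Rightarrow> real) \<Rightarrow> (nat \<Rightarrow> nat \<Rightarrow> real) \<Rightarrow> bool" where
  "nb_fixpoint N r g \<longleftrightarrow> (\<forall>x<N. \<forall>y<N. g x y = r x y * (\<Sum>z\<in>{..<N} - {x}. g y z))"

lemma qform_ib_matrix:
  "qform N (ib_matrix N r) v =
    (\<Sum>x<N. (v x)\<^sup>2 * (1 + (\<Sum>y<N. (r x y)\<^sup>2 / (1 - (r x y)\<^sup>2))))
    - (\<Sum>x<N. \<Sum>y<N. r x y / (1 - (r x y)\<^sup>2) * (v x * v y))"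
proof -
  have "qform N (ib_matrix N r) v =
     (\<Sum>x<N. (\<Sum>y<N. of_bool (x = y) * ((v x * v y) * (1 + (\<Sum>z<N. (r x z)\<^sup>2 / (1 - (r x z)\<^sup>2)))))
        - (\<Sum>y<N. r x y / (1 - (r x y)\<^sup>2) * (v x * v y)))"
    unfolding bil_def ib_matrix_def sum_subtractf[symmetric]
    by (intro sum.cong refl) (simp add: algebra_simps)
  also have "\<dots> = (\<Sum>x<N. (v x)\<^sup>2 * (1 + (\<Sum>y<N. (r x y)\<^sup>2 / (1 - (r x y)\<^sup>2)))
        - (\<Sum>y<N. r x y / (1 - (r x y)\<^sup>2) * (v x * v y)))"
    by (intro sum.cong refl) (simp add: power2_eq_square)
  finally show ?thesis by (simp add: sum_subtractf)
qed

text \<open>A kernel vector of the Ihara--Bass matrix yields a fixed point of the nonbacktracking operator.\<close>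

lemma nb_fixpoint_of_kernel:
  assumes sym: "symm_upto N r" and small: "\<And>x y. x < N \<Longrightarrow> y < N \<Longrightarrow> \<bar>r x y\<bar> < 1"
    and ker: "\<And>x. x < N \<Longrightarrow> (\<Sum>y<N. ib_matrix N r x y * v y) = 0"
  defines "g \<equiv> \<lambda>x y. r x y * (v y - r x y * v x) / (1 - (r x y)\<^sup>2)"
  shows "nb_fixpoint N r g" "\<And>x. x < N \<Longrightarrow> (\<Sum>y<N. g x y) = v x"
proof -
  have sum_g: "(\<Sum>y<N. g x y) = v x" if x: "x < N" for x
  proof -
    have "0 = (\<Sum>y<N. of_bool (x = y) * (v y * (1 + (\<Sum>z<N. (r x z)\<^sup>2 / (1 - (r x z)\<^sup>2)))))
        - (\<Sum>y<N. r x y / (1 - (r x y)\<^sup>2) * v y)"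
      unfolding ker[OF x, symmetric] ib_matrix_def sum_subtractf[symmetric]
      by (intro sum.cong refl) (simp add: algebra_simps)
    also have "\<dots> = v x * (1 + (\<Sum>z<N. (r x z)\<^sup>2 / (1 - (r x z)\<^sup>2))) - (\<Sum>y<N. r x y / (1 - (r x y)\<^sup>2) * v y)"
      using x by simp
    also have "\<dots> = v x - (\<Sum>y<N. r x y / (1 - (r x y)\<^sup>2) * v y - v x * ((r x y)\<^sup>2 / (1 - (r x y)\<^sup>2)))"
      by (simp add: sum_subtractf sum_distrib_left algebra_simps)
    also have "(\<Sum>y<N. r x y / (1 - (r x y)\<^sup>2) * v y - v x * ((r x y)\<^sup>2 / (1 - (r x y)\<^sup>2))) = (\<Sum>y<N. g x y)"
      by (intro sum.cong refl) (simp add: g_def power2_eq_square algebra_simps diff_divide_distrib)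
    finally show ?thesis by simp
  qed
  thus "\<And>x. x < N \<Longrightarrow> (\<Sum>y<N. g x y) = v x" .
  show "nb_fixpoint N r g" unfolding nb_fixpoint_def
  proof (intro allI impI)
    fix x y assume x: "x < N" and y: "y < N"
    have "(\<Sum>z\<in>{..<N} - {x}. g y z) = v y - g y x"
      using sum_g[OF y] x by (simp add: sum_diff1)
    also have "g y x = r x y * (v x - r x y * v y) / (1 - (r x y)\<^sup>2)"
      using sym x y by (simp add: g_def symm_upto_def)
    also have "v y - \<dots> = (v y - r x y * v x) / (1 - (r x y)\<^sup>2)"
    proof -
      have "1 - (r x y)\<^sup>2 > 0" using small[OF x y] by (simp add: abs_square_less_1)
      thus ?thesis by (simp add: field_simps power2_eq_square)
    qed
    finally show "g x y = r x y * (\<Sum>z\<in>{..<N} - {x}. g y z)" by (simp add: g_def)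
  qed
qed

text \<open>Homotopy in \<open>s\<close> from the identity matrix at \<open>s = 0\<close>: if the
  form for \<open>s = 1\<close> had a negative value, then at the first \<open>s\<close> where
  positive definiteness fails it would be nonnegative and singular, and its kernel vector would
  yield a nonzero fixed point.\<close>

theorem ihara_bass_psd:
  assumes sym: "symm_upto N r" and small: "\<And>x y. x < N \<Longrightarrow> y < N \<Longrightarrow> \<bar>r x y\<bar> < 1"
    and nofix: "\<And>s g. 0 < s \<Longrightarrow> s \<le> 1 \<Longrightarrow> nb_fixpoint N (\<lambda>x y. s * r x y) g \<Longrightarrow> \<forall>x<N. \<forall>y<N. g x y = 0"
  shows "qform N (ib_matrix N r) v \<ge> 0"
proof (rule ccontr)
  assume neg: "\<not> qform N (ib_matrix N r) v \<ge> 0"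
  define Q where "Q = (\<lambda>s. qform N (ib_matrix N (\<lambda>x y. s * r x y)))"
  have ssmall: "\<bar>s * r x y\<bar> < 1" if "x < N" "y < N" "s \<in> {0..1}" for s x y
  proof -
    have "\<bar>s\<bar> * \<bar>r x y\<bar> \<le> 1 * \<bar>r x y\<bar>" using that(3) by (intro mult_right_mono) auto
    thus ?thesis using small[OF that(1,2)] by (simp add: abs_mult)
  qed
  have pos: "1 - (s * r x y)\<^sup>2 > 0" if "x < N" "y < N" "s \<in> {0..1}" for s x y
    using ssmall[OF that] abs_square_less_1[of "s * r x y"] by linarith
  let ?S = "{w :: nat \<Rightarrow> real. (\<forall>i\<ge>N. w i = 0) \<and> sqn N w = 1}"
  have cont: "continuous_on ({0..1} \<times> ?S) (\<lambda>p. Q (fst p) (snd p))"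
  proof -
    have *: "continuous_on A (\<lambda>p. (snd p :: nat \<Rightarrow> real) x)" for A :: "(real \<times> (nat \<Rightarrow> real)) set" and x
      by (rule continuous_on_compose2[OF continuous_on_product_coordinates[of x]])
         (auto intro!: continuous_on_snd continuous_on_id)
    have nz: "1 - (fst p * r x y)\<^sup>2 \<noteq> 0" if "x \<in> {..<N}" "y \<in> {..<N}" "p \<in> {0..1} \<times> ?S"
      for x y and p :: "real \<times> (nat \<Rightarrow> real)"
      using pos[of x y "fst p"] that by (auto simp: mem_Times_iff)
    show ?thesis
      unfolding Q_def qform_ib_matrix
      by (intro continuous_on_sum continuous_on_diff continuous_on_mult continuous_on_divide continuous_on_add
          continuous_on_power continuous_on_const continuous_on_fst continuous_on_id ballI nz *; assumption)
  qed
  \<comment> \<open>Pairs of a parameter and a unit vector at which positivity fails; compactness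
    makes the smallest such parameter attained.\<close>
  define K where "K = {p \<in> {0..1} \<times> ?S. Q (fst p) (snd p) \<le> 0}"
  have "compact ({0..1::real} \<times> ?S)" by (intro compact_Times compact_unit_vectors compact_Icc)
  moreover have "K = ({0..1} \<times> ?S) \<inter> (\<lambda>p. Q (fst p) (snd p)) -` {..0}"
    by (auto simp: K_def)
  moreover have "compact (({0..1} \<times> ?S) \<inter> (\<lambda>p. Q (fst p) (snd p)) -` {..0})"
  proof -
    have "closed (({0..1} \<times> ?S) \<inter> (\<lambda>p. Q (fst p) (snd p)) -` {..0})"
      by (rule continuous_closed_preimage[OF cont compact_imp_closed[OF calculation(1)]]) simp
    hence "compact (({0..1} \<times> ?S) \<inter> (({0..1} \<times> ?S) \<inter> (\<lambda>p. Q (fst p) (snd p)) -` {..0}))"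
      by (rule compact_Int_closed[OF calculation(1)])
    thus ?thesis by (simp only: Int_assoc[symmetric] Int_absorb)
  qed
  ultimately have cK: "compact K" by simp
  have nz: "sqn N v \<noteq> 0" using neg qform_zero[of N v] by force
  note nv = normalise[OF nz]
  let ?u = "\<lambda>i. if i < N then v i / sqrt (sqn N v) else 0"
  have "sqn N v * qform N (ib_matrix N r) ?u < 0" using neg nv(3)[of "ib_matrix N r"] by linarith
  hence "Q 1 ?u < 0" using nz sqn_nonneg[of N v] by (simp add: Q_def mult_less_0_iff)
  hence "(1, ?u) \<in> K" using nv(1,2) by (simp add: K_def)
  hence "K \<noteq> {}" by (metis empty_iff)
  moreover have "continuous_on K fst" by (intro continuous_on_fst continuous_on_id)
  ultimately obtain p0 where p0: "p0 \<in> K" and min: "\<And>p. p \<in> K \<Longrightarrow> fst p0 \<le> fst p"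
    using continuous_attains_inf[OF cK, of fst] by blast
  obtain s w where sw: "p0 = (s, w)" by (cases p0)
  have s: "s \<in> {0..1}" and w: "w \<in> ?S" and Qsw: "Q s w \<le> 0" using p0 by (auto simp: K_def sw)
  have before: "Q t u > 0" if "t \<in> {0..1}" "t < s" "u \<in> ?S" for t u
  proof (rule ccontr)
    assume "\<not> Q t u > 0"
    hence "(t, u) \<in> K" using that by (auto simp: K_def)
    from min[OF this] show False using that by (simp add: sw)
  qed
  have s0: "s > 0"
  proof (rule ccontr)
    assume "\<not> s > 0"
    hence "s = 0" using s by simp
    hence "Q s w = sqn N w" by (simp add: Q_def qform_ib_matrix sqn_def)
    thus False using Qsw w by simp
  qed
  \<comment> \<open>Below \<open>s\<close> the form is positive, and continuity in the parameter
    gives nonnegativity at \<open>s\<close> itself.\<close>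
  have unit_nonneg: "Q s u \<ge> 0" if u: "u \<in> ?S" for u
  proof -
    have cl: "closure {0..<s} = {0..s}" using s0 by simp
    have "continuous_on {0..s} (\<lambda>t. Q t u)"
    proof -
      have "continuous_on {0..s} (\<lambda>t. (\<lambda>p. Q (fst p) (snd p)) (t, u))"
        by (rule continuous_on_compose2[OF cont]) (use s u in \<open>auto intro!: continuous_intros\<close>)
      thus ?thesis by simp
    qed
    thus ?thesis
      by (intro continuous_ge_on_closure[of "{0..<s}" "\<lambda>t. Q t u" s 0])
         (use s0 s before u in \<open>auto simp: cl intro!: less_imp_le\<close>)
  qed
  define M where "M = ib_matrix N (\<lambda>x y. s * r x y)"
  have QM: "Q s = qform N M" by (simp add: Q_def M_def)
  have psd: "qform N M u \<ge> 0" for u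
  proof (cases "sqn N u = 0")
    case True thus ?thesis by (simp add: qform_zero)
  next
    case False
    note n = normalise[OF False]
    have "qform N M (\<lambda>i. if i < N then u i / sqrt (sqn N u) else 0) \<ge> 0"
      using unit_nonneg[of "\<lambda>i. if i < N then u i / sqrt (sqn N u) else 0"] n(1,2) by (simp add: QM)
    thus ?thesis unfolding n(3)[of M] by simp
  qed
  have zero: "qform N M w = 0" using psd[of w] Qsw by (simp add: QM)
  have symr: "symm_upto N (\<lambda>x y. s * r x y)" using sym by (simp add: symm_upto_def)
  have symM: "symm_upto N M" unfolding symm_upto_def
  proof (intro allI impI)
    fix i j assume ij: "i < N" "j < N"
    have "s * r i j = s * r j i" using symr ij by (simp add: symm_upto_def)
    thus "M i j = M j i" by (cases "i = j") (simp_all only: M_def ib_matrix_def, simp)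
  qed
  note ker = psd_kernel[OF symM psd zero]
  have "nb_fixpoint N (\<lambda>x y. s * r x y) (\<lambda>x y. s * r x y * (w y - s * r x y * w x) / (1 - (s * r x y)\<^sup>2))"
    by (rule nb_fixpoint_of_kernel(1)[OF symr ssmall ker[unfolded M_def]]) (use s in auto)
  from nofix[OF s0 _ this] have g0: "\<forall>x<N. \<forall>y<N. s * r x y * (w y - s * r x y * w x) / (1 - (s * r x y)\<^sup>2) = 0"
    using s by simp
  \<comment> \<open>Summing the fixed point over its second index recovers \<open>w\<close>, so a
    vanishing fixed point contradicts \<open>sqn N w = 1\<close>.\<close>
  have "w x = 0" if x: "x < N" for x
  proof -
    have "(\<Sum>y<N. s * r x y * (w y - s * r x y * w x) / (1 - (s * r x y)\<^sup>2)) = w x"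
      by (rule nb_fixpoint_of_kernel(2)[OF symr ssmall ker[unfolded M_def]]) (use s x in auto)
    moreover have "(\<Sum>y<N. s * r x y * (w y - s * r x y * w x) / (1 - (s * r x y)\<^sup>2)) = 0"
      by (rule sum.neutral) (use g0 x in blast)
    ultimately show ?thesis by simp
  qed
  hence "sqn N w = 0" by (simp add: sqn_def)
  thus False using w by simp
qed

section \<open>Powers of the nonbacktracking operator as sums over paths\<close>

text \<open>Paths from the directed edge (x, y) to the directed edge (z, u) in \<open>l\<close>
  steps. The list runs from \<open>x\<close> to \<open>z\<close> and omits \<open>u\<close>:
  \<open>l\<close> steps carry the weights of \<open>l\<close> edges, and the final edge (z, u) is
  not among them.\<close>

fun nb_paths :: "nat \<Rightarrow> nat \<Rightarrow> nat \<Rightarrow> nat \<Rightarrow> nat \<Rightarrow> nat \<Rightarrow> nat list set" where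
  "nb_paths N 0 x y z u = (if z = x \<and> u = y then {[x]} else {})"
| "nb_paths N (Suc l) x y z u = (\<Union>t\<in>{..<N} - {x}. (#) x ` nb_paths N l y t z u)"

fun wprod :: "(nat \<Rightarrow> nat \<Rightarrow> real) \<Rightarrow> nat list \<Rightarrow> real" where
  "wprod h (a # b # c) = h a b * wprod h (b # c)"
| "wprod h _ = 1"

definition nb_kernel :: "nat \<Rightarrow> (nat \<Rightarrow> nat \<Rightarrow> real) \<Rightarrow> nat \<Rightarrow> nat \<Rightarrow> nat \<Rightarrow> nat \<Rightarrow> nat \<Rightarrow> real" where
  "nb_kernel N h l x y z u = (\<Sum>p\<in>nb_paths N l x y z u. wprod h p)"

fun nobt :: "nat list \<Rightarrow> bool" where
  "nobt (a # b # c # p) \<longleftrightarrow> a \<noteq> c \<and> nobt (b # c # p)"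
| "nobt _ \<longleftrightarrow> True"

lemma nb_paths_props:
  assumes "p \<in> nb_paths N l x y z u"
  shows "length p = Suc l" "hd p = x" "last p = z" "(p @ [u]) ! 1 = y" "nobt (p @ [u])" "x < N \<Longrightarrow> y < N \<Longrightarrow> set p \<subseteq> {..<N}"
proof -
  have "length p = Suc l \<and> hd p = x \<and> last p = z \<and> (p @ [u]) ! 1 = y \<and> nobt (p @ [u]) \<and> (x < N \<longrightarrow> y < N \<longrightarrow> set p \<subseteq> {..<N})"
    using assms
  proof (induction l arbitrary: x y p)
    case 0 thus ?case by (auto split: if_splits)
  next
    case (Suc l)
    from Suc.prems obtain t q where t: "t < N" "t \<noteq> x" and q: "q \<in> nb_paths N l y t z u" and p: "p = x # q"
      by auto
    note IH = Suc.IH[OF q]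
    from IH obtain q' where q': "q = y # q'" by (cases q) auto
    have nn: "nobt (x # y # q' @ [u])"
    proof (cases q')
      case Nil thus ?thesis using IH q' t by auto
    next
      case (Cons a q'') thus ?thesis using IH q' t by auto
    qed
    show ?case using IH t nn by (auto simp: p q')
  qed
  thus "length p = Suc l" "hd p = x" "last p = z" "(p @ [u]) ! 1 = y" "nobt (p @ [u])" "x < N \<Longrightarrow> y < N \<Longrightarrow> set p \<subseteq> {..<N}"
    by auto
qed

lemma finite_nb_paths [simp]: "finite (nb_paths N l x y z u)"
  by (induction l arbitrary: x y) auto

lemma nb_kernel_Suc:
  "nb_kernel N h (Suc l) x y z u = h x y * (\<Sum>t\<in>{..<N} - {x}. nb_kernel N h l y t z u)"
proof -
  have disj: "nb_paths N l y i z u \<inter> nb_paths N l y j z u = {}" if "i \<noteq> j" for i j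
    using nb_paths_props(4)[of _ N l y i z u] nb_paths_props(4)[of _ N l y j z u] that by auto
  have "nb_kernel N h (Suc l) x y z u = (\<Sum>t\<in>{..<N} - {x}. \<Sum>p\<in>(#) x ` nb_paths N l y t z u. wprod h p)"
    unfolding nb_kernel_def nb_paths.simps
    by (rule sum.UNION_disjoint) (use disj in auto)
  also have "\<dots> = (\<Sum>t\<in>{..<N} - {x}. \<Sum>p\<in>nb_paths N l y t z u. h x y * wprod h p)"
  proof (rule sum.cong[OF refl])
    fix t
    have "(\<Sum>p\<in>(#) x ` nb_paths N l y t z u. wprod h p) = (\<Sum>p\<in>nb_paths N l y t z u. wprod h (x # p))"
      by (subst sum.reindex) auto
    also have "\<dots> = (\<Sum>p\<in>nb_paths N l y t z u. h x y * wprod h p)"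
    proof (intro sum.cong refl)
      fix p assume "p \<in> nb_paths N l y t z u"
      from nb_paths_props(1,2)[OF this] obtain q where "p = y # q" by (cases p) auto
      thus "wprod h (x # p) = h x y * wprod h p" by simp
    qed
    finally show "(\<Sum>p\<in>(#) x ` nb_paths N l y t z u. wprod h p) = (\<Sum>p\<in>nb_paths N l y t z u. h x y * wprod h p)" .
  qed
  finally show ?thesis by (simp add: nb_kernel_def sum_distrib_left)
qed

lemma sum_rotate: "(\<Sum>t\<in>T. \<Sum>z\<in>A. \<Sum>u\<in>B. f t z u) = (\<Sum>z\<in>A. \<Sum>u\<in>B. \<Sum>t\<in>T. f t z u)"
  by (subst sum.swap, intro sum.cong refl, rule sum.swap)

text \<open>The scalar is pulled out of the \<open>l\<close>-th power, so that one kernel serves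
  every \<open>s\<close> of the homotopy.\<close>

lemma nb_fixpoint_iterate:
  assumes "nb_fixpoint N (\<lambda>x y. s * h x y) g" "x < N" "y < N"
  shows "g x y = s ^ l * (\<Sum>z<N. \<Sum>u<N. nb_kernel N h l x y z u * g z u)"
  using assms(2,3)
proof (induction l arbitrary: x y)
  case 0
  have "(\<Sum>z<N. \<Sum>u<N. nb_kernel N h 0 x y z u * g z u) = (\<Sum>z<N. \<Sum>u<N. (if z = x then if u = y then g z u else 0 else 0))"
    by (intro sum.cong refl) (simp add: nb_kernel_def)
  also have "\<dots> = (\<Sum>z<N. if z = x then (\<Sum>u<N. if u = y then g z u else 0) else 0)"
    by (intro sum.cong refl) simp
  also have "\<dots> = g x y" using 0 by (simp add: sum.delta)
  finally show ?case by simp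
next
  case (Suc l)
  have "g x y = s * h x y * (\<Sum>t\<in>{..<N} - {x}. g y t)"
    using assms(1) Suc.prems by (simp add: nb_fixpoint_def)
  also have "(\<Sum>t\<in>{..<N} - {x}. g y t) = (\<Sum>t\<in>{..<N} - {x}. s ^ l * (\<Sum>z<N. \<Sum>u<N. nb_kernel N h l y t z u * g z u))"
    by (intro sum.cong refl Suc.IH) (use Suc.prems in auto)
  also have "\<dots> = s ^ l * (\<Sum>z<N. \<Sum>u<N. \<Sum>t\<in>{..<N} - {x}. nb_kernel N h l y t z u * g z u)"
    unfolding sum_distrib_left[symmetric] by (subst sum_rotate) (rule refl)
  also have "s * h x y * \<dots> = s ^ Suc l * (\<Sum>z<N. \<Sum>u<N. nb_kernel N h (Suc l) x y z u * g z u)"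
  proof -
    have "(\<Sum>z<N. \<Sum>u<N. nb_kernel N h (Suc l) x y z u * g z u)
      = h x y * (\<Sum>z<N. \<Sum>u<N. \<Sum>t\<in>{..<N} - {x}. nb_kernel N h l y t z u * g z u)"
      unfolding nb_kernel_Suc sum_distrib_left sum_distrib_right
      by (intro sum.cong refl) (simp add: mult.assoc)
    thus ?thesis by simp
  qed
  finally show ?case .
qed

text \<open>The squared Hilbert-Schmidt norm of the \<open>l\<close>-th power of the nonbacktracking
  operator.\<close>

definition nb_hs :: "nat \<Rightarrow> (nat \<Rightarrow> nat \<Rightarrow> real) \<Rightarrow> nat \<Rightarrow> real" where
  "nb_hs N h l = (\<Sum>x<N. \<Sum>y<N. \<Sum>z<N. \<Sum>u<N. (nb_kernel N h l x y z u)\<^sup>2)"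

text \<open>Cauchy-Schwarz applied to the \<open>l\<close>-th iterate bounds the squared norm
  \<open>G\<close> of a fixed point by \<open>G\<close> times a factor below 1.\<close>

lemma nb_no_fixpoint:
  assumes fp: "nb_fixpoint N (\<lambda>x y. s * h x y) g" and hs: "s ^ (2 * l) * nb_hs N h l < 1" and "s \<ge> 0"
  shows "\<forall>x<N. \<forall>y<N. g x y = 0"
proof -
  define G where "G = (\<Sum>z<N. \<Sum>u<N. (g z u)\<^sup>2)"
  have G0: "G \<ge> 0" unfolding G_def by (intro sum_nonneg) auto
  have "(g x y)\<^sup>2 \<le> s ^ (2*l) * ((\<Sum>z<N. \<Sum>u<N. (nb_kernel N h l x y z u)\<^sup>2) * G)" if "x < N" "y < N" for x y
  proof -
    have cs: "(\<Sum>p\<in>{..<N}\<times>{..<N}. nb_kernel N h l x y (fst p) (snd p) * g (fst p) (snd p))\<^sup>2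
      \<le> (\<Sum>p\<in>{..<N}\<times>{..<N}. (nb_kernel N h l x y (fst p) (snd p))\<^sup>2) * (\<Sum>p\<in>{..<N}\<times>{..<N}. (g (fst p) (snd p))\<^sup>2)"
      by (rule Cauchy_Schwarz_ineq_sum)
    have "(g x y)\<^sup>2 = s ^ (2*l) * (\<Sum>z<N. \<Sum>u<N. nb_kernel N h l x y z u * g z u)\<^sup>2"
      by (subst nb_fixpoint_iterate[OF fp that, of l]) (simp add: power_mult_distrib power_even_eq)
    also have "\<dots> \<le> s ^ (2*l) * ((\<Sum>z<N. \<Sum>u<N. (nb_kernel N h l x y z u)\<^sup>2) * G)"
      using cs \<open>s \<ge> 0\<close> by (intro mult_left_mono) (simp_all add: G_def sum.cartesian_product case_prod_unfold)
    finally show ?thesis .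
  qed
  hence "G \<le> (\<Sum>x<N. \<Sum>y<N. s ^ (2*l) * ((\<Sum>z<N. \<Sum>u<N. (nb_kernel N h l x y z u)\<^sup>2) * G))"
    unfolding G_def[of] by (intro sum_mono) (auto simp: G_def)
  also have "\<dots> = (s ^ (2*l) * nb_hs N h l) * G"
    unfolding nb_hs_def sum_distrib_left sum_distrib_right
    by (intro sum.cong refl) (simp add: mult.assoc)
  finally have "G * (1 - s ^ (2*l) * nb_hs N h l) \<le> 0" by (simp add: algebra_simps)
  hence "G = 0" using G0 hs by (smt (verit) mult_pos_pos)
  hence "\<forall>z\<in>{..<N}. (\<Sum>u<N. (g z u)\<^sup>2) = 0"
    unfolding G_def by (subst (asm) sum_nonneg_eq_0_iff) (auto intro: sum_nonneg)
  thus ?thesis by (auto simp: sum_nonneg_eq_0_iff)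
qed

section \<open>Walks with memory and the trace expansion\<close>

definition ed :: "nat \<Rightarrow> nat \<Rightarrow> nat \<times> nat" where
  "ed a b = (min a b, max a b)"

definition cross :: "nat \<Rightarrow> nat \<Rightarrow> nat \<Rightarrow> bool" where
  "cross n a b \<longleftrightarrow> (a < n) \<noteq> (b < n)"

fun wsteps :: "nat list \<Rightarrow> (nat \<times> nat) list" where
  "wsteps (a # b # c) = ed a b # wsteps (b # c)"
| "wsteps _ = []"

abbreviation wed :: "nat list \<Rightarrow> (nat \<times> nat) set" where
  "wed c \<equiv> set (wsteps c)"

fun alternating :: "nat \<Rightarrow> nat list \<Rightarrow> bool" where
  "alternating n (a # b # c) \<longleftrightarrow> cross n a b \<and> alternating n (b # c)"
| "alternating n _ \<longleftrightarrow> True"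

definition inc :: "(nat \<times> nat) set \<Rightarrow> nat \<Rightarrow> (nat \<times> nat) set" where
  "inc F u = {f \<in> F. fst f = u \<or> snd f = u}"

definition dg :: "(nat \<times> nat) set \<Rightarrow> nat \<Rightarrow> nat" where
  "dg F u = card (inc F u)"

lemma ed_commute: "ed a b = ed b a" by (simp add: ed_def min.commute max.commute)

lemma ed_inject [simp]: "ed u v = ed u w \<longleftrightarrow> v = w"
  by (auto simp: ed_def min_def max_def split: if_splits)

lemma ed_incident: "fst (ed u v) = u \<or> snd (ed u v) = u" "fst (ed u v) = v \<or> snd (ed u v) = v"
  by (auto simp: ed_def min_def max_def)

lemma ed_in_inc [simp]: "ed u v \<in> inc F u \<longleftrightarrow> ed u v \<in> F" "ed u v \<in> inc F v \<longleftrightarrow> ed u v \<in> F"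
  using ed_incident[of u v] by (auto simp: inc_def)

lemma finite_inc [simp]: "finite F \<Longrightarrow> finite (inc F u)"
  by (simp add: inc_def)

lemma dg_mono: "F \<subseteq> G \<Longrightarrow> finite G \<Longrightarrow> dg F u \<le> dg G u"
  unfolding dg_def by (rule card_mono) (auto simp: inc_def)

lemma dg_insert: "finite F \<Longrightarrow> e \<notin> F \<Longrightarrow> fst e = u \<or> snd e = u \<Longrightarrow> dg (insert e F) u = Suc (dg F u)"
proof -
  assume *: "finite F" "e \<notin> F" "fst e = u \<or> snd e = u"
  have "inc (insert e F) u = insert e (inc F u)" using * by (auto simp: inc_def)
  thus ?thesis using * by (simp add: dg_def inc_def)
qed

lemma wed_subset: "f \<in> wed c \<Longrightarrow> fst f \<in> set c \<and> snd f \<in> set c"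
  by (induction c rule: wsteps.induct) (auto simp: ed_def min_def max_def split: if_splits)

lemma wed_cross: "alternating n c \<Longrightarrow> set c \<subseteq> {..<N} \<Longrightarrow> wed c \<subseteq> {..<n} \<times> {n..<N}"
  by (induction c rule: wsteps.induct) (auto simp: ed_def cross_def min_def max_def)

lemma wsteps_nth: "Suc k < length c \<Longrightarrow> ed (c ! k) (c ! Suc k) \<in> wed c"
proof (induction c arbitrary: k rule: wsteps.induct)
  case (1 a b c) thus ?case by (cases k) auto
qed auto

lemma length_wsteps: "length (wsteps c) = length c - 1"
  by (induction c rule: wsteps.induct) auto

lemma nbr_edges_le:
  assumes "finite F" "ed u p \<in> F"
  shows "card {w. ed u w \<in> F} \<le> dg F u" "card {w. w \<noteq> p \<and> ed u w \<in> F} \<le> dg F u - 1"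
    "finite {w. ed u w \<in> F}"
proof -
  have inj: "inj_on (ed u) A" for A by (auto simp: inj_on_def)
  have sub: "ed u ` {w. ed u w \<in> F} \<subseteq> inc F u" by auto
  show fin: "finite {w. ed u w \<in> F}"
    using inj_on_finite[OF inj sub] assms by simp
  show "card {w. ed u w \<in> F} \<le> dg F u"
    unfolding dg_def using card_inj_on_le[OF inj sub] assms by simp
  have sub': "ed u ` {w. w \<noteq> p \<and> ed u w \<in> F} \<subseteq> inc F u - {ed u p}" by auto
  have "card {w. w \<noteq> p \<and> ed u w \<in> F} \<le> card (inc F u - {ed u p})"
    using card_inj_on_le[OF inj sub'] assms by simp
  also have "\<dots> = dg F u - 1" using assms by (simp add: dg_def card_Diff_subset)
  finally show "card {w. w \<noteq> p \<and> ed u w \<in> F} \<le> dg F u - 1" .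
qed

text \<open>A random walk with memory on \<open>{..<n} \<union> {n..<n+m}\<close>, lists being histories with the current vertex
  at the head. By default it goes on along a path: a vertex with at most one explored edge is left
  to a uniform vertex of the other side, a vertex with two explored edges is left by the edge other than the
  one used to enter. Its trajectories dominate the weights of the walks in the trace expansion.\<close>

definition own :: "nat \<Rightarrow> nat \<Rightarrow> nat \<Rightarrow> real" where
  "own n m u = real (if u < n then n else m)"

definition stepw :: "nat \<Rightarrow> nat \<Rightarrow> real \<Rightarrow> real \<Rightarrow> nat \<Rightarrow> nat list \<Rightarrow> real" where
  "stepw n m \<delta> Q w c =
    (let u = hd c; D = dg (wed c) u; unif = of_bool (cross n u w) / own n m w; vis = of_bool (w \<in> set c) / Q in
     if D \<le> 1 then (1 - \<delta>) * unif + \<delta> * vis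
     else if D = 2 then (1 - 2 * \<delta>) * of_bool (w \<noteq> c ! 1 \<and> ed u w \<in> wed c) + \<delta> * unif + \<delta> * vis
     else (1/3) * (of_bool (ed u w \<in> wed c) / D) + (1/3) * unif + (1/3) * vis)"

fun wprob :: "nat \<Rightarrow> nat \<Rightarrow> real \<Rightarrow> real \<Rightarrow> nat list \<Rightarrow> real" where
  "wprob n m \<delta> Q (w # u # c) = stepw n m \<delta> Q w (u # c) * wprob n m \<delta> Q (u # c)"
| "wprob n m \<delta> Q [u] = 1 / own n m u"
| "wprob n m \<delta> Q [] = 0"

lemma own_pos: "n > 0 \<Longrightarrow> m > 0 \<Longrightarrow> own n m u > 0" by (simp add: own_def)

lemma stepw_nonneg:
  assumes "0 \<le> \<delta>" "\<delta> \<le> 1/3" "Q > 0"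
  shows "stepw n m \<delta> Q w c \<ge> 0"
  using assms by (auto simp: stepw_def Let_def own_def intro!: add_nonneg_nonneg)

lemma wprob_nonneg:
  "0 \<le> \<delta> \<Longrightarrow> \<delta> \<le> 1/3 \<Longrightarrow> Q > 0 \<Longrightarrow> wprob n m \<delta> Q c \<ge> 0"
  by (induction n m \<delta> Q c rule: wprob.induct) (auto simp: own_def stepw_nonneg)

lemma sum_of_bool_card: "finite A \<Longrightarrow> (\<Sum>w\<in>A. of_bool (P w) :: real) = real (card {w\<in>A. P w})"
  by (simp add: of_bool_def sum.If_cases Int_def)

text \<open>Each branch is a convex combination of components of mass at most 1. The default
  component at a vertex with two explored edges has this property because only one edge besides the
  entering one is left; the revisiting component has it because \<open>Q\<close> is at least the
  length of the history.\<close>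

lemma sum_stepw_le:
  assumes \<delta>: "0 \<le> \<delta>" "\<delta> \<le> 1/3" and nm: "n > 0" "m > 0" and c: "c \<noteq> []" "set c \<subseteq> {..<n+m}" "real (length c) \<le> Q"
  shows "(\<Sum>w<n+m. stepw n m \<delta> Q w c) \<le> 1"
proof -
  define F where "F = wed c"
  define u where "u = hd c"
  define D where "D = dg F u"
  define U where "U = (\<Sum>w<n+m. of_bool (cross n u w) / own n m w)"
  define V where "V = (\<Sum>w<n+m. of_bool (w \<in> set c) / Q)"
  have fF: "finite F" by (simp add: F_def)
  have Q: "Q > 0" using c by (cases c) auto
  have st: "stepw n m \<delta> Q w c = (if D \<le> 1 then (1 - \<delta>) * (of_bool (cross n u w) / own n m w) + \<delta> * (of_bool (w \<in> set c) / Q)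
     else if D = 2 then (1 - 2 * \<delta>) * of_bool (w \<noteq> c ! 1 \<and> ed u w \<in> F) + \<delta> * (of_bool (cross n u w) / own n m w) + \<delta> * (of_bool (w \<in> set c) / Q)
     else (1/3) * (of_bool (ed u w \<in> F) / real D) + (1/3) * (of_bool (cross n u w) / own n m w) + (1/3) * (of_bool (w \<in> set c) / Q))" for w
    by (simp add: stepw_def Let_def D_def F_def u_def)
  have U: "U \<le> 1"
  proof -
    have "U = (\<Sum>w\<in>{..<n}. of_bool (cross n u w) / own n m w) + (\<Sum>w\<in>{n..<n+m}. of_bool (cross n u w) / own n m w)"
      unfolding U_def by (subst sum.union_disjoint[symmetric]) (auto simp: ivl_disj_un)
    also have "(\<Sum>w\<in>{..<n}. of_bool (cross n u w) / own n m w) = (\<Sum>w\<in>{..<n}. of_bool (\<not> u < n) / real n)"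
      by (intro sum.cong refl) (auto simp: cross_def own_def)
    also have "(\<Sum>w\<in>{n..<n+m}. of_bool (cross n u w) / own n m w) = (\<Sum>w\<in>{n..<n+m}. of_bool (u < n) / real m)"
      by (intro sum.cong refl) (auto simp: cross_def own_def)
    finally show ?thesis using nm by simp
  qed
  have V: "V \<le> 1"
  proof -
    have "V = real (card {w\<in>{..<n+m}. w \<in> set c}) / Q"
      unfolding V_def sum_divide_distrib[symmetric] by (subst sum_of_bool_card) auto
    also have "{w\<in>{..<n+m}. w \<in> set c} = set c" using c by auto
    finally show ?thesis using Q card_length[of c] c(3) by simp
  qed
  show ?thesis
  proof (cases "D \<le> 1")
    case True
    have "(\<Sum>w<n+m. stepw n m \<delta> Q w c) = (\<Sum>w<n+m. (1 - \<delta>) * (of_bool (cross n u w) / own n m w) + \<delta> * (of_bool (w \<in> set c) / Q))"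
      using True by (intro sum.cong refl) (simp only: st if_True)
    also have "\<dots> = (1 - \<delta>) * U + \<delta> * V"
      by (simp only: sum.distrib sum_distrib_left[symmetric] U_def V_def)
    also have "\<dots> \<le> (1 - \<delta>) * 1 + \<delta> * 1" using U V \<delta> by (intro add_mono mult_left_mono) auto
    finally show ?thesis by simp
  next
    case D1: False
    obtain p c' where c': "c = u # p # c'"
    proof (cases c rule: wsteps.cases)
      case (1 a b r)
      hence "u = a" by (simp add: u_def)
      thus ?thesis using that 1 by blast
    qed (use D1 in \<open>auto simp: D_def F_def dg_def inc_def\<close>)
    have eF: "ed u p \<in> F" and p: "c ! 1 = p" by (simp_all add: F_def c')
    note nb = nbr_edges_le[OF fF eF]
    show ?thesis
    proof (cases "D = 2")
      case True
      define W where "W = (\<Sum>w<n+m. of_bool (w \<noteq> p \<and> ed u w \<in> F) :: real)"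
      have "W \<le> 1"
      proof -
        have "W = real (card {w\<in>{..<n+m}. w \<noteq> p \<and> ed u w \<in> F})" unfolding W_def by (rule sum_of_bool_card) simp
        also have "\<dots> \<le> real (card {w. w \<noteq> p \<and> ed u w \<in> F})"
          using nb(3) by (intro of_nat_mono card_mono) (auto intro: finite_subset)
        also have "\<dots> \<le> 1" using nb(2) True by (simp add: D_def)
        finally show ?thesis .
      qed
      have "(\<Sum>w<n+m. stepw n m \<delta> Q w c) = (\<Sum>w<n+m. (1 - 2 * \<delta>) * of_bool (w \<noteq> p \<and> ed u w \<in> F)
          + \<delta> * (of_bool (cross n u w) / own n m w) + \<delta> * (of_bool (w \<in> set c) / Q))"
        using True D1 by (intro sum.cong refl) (simp only: st if_True if_False p simp_thms)
      also have "\<dots> = (1 - 2 * \<delta>) * W + \<delta> * U + \<delta> * V"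
        by (simp only: sum.distrib sum_distrib_left[symmetric] U_def V_def W_def)
      also have "\<dots> \<le> (1 - 2 * \<delta>) * 1 + \<delta> * 1 + \<delta> * 1"
        using U V \<open>W \<le> 1\<close> \<delta> by (intro add_mono mult_left_mono) auto
      finally show ?thesis by simp
    next
      case False
      define W where "W = (\<Sum>w<n+m. of_bool (ed u w \<in> F) / real D)"
      have "W \<le> 1"
      proof -
        have "W = real (card {w\<in>{..<n+m}. ed u w \<in> F}) / D"
          unfolding W_def sum_divide_distrib[symmetric] by (subst sum_of_bool_card) auto
        moreover have "card {w\<in>{..<n+m}. ed u w \<in> F} \<le> card {w. ed u w \<in> F}"
          using nb(3) by (intro card_mono) (auto intro: finite_subset)
        ultimately show ?thesis using nb(1) D1 by (simp add: D_def)
      qed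
      have "(\<Sum>w<n+m. stepw n m \<delta> Q w c) = (\<Sum>w<n+m. (1/3) * (of_bool (ed u w \<in> F) / real D)
          + (1/3) * (of_bool (cross n u w) / own n m w) + (1/3) * (of_bool (w \<in> set c) / Q))"
        using False D1 by (intro sum.cong refl) (simp only: st if_False)
      also have "\<dots> = (1/3) * W + (1/3) * U + (1/3) * V"
        by (simp only: sum.distrib sum_distrib_left[symmetric] U_def V_def W_def)
      also have "\<dots> \<le> (1/3) * 1 + (1/3) * 1 + (1/3) * 1"
        using U V \<open>W \<le> 1\<close> by (intro add_mono mult_left_mono) auto
      finally show ?thesis by simp
    qed
  qed
qed

text \<open>The initial weights have mass 1 on each of the two sides, hence the bound 2; extending
  the histories does not increase the mass.\<close>

lemma sum_wprob_le:
  assumes \<delta>: "0 \<le> \<delta>" "\<delta> \<le> 1/3" and nm: "n > 0" "m > 0"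
  shows "real (Suc k) \<le> Q \<Longrightarrow> (\<Sum>c | set c \<subseteq> {..<n+m} \<and> length c = Suc k. wprob n m \<delta> Q c) \<le> 2"
proof (induction k)
  case 0
  have "{c. set c \<subseteq> {..<n+m} \<and> length c = Suc 0} = (\<lambda>u. [u]) ` {..<n+m}"
    by (auto simp: length_Suc_conv)
  hence "(\<Sum>c | set c \<subseteq> {..<n+m} \<and> length c = Suc 0. wprob n m \<delta> Q c) = (\<Sum>u<n+m. 1 / own n m u)"
    by (simp add: sum.reindex inj_on_def)
  also have "\<dots> = (\<Sum>u\<in>{..<n}. 1 / own n m u) + (\<Sum>u\<in>{n..<n+m}. 1 / own n m u)"
    by (subst sum.union_disjoint[symmetric]) (auto simp: ivl_disj_un)
  also have "(\<Sum>u\<in>{..<n}. 1 / own n m u) = (\<Sum>u\<in>{..<n}. 1 / real n)"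
    by (intro sum.cong refl) (auto simp: own_def)
  also have "(\<Sum>u\<in>{n..<n+m}. 1 / own n m u) = (\<Sum>u\<in>{n..<n+m}. 1 / real m)"
    by (intro sum.cong refl) (auto simp: own_def)
  finally show ?case using nm by simp
next
  case (Suc k)
  let ?C = "{c. set c \<subseteq> {..<n+m} \<and> length c = Suc k}"
  have Q: "Q > 0" using Suc.prems by linarith
  have "(\<Sum>c | set c \<subseteq> {..<n+m} \<and> length c = Suc (Suc k). wprob n m \<delta> Q c)
      = (\<Sum>(c, w)\<in>?C \<times> {..<n+m}. wprob n m \<delta> Q (w # c))"
    by (subst lists_length_Suc_eq, subst sum.reindex) (auto simp: inj_on_def case_prod_unfold)
  also have "\<dots> = (\<Sum>c\<in>?C. \<Sum>w<n+m. wprob n m \<delta> Q (w # c))"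
    by (rule sum.cartesian_product[symmetric])
  also have "\<dots> \<le> (\<Sum>c\<in>?C. wprob n m \<delta> Q c)"
  proof (rule sum_mono)
    fix c assume c: "c \<in> ?C"
    then obtain u c' where uc: "c = u # c'" by (cases c) auto
    have "(\<Sum>w<n+m. wprob n m \<delta> Q (w # c)) = (\<Sum>w<n+m. stepw n m \<delta> Q w c) * wprob n m \<delta> Q c"
      by (simp add: uc sum_distrib_right)
    also have "\<dots> \<le> 1 * wprob n m \<delta> Q c"
      using c Suc.prems by (intro mult_right_mono wprob_nonneg sum_stepw_le \<delta> nm Q) (auto simp: uc)
    finally show "(\<Sum>w<n+m. wprob n m \<delta> Q (w # c)) \<le> wprob n m \<delta> Q c" by simp
  qed
  also have "\<dots> \<le> 2" using Suc by simp
  finally show ?case .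
qed

text \<open>Numbers of steps along a new edge to an explored vertex, of steps to a new vertex from a vertex that
  already has two edges, of backtracking steps, and of steps along an old edge out of a branching vertex.\<close>

fun nclose :: "nat list \<Rightarrow> nat" where
  "nclose (w # u # c) = nclose (u # c) + of_bool (w \<in> set (u # c) \<and> ed u w \<notin> wed (u # c))"
| "nclose _ = 0"

fun nbranch :: "nat list \<Rightarrow> nat" where
  "nbranch (w # u # c) = nbranch (u # c) + of_bool (w \<notin> set (u # c) \<and> dg (wed (u # c)) u \<ge> 2)"
| "nbranch _ = 0"

fun nback :: "nat list \<Rightarrow> nat" where
  "nback (w # u # c) = nback (u # c) + of_bool (c \<noteq> [] \<and> w = hd c)"
| "nback _ = 0"

fun nold :: "nat list \<Rightarrow> nat" where
  "nold (w # u # c) = nold (u # c) + of_bool (ed u w \<in> wed (u # c) \<and> dg (wed (u # c)) u \<ge> 3)"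
| "nold _ = 0"

section \<open>Lower bounds for the weight of a trajectory\<close>

text \<open>A step to a new vertex pays \<open>1 / own n m w\<close>, and only a deviation from the
  default behaviour pays \<open>\<delta> / Q\<close>. An old edge out of a vertex with two explored
  edges is forced unless it backtracks; out of a vertex with more it is drawn uniformly, at the cost
  \<open>1 / (3 * \<Delta>)\<close>.\<close>

lemma stepw_ge:
  assumes \<delta>: "0 < \<delta>" "\<delta> \<le> 1/3" and nm: "n > 0" "m > 0" and Q: "Q \<ge> 1"
    and cr: "cross n u w" and D: "real (dg (wed (u # c)) u) \<le> \<Delta>" "\<Delta> \<ge> 1"
  defines "A1 \<equiv> w \<in> set (u # c) \<and> ed u w \<notin> wed (u # c)"
    and "A2 \<equiv> w \<notin> set (u # c) \<and> dg (wed (u # c)) u \<ge> 2"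
    and "A3 \<equiv> c \<noteq> [] \<and> w = hd c" and "B \<equiv> ed u w \<in> wed (u # c) \<and> dg (wed (u # c)) u \<ge> 3"
    and "ow \<equiv> if w \<in> set (u # c) then 1 else 1 / own n m w"
  shows "stepw n m \<delta> Q w (u # c) \<ge> ow * (1 - 2 * \<delta>) * (\<delta> / Q) ^ (of_bool A1 + of_bool A2 + of_bool A3)
     * (1 / (3 * \<Delta>)) ^ of_bool B"
    (is "_ \<ge> _ * ?d * ?q ^ ?a * ?r ^ ?b")
proof -
  define F where "F = wed (u # c)"
  define d where "d = dg F u"
  define unif where "unif = of_bool (cross n u w) / own n m w"
  define vis where "vis = of_bool (w \<in> set (u # c)) / Q"
  have st: "stepw n m \<delta> Q w (u # c) = (if d \<le> 1 then (1 - \<delta>) * unif + \<delta> * vis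
     else if d = 2 then (1 - 2 * \<delta>) * of_bool (w \<noteq> (u # c) ! 1 \<and> ed u w \<in> F) + \<delta> * unif + \<delta> * vis
     else (1/3) * (of_bool (ed u w \<in> F) / d) + (1/3) * unif + (1/3) * vis)"
    by (simp add: stepw_def Let_def d_def F_def unif_def vis_def)
  have ow0: "own n m w > 0" using nm by (rule own_pos)
  have unif: "unif = 1 / own n m w" using cr by (simp add: unif_def)
  have u0: "unif \<ge> 0" and v0: "vis \<ge> 0" using ow0 Q by (auto simp: unif vis_def)
  have q: "0 \<le> ?q" "?q \<le> 1" using \<delta> Q by (auto simp: field_simps)
  have r: "0 \<le> ?r" "?r \<le> 1" using D(2) by auto
  have dd: "0 \<le> ?d" "?d \<le> 1" using \<delta> by auto
  consider (new) "w \<notin> set (u # c)" | (close) "w \<in> set (u # c)" "ed u w \<notin> F" | (old) "ed u w \<in> F" by blast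
  thus ?thesis
  proof cases
    case new
    hence nF: "ed u w \<notin> F" using wed_subset[of "ed u w" "u # c"] ed_incident[of u w] by (auto simp: F_def)
    have nb: "\<not> (c \<noteq> [] \<and> w = hd c)" using new by (cases c) auto
    have ns: "\<not> A1" "\<not> A3" "\<not> B" "A2 = (d \<ge> 2)" "ow = unif"
      using new nb nF by (auto simp: A1_def A2_def A3_def B_def ow_def unif F_def d_def)
    show ?thesis
    proof (cases "d \<ge> 2")
      case False
      have "stepw n m \<delta> Q w (u # c) \<ge> (1 - \<delta>) * unif" using False v0 \<delta> unfolding st by simp
      moreover have "(1 - \<delta>) * unif \<ge> (1 - 2 * \<delta>) * unif" using u0 \<delta> by (intro mult_right_mono) auto
      moreover have "ow * ?d * ?q ^ ?a * ?r ^ ?b = (1 - 2 * \<delta>) * unif"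
        using False by (simp add: ns)
      ultimately show ?thesis by linarith
    next
      case True
      have "stepw n m \<delta> Q w (u # c) \<ge> \<delta> * unif"
      proof (cases "d = 2")
        case True
        have "(1 - 2 * \<delta>) * of_bool (w \<noteq> (u # c) ! 1 \<and> ed u w \<in> F) \<ge> 0" using dd by (intro mult_nonneg_nonneg) auto
        thus ?thesis using True v0 \<delta> unfolding st by simp
      next
        case False
        have "\<delta> * unif \<le> (1/3) * unif" using u0 \<delta> by (intro mult_right_mono) auto
        thus ?thesis using True False v0 nF unfolding st by simp
      qed
      moreover have "unif * (?d * ?q) \<le> unif * (1 * \<delta>)"
        using u0 dd q \<delta> Q by (intro mult_left_mono mult_mono) (auto simp: field_simps mult_le_cancel_left)
      moreover have "ow * ?d * ?q ^ ?a * ?r ^ ?b = unif * (?d * ?q)"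
        using True by (simp add: ns)
      ultimately show ?thesis by (simp add: mult.commute)
    qed
  next
    case close
    have nb: "\<not> (c \<noteq> [] \<and> w = hd c)"
    proof
      assume "c \<noteq> [] \<and> w = hd c"
      hence "ed u w \<in> F" by (cases c) (auto simp: F_def)
      thus False using close by simp
    qed
    have vis: "vis = 1 / Q" using close by (simp add: vis_def)
    have ns: "A1" "\<not> A3" "\<not> B" "\<not> A2" "ow = 1"
      using close nb by (auto simp: A1_def A2_def A3_def B_def ow_def F_def)
    have "stepw n m \<delta> Q w (u # c) \<ge> \<delta> * vis"
    proof -
      have "\<delta> * vis \<le> (1/3) * vis" using v0 \<delta> by (intro mult_right_mono) auto
      moreover have "(1 - \<delta>) * unif \<ge> 0" "\<delta> * unif \<ge> 0" using u0 \<delta> by auto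
      moreover have "(1 - 2 * \<delta>) * of_bool (w \<noteq> (u # c) ! 1 \<and> ed u w \<in> F) \<ge> 0" using dd by (intro mult_nonneg_nonneg) auto
      ultimately show ?thesis using u0 close unfolding st by auto
    qed
    moreover have "?d * ?q \<le> 1 * ?q" using dd q by (intro mult_right_mono) auto
    moreover have "ow * ?d * ?q ^ ?a * ?r ^ ?b = ?d * ?q"
      using close nb by (simp add: ns)
    ultimately show ?thesis by (simp add: vis)
  next
    case old
    have ws: "w \<in> set (u # c)" using old wed_subset[of "ed u w" "u # c"] ed_incident[of u w] by (auto simp: F_def)
    have vis: "vis = 1 / Q" using ws by (simp add: vis_def)
    obtain p c' where c: "c = p # c'" using old by (cases c) (auto simp: F_def)
    have ns: "\<not> A1" "\<not> A2" "A3 = (w = p)" "B = (d \<ge> 3)" and ow1: "ow = 1"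
      using old ws by (auto simp: A1_def A2_def A3_def B_def ow_def F_def d_def c)
    show ?thesis
    proof (cases "d \<ge> 3")
      case True
      have "stepw n m \<delta> Q w (u # c) \<ge> (1/3) * (1 / d)"
        using True old u0 v0 unfolding st by simp
      moreover have "(1/3) * (1 / d) \<ge> ?r"
        using True D by (simp add: d_def F_def frac_le)
      moreover have "?d * ?q ^ ?a * ?r \<le> 1 * 1 * ?r"
        using dd q r by (intro mult_mono power_le_one mult_nonneg_nonneg zero_le_power) auto
      moreover have "ow * ?d * ?q ^ ?a * ?r ^ ?b = ?d * ?q ^ ?a * ?r"
        using True by (simp add: ns ow1)
      ultimately show ?thesis by linarith
    next
      case d3: False
      show ?thesis
      proof (cases "w = p")
        case True
        have "stepw n m \<delta> Q w (u # c) \<ge> \<delta> * vis"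
        proof -
          have "(1 - \<delta>) * unif \<ge> 0" "\<delta> * unif \<ge> 0" using u0 \<delta> by auto
          moreover have "(1 - 2 * \<delta>) * of_bool (w \<noteq> (u # c) ! 1 \<and> ed u w \<in> F) \<ge> 0" using dd by (intro mult_nonneg_nonneg) auto
          ultimately show ?thesis using d3 unfolding st by auto
        qed
        moreover have "?d * ?q \<le> 1 * ?q" using dd q by (intro mult_right_mono) auto
        moreover have "ow * ?d * ?q ^ ?a * ?r ^ ?b = ?d * ?q"
          using d3 True by (simp add: ns ow1)
        ultimately show ?thesis by (simp add: vis)
      next
        case False
        \<comment> \<open>Two distinct old edges at \<open>u\<close> leave degree exactly 2, and the
          default component goes to \<open>w\<close>.\<close>
        have "{ed u w, ed u p} \<subseteq> inc F u" using old by (auto simp: F_def c)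
        moreover have "card {ed u w, ed u p} = 2" using False by simp
        ultimately have "d \<ge> 2" unfolding d_def dg_def by (metis F_def List.finite_set card_mono finite_inc)
        hence d2: "d = 2" using d3 by simp
        have "stepw n m \<delta> Q w (u # c) \<ge> ?d"
        proof -
          have "\<delta> * unif \<ge> 0" "\<delta> * vis \<ge> 0" using u0 v0 \<delta> by auto
          moreover have "of_bool (w \<noteq> (u # c) ! 1 \<and> ed u w \<in> F) = (1::real)" using False old by (simp add: c)
          ultimately show ?thesis unfolding st by (simp add: d2)
        qed
        moreover have "ow * ?d * ?q ^ ?a * ?r ^ ?b \<le> ?d"
        proof -
          have "ow * ?d * ?q ^ ?a * ?r ^ ?b \<le> 1 * ?d * 1 * 1"
            unfolding ow1 using dd q r by (intro mult_mono power_le_one mult_nonneg_nonneg zero_le_power) auto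
          thus ?thesis by simp
        qed
        ultimately show ?thesis by (rule order_trans[rotated])
      qed
    qed
  qed
qed

text \<open>Every vertex is discovered once, so the factors \<open>1 / own n m v\<close> form a
  product over the vertex set rather than over the steps.\<close>

lemma wprob_ge:
  assumes \<delta>: "0 < \<delta>" "\<delta> \<le> 1/3" and nm: "n > 0" "m > 0" and Q: "Q \<ge> 1" and \<Delta>: "\<Delta> \<ge> 1"
  shows "c \<noteq> [] \<Longrightarrow> alternating n c \<Longrightarrow> (\<And>u. real (dg (wed c) u) \<le> \<Delta>) \<Longrightarrow>
    wprob n m \<delta> Q c \<ge> (\<Prod>v\<in>set c. 1 / own n m v) * (1 - 2 * \<delta>) ^ (length c - 1)
      * (\<delta> / Q) ^ (nclose c + nbranch c + nback c) * (1 / (3 * \<Delta>)) ^ nold c"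
proof (induction c rule: wsteps.induct)
  case (1 w u c)
  have deg: "real (dg (wed (u # c)) v) \<le> \<Delta>" for v
  proof -
    have "dg (wed (u # c)) v \<le> dg (wed (w # u # c)) v" by (rule dg_mono) auto
    thus ?thesis using 1(4)[of v] by linarith
  qed
  have IH: "wprob n m \<delta> Q (u # c) \<ge> (\<Prod>v\<in>set (u # c). 1 / own n m v) * (1 - 2 * \<delta>) ^ (length (u # c) - 1)
      * (\<delta> / Q) ^ (nclose (u # c) + nbranch (u # c) + nback (u # c)) * (1 / (3 * \<Delta>)) ^ nold (u # c)"
    using 1(3) by (intro 1(1) deg) auto
  have st: "stepw n m \<delta> Q w (u # c) \<ge> (if w \<in> set (u # c) then 1 else 1 / own n m w) * (1 - 2 * \<delta>)
     * (\<delta> / Q) ^ (of_bool (w \<in> set (u # c) \<and> ed u w \<notin> wed (u # c)) + of_bool (w \<notin> set (u # c) \<and> dg (wed (u # c)) u \<ge> 2)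
         + of_bool (c \<noteq> [] \<and> w = hd c))
     * (1 / (3 * \<Delta>)) ^ of_bool (ed u w \<in> wed (u # c) \<and> dg (wed (u # c)) u \<ge> 3)"
    using 1(3) by (intro stepw_ge \<delta> nm Q \<Delta> deg) (auto simp: cross_def)
  have pr: "(\<Prod>v\<in>set (w # u # c). 1 / own n m v) = (if w \<in> set (u # c) then 1 else 1 / own n m w) * (\<Prod>v\<in>set (u # c). 1 / own n m v)"
    by (simp add: insert_absorb)
  have own0: "own n m v > 0" for v using nm by (rule own_pos)
  have "(\<Prod>v\<in>set (w # u # c). 1 / own n m v) * (1 - 2 * \<delta>) ^ (length (w # u # c) - 1)
      * (\<delta> / Q) ^ (nclose (w # u # c) + nbranch (w # u # c) + nback (w # u # c)) * (1 / (3 * \<Delta>)) ^ nold (w # u # c)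
    = ((if w \<in> set (u # c) then 1 else 1 / own n m w) * (1 - 2 * \<delta>)
     * (\<delta> / Q) ^ (of_bool (w \<in> set (u # c) \<and> ed u w \<notin> wed (u # c)) + of_bool (w \<notin> set (u # c) \<and> dg (wed (u # c)) u \<ge> 2)
         + of_bool (c \<noteq> [] \<and> w = hd c))
     * (1 / (3 * \<Delta>)) ^ of_bool (ed u w \<in> wed (u # c) \<and> dg (wed (u # c)) u \<ge> 3))
     * ((\<Prod>v\<in>set (u # c). 1 / own n m v) * (1 - 2 * \<delta>) ^ (length (u # c) - 1)
      * (\<delta> / Q) ^ (nclose (u # c) + nbranch (u # c) + nback (u # c)) * (1 / (3 * \<Delta>)) ^ nold (u # c))"
    unfolding pr nclose.simps nbranch.simps nback.simps nold.simps power_add by simp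
  also have "\<dots> \<le> stepw n m \<delta> Q w (u # c) * wprob n m \<delta> Q (u # c)"
    using \<delta> Q \<Delta> own0 by (intro mult_mono IH st stepw_nonneg mult_nonneg_nonneg zero_le_power prod_nonneg) (auto intro: less_imp_le)
  finally show ?case by simp
qed auto

section \<open>Counting vertices, edges and old steps of a walk\<close>

text \<open>\<open>nclose\<close> is the cyclomatic number of the explored graph: a step to a new
  vertex adds a vertex and an edge, a closing step only an edge.\<close>

lemma card_wed_nclose: "c \<noteq> [] \<Longrightarrow> card (wed c) + 1 = card (set c) + nclose c"
proof (induction c rule: wsteps.induct)
  case (1 w u c)
  hence IH: "card (wed (u # c)) + 1 = card (set (u # c)) + nclose (u # c)" by simp
  have new: "ed u w \<notin> wed (u # c)" if "w \<notin> set (u # c)"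
    using wed_subset[of "ed u w" "u # c"] ed_incident[of u w] that by auto
  have e: "wed (w # u # c) = insert (ed u w) (wed (u # c))" by (simp add: ed_commute)
  have v: "set (w # u # c) = insert w (set (u # c))" by simp
  show ?case
    using IH new unfolding e v nclose.simps by (simp only: card_insert_if List.finite_set) auto
qed auto

definition excess :: "nat list \<Rightarrow> nat" where
  "excess c = (\<Sum>u\<in>set c. dg (wed c) u - 2)"

text \<open>A branching step raises the degree of its starting vertex from at least 2, and so the
  excess by 1.\<close>

lemma nbranch_le_excess: "nbranch c \<le> excess c"
proof (induction c rule: wsteps.induct)
  case (1 w u c)
  let ?F = "wed (u # c)" and ?F' = "wed (w # u # c)"
  have e: "?F' = insert (ed u w) ?F" by (simp add: ed_commute)
  have "excess (u # c) + of_bool (w \<notin> set (u # c) \<and> dg ?F u \<ge> 2)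
      = (\<Sum>v\<in>set (u # c). dg ?F v - 2 + of_bool (v = u \<and> w \<notin> set (u # c) \<and> dg ?F u \<ge> 2))"
    unfolding excess_def sum.distrib by (simp add: of_bool_conj flip: sum_distrib_right)
  also have "\<dots> \<le> (\<Sum>v\<in>set (u # c). dg ?F' v - 2)"
  proof (rule sum_mono)
    fix v
    have m: "dg ?F v \<le> dg ?F' v" by (rule dg_mono) (auto simp: e)
    have "dg ?F' u = Suc (dg ?F u)" if "w \<notin> set (u # c)"
      unfolding e using wed_subset[of "ed u w" "u # c"] ed_incident[of u w] that
      by (intro dg_insert) auto
    thus "dg ?F v - 2 + of_bool (v = u \<and> w \<notin> set (u # c) \<and> dg ?F u \<ge> 2) \<le> dg ?F' v - 2"
      using m by (auto simp: of_bool_def)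
  qed
  also have "\<dots> \<le> excess (w # u # c)" unfolding excess_def by (rule sum_mono2) auto
  finally show ?case using 1 by simp
qed (auto simp: excess_def)

lemma sum_dg_sides:
  assumes "alternating n c" "set c \<subseteq> {..<N}"
  shows "(\<Sum>u | u \<in> set c \<and> u < n. dg (wed c) u) = card (wed c)"
    "(\<Sum>u | u \<in> set c \<and> \<not> u < n. dg (wed c) u) = card (wed c)"
proof -
  let ?F = "wed c"
  note cr = wed_cross[OF assms]
  have "(\<Sum>u | u \<in> set c \<and> u < n. dg ?F u) = card (\<Union>u\<in>{u. u \<in> set c \<and> u < n}. inc ?F u)"
    unfolding dg_def by (rule card_UN_disjoint[symmetric]) (use cr in \<open>auto simp: inc_def\<close>)
  also have "(\<Union>u\<in>{u. u \<in> set c \<and> u < n}. inc ?F u) = ?F"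
    using cr wed_subset[of _ c] by (auto simp: inc_def)
  finally show "(\<Sum>u | u \<in> set c \<and> u < n. dg (wed c) u) = card (wed c)" .
  have "(\<Sum>u | u \<in> set c \<and> \<not> u < n. dg ?F u) = card (\<Union>u\<in>{u. u \<in> set c \<and> \<not> u < n}. inc ?F u)"
    unfolding dg_def by (rule card_UN_disjoint[symmetric]) (use cr in \<open>auto simp: inc_def\<close>)
  also have "(\<Union>u\<in>{u. u \<in> set c \<and> \<not> u < n}. inc ?F u) = ?F"
    using cr wed_subset[of _ c] by (auto simp: inc_def)
  finally show "(\<Sum>u | u \<in> set c \<and> \<not> u < n. dg (wed c) u) = card (wed c)" .
qed

text \<open>The Hilbert--Schmidt norm joins two nonbacktracking walks of length \<open>l\<close> at position \<open>l\<close>, hence the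
  exemption there.\<close>

definition nb_walk :: "nat \<Rightarrow> nat list \<Rightarrow> bool" where
  "nb_walk l c \<longleftrightarrow> length c = 2 * l + 1 \<and> (\<forall>k. Suc (Suc k) < length c \<longrightarrow> Suc k \<noteq> l \<longrightarrow> c ! k \<noteq> c ! Suc (Suc k))"

lemma dg_pos:
  assumes "length c \<ge> 2" "u \<in> set c"
  shows "dg (wed c) u \<ge> 1"
proof -
  from assms(2) obtain k where k: "k < length c" "u = c ! k" by (metis in_set_conv_nth)
  have "\<exists>e. e \<in> inc (wed c) u"
  proof (cases "Suc k < length c")
    case True
    from wsteps_nth[OF this] have "ed (c ! k) (c ! Suc k) \<in> inc (wed c) u" by (simp add: k)
    thus ?thesis by blast
  next
    case False
    then obtain j where j: "k = Suc j" using assms(1) k by (cases k) auto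
    have "ed (c ! j) (c ! Suc j) \<in> wed c" using k j by (intro wsteps_nth) simp
    hence "ed (c ! j) (c ! Suc j) \<in> inc (wed c) u" by (simp add: k j)
    thus ?thesis by blast
  qed
  hence "inc (wed c) u \<noteq> {}" by blast
  hence "card (inc (wed c) u) > 0" by (simp add: card_gt_0_iff)
  thus ?thesis by (simp add: dg_def)
qed

text \<open>Where the walk does not backtrack, the neighbouring positions give two distinct edges. A
  leaf can only sit at the two ends or at the joint.\<close>

lemma leaves_le:
  assumes nb: "nb_walk l c" and l: "l \<ge> 1"
  shows "card {u \<in> set c. dg (wed c) u = 1} \<le> 3"
proof -
  have len: "length c = 2 * l + 1" using nb by (simp add: nb_walk_def)
  have "{u \<in> set c. dg (wed c) u = 1} \<subseteq> {c ! 0, c ! l, c ! (2 * l)}"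
  proof
    fix u assume u: "u \<in> {u \<in> set c. dg (wed c) u = 1}"
    then obtain k where k: "k < length c" "u = c ! k" by (metis (no_types, lifting) in_set_conv_nth mem_Collect_eq)
    show "u \<in> {c ! 0, c ! l, c ! (2 * l)}"
    proof (rule ccontr)
      assume "u \<notin> {c ! 0, c ! l, c ! (2 * l)}"
      hence k': "k \<noteq> 0" "k \<noteq> l" "k \<noteq> 2 * l" unfolding k(2) by (metis insertCI)+
      then obtain j where j: "k = Suc j" using not0_implies_Suc by blast
      have jl: "Suc (Suc j) < length c" using k k' len j by linarith
      have ne: "c ! j \<noteq> c ! Suc (Suc j)" using nb jl k' j by (simp add: nb_walk_def)
      have "ed (c ! j) (c ! Suc j) \<in> wed c" "ed (c ! Suc j) (c ! Suc (Suc j)) \<in> wed c"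
        using jl by (intro wsteps_nth; simp)+
      hence sub: "{ed u (c ! j), ed u (c ! Suc (Suc j))} \<subseteq> inc (wed c) u"
        by (simp add: k j ed_commute)
      have "2 = card {ed u (c ! j), ed u (c ! Suc (Suc j))}" using ne by simp
      also have "\<dots> \<le> dg (wed c) u" unfolding dg_def by (rule card_mono[OF _ sub]) simp
      finally show False using u by simp
    qed
  qed
  hence "card {u \<in> set c. dg (wed c) u = 1} \<le> card {c ! 0, c ! l, c ! (2 * l)}" by (intro card_mono) auto
  also have "\<dots> \<le> 3" using card_length[of "[c ! 0, c ! l, c ! (2 * l)]"] by simp
  finally show ?thesis .
qed

text \<open>All but at most three vertices have degree at least 2, and on either side the degrees
  sum to \<open>e\<close>; this bounds \<open>v1\<close> and \<open>v2\<close>. Over both sides the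
  excess is \<open>2 * e - 2 * (v1 + v2)\<close> plus the number of leaves, which
  \<open>card_wed_nclose\<close> turns into the bound by \<open>nclose\<close>.\<close>

lemma walk_counts:
  assumes nb: "nb_walk l c" and l: "l \<ge> 1" and al: "alternating n c" and N: "set c \<subseteq> {..<N}"
  defines "v1 \<equiv> card {u \<in> set c. u < n}" and "v2 \<equiv> card {u \<in> set c. \<not> u < n}" and "e \<equiv> card (wed c)"
  shows "v1 + v2 + nclose c = e + 1" "2 * v1 \<le> e + 3" "2 * v2 \<le> e + 3" "excess c \<le> 2 * nclose c + 1"
    "dg (wed c) u \<le> excess c + 2"
proof -
  have len: "length c = 2 * l + 1" using nb by (simp add: nb_walk_def)
  hence len2: "length c \<ge> 2" and ne: "c \<noteq> []" using l by auto
  have split: "set c = {u \<in> set c. u < n} \<union> {u \<in> set c. \<not> u < n}" by auto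
  have v: "card (set c) = v1 + v2" unfolding v1_def v2_def
    by (subst split, rule card_Un_disjoint) auto
  show a: "v1 + v2 + nclose c = e + 1" using card_wed_nclose[OF ne] by (simp add: v e_def)
  let ?L = "{u \<in> set c. dg (wed c) u = 1}"
  have dg2: "2 \<le> dg (wed c) u + of_bool (u \<in> ?L)" if "u \<in> set c" for u
    using dg_pos[OF len2 that] that by (cases "dg (wed c) u = 1") auto
  have lf: "(\<Sum>u\<in>A. of_bool (u \<in> ?L)) \<le> (3 :: nat)" if "A \<subseteq> set c" for A
  proof -
    have fA: "finite A" using that finite_subset by blast
    have "(\<Sum>u\<in>A. of_bool (u \<in> ?L)) = card (A \<inter> ?L)"
      using fA by (simp add: of_bool_def sum.If_cases Int_def)
    also have "\<dots> \<le> card ?L" by (rule card_mono) auto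
    finally show ?thesis using leaves_le[OF nb l] by linarith
  qed
  have side: "2 * card A \<le> (\<Sum>u\<in>A. dg (wed c) u) + 3" if "A \<subseteq> set c" for A
  proof -
    have "2 * card A = (\<Sum>u\<in>A. 2)" by simp
    also have "\<dots> \<le> (\<Sum>u\<in>A. dg (wed c) u + of_bool (u \<in> ?L))"
      by (intro sum_mono dg2) (use that in auto)
    also have "\<dots> \<le> (\<Sum>u\<in>A. dg (wed c) u) + 3" using lf[OF that] by (simp add: sum.distrib)
    finally show ?thesis .
  qed
  note hs = sum_dg_sides[OF al N]
  show "2 * v1 \<le> e + 3" unfolding v1_def e_def using side[of "{u \<in> set c. u < n}"] hs(1) by auto
  show "2 * v2 \<le> e + 3" unfolding v2_def e_def using side[of "{u \<in> set c. \<not> u < n}"] hs(2) by auto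
  have tot: "(\<Sum>u\<in>set c. dg (wed c) u) = 2 * e"
  proof -
    have "(\<Sum>u\<in>set c. dg (wed c) u) = (\<Sum>u | u \<in> set c \<and> u < n. dg (wed c) u) + (\<Sum>u | u \<in> set c \<and> \<not> u < n. dg (wed c) u)"
      by (subst split, rule sum.union_disjoint) auto
    thus ?thesis using hs by (simp add: e_def)
  qed
  have "(\<Sum>u\<in>set c. (dg (wed c) u - 2) + 2) = (\<Sum>u\<in>set c. dg (wed c) u + of_bool (u \<in> ?L))"
  proof (intro sum.cong refl)
    fix u assume u: "u \<in> set c"
    show "(dg (wed c) u - 2) + 2 = dg (wed c) u + of_bool (u \<in> ?L)"
      using dg_pos[OF len2 u] u by (cases "dg (wed c) u = 1") auto
  qed
  hence "excess c + 2 * (v1 + v2) \<le> 2 * e + 3"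
    using lf[of "set c"] tot unfolding sum.distrib by (simp add: excess_def v)
  hence "excess c + 2 * (v1 + v2 + nclose c) \<le> 2 * e + 3 + 2 * nclose c" by simp
  thus "excess c \<le> 2 * nclose c + 1" unfolding a by simp
  show "dg (wed c) u \<le> excess c + 2"
  proof (cases "u \<in> set c")
    case True
    hence "dg (wed c) u - 2 \<le> excess c" unfolding excess_def by (intro member_le_sum) auto
    thus ?thesis by linarith
  next
    case False
    hence "inc (wed c) u = {}" using wed_subset[of _ c] by (auto simp: inc_def)
    thus ?thesis by (simp add: dg_def)
  qed
qed

lemma nback_le: "nback c \<le> card {k. Suc (Suc k) < length c \<and> c ! k = c ! Suc (Suc k)}"
proof (induction c rule: wsteps.induct)
  case (1 w u c)
  let ?A = "\<lambda>c. {k. Suc (Suc k) < length c \<and> c ! k = c ! Suc (Suc k)}"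
  have fin: "finite (?A c)" for c :: "nat list" by (rule finite_subset[of _ "{..<length c}"]) auto
  have sub: "Suc ` ?A (u # c) \<union> (if c \<noteq> [] \<and> w = hd c then {0} else {}) \<subseteq> ?A (w # u # c)"
    by (auto simp: hd_conv_nth)
  define B where "B = ?A (u # c)"
  have fB: "finite B" unfolding B_def by (rule fin)
  have "nback (w # u # c) \<le> card (?A (u # c)) + of_bool (c \<noteq> [] \<and> w = hd c)" using 1 by simp
  also have "\<dots> = card (Suc ` ?A (u # c) \<union> (if c \<noteq> [] \<and> w = hd c then {0} else {}))"
    unfolding B_def[symmetric] by (subst card_Un_disjoint) (use fB in \<open>auto simp: card_image\<close>)
  also have "\<dots> \<le> card (?A (w # u # c))" by (rule card_mono[OF fin sub])
  finally show ?case .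
qed auto

lemma nback_nb_walk:
  assumes "nb_walk l c"
  shows "nback c \<le> 1"
proof -
  have "{k. Suc (Suc k) < length c \<and> c ! k = c ! Suc (Suc k)} \<subseteq> {l - 1}"
    using assms by (auto simp: nb_walk_def)
  hence "card {k. Suc (Suc k) < length c \<and> c ! k = c ! Suc (Suc k)} \<le> card {l - 1}" by (intro card_mono) auto
  thus ?thesis using nback_le[of c] by simp
qed

lemma nold_le_filter:
  assumes "finite F" "wed c \<subseteq> F"
  shows "nold c \<le> length (filter (\<lambda>f. dg F (fst f) \<ge> 3 \<or> dg F (snd f) \<ge> 3) (wsteps c))"
  using assms(2)
proof (induction c rule: wsteps.induct)
  case (1 w u c)
  have "dg (wed (u # c)) u \<le> dg F u" using 1 assms(1) by (intro dg_mono) auto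
  moreover have "dg F u \<ge> 3 \<Longrightarrow> dg F (fst (ed w u)) \<ge> 3 \<or> dg F (snd (ed w u)) \<ge> 3"
    using ed_incident(2)[of w u] by auto
  ultimately show ?case using 1 by auto
qed auto

lemma length_filter_count:
  "length (filter P xs) = (\<Sum>f | f \<in> set xs \<and> P f. count_list xs f)"
proof -
  have "length (filter P xs) = (\<Sum>f\<in>set (filter P xs). count_list (filter P xs) f)"
    by (simp add: sum_count_set)
  also have "\<dots> = (\<Sum>f | f \<in> set xs \<and> P f. count_list xs f)"
  proof (rule sum.cong)
    fix f assume "f \<in> {f. f \<in> set xs \<and> P f}"
    hence "P f" by simp
    thus "count_list (filter P xs) f = count_list xs f" by (induction xs) auto
  qed auto
  finally show ?thesis .
qed

text \<open>Old steps out of branching vertices use edges that touch a vertex of degree at least 3.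
  All crossings beyond the second of an edge add up to the length minus
  \<open>2 * card (wed c)\<close>. The first two crossings are covered by twice the number of these
  edges, and D <= 3 (D - 2) for D >= 3 bounds that number by \<open>3 * excess c\<close>.\<close>

lemma nold_le:
  assumes mult: "\<And>f. f \<in> wed c \<Longrightarrow> count_list (wsteps c) f \<ge> 2"
  shows "nold c + 2 * card (wed c) \<le> (length c - 1) + 6 * excess c"
proof -
  let ?F = "wed c"
  let ?P = "\<lambda>f. dg ?F (fst f) \<ge> 3 \<or> dg ?F (snd f) \<ge> 3"
  let ?T = "{f. f \<in> ?F \<and> ?P f}"
  let ?m = "count_list (wsteps c)"
  have fT: "finite ?T" by simp
  have "nold c \<le> (\<Sum>f\<in>?T. ?m f)" using nold_le_filter[of ?F c] by (simp add: length_filter_count)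
  also have "\<dots> = (\<Sum>f\<in>?T. (?m f - 2) + 2)" using mult by (intro sum.cong refl) fastforce
  also have "\<dots> = (\<Sum>f\<in>?T. ?m f - 2) + 2 * card ?T" unfolding sum.distrib by simp
  also have "(\<Sum>f\<in>?T. ?m f - 2) \<le> (\<Sum>f\<in>?F. ?m f - 2)" by (rule sum_mono2) auto
  finally have 1: "nold c \<le> (\<Sum>f\<in>?F. ?m f - 2) + 2 * card ?T" by simp
  have "(\<Sum>f\<in>?F. ?m f - 2) + 2 * card ?F = (\<Sum>f\<in>?F. (?m f - 2) + 2)" unfolding sum.distrib by simp
  also have "\<dots> = (\<Sum>f\<in>?F. ?m f)" using mult by (intro sum.cong refl) fastforce
  also have "\<dots> = length c - 1" by (simp add: sum_count_set length_wsteps)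
  finally have 2: "(\<Sum>f\<in>?F. ?m f - 2) + 2 * card ?F = length c - 1" .
  have "?T \<subseteq> (\<Union>u\<in>{u\<in>set c. dg ?F u \<ge> 3}. inc ?F u)"
    using wed_subset[of _ c] by (fastforce simp: inc_def)
  hence "card ?T \<le> card (\<Union>u\<in>{u\<in>set c. dg ?F u \<ge> 3}. inc ?F u)" by (intro card_mono) auto
  also have "\<dots> \<le> (\<Sum>u\<in>{u\<in>set c. dg ?F u \<ge> 3}. dg ?F u)" unfolding dg_def by (rule card_UN_le) simp
  also have "\<dots> \<le> (\<Sum>u\<in>{u\<in>set c. dg ?F u \<ge> 3}. 3 * (dg ?F u - 2))" by (rule sum_mono) auto
  also have "\<dots> \<le> (\<Sum>u\<in>set c. 3 * (dg ?F u - 2))" by (rule sum_mono2) auto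
  also have "\<dots> = 3 * excess c" by (simp add: excess_def sum_distrib_left)
  finally show ?thesis using 1 2 by linarith
qed

text \<open>The exponents collect the counts: \<open>3 * g + 2\<close> is for \<open>g\<close>
  closing steps, at most \<open>2 * g + 1\<close> branchings and one backtrack;
  \<open>T + 12 * g + 6\<close> is \<open>nold_le\<close> with excess at most
  \<open>2 * g + 1\<close>; \<open>6 * real g + 9\<close> is three times the degree bound
  \<open>2 * g + 3\<close>. The form 1 <= ... allows multiplication into any other bound.\<close>

lemma wprob_lower_bound:
  assumes \<delta>: "0 < \<delta>" "\<delta> \<le> 1/3" and nm: "n > 0" "m > 0" and Q: "Q \<ge> 1"
    and nb: "nb_walk l c" and l: "l \<ge> 1" and al: "alternating n c" and N: "set c \<subseteq> {..<N}"
    and mult: "\<And>f. f \<in> wed c \<Longrightarrow> count_list (wsteps c) f \<ge> 2"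
  defines "v1 \<equiv> card {u \<in> set c. u < n}" and "v2 \<equiv> card {u \<in> set c. \<not> u < n}" and "g \<equiv> nclose c"
    and "T \<equiv> 2 * l - 2 * card (wed c)"
  shows "1 \<le> wprob n m \<delta> Q c * (real n ^ v1 * real m ^ v2 * (1 / (1 - 2 * \<delta>)) ^ (2 * l)
       * (Q / \<delta>) ^ (3 * g + 2) * (6 * real g + 9) ^ (T + 12 * g + 6))"
proof -
  note wc = walk_counts[OF nb l al N]
  have len: "length c = 2 * l + 1" using nb by (simp add: nb_walk_def)
  hence ne: "c \<noteq> []" by auto
  define \<Delta> where "\<Delta> = 2 * real g + 3"
  have dg\<Delta>: "real (dg (wed c) u) \<le> \<Delta>" for u
    using wc(4) wc(5)[of u] by (simp add: \<Delta>_def g_def)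
  define S where "S = nclose c + nbranch c + nback c"
  have S: "S \<le> 3 * g + 2"
    using wc(4) nbranch_le_excess[of c] nback_nb_walk[OF nb] by (simp add: S_def g_def)
  have O: "nold c \<le> T + 12 * g + 6"
    using nold_le[OF mult] wc(4) len by (simp add: T_def g_def)
  have pr: "(\<Prod>v\<in>set c. 1 / own n m v) = 1 / (real n ^ v1 * real m ^ v2)"
  proof -
    have split: "set c = {u \<in> set c. u < n} \<union> {u \<in> set c. \<not> u < n}" by auto
    have "(\<Prod>v\<in>set c. 1 / own n m v) = (\<Prod>v\<in>{u \<in> set c. u < n}. 1 / own n m v) * (\<Prod>v\<in>{u \<in> set c. \<not> u < n}. 1 / own n m v)"
      by (subst split, rule prod.union_disjoint) auto
    also have "(\<Prod>v\<in>{u \<in> set c. u < n}. 1 / own n m v) = (\<Prod>v\<in>{u \<in> set c. u < n}. 1 / real n)"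
      by (intro prod.cong refl) (auto simp: own_def)
    also have "(\<Prod>v\<in>{u \<in> set c. \<not> u < n}. 1 / own n m v) = (\<Prod>v\<in>{u \<in> set c. \<not> u < n}. 1 / real m)"
      by (intro prod.cong refl) (auto simp: own_def)
    finally show ?thesis by (simp add: v1_def v2_def power_one_over)
  qed
  have q: "Q / \<delta> \<ge> 1" using Q \<delta> by (simp add: field_simps)
  have d0: "1 - 2 * \<delta> > 0" using \<delta> by simp
  have "1 / (real n ^ v1 * real m ^ v2) * (1 - 2 * \<delta>) ^ (2 * l) * (\<delta> / Q) ^ S * (1 / (3 * \<Delta>)) ^ nold c
      \<le> wprob n m \<delta> Q c"
    using wprob_ge[OF \<delta> nm Q _ ne al dg\<Delta>] len by (simp add: pr S_def \<Delta>_def)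
  hence "1 \<le> wprob n m \<delta> Q c * ((real n ^ v1 * real m ^ v2) * (1 / (1 - 2 * \<delta>)) ^ (2 * l) * (Q / \<delta>) ^ S * (3 * \<Delta>) ^ nold c)"
    using nm \<delta> Q d0 by (simp add: power_divide \<Delta>_def divide_simps mult_ac)
  also have "\<dots> \<le> wprob n m \<delta> Q c * (real n ^ v1 * real m ^ v2 * (1 / (1 - 2 * \<delta>)) ^ (2 * l)
       * (Q / \<delta>) ^ (3 * g + 2) * (3 * \<Delta>) ^ (T + 12 * g + 6))"
    using S O q d0 \<delta> Q by (intro mult_left_mono mult_mono power_increasing wprob_nonneg mult_nonneg_nonneg zero_le_power)
      (auto simp: \<Delta>_def)
  finally show ?thesis by (simp add: \<Delta>_def algebra_simps)
qed

section \<open>Moments of the entries and expected walk weights\<close>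

lemma finite_set_Pi_pmf_bool:
  assumes "finite I"
  shows "finite (set_pmf (Pi_pmf I dflt p :: ('a \<Rightarrow> bool) pmf))"
proof -
  have "set_pmf (Pi_pmf I dflt p) \<subseteq> PiE_dflt I dflt (\<lambda>_. UNIV :: bool set)"
    using set_Pi_pmf_subset[OF assms, of dflt p] by (force simp: PiE_dflt_def)
  moreover have "finite (PiE_dflt I dflt (\<lambda>_. UNIV :: bool set))"
    using assms by (rule finite_PiE_dflt) auto
  ultimately show ?thesis by (rule finite_subset)
qed

lemma expectation_prod_Pi_pmf_signed:
  fixes f :: "'a \<Rightarrow> bool \<Rightarrow> real"
  assumes fin: "finite I"
  shows "measure_pmf.expectation (Pi_pmf I dflt p) (\<lambda>A. \<Prod>x\<in>I. f x (A x))
    = (\<Prod>x\<in>I. measure_pmf.expectation (p x) (f x))"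
proof -
  let ?M = "measure_pmf (Pi_pmf I dflt p)"
  have ind: "prob_space.indep_vars ?M (\<lambda>_. borel) (\<lambda>x A. f x (A x)) I"
    by (rule prob_space.indep_vars_compose2[OF measure_pmf.prob_space_axioms indep_vars_Pi_pmf[OF fin]]) auto
  have int: "integrable ?M (\<lambda>A. f x (A x))" for x
    by (rule integrable_measure_pmf_finite[OF finite_set_Pi_pmf_bool[OF fin]])
  have "measure_pmf.expectation (Pi_pmf I dflt p) (\<lambda>A. \<Prod>x\<in>I. f x (A x)) = (\<Prod>x\<in>I. measure_pmf.expectation (Pi_pmf I dflt p) (\<lambda>A. f x (A x)))"
    by (rule prob_space.indep_vars_lebesgue_integral[OF measure_pmf.prob_space_axioms fin ind int])
  also have "\<dots> = (\<Prod>x\<in>I. measure_pmf.expectation (p x) (f x))"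
  proof (rule prod.cong[OF refl])
    fix x assume "x \<in> I"
    hence "p x = map_pmf (\<lambda>A. A x) (Pi_pmf I dflt p)" using Pi_pmf_component[OF fin, of x dflt p] by simp
    thus "measure_pmf.expectation (Pi_pmf I dflt p) (\<lambda>A. f x (A x)) = measure_pmf.expectation (p x) (f x)"
      by simp
  qed
  finally show ?thesis .
qed

lemma finite_set_bip_ER: "finite (set_pmf (bip_ER n m p))"
  unfolding bip_ER_def by (rule finite_set_Pi_pmf_bool) simp

lemma integrable_bip_ER [simp]: "integrable (measure_pmf (bip_ER n m p)) (f :: _ \<Rightarrow> real)"
  by (rule integrable_measure_pmf_finite[OF finite_set_bip_ER])

lemma centH_ed:
  "centH n p d A a b = (if cross n a b then centX p d A (fst (ed a b)) (snd (ed a b) - n) else 0)"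
  by (auto simp: centH_def cross_def ed_def min_def max_def)

lemma centH_commute: "centH n p d A a b = centH n p d A b a"
  by (auto simp: centH_def)

text \<open>Regrouping by edges exposes the independent factors, with multiplicities as
  exponents.\<close>

lemma wprod_centH:
  assumes "alternating n c" "set c \<subseteq> {..<n+m}"
  shows "wprod (centH n p d A) c
    = (\<Prod>x\<in>{..<n}\<times>{..<m}. ((of_bool (A x) - p) / sqrt d) ^ count_list (wsteps c) (fst x, n + snd x))"
  using assms
proof (induction c rule: wsteps.induct)
  case (1 a b c)
  define I where "I = {..<n} \<times> {..<m}"
  define f where "f = (\<lambda>x. (of_bool (A x) - p) / sqrt d)"
  define k where "k = (\<lambda>x. count_list (wsteps (b # c)) (fst x, n + snd x))"
  define x0 where "x0 = (fst (ed a b), snd (ed a b) - n)"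
  have cr: "cross n a b" using 1 by simp
  have x0: "x0 \<in> I" using cr 1(3) by (auto simp: x0_def I_def cross_def ed_def min_def max_def)
  have eq: "ed a b = (fst x, n + snd x) \<longleftrightarrow> x = x0" for x
    using cr by (cases x) (auto simp: x0_def cross_def ed_def min_def max_def)
  have IH: "wprod (centH n p d A) (b # c) = (\<Prod>x\<in>I. f x ^ k x)"
    using 1 by (simp add: I_def f_def k_def)
  have h: "centH n p d A a b = f x0" using cr by (simp add: centH_ed x0_def f_def centX_def)
  have "wprod (centH n p d A) (a # b # c) = f x0 * (\<Prod>x\<in>I. f x ^ k x)" by (simp add: IH h)
  also have "f x0 = (\<Prod>x\<in>I. f x ^ of_bool (x = x0))"
  proof -
    have "(\<Prod>x\<in>I. f x ^ of_bool (x = x0)) = (\<Prod>x\<in>I. if x = x0 then f x else 1)"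
      by (intro prod.cong refl) auto
    thus ?thesis using x0 by (simp add: I_def)
  qed
  also have "\<dots> * (\<Prod>x\<in>I. f x ^ k x) = (\<Prod>x\<in>I. f x ^ (of_bool (x = x0) + k x))"
    by (simp add: prod.distrib power_add)
  also have "\<dots> = (\<Prod>x\<in>I. f x ^ count_list (wsteps (a # b # c)) (fst x, n + snd x))"
    by (intro prod.cong refl) (auto simp: k_def eq)
  finally show ?case by (simp add: I_def f_def)
qed auto

lemma wprod_not_alternating: "\<not> alternating n c \<Longrightarrow> wprod (centH n p d A) c = 0"
  by (induction c rule: wsteps.induct) (auto simp: centH_ed)

text \<open>An entry is at most 1 / sqrt d in modulus and has variance at most p / d; the exponent
  beyond 2 is paid by the former.\<close>

lemma bernoulli_moment_bound:
  fixes p d :: real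
  assumes p: "0 \<le> p" "p \<le> 1" and d: "d > 0"
  defines "M \<equiv> \<lambda>k. measure_pmf.expectation (bernoulli_pmf p) (\<lambda>b. ((of_bool b - p) / sqrt d) ^ k)"
  shows "M 0 = 1" "M 1 = 0" "k \<ge> 2 \<Longrightarrow> \<bar>M k\<bar> \<le> p / d * (1 / sqrt d) ^ (k - 2)"
proof -
  have M: "M k = ((1 - p) / sqrt d) ^ k * p + (- p / sqrt d) ^ k * (1 - p)" for k
    using p by (simp add: M_def)
  show "M 0 = 1" by (simp add: M)
  show "M 1 = 0" by (simp add: M field_simps)
  assume k: "k \<ge> 2"
  have "\<bar>M k\<bar> \<le> \<bar>((1 - p) / sqrt d) ^ k * p\<bar> + \<bar>(- p / sqrt d) ^ k * (1 - p)\<bar>"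
    unfolding M by (rule abs_triangle_ineq)
  also have "\<dots> = ((1 - p) ^ k * p + p ^ k * (1 - p)) / sqrt d ^ k"
    using p d by (simp add: abs_mult power_abs power_divide add_divide_distrib)
  also have "\<dots> \<le> ((1 - p) ^ 2 * p + p ^ 2 * (1 - p)) / sqrt d ^ k"
    using p d k by (intro divide_right_mono add_mono mult_right_mono power_decreasing) auto
  also have "(1 - p) ^ 2 * p + p ^ 2 * (1 - p) = p * (1 - p)" by (simp add: power2_eq_square algebra_simps)
  also have "p * (1 - p) / sqrt d ^ k \<le> p / sqrt d ^ k"
    using p d by (intro divide_right_mono) (auto simp: mult_left_le)
  also have "\<dots> = p / d * (1 / sqrt d) ^ (k - 2)"
  proof -
    have "sqrt d ^ k = sqrt d ^ 2 * sqrt d ^ (k - 2)" using k by (metis le_add_diff_inverse power_add)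
    thus ?thesis using d by (simp add: power_one_over)
  qed
  finally show "\<bar>M k\<bar> \<le> p / d * (1 / sqrt d) ^ (k - 2)" .
qed

text \<open>An edge crossed once contributes its mean 0. Otherwise each edge gives p / d, and each
  crossing beyond the second a factor 1 / sqrt d.\<close>

lemma abs_expectation_wprod_le:
  assumes p: "0 \<le> p" "p \<le> 1" and d: "d > 0" and al: "alternating n c" and N: "set c \<subseteq> {..<n+m}"
  shows "\<bar>measure_pmf.expectation (bip_ER n m p) (\<lambda>A. wprod (centH n p d A) c)\<bar>
    \<le> (if \<forall>f\<in>wed c. count_list (wsteps c) f \<ge> 2
        then (p / d) ^ card (wed c) * (1 / sqrt d) ^ (length c - 1 - 2 * card (wed c)) else 0)"
proof -
  define I where "I = {..<n} \<times> {..<m}"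
  define k where "k = (\<lambda>x. count_list (wsteps c) (fst x, n + snd x))"
  define M where "M = (\<lambda>k. measure_pmf.expectation (bernoulli_pmf p) (\<lambda>b. ((of_bool b - p) / sqrt d) ^ k))"
  have mom: "M 0 = 1" "M 1 = 0" "k \<ge> 2 \<Longrightarrow> \<bar>M k\<bar> \<le> p / d * (1 / sqrt d) ^ (k - 2)" for k
    unfolding M_def using bernoulli_moment_bound[OF p d] by blast+
  let ?j = "\<lambda>x :: nat \<times> nat. (fst x, n + snd x)"
  have fI: "finite I" by (simp add: I_def)
  have E: "measure_pmf.expectation (bip_ER n m p) (\<lambda>A. wprod (centH n p d A) c) = (\<Prod>x\<in>I. M (k x))"
    unfolding wprod_centH[OF al N] bip_ER_def
    using expectation_prod_Pi_pmf_signed[OF fI, of False "\<lambda>_. bernoulli_pmf p" "\<lambda>x b. ((of_bool b - p) / sqrt d) ^ k x"]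
    by (simp add: I_def k_def M_def)
  define J where "J = {x\<in>I. ?j x \<in> wed c}"
  have fJ: "finite J" using fI by (simp add: J_def)
  have jJ: "bij_betw ?j J (wed c)"
  proof (rule bij_betwI')
    fix f assume f: "f \<in> wed c"
    have "f \<in> {..<n} \<times> {n..<n+m}" using wed_cross[OF al N] f by blast
    hence "f = ?j (fst f, snd f - n)" "(fst f, snd f - n) \<in> I" by (auto simp: I_def)
    thus "\<exists>x\<in>J. f = ?j x" using f by (metis (no_types, lifting) J_def mem_Collect_eq)
  qed (auto simp: J_def)
  have E2: "(\<Prod>x\<in>I. M (k x)) = (\<Prod>x\<in>J. M (k x))"
  proof (rule prod.mono_neutral_right[OF fI])
    show "\<forall>x\<in>I - J. M (k x) = 1"
      using mom(1) by (auto simp: J_def k_def count_list_0_iff)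
  qed (auto simp: J_def)
  show ?thesis
  proof (cases "\<forall>f\<in>wed c. count_list (wsteps c) f \<ge> 2")
    case True
    have k2: "k x \<ge> 2" if "x \<in> J" for x using True that by (auto simp: J_def k_def)
    have "\<bar>\<Prod>x\<in>J. M (k x)\<bar> \<le> (\<Prod>x\<in>J. p / d * (1 / sqrt d) ^ (k x - 2))"
      unfolding abs_prod using mom(3) k2 by (intro prod_mono) auto
    also have "\<dots> = (p / d) ^ card J * (1 / sqrt d) ^ (\<Sum>x\<in>J. k x - 2)"
      unfolding prod.distrib by (simp add: power_sum)
    also have "card J = card (wed c)" using jJ by (rule bij_betw_same_card)
    also have "(\<Sum>x\<in>J. k x - 2) = length c - 1 - 2 * card (wed c)"
    proof -
      have "(\<Sum>x\<in>J. k x - 2) + 2 * card J = (\<Sum>x\<in>J. (k x - 2) + 2)" unfolding sum.distrib by simp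
      also have "\<dots> = (\<Sum>x\<in>J. k x)" using k2 by (intro sum.cong refl) fastforce
      also have "\<dots> = (\<Sum>f\<in>wed c. count_list (wsteps c) f)"
        unfolding k_def by (rule sum.reindex_bij_betw[OF jJ])
      also have "\<dots> = length c - 1" by (simp add: sum_count_set length_wsteps)
      finally show ?thesis using \<open>card J = card (wed c)\<close> by linarith
    qed
    finally show ?thesis using True by (simp add: E E2)
  next
    case False
    then obtain f where f: "f \<in> wed c" "\<not> count_list (wsteps c) f \<ge> 2" by blast
    from jJ f(1) have "f \<in> ?j ` J" by (simp only: bij_betw_def)
    then obtain x where x: "x \<in> J" "?j x = f" by (elim imageE) simp
    have "count_list (wsteps c) f \<noteq> 0" using f(1) by (simp add: count_list_0_iff)
    hence "k x = 1" using f x by (simp add: k_def)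
    hence "M (k x) = 0" using mom(2) by simp
    hence "(\<Prod>x\<in>J. M (k x)) = 0" using x fJ by (meson prod_zero)
    thus ?thesis using p d by (simp add: E E2)
  qed
qed

section \<open>From pairs of nonbacktracking paths to walks\<close>

lemma wprod_append: "p \<noteq> [] \<Longrightarrow> q \<noteq> [] \<Longrightarrow> last p = hd q \<Longrightarrow> wprod h (p @ tl q) = wprod h p * wprod h q"
proof (induction p rule: wsteps.induct)
  case (1 a b c) thus ?case by simp
next
  case ("2_2" v)
  thus ?case by (cases q) auto
qed auto

lemma wprod_rev:
  assumes "\<And>a b. h a b = h b a"
  shows "wprod h (rev p) = wprod h p"
proof (induction p rule: wsteps.induct)
  case (1 a b c)
  have "wprod h (rev (a # b # c)) = wprod h (rev (b # c) @ tl [b, a])" by simp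
  also have "\<dots> = wprod h (rev (b # c)) * wprod h [b, a]" by (rule wprod_append) auto
  finally show ?case using 1 assms[of b a] by simp
qed auto

lemma nobt_nth: "nobt p \<Longrightarrow> Suc (Suc k) < length p \<Longrightarrow> p ! k \<noteq> p ! Suc (Suc k)"
proof (induction p arbitrary: k rule: nobt.induct)
  case (1 a b c p) thus ?case by (cases k) auto
qed auto

lemma nb_walk_join:
  assumes "p \<in> nb_paths N l x y z u" "q \<in> nb_paths N l x y z u"
  shows "nb_walk l (p @ tl (rev q))"
proof -
  note pp = nb_paths_props[OF assms(1)] and qq = nb_paths_props[OF assms(2)]
  have nth: "(p @ tl (rev q)) ! k = (if k \<le> l then p ! k else q ! (2 * l - k))" if "k < 2 * l + 1" for k
  proof (cases "k \<le> l")
    case True thus ?thesis using pp(1) by (simp add: nth_append)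
  next
    case False
    thus ?thesis using pp(1) qq(1) that by (simp add: nth_append nth_tl rev_nth mult_2)
  qed
  have mid: "p ! l = q ! l"
    using pp(1,3) qq(1,3) by (metis last_conv_nth diff_Suc_1 length_0_conv nat.distinct(1))
  show ?thesis unfolding nb_walk_def
  proof (intro conjI allI impI)
    show len: "length (p @ tl (rev q)) = 2 * l + 1" using pp(1) qq(1) by simp
    fix k assume k: "Suc (Suc k) < length (p @ tl (rev q))" "Suc k \<noteq> l"
    have k': "k < 2 * l + 1" "Suc (Suc k) < 2 * l + 1" using k len by auto
    show "(p @ tl (rev q)) ! k \<noteq> (p @ tl (rev q)) ! Suc (Suc k)"
    proof (cases "Suc (Suc k) \<le> l")
      case True
      have "(p @ [u]) ! k \<noteq> (p @ [u]) ! Suc (Suc k)"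
        using True pp(1) by (intro nobt_nth pp(5)) auto
      thus ?thesis unfolding nth[OF k'(1)] nth[OF k'(2)] using True pp(1) by (simp add: nth_append)
    next
      case False
      hence kl: "k \<ge> l" using k by linarith
      define j where "j = 2 * l - Suc (Suc k)"
      have j: "Suc (Suc j) = 2 * l - k" "Suc (Suc j) \<le> l" using k'(2) kl by (auto simp: j_def)
      have "(q @ [u]) ! j \<noteq> (q @ [u]) ! Suc (Suc j)"
        using j qq(1) by (intro nobt_nth qq(5)) auto
      hence "q ! j \<noteq> q ! (2 * l - k)" using j qq(1) by (simp add: nth_append)
      moreover have "(p @ tl (rev q)) ! k = q ! (2 * l - k)"
        unfolding nth[OF k'(1)] using kl mid by (cases "k = l") auto
      ultimately show ?thesis unfolding nth[OF k'(2)] using False by (simp add: j_def)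
    qed
  qed
qed

text \<open>The square of a kernel entry is a sum over pairs of paths with the same first and last
  directed edges; such a pair, joined at \<open>z\<close>, is a walk of length
  \<open>2 * l\<close>.\<close>

lemma expectation_nb_hs_le:
  fixes n m :: nat and p d :: real
  assumes bound: "\<And>c. nb_walk l c \<Longrightarrow> set c \<subseteq> {..<n+m} \<Longrightarrow>
      \<bar>measure_pmf.expectation (bip_ER n m p) (\<lambda>A. wprod (centH n p d A) c)\<bar> \<le> B * W c"
    and W: "\<And>c. W c \<ge> 0" "(\<Sum>c | set c \<subseteq> {..<n+m} \<and> length c = Suc (2 * l). W c) \<le> 2" and B: "B \<ge> 0"
  shows "measure_pmf.expectation (bip_ER n m p) (\<lambda>A. nb_hs (n+m) (centH n p d A) l) \<le> real (n + m) * (2 * B)"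
proof -
  define N where "N = n + m"
  define E where "E = (\<lambda>c. \<bar>measure_pmf.expectation (bip_ER n m p) (\<lambda>A. wprod (centH n p d A) c)\<bar>)"
  define C where "C = {c. nb_walk l c \<and> set c \<subseteq> {..<N}}"
  have fC': "finite {c. set c \<subseteq> {..<N} \<and> length c = Suc (2 * l)}" by (rule finite_lists_length_eq) simp
  have subC: "C \<subseteq> {c. set c \<subseteq> {..<N} \<and> length c = Suc (2 * l)}" by (auto simp: C_def nb_walk_def)
  have fC: "finite C" using subC fC' by (rule finite_subset)
  let ?P = "\<lambda>x y z u. nb_paths N l x y z u"
  define S where "S = (SIGMA t : {..<N} \<times> {..<N} \<times> {..<N} \<times> {..<N}.
     (case t of (x, y, z, u) \<Rightarrow> ?P x y z u \<times> ?P x y z u))"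
  \<comment> \<open>The joined walk does not determine \<open>u\<close>, so \<open>u\<close> is
    recorded to keep the map injective. Its free choice is the factor
    \<open>real (n + m)\<close>.\<close>
  define F where "F = (\<lambda>(t :: nat \<times> nat \<times> nat \<times> nat, pq :: nat list \<times> nat list). (snd (snd (snd t)), fst pq @ tl (rev (snd pq))))"
  have fS: "finite S" unfolding S_def by (rule finite_SigmaI) (auto split: prod.splits)
  have join: "wprod (centH n p d A) a * wprod (centH n p d A) b = wprod (centH n p d A) (a @ tl (rev b))"
    if "a \<in> ?P x y z u" "b \<in> ?P x y z u" for A a b x y z u
  proof -
    have ne: "a \<noteq> []" "b \<noteq> []" using nb_paths_props(1)[OF that(1)] nb_paths_props(1)[OF that(2)] by auto
    hence "last a = hd (rev b)" using nb_paths_props(3)[OF that(1)] nb_paths_props(3)[OF that(2)] by (simp add: hd_rev)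
    thus ?thesis using ne by (subst wprod_append) (auto simp: wprod_rev centH_commute)
  qed
  have "nb_hs N (centH n p d A) l = (\<Sum>(t, a, b)\<in>S. wprod (centH n p d A) (a @ tl (rev b)))" for A
  proof -
    have "nb_hs N (centH n p d A) l = (\<Sum>x<N. \<Sum>y<N. \<Sum>z<N. \<Sum>u<N. \<Sum>a\<in>?P x y z u. \<Sum>b\<in>?P x y z u.
        wprod (centH n p d A) a * wprod (centH n p d A) b)"
      unfolding nb_hs_def nb_kernel_def power2_eq_square sum_product ..
    also have "\<dots> = (\<Sum>x<N. \<Sum>y<N. \<Sum>z<N. \<Sum>u<N. \<Sum>a\<in>?P x y z u. \<Sum>b\<in>?P x y z u.
        wprod (centH n p d A) (a @ tl (rev b)))"
      by (intro sum.cong refl) (simp add: join)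
    also have "\<dots> = (\<Sum>(t, a, b)\<in>S. wprod (centH n p d A) (a @ tl (rev b)))"
      unfolding S_def by (subst sum.Sigma[symmetric]) (auto simp: sum.cartesian_product split_beta)
    finally show ?thesis .
  qed
  hence "measure_pmf.expectation (bip_ER n m p) (\<lambda>A. nb_hs N (centH n p d A) l)
      = (\<Sum>(t, a, b)\<in>S. measure_pmf.expectation (bip_ER n m p) (\<lambda>A. wprod (centH n p d A) (a @ tl (rev b))))"
    by (simp add: split_beta Bochner_Integration.integral_sum)
  also have "\<dots> \<le> (\<Sum>s\<in>S. E (snd (F s)))"
    by (intro sum_mono) (auto simp: E_def F_def)
  also have "\<dots> = (\<Sum>r\<in>F ` S. E (snd r))"
  proof (subst sum.reindex)
    show "inj_on F S"
    proof (rule inj_onI)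
      fix s s' assume s: "s \<in> S" "s' \<in> S" and eq: "F s = F s'"
      obtain x y z u a b where s1: "s = ((x, y, z, u), (a, b))" by (metis surj_pair)
      obtain x' y' z' u' a' b' where s2: "s' = ((x', y', z', u'), (a', b'))" by (metis surj_pair)
      have ab: "a \<in> ?P x y z u" "b \<in> ?P x y z u" using s s1 by (auto simp: S_def)
      have ab': "a' \<in> ?P x' y' z' u'" "b' \<in> ?P x' y' z' u'" using s s2 by (auto simp: S_def)
      note l1 = nb_paths_props[OF ab(1)] and l2 = nb_paths_props[OF ab(2)]
      note l1' = nb_paths_props[OF ab'(1)] and l2' = nb_paths_props[OF ab'(2)]
      have u: "u = u'" and ap: "a @ tl (rev b) = a' @ tl (rev b')" using eq by (auto simp: F_def s1 s2)
      have aa: "a = a'" and tt: "tl (rev b) = tl (rev b')" using ap l1(1) l1'(1) by auto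
      have xz: "x = x'" "z = z'" "y = y'" using aa u l1(2-4) l1'(2-4) by auto
      have "hd (rev b) = hd (rev b')" using l2(1,3) l2'(1,3) xz by (simp add: hd_rev)
      hence "rev b = rev b'" using tt l2(1) l2'(1) by (metis hd_Cons_tl length_0_conv length_rev nat.distinct(1))
      thus "s = s'" using aa u xz by (simp add: s1 s2)
    qed
  qed simp
  also have "\<dots> \<le> (\<Sum>r\<in>{..<N} \<times> C. E (snd r))"
  proof (rule sum_mono2)
    show "F ` S \<subseteq> {..<N} \<times> C"
    proof
      fix r assume "r \<in> F ` S"
      then obtain x y z u a b where r: "r = (u, a @ tl (rev b))" and xy: "x < N" "y < N" "u < N"
        and ab: "a \<in> ?P x y z u" "b \<in> ?P x y z u" by (auto simp: F_def S_def)
      have "set (tl (rev b)) \<subseteq> set b" by (metis list.set_sel(2) set_rev subsetI tl_Nil)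
      hence "set (a @ tl (rev b)) \<subseteq> {..<N}"
        using nb_paths_props(6)[OF ab(1) xy(1,2)] nb_paths_props(6)[OF ab(2) xy(1,2)] by auto
      thus "r \<in> {..<N} \<times> C" using nb_walk_join[OF ab] xy by (simp add: r C_def)
    qed
  qed (auto simp: fC E_def)
  also have "\<dots> = real N * (\<Sum>c\<in>C. E c)"
    by (simp add: sum.cartesian_product' flip: sum.cartesian_product)
  finally have le: "measure_pmf.expectation (bip_ER n m p) (\<lambda>A. nb_hs N (centH n p d A) l) \<le> real N * (\<Sum>c\<in>C. E c)" .
  have "(\<Sum>c\<in>C. E c) \<le> (\<Sum>c\<in>C. B * W c)"
    by (intro sum_mono) (auto simp: C_def E_def N_def intro!: bound)
  also have "\<dots> \<le> (\<Sum>c | set c \<subseteq> {..<N} \<and> length c = Suc (2 * l). B * W c)"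
    using fC' subC W(1) B by (intro sum_mono2) auto
  also have "\<dots> \<le> B * 2" using W(2) B by (simp add: N_def mult_left_mono flip: sum_distrib_left)
  finally have "real N * (\<Sum>c\<in>C. E c) \<le> real N * (B * 2)" by (rule mult_left_mono) simp
  thus ?thesis using le by (simp add: N_def mult.commute)
qed

section \<open>Balancing the factors of the trace bound\<close>

text \<open>Applied to a = sqrt n and b = sqrt m. For sides of equal size
  \<open>v1 + v2 + g = e + 1\<close> would leave \<open>b\<^sup>2 / (b\<^sup>2) ^ g\<close>; the
  imbalance \<open>a / b\<close> enters with exponent \<open>2 * v1 - e\<close>, which is at most
  3.\<close>

lemma vertex_edge_balance:
  fixes a b :: real
  assumes ab: "a \<ge> b" "b > 0" and v: "v1 + v2 + g = e + (1::nat)" "2 * v1 \<le> e + 3"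
  shows "(1 / (a * b)) ^ e * ((a\<^sup>2) ^ v1 * (b\<^sup>2) ^ v2) \<le> (a / b) ^ 3 * b\<^sup>2 / (b\<^sup>2) ^ g"
proof -
  define r where "r = a / b"
  have r: "r \<ge> 1" "a = r * b" using ab by (auto simp: r_def)
  have "(a\<^sup>2) ^ v1 * (b\<^sup>2) ^ v2 * (b\<^sup>2) ^ g = r ^ (2 * v1) * (b\<^sup>2) ^ (v1 + v2 + g)"
    unfolding r(2) power_mult_distrib power_add power_mult by (simp only: mult_ac)
  also have "\<dots> = r ^ (2 * v1) * (b\<^sup>2 * (b * b) ^ e)" unfolding v(1) by (simp add: power2_eq_square)
  also have "\<dots> \<le> r ^ (e + 3) * (b\<^sup>2 * (b * b) ^ e)"
    using v(2) r ab by (intro mult_right_mono power_increasing) auto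
  also have "\<dots> = r ^ 3 * b\<^sup>2 * (a * b) ^ e" unfolding r(2) by (simp add: power_add power_mult_distrib mult_ac)
  finally have "(a\<^sup>2) ^ v1 * (b\<^sup>2) ^ v2 * (b\<^sup>2) ^ g \<le> r ^ 3 * b\<^sup>2 * (a * b) ^ e" .
  moreover have "(a * b) ^ e > 0" "(b\<^sup>2) ^ g > 0" using ab by auto
  ultimately show ?thesis by (simp add: r_def[symmetric] power_one_over divide_simps mult_ac)
qed

text \<open>Each unit of excess \<open>g\<close> gains a factor \<open>1/m\<close>. For \<open>6 g + 9 \<le> sqrt d\<close> the factor \<open>1 / sqrt d\<close> per repeated
  step pays for the choices at branching vertices; for larger \<open>g\<close> the gain from \<open>1/m\<close> pays for all of them.\<close>

lemma excess_cost_le: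
  fixes M s Y Q :: real
  assumes s: "s \<ge> 1" and Y: "Y \<ge> 1" "6 * real g + 9 \<le> Y" and Q: "Q \<ge> 1" and M: "M \<ge> 1"
    and h1: "Q ^ 3 * Y ^ 12 \<le> sqrt M" and h2: "Y ^ L \<le> sqrt M ^ g0" "6 * real g0 + 9 \<le> s" and T: "T \<le> L"
  shows "(1 / s) ^ T * (Q ^ (3 * g + 2) * (6 * real g + 9) ^ (T + 12 * g + 6)) / M ^ g \<le> Q\<^sup>2 * Y ^ 6"
proof -
  define G where "G = 6 * real g + 9"
  have G: "0 \<le> G" "1 \<le> G" "G \<le> Y" using Y by (auto simp: G_def)
  have sM: "sqrt M \<ge> 1" "sqrt M * sqrt M = M" using M by auto
  have key: "(1 / s) ^ T * G ^ T \<le> sqrt M ^ g"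
  proof (cases "G \<le> s")
    case True
    have "(1 / s) ^ T * G ^ T = (G / s) ^ T" by (simp add: power_divide)
    also have "\<dots> \<le> 1" using True G s by (intro power_le_one) auto
    also have "\<dots> \<le> sqrt M ^ g" using sM by simp
    finally show ?thesis .
  next
    case False
    have "(1 / s) ^ T * G ^ T \<le> 1 * Y ^ L"
    proof (rule mult_mono)
      show "(1 / s) ^ T \<le> 1" using s by (intro power_le_one) auto
      have "G ^ T \<le> Y ^ T" using G by (intro power_mono) auto
      also have "\<dots> \<le> Y ^ L" using Y T by (intro power_increasing) auto
      finally show "G ^ T \<le> Y ^ L" .
    qed (use G Y in auto)
    also have "\<dots> \<le> sqrt M ^ g0" using h2 by simp
    also have "\<dots> \<le> sqrt M ^ g"
    proof (rule power_increasing)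
      have "6 * real g0 + 9 < 6 * real g + 9" using False h2(2) by (simp add: G_def)
      thus "g0 \<le> g" by simp
    qed (use sM in auto)
    finally show ?thesis .
  qed
  have "(1 / s) ^ T * (Q ^ (3 * g + 2) * G ^ (T + 12 * g + 6))
      = ((1 / s) ^ T * G ^ T) * ((Q ^ 3 * G ^ 12) ^ g * (Q\<^sup>2 * G ^ 6))"
  proof -
    have "(Q ^ 3 * G ^ 12) ^ g = Q ^ (3 * g) * G ^ (12 * g)" by (simp add: power_mult_distrib flip: power_mult)
    thus ?thesis by (simp add: power_add power2_eq_square mult_ac)
  qed
  also have "\<dots> \<le> sqrt M ^ g * ((Q ^ 3 * Y ^ 12) ^ g * (Q\<^sup>2 * Y ^ 6))"
    using key G Q Y s sM by (intro mult_mono power_mono) auto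
  also have "\<dots> \<le> sqrt M ^ g * (sqrt M ^ g * (Q\<^sup>2 * Y ^ 6))"
    using h1 Q Y sM by (intro mult_left_mono mult_right_mono power_mono) auto
  also have "\<dots> = (Q\<^sup>2 * Y ^ 6) * M ^ g" using sM by (simp add: power_mult_distrib[symmetric] mult.assoc[symmetric])
  finally have "(1 / s) ^ T * (Q ^ (3 * g + 2) * G ^ (T + 12 * g + 6)) \<le> (Q\<^sup>2 * Y ^ 6) * M ^ g" .
  moreover have "M ^ g > 0" using M by simp
  ultimately show ?thesis unfolding G_def by (simp only: pos_divide_le_eq)
qed

text \<open>\<open>h1\<close> lets one factor 1 / sqrt m per unit of excess pay for the deviations,
  and \<open>h2\<close> supplies the \<open>g0\<close> that separates the two regimes of
  \<open>excess_cost_le\<close>. Each expected walk weight is then at most \<open>B\<close> times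
  the probability of the walk under the process with memory, and these probabilities sum to at most
  2.\<close>

theorem expected_nb_hs:
  fixes n m l g0 :: nat and p d \<delta> :: real
  assumes nm: "m \<ge> 1" "n \<ge> m" and p: "p = d / sqrt (real m * real n)" "p \<le> 1" and d: "d \<ge> 1"
    and \<delta>: "0 < \<delta>" "\<delta> \<le> 1/3" and l: "l \<ge> 1"
    and h1: "(real (2 * l + 1) / \<delta>) ^ 3 * (12 * real l + 9) ^ 12 \<le> sqrt m"
    and h2: "(12 * real l + 9) ^ (2 * l) \<le> sqrt m ^ g0" "6 * real g0 + 9 \<le> sqrt d"
  shows "measure_pmf.expectation (bip_ER n m p) (\<lambda>A. nb_hs (n + m) (centH n p d A) l)
    \<le> real (n + m) * (2 * ((sqrt n / sqrt m) ^ 3 * m * ((real (2 * l + 1) / \<delta>)\<^sup>2 * (12 * real l + 9) ^ 6)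
        * (1 / (1 - 2 * \<delta>)) ^ (2 * l)))"
proof -
  define Q where "Q = real (2 * l + 1)"
  define Y where "Y = 12 * real l + 9"
  define B where "B = (sqrt n / sqrt m) ^ 3 * m * ((Q / \<delta>)\<^sup>2 * Y ^ 6) * (1 / (1 - 2 * \<delta>)) ^ (2 * l)"
  have Q: "Q \<ge> 1" by (simp add: Q_def)
  have Q\<delta>: "Q / \<delta> \<ge> 1" using Q \<delta> by (simp add: field_simps)
  have n0: "n > 0" and m0: "m > 0" using nm by auto
  have p0: "p \<ge> 0" using d by (simp add: p)
  have B0: "B \<ge> 0" using \<delta> by (auto simp: B_def Y_def intro!: mult_nonneg_nonneg)
  have W0: "wprob n m \<delta> Q c \<ge> 0" for c using \<delta> Q by (intro wprob_nonneg) auto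
  have W2: "(\<Sum>c | set c \<subseteq> {..<n + m} \<and> length c = Suc (2 * l). wprob n m \<delta> Q c) \<le> 2"
    using \<delta> n0 m0 by (intro sum_wprob_le) (auto simp: Q_def)
  have main: "\<bar>measure_pmf.expectation (bip_ER n m p) (\<lambda>A. wprod (centH n p d A) c)\<bar> \<le> B * wprob n m \<delta> Q c"
    if nb: "nb_walk l c" and N: "set c \<subseteq> {..<n + m}" for c
    proof (cases "alternating n c \<and> (\<forall>f\<in>wed c. count_list (wsteps c) f \<ge> 2)")
      case False
      have "\<bar>measure_pmf.expectation (bip_ER n m p) (\<lambda>A. wprod (centH n p d A) c)\<bar> \<le> 0"
      proof (cases "alternating n c")
        case True
        hence "\<not> (\<forall>f\<in>wed c. count_list (wsteps c) f \<ge> 2)" using False by simp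
        thus ?thesis using abs_expectation_wprod_le[OF p0 p(2) _ True N, of d] d by (simp only: if_False)
      next
        case False
        thus ?thesis by (simp add: wprod_not_alternating)
      qed
      thus ?thesis using B0 W0[of c] by (meson mult_nonneg_nonneg order_trans)
    next
      case True
      hence al: "alternating n c" and mult: "\<And>f. f \<in> wed c \<Longrightarrow> count_list (wsteps c) f \<ge> 2" by auto
      define e where "e = card (wed c)"
      define g where "g = nclose c"
      define T where "T = 2 * l - 2 * e"
      define v1 where "v1 = card {u \<in> set c. u < n}"
      define v2 where "v2 = card {u \<in> set c. \<not> u < n}"
      have len: "length c = 2 * l + 1" using nb by (simp add: nb_walk_def)
      note wc = walk_counts[OF nb l al N, folded e_def g_def v1_def v2_def]
      have "2 * e \<le> 2 * l"
      proof -
        have "2 * e = (\<Sum>f\<in>wed c. 2)" by (simp add: e_def)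
        also have "\<dots> \<le> (\<Sum>f\<in>wed c. count_list (wsteps c) f)" by (rule sum_mono) (rule mult)
        also have "\<dots> = 2 * l" by (simp add: sum_count_set length_wsteps len)
        finally show ?thesis .
      qed
      moreover have "v1 + v2 \<ge> 1"
      proof -
        have "card (set c) \<ge> 1" using len by (cases c) (auto simp: Suc_le_eq card_gt_0_iff)
        moreover have "card (set c) \<le> v1 + v2" unfolding v1_def v2_def
          by (rule order_trans[OF _ card_Un_le]) (auto intro!: card_mono)
        ultimately show ?thesis by linarith
      qed
      \<comment> \<open>At least one vertex and at most \<open>l\<close> edges bound the cyclomatic
        number by \<open>l\<close>, so the uniform \<open>Y\<close> dominates every
        \<open>6 * real g + 9\<close>.\<close>
      ultimately have gl: "g \<le> l" using wc(1) by linarith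
      have Yg: "6 * real g + 9 \<le> Y" using gl by (simp add: Y_def)
      have pd: "p / d = 1 / (sqrt n * sqrt m)" using d by (simp add: p real_sqrt_mult mult.commute)
      have bal: "(p / d) ^ e * (real n ^ v1 * real m ^ v2) \<le> (sqrt n / sqrt m) ^ 3 * m / real m ^ g"
        using vertex_edge_balance[of "sqrt m" "sqrt n" v1 v2 g e] wc(1,2) nm by (simp add: pd)
      have exc: "(1 / sqrt d) ^ T * ((Q / \<delta>) ^ (3 * g + 2) * (6 * real g + 9) ^ (T + 12 * g + 6)) / real m ^ g
          \<le> (Q / \<delta>)\<^sup>2 * Y ^ 6"
        by (rule excess_cost_le[where L = "2 * l" and ?g0.0 = g0])
           (use d Yg Q\<delta> nm h1 h2 in \<open>auto simp: Q_def Y_def T_def\<close>)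
      have d0: "1 - 2 * \<delta> > 0" using \<delta> by simp
      define R where "R = (1 / (1 - 2 * \<delta>)) ^ (2 * l)"
      have R: "R \<ge> 0" using d0 by (simp add: R_def)
      have "\<bar>measure_pmf.expectation (bip_ER n m p) (\<lambda>A. wprod (centH n p d A) c)\<bar> \<le> (p / d) ^ e * (1 / sqrt d) ^ T"
        using abs_expectation_wprod_le[OF p0 p(2) _ al N, of d] d mult len by (simp add: e_def T_def)
      also have "\<dots> \<le> (p / d) ^ e * (1 / sqrt d) ^ T * (wprob n m \<delta> Q c * (real n ^ v1 * real m ^ v2 * R
         * (Q / \<delta>) ^ (3 * g + 2) * (6 * real g + 9) ^ (T + 12 * g + 6)))"
      proof -
        have "1 \<le> wprob n m \<delta> Q c * (real n ^ v1 * real m ^ v2 * R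
         * (Q / \<delta>) ^ (3 * g + 2) * (6 * real g + 9) ^ (T + 12 * g + 6))"
          unfolding R_def v1_def v2_def g_def T_def e_def
          by (rule wprob_lower_bound[OF \<delta> n0 m0 Q nb l al N mult])
        from mult_left_mono[OF this, of "(p / d) ^ e * (1 / sqrt d) ^ T"] show ?thesis
          using p0 d by (simp only: mult_1_right) auto
      qed
      also have "\<dots> = ((p / d) ^ e * (real n ^ v1 * real m ^ v2)) *
          ((1 / sqrt d) ^ T * ((Q / \<delta>) ^ (3 * g + 2) * (6 * real g + 9) ^ (T + 12 * g + 6))) * (R * wprob n m \<delta> Q c)"
        by (simp only: mult_ac)
      also have "\<dots> \<le> ((sqrt n / sqrt m) ^ 3 * m / real m ^ g) *
          ((1 / sqrt d) ^ T * ((Q / \<delta>) ^ (3 * g + 2) * (6 * real g + 9) ^ (T + 12 * g + 6))) * (R * wprob n m \<delta> Q c)"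
      proof (rule mult_right_mono[OF mult_right_mono[OF bal]])
        have "Q / \<delta> \<ge> 0" "6 * real g + 9 \<ge> 0" "1 / sqrt d \<ge> 0" using Q\<delta> d by auto
        thus "0 \<le> (1 / sqrt d) ^ T * ((Q / \<delta>) ^ (3 * g + 2) * (6 * real g + 9) ^ (T + 12 * g + 6))"
          by (intro mult_nonneg_nonneg zero_le_power)
        show "0 \<le> R * wprob n m \<delta> Q c" using R W0[of c] by simp
      qed
      also have "\<dots> = ((sqrt n / sqrt m) ^ 3 * m) *
          ((1 / sqrt d) ^ T * ((Q / \<delta>) ^ (3 * g + 2) * (6 * real g + 9) ^ (T + 12 * g + 6)) / real m ^ g) * (R * wprob n m \<delta> Q c)"
      proof -
        have "a / x * y * z = a * (y / x) * z" for a x y z :: real by simp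
        thus ?thesis .
      qed
      also have "\<dots> \<le> ((sqrt n / sqrt m) ^ 3 * m) * ((Q / \<delta>)\<^sup>2 * Y ^ 6) * (R * wprob n m \<delta> Q c)"
        using R W0[of c] nm by (intro mult_right_mono[OF mult_left_mono[OF exc]]) auto
      also have "\<dots> = B * wprob n m \<delta> Q c" unfolding B_def R_def by (simp only: mult_ac)
      finally show ?thesis .
    qed
  show ?thesis
    using expectation_nb_hs_le[OF main W0 W2 B0] by (simp only: B_def Q_def Y_def)
qed

section \<open>Dense subgraphs with exceptional vertices\<close>

definition pot_edges :: "nat \<Rightarrow> nat \<Rightarrow> (nat \<times> nat) set" where
  "pot_edges n m = {..<n} \<times> {n..<n+m}"

definition gset :: "nat \<Rightarrow> nat \<Rightarrow> (nat \<times> nat \<Rightarrow> bool) \<Rightarrow> (nat \<times> nat) set" where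
  "gset n m A = {f \<in> pot_edges n m. A (fst f, snd f - n)}"

definition verts :: "(nat \<times> nat) set \<Rightarrow> nat set" where
  "verts F = fst ` F \<union> snd ` F"

definition opp :: "nat \<Rightarrow> nat \<Rightarrow> nat \<Rightarrow> real" where
  "opp n m x = real (if x < n then m else n)"

lemma finite_pot_edges [simp]: "finite (pot_edges n m)" by (simp add: pot_edges_def)
lemma finite_gset [simp]: "finite (gset n m A)" by (simp add: gset_def)
lemma finite_verts [simp]: "finite F \<Longrightarrow> finite (verts F)" by (simp add: verts_def)
lemma gset_subset: "gset n m A \<subseteq> pot_edges n m" by (auto simp: gset_def)

lemma expectation_prod_pot_edges:
  fixes g :: "nat \<times> nat \<Rightarrow> bool \<Rightarrow> real"
  assumes p: "0 \<le> p" "p \<le> 1"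
  shows "measure_pmf.expectation (bip_ER n m p) (\<lambda>A. \<Prod>f\<in>pot_edges n m. g f (A (fst f, snd f - n)))
    = (\<Prod>f\<in>pot_edges n m. p * g f True + (1 - p) * g f False)"
proof -
  let ?j = "\<lambda>e :: nat \<times> nat. (fst e, n + snd e)"
  have bij: "bij_betw ?j ({..<n} \<times> {..<m}) (pot_edges n m)"
    by (rule bij_betwI[where g = "\<lambda>f. (fst f, snd f - n)"]) (auto simp: pot_edges_def)
  have 1: "(\<Prod>f\<in>pot_edges n m. g f (A (fst f, snd f - n))) = (\<Prod>e\<in>{..<n}\<times>{..<m}. g (?j e) (A e))" for A
    by (subst prod.reindex_bij_betw[OF bij, symmetric]) simp
  have 2: "(\<Prod>f\<in>pot_edges n m. p * g f True + (1 - p) * g f False)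
    = (\<Prod>e\<in>{..<n}\<times>{..<m}. p * g (?j e) True + (1 - p) * g (?j e) False)"
    by (subst prod.reindex_bij_betw[OF bij, symmetric]) simp
  show ?thesis unfolding 1 2 bip_ER_def
    using p by (subst expectation_prod_Pi_pmf_signed) (auto simp: mult.commute)
qed

text \<open>Exponential tilting of the edges that leave \<open>W\<close> from \<open>J\<close>: these sets of edges are disjoint for different
  elements of \<open>J\<close> and disjoint from \<open>F\<close>.\<close>

lemma prob_tilt_le:
  fixes \<theta> \<kappa> :: "nat \<Rightarrow> real"
  assumes p: "0 \<le> p" "p \<le> 1" and F: "F \<subseteq> pot_edges n m" "verts F \<subseteq> W"
    and J: "J \<subseteq> W" "J \<subseteq> {..<n+m}" and W: "finite W" "card W \<le> w0"
  shows "measure_pmf.prob (bip_ER n m p)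
      {A. F \<subseteq> gset n m A \<and> (\<forall>x\<in>J. \<theta> x * real (dg (gset n m A) x) \<ge> \<kappa> x)}
    \<le> p ^ card F * (\<Prod>x\<in>J. exp (p * (exp (\<theta> x) - 1) * opp n m x - \<kappa> x + (\<bar>\<theta> x\<bar> + p) * real w0))"
proof -
  let ?E = "pot_edges n m"
  have fJ: "finite J" using J(1) W(1) finite_subset by blast
  have fF: "finite F" using F(1) finite_subset by fastforce
  define out where "out = (\<lambda>x. {f\<in>?E. (fst f = x \<and> snd f \<notin> W) \<or> (snd f = x \<and> fst f \<notin> W)})"
  have fo: "finite (out x)" for x by (simp add: out_def)
  define t where "t = (\<lambda>f. \<Sum>x\<in>J. of_bool (f \<in> out x) * \<theta> x)"
  define c where "c = (\<Sum>x\<in>J. \<kappa> x - \<bar>\<theta> x\<bar> * real w0)"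
  define g where "g = (\<lambda>f b. (if f \<in> F then of_bool b else 1) * exp (t f * of_bool b) :: real)"
  let ?B = "\<lambda>A f. A (fst f, snd f - n)"
  have prodexp: "(\<Prod>f\<in>?E. exp (t f * of_bool (?B A f))) = exp (\<Sum>x\<in>J. \<theta> x * real (card {f\<in>out x. ?B A f}))" for A
  proof -
    have "(\<Sum>f\<in>?E. t f * of_bool (?B A f)) = (\<Sum>x\<in>J. \<Sum>f\<in>?E. of_bool (f \<in> out x) * \<theta> x * of_bool (?B A f))"
      unfolding t_def sum_distrib_right by (rule sum.swap)
    also have "\<dots> = (\<Sum>x\<in>J. \<theta> x * (\<Sum>f\<in>?E. of_bool (f \<in> out x \<and> ?B A f)))"
      unfolding sum_distrib_left by (intro sum.cong refl) auto
    also have "\<dots> = (\<Sum>x\<in>J. \<theta> x * real (card {f\<in>out x. ?B A f}))"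
      by (intro sum.cong refl, subst sum_of_bool_card) (auto simp: out_def intro!: arg_cong[of _ _ card])
    finally show ?thesis by (simp only: exp_sum[OF finite_pot_edges, symmetric])
  qed
  \<comment> \<open>At most \<open>w0\<close> edges lead from \<open>x\<close> into
    \<open>W\<close>, so outgoing degrees may replace degrees up to \<open>w0\<close>.\<close>
  have deg: "\<bar>real (dg (gset n m A) x) - real (card {f\<in>out x. ?B A f})\<bar> \<le> real w0" if x: "x \<in> J" for A x
  proof -
    have sub: "{f\<in>out x. ?B A f} \<subseteq> inc (gset n m A) x" by (auto simp: out_def inc_def gset_def)
    have "inc (gset n m A) x - {f\<in>out x. ?B A f} \<subseteq> (\<lambda>w. ed x w) ` W"
    proof
      fix f assume f: "f \<in> inc (gset n m A) x - {f\<in>out x. ?B A f}"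
      hence fe: "f \<in> ?E" "fst f = x \<or> snd f = x" "?B A f" by (auto simp: inc_def gset_def)
      hence w: "(fst f = x \<and> snd f \<in> W) \<or> (snd f = x \<and> fst f \<in> W)" using f by (auto simp: out_def)
      moreover have "fst f \<le> snd f" using fe(1) by (auto simp: pot_edges_def)
      hence "f = ed (fst f) (snd f)" "f = ed (snd f) (fst f)" by (auto simp: ed_def prod_eq_iff)
      ultimately show "f \<in> (\<lambda>w. ed x w) ` W" by blast
    qed
    hence "card (inc (gset n m A) x - {f\<in>out x. ?B A f}) \<le> card ((\<lambda>w. ed x w) ` W)"
      using W by (intro card_mono) auto
    also have "\<dots> \<le> w0" using card_image_le[OF W(1)] W(2) le_trans by blast
    finally have le: "card (inc (gset n m A) x - {f\<in>out x. ?B A f}) \<le> w0" .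
    have fin: "finite {f\<in>out x. ?B A f}" using fo[of x] by simp
    have "card (inc (gset n m A) x - {f\<in>out x. ?B A f}) = card (inc (gset n m A) x) - card {f\<in>out x. ?B A f}"
      by (rule card_Diff_subset[OF fin sub])
    moreover have "card {f\<in>out x. ?B A f} \<le> card (inc (gset n m A) x)" by (rule card_mono[OF _ sub]) simp
    ultimately show ?thesis using le unfolding dg_def by linarith
  qed
  \<comment> \<open>Exponential Markov inequality: on the event the tilted product is at least
    \<open>exp c\<close>.\<close>
  have ind: "indicator {A. F \<subseteq> gset n m A \<and> (\<forall>x\<in>J. \<theta> x * real (dg (gset n m A) x) \<ge> \<kappa> x)} A
      \<le> exp (- c) * (\<Prod>f\<in>?E. g f (?B A f))" for A
  proof (cases "F \<subseteq> gset n m A \<and> (\<forall>x\<in>J. \<theta> x * real (dg (gset n m A) x) \<ge> \<kappa> x)")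
    case True
    have "(\<Prod>f\<in>?E. g f (?B A f)) = (\<Prod>f\<in>?E. exp (t f * of_bool (?B A f)))"
      using True by (intro prod.cong refl) (auto simp: g_def gset_def)
    also have "\<dots> = exp (\<Sum>x\<in>J. \<theta> x * real (card {f\<in>out x. ?B A f}))" by (rule prodexp)
    also have "\<dots> \<ge> exp c"
      unfolding c_def exp_le_cancel_iff
    proof (rule sum_mono)
      fix x assume x: "x \<in> J"
      have "\<theta> x * real (dg (gset n m A) x) - \<theta> x * real (card {f\<in>out x. ?B A f})
          \<le> \<bar>\<theta> x\<bar> * \<bar>real (dg (gset n m A) x) - real (card {f\<in>out x. ?B A f})\<bar>"
        by (simp flip: abs_mult right_diff_distrib)
      also have "\<dots> \<le> \<bar>\<theta> x\<bar> * real w0" using deg[OF x] by (intro mult_left_mono) auto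
      finally show "\<kappa> x - \<bar>\<theta> x\<bar> * real w0 \<le> \<theta> x * real (card {f\<in>out x. ?B A f})" using True x by fastforce
    qed
    finally have "exp (- c) * (\<Prod>f\<in>?E. g f (?B A f)) \<ge> exp (- c) * exp c" by (intro mult_left_mono) auto
    thus ?thesis using True by (simp add: exp_minus)
  next
    case False
    have "g f b \<ge> 0" for f b by (simp add: g_def)
    hence "exp (- c) * (\<Prod>f\<in>?E. g f (?B A f)) \<ge> 0" by (intro mult_nonneg_nonneg prod_nonneg) auto
    thus ?thesis using False unfolding indicator_def of_bool_def mem_Collect_eq by (simp only: if_False)
  qed
  have uniq: "x = y" if "x \<in> J" "y \<in> J" "f \<in> out x" "f \<in> out y" for x y f
    using that J(1) by (auto simp: out_def)
  have gE: "p * g f True + (1 - p) * g f False \<le> (if f \<in> F then p else 1) * exp (p * (\<Sum>x\<in>J. of_bool (f \<in> out x) * (exp (\<theta> x) - 1)))"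
    if f: "f \<in> ?E" for f
  proof (cases "f \<in> F")
    case True
    have "f \<notin> out x" for x using True F(2) by (auto simp: out_def verts_def)
    thus ?thesis using True by (simp add: g_def t_def)
  next
    case False
    have "exp (t f) - 1 = (\<Sum>x\<in>J. of_bool (f \<in> out x) * (exp (\<theta> x) - 1))"
    proof (cases "\<exists>x\<in>J. f \<in> out x")
      case True
      then obtain x where x: "x \<in> J" "f \<in> out x" by blast
      have iff: "f \<in> out y \<longleftrightarrow> y = x" if "y \<in> J" for y using uniq[of x y f] x that by blast
      have "(\<Sum>y\<in>J. of_bool (f \<in> out y) * h y) = (\<Sum>y\<in>J. if y = x then h y else 0)" for h :: "nat \<Rightarrow> real"
        by (intro sum.cong refl) (simp add: iff)
      hence "(\<Sum>y\<in>J. of_bool (f \<in> out y) * h y) = h x" for h :: "nat \<Rightarrow> real" using x fJ by simp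
      thus ?thesis by (simp add: t_def)
    next
      case False
      hence "(\<Sum>x\<in>J. of_bool (f \<in> out x) * h x) = 0" for h :: "nat \<Rightarrow> real" by (intro sum.neutral) auto
      thus ?thesis by (simp add: t_def)
    qed
    moreover have "p * g f True + (1 - p) * g f False = 1 + p * (exp (t f) - 1)"
      using False by (simp add: g_def algebra_simps)
    ultimately show ?thesis using False exp_ge_add_one_self[of "p * (exp (t f) - 1)"] by simp
  qed
  have out_card: "opp n m x - real w0 \<le> real (card (out x)) \<and> real (card (out x)) \<le> opp n m x" if x: "x \<in> J" for x
  proof -
    define V where "V = (if x < n then {n..<n+m} else {..<n})"
    have oV: "opp n m x = real (card V)" by (simp add: opp_def V_def)
    have "bij_betw (ed x) (V - W) (out x)"
    proof (rule bij_betwI[where g = "\<lambda>f. if fst f = x then snd f else fst f"])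
      show "ed x \<in> (V - W) \<rightarrow> out x"
        using x J by (auto simp: out_def V_def ed_def pot_edges_def min_def max_def split: if_splits)
      show "(\<lambda>f. if fst f = x then snd f else fst f) \<in> out x \<rightarrow> V - W"
        using x J by (auto simp: out_def V_def pot_edges_def split: if_splits)
    qed (use x J in \<open>auto simp: out_def V_def ed_def pot_edges_def min_def max_def split: if_splits\<close>)
    hence co: "card (out x) = card (V - W)" by (simp add: bij_betw_same_card)
    have "card (V - W) \<le> card V" by (rule card_mono) (auto simp: V_def)
    moreover have "card V \<le> card (V - W) + card W"
      by (rule order_trans[OF card_mono card_Un_le]) (use W in \<open>auto simp: V_def\<close>)
    ultimately show ?thesis using W(2) unfolding co oV by linarith
  qed
  have "measure_pmf.prob (bip_ER n m p) {A. F \<subseteq> gset n m A \<and> (\<forall>x\<in>J. \<theta> x * real (dg (gset n m A) x) \<ge> \<kappa> x)}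
      = measure_pmf.expectation (bip_ER n m p) (indicator {A. F \<subseteq> gset n m A \<and> (\<forall>x\<in>J. \<theta> x * real (dg (gset n m A) x) \<ge> \<kappa> x)})"
    by simp
  also have "\<dots> \<le> measure_pmf.expectation (bip_ER n m p) (\<lambda>A. exp (- c) * (\<Prod>f\<in>?E. g f (?B A f)))"
    by (intro integral_mono ind) auto
  also have "\<dots> = exp (- c) * (\<Prod>f\<in>?E. p * g f True + (1 - p) * g f False)"
    using expectation_prod_pot_edges[OF p, of n m g] by simp
  also have "\<dots> \<le> exp (- c) * (\<Prod>f\<in>?E. (if f \<in> F then p else 1) * exp (p * (\<Sum>x\<in>J. of_bool (f \<in> out x) * (exp (\<theta> x) - 1))))"
    using gE p by (intro mult_left_mono prod_mono conjI) (auto simp: g_def)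
  also have "(\<Prod>f\<in>?E. (if f \<in> F then p else 1) * exp (p * (\<Sum>x\<in>J. of_bool (f \<in> out x) * (exp (\<theta> x) - 1))))
      = p ^ card F * exp (\<Sum>f\<in>?E. p * (\<Sum>x\<in>J. of_bool (f \<in> out x) * (exp (\<theta> x) - 1)))"
  proof -
    have "(\<Prod>f\<in>?E. if f \<in> F then p else 1) = p ^ card F"
      using F(1) by (simp add: prod.If_cases Int_absorb1)
    thus ?thesis by (simp only: prod.distrib exp_sum[OF finite_pot_edges])
  qed
  also have "(\<Sum>f\<in>?E. p * (\<Sum>x\<in>J. of_bool (f \<in> out x) * (exp (\<theta> x) - 1)))
     = (\<Sum>x\<in>J. p * (exp (\<theta> x) - 1) * real (card (out x)))"
  proof -
    have "(\<Sum>f\<in>?E. of_bool (f \<in> out x)) = real (card (out x))" for x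
      by (subst sum_of_bool_card) (auto simp: out_def intro!: arg_cong[of _ _ card])
    hence "(\<Sum>x\<in>J. p * (exp (\<theta> x) - 1) * real (card (out x))) = (\<Sum>x\<in>J. \<Sum>f\<in>?E. p * (exp (\<theta> x) - 1) * of_bool (f \<in> out x))"
      by (simp flip: sum_distrib_left)
    also have "\<dots> = (\<Sum>f\<in>?E. \<Sum>x\<in>J. p * (exp (\<theta> x) - 1) * of_bool (f \<in> out x))" by (rule sum.swap)
    also have "\<dots> = (\<Sum>f\<in>?E. p * (\<Sum>x\<in>J. of_bool (f \<in> out x) * (exp (\<theta> x) - 1)))"
      by (simp only: sum_distrib_left mult_ac)
    finally show ?thesis by simp
  qed
  also have "exp (- c) * (p ^ card F * exp (\<Sum>x\<in>J. p * (exp (\<theta> x) - 1) * real (card (out x))))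
      = p ^ card F * exp (\<Sum>x\<in>J. p * (exp (\<theta> x) - 1) * real (card (out x)) - (\<kappa> x - \<bar>\<theta> x\<bar> * real w0))"
  proof -
    have "(\<Sum>x\<in>J. p * (exp (\<theta> x) - 1) * real (card (out x)) - (\<kappa> x - \<bar>\<theta> x\<bar> * real w0))
        = (\<Sum>x\<in>J. p * (exp (\<theta> x) - 1) * real (card (out x))) - c"
      unfolding c_def by (rule sum_subtractf)
    thus ?thesis by (simp only: exp_diff exp_minus) (simp add: divide_inverse mult_ac)
  qed
  also have "\<dots> \<le> p ^ card F * exp (\<Sum>x\<in>J. p * (exp (\<theta> x) - 1) * opp n m x - \<kappa> x + (\<bar>\<theta> x\<bar> + p) * real w0)"
  proof (intro mult_left_mono, unfold exp_le_cancel_iff, rule sum_mono)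
    fix x assume x: "x \<in> J"
    \<comment> \<open>For a negative tilt the missing edges into \<open>W\<close> enlarge the
      exponent, by at most \<open>p * real w0\<close>.\<close>
    have "p * (exp (\<theta> x) - 1) * real (card (out x)) \<le> p * (exp (\<theta> x) - 1) * opp n m x + p * real w0"
    proof (cases "\<theta> x \<ge> 0")
      case True
      hence "p * (exp (\<theta> x) - 1) * real (card (out x)) \<le> p * (exp (\<theta> x) - 1) * opp n m x"
        using out_card[OF x] p by (intro mult_left_mono) auto
      thus ?thesis using p by (smt (verit) mult_nonneg_nonneg of_nat_0_le_iff)
    next
      case False
      hence e: "0 \<le> 1 - exp (\<theta> x)" "1 - exp (\<theta> x) \<le> 1" by auto
      have "p * (1 - exp (\<theta> x)) * (opp n m x - real (card (out x))) \<le> p * 1 * real w0"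
        using out_card[OF x] e p by (intro mult_mono) auto
      thus ?thesis by (simp add: algebra_simps)
    qed
    thus "p * (exp (\<theta> x) - 1) * real (card (out x)) - (\<kappa> x - \<bar>\<theta> x\<bar> * real w0)
        \<le> p * (exp (\<theta> x) - 1) * opp n m x - \<kappa> x + (\<bar>\<theta> x\<bar> + p) * real w0"
      by (simp add: algebra_simps)
  qed (use p in auto)
  finally show ?thesis using fJ by (simp add: exp_sum)
qed

definition tiltset :: "nat \<Rightarrow> nat \<Rightarrow> (nat \<Rightarrow> real) \<Rightarrow> (nat \<Rightarrow> real) \<Rightarrow> (nat \<times> nat \<Rightarrow> bool) \<Rightarrow> nat set" where
  "tiltset n m \<theta> \<kappa> A = {x. x < n + m \<and> \<theta> x * real (dg (gset n m A) x) \<ge> \<kappa> x}"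

lemma prob_tiltset_le:
  assumes p: "0 \<le> p" "p \<le> 1" and F: "F \<subseteq> pot_edges n m" "verts F \<subseteq> W"
    and J: "J \<subseteq> W" "J \<subseteq> {..<n+m}" and W: "finite W" "card W \<le> w0"
    and tilt: "\<And>x. x < n + m \<Longrightarrow> exp (p * (exp (\<theta> x) - 1) * opp n m x - \<kappa> x + (\<bar>\<theta> x\<bar> + p) * real w0) \<le> q"
  shows "measure_pmf.prob (bip_ER n m p) {A. F \<subseteq> gset n m A \<and> J \<subseteq> tiltset n m \<theta> \<kappa> A} \<le> p ^ card F * q ^ card J"
proof -
  have "{A. F \<subseteq> gset n m A \<and> J \<subseteq> tiltset n m \<theta> \<kappa> A}
      = {A. F \<subseteq> gset n m A \<and> (\<forall>x\<in>J. \<theta> x * real (dg (gset n m A) x) \<ge> \<kappa> x)}"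
    using J(2) by (auto simp: tiltset_def)
  hence "measure_pmf.prob (bip_ER n m p) {A. F \<subseteq> gset n m A \<and> J \<subseteq> tiltset n m \<theta> \<kappa> A}
     \<le> p ^ card F * (\<Prod>x\<in>J. exp (p * (exp (\<theta> x) - 1) * opp n m x - \<kappa> x + (\<bar>\<theta> x\<bar> + p) * real w0))"
    using prob_tilt_le[OF p F J W, where \<theta> = \<theta> and \<kappa> = \<kappa>] by simp
  also have "\<dots> \<le> p ^ card F * (\<Prod>x\<in>J. q)"
    using p J(2) tilt by (intro mult_left_mono prod_mono) auto
  finally show ?thesis by simp
qed

lemma verts_pot_edges: "F \<subseteq> pot_edges n m \<Longrightarrow> verts F \<subseteq> {..<n+m}"
  by (fastforce simp: pot_edges_def verts_def)

lemma card_verts_le: "finite F \<Longrightarrow> card (verts F) \<le> 2 * card F"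
  unfolding verts_def by (rule order_trans[OF card_Un_le]) (simp add: card_image_le mult_2 add_mono)

lemma sum_small_subsets_le:
  assumes "N \<ge> 1"
  shows "(\<Sum>V | V \<subseteq> {..<N} \<and> card V \<le> w. 1 / real N ^ card V) \<le> real w + 1"
proof -
  have "(\<Sum>V | V \<subseteq> {..<N} \<and> card V \<le> w. 1 / real N ^ card V)
      = (\<Sum>k\<in>{..w}. \<Sum>V | V \<subseteq> {..<N} \<and> card V \<le> w \<and> card V = k. 1 / real N ^ card V)"
    by (subst sum.group[symmetric, where g = card and T = "{..w}"]) (auto intro!: sum.cong)
  also have "\<dots> \<le> (\<Sum>k\<in>{..w}. 1)"
  proof (rule sum_mono)
    fix k assume "k \<in> {..w}"
    hence "{V. V \<subseteq> {..<N} \<and> card V \<le> w \<and> card V = k} = {V. V \<subseteq> {..<N} \<and> card V = k}" by auto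
    hence "(\<Sum>V | V \<subseteq> {..<N} \<and> card V \<le> w \<and> card V = k. 1 / real N ^ card V) = (\<Sum>V | V \<subseteq> {..<N} \<and> card V = k. 1 / real N ^ k)"
      by (auto intro!: sum.cong)
    also have "\<dots> = real (N choose k) / real N ^ k" using n_subsets[of "{..<N}" k] by simp
    also have "\<dots> \<le> 1"
    proof (cases "k \<le> N")
      case True
      hence "N choose k \<le> N ^ k" by (rule binomial_le_pow)
      hence "real (N choose k) \<le> real N ^ k" by (metis of_nat_le_iff of_nat_power)
      thus ?thesis using assms by simp
    qed (simp add: binomial_eq_0)
    finally show "(\<Sum>V | V \<subseteq> {..<N} \<and> card V \<le> w \<and> card V = k. 1 / real N ^ card V) \<le> 1" .
  qed
  finally show ?thesis by simp
qed

text \<open>A configuration that is expected at most N^(- \<beta>) times, up to logarithms, if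
  membership in \<open>S\<close> costs a factor N^(- c) per vertex.\<close>

definition dense_cluster :: "nat \<Rightarrow> real \<Rightarrow> real \<Rightarrow> (nat \<times> nat) set \<Rightarrow> nat set \<Rightarrow> (nat \<times> nat) set \<Rightarrow> nat set \<Rightarrow> bool" where
  "dense_cluster f0 c \<beta> G S F J \<longleftrightarrow> F \<subseteq> G \<and> card F \<le> f0 \<and> J \<subseteq> verts F \<and> J \<subseteq> S
      \<and> real (card F) + c * real (card J) \<ge> real (card (verts F)) + \<beta>"

text \<open>First moment: a subgraph with \<open>v\<close> vertices, \<open>f\<close> edges and \<open>j\<close> exceptional vertices is expected
  about \<open>N powr (v - f - c j)\<close> times.\<close>

lemma prob_dense_cluster_le:
  assumes p: "0 \<le> p" "p \<le> 1" "p \<le> L / real (n+m)" and L: "L \<ge> 1" and N: "n + m \<ge> 1"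
    and tilt: "\<And>x. x < n + m \<Longrightarrow>
      exp (p * (exp (\<theta> x) - 1) * opp n m x - \<kappa> x + (\<bar>\<theta> x\<bar> + p) * real (2 * f0)) \<le> real (n+m) powr (- c)"
  shows "measure_pmf.prob (bip_ER n m p) {A. \<exists>F J. dense_cluster f0 c \<beta> (gset n m A) (tiltset n m \<theta> \<kappa> A) F J}
     \<le> (real (2 * f0) + 1) * 2 ^ ((2 * f0)\<^sup>2 + 2 * f0) * L ^ f0 * real (n+m) powr (- \<beta>)"
proof -
  define N where "N = n + m"
  have N1: "real N \<ge> 1" using assms(5) by (simp add: N_def)
  define w where "w = 2 * f0"
  define I where "I = {(F, J). F \<subseteq> pot_edges n m \<and> card F \<le> f0 \<and> J \<subseteq> verts F
      \<and> real (card F) + c * real (card J) \<ge> real (card (verts F)) + \<beta>}"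
  define P where "P = (\<lambda>(F, J). {A. F \<subseteq> gset n m A \<and> J \<subseteq> tiltset n m \<theta> \<kappa> A})"
  have "I \<subseteq> Pow (pot_edges n m) \<times> Pow {..<N}"
  proof
    fix i assume i: "i \<in> I"
    obtain F J where FJ: "i = (F, J)" by (cases i)
    have "F \<subseteq> pot_edges n m" "J \<subseteq> verts F" using i unfolding I_def FJ by simp_all
    thus "i \<in> Pow (pot_edges n m) \<times> Pow {..<N}" using verts_pot_edges[of F n m] by (auto simp: FJ N_def)
  qed
  hence fI: "finite I" by (rule finite_subset) simp
  let ?M = "measure_pmf.prob (bip_ER n m p)"
  have "?M {A. \<exists>F J. dense_cluster f0 c \<beta> (gset n m A) (tiltset n m \<theta> \<kappa> A) F J} \<le> ?M (\<Union>i\<in>I. P i)"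
  proof (rule measure_pmf.finite_measure_mono)
    show "{A. \<exists>F J. dense_cluster f0 c \<beta> (gset n m A) (tiltset n m \<theta> \<kappa> A) F J} \<subseteq> (\<Union>i\<in>I. P i)"
    proof
      fix A assume "A \<in> {A. \<exists>F J. dense_cluster f0 c \<beta> (gset n m A) (tiltset n m \<theta> \<kappa> A) F J}"
      then obtain F J where d: "dense_cluster f0 c \<beta> (gset n m A) (tiltset n m \<theta> \<kappa> A) F J" by blast
      hence "(F, J) \<in> I" "A \<in> P (F, J)" using gset_subset[of n m A] by (auto simp: dense_cluster_def I_def P_def)
      thus "A \<in> (\<Union>i\<in>I. P i)" by blast
    qed
  qed simp
  also have "\<dots> \<le> (\<Sum>i\<in>I. ?M (P i))"
    by (rule measure_pmf.finite_measure_subadditive_finite[OF fI]) simp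
  also have "\<dots> \<le> (\<Sum>i\<in>I. L ^ f0 * real N powr (- \<beta>) * (1 / real N ^ card (verts (fst i))))"
  proof (rule sum_mono)
    fix i assume i: "i \<in> I"
    obtain F J where FJ: "i = (F, J)" by (cases i)
    have F: "F \<subseteq> pot_edges n m" "card F \<le> f0" and J: "J \<subseteq> verts F"
      and ge: "real (card F) + c * real (card J) \<ge> real (card (verts F)) + \<beta>" using i unfolding I_def FJ by simp_all
    have fF: "finite F" by (rule finite_subset[OF F(1)]) simp
    have cv: "card (verts F) \<le> w" using card_verts_le[OF fF] F(2) by (simp add: w_def)
    have "?M (P i) \<le> p ^ card F * (real N powr (- c)) ^ card J"
      unfolding P_def FJ prod.case
    proof (rule prob_tiltset_le[OF p(1,2) F(1) order_refl J])
      show "J \<subseteq> {..<n+m}" using J verts_pot_edges[OF F(1)] by blast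
      show "finite (verts F)" using fF by simp
      show "card (verts F) \<le> 2 * f0" using cv by (simp add: w_def)
    qed (use tilt in \<open>simp add: N_def\<close>)
    also have "(real N powr (- c)) ^ card J = real N powr (- c * real (card J))"
      using N1 by (simp add: powr_powr flip: powr_realpow)
    finally have 1: "?M (P i) \<le> p ^ card F * real N powr (- c * real (card J))" .
    have "p ^ card F \<le> (L / real N) ^ card F" using p by (intro power_mono) (auto simp: N_def)
    also have "\<dots> = L ^ card F * real N powr (- real (card F))"
      unfolding power_divide using N1 by (simp add: powr_minus powr_realpow divide_inverse)
    also have "\<dots> \<le> L ^ f0 * real N powr (- real (card F))"
      using L F(2) by (intro mult_right_mono power_increasing) auto
    finally have "p ^ card F * real N powr (- c * real (card J)) \<le> L ^ f0 * real N powr (- real (card F)) * real N powr (- c * real (card J))"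
      by (rule mult_right_mono) simp
    with 1 have 2: "?M (P i) \<le> L ^ f0 * (real N powr (- real (card F)) * real N powr (- c * real (card J)))"
      by (simp only: mult.assoc)
    have "real N powr (- real (card F)) * real N powr (- c * real (card J)) = real N powr (- (real (card F) + c * real (card J)))"
      by (simp flip: powr_add)
    also have "\<dots> \<le> real N powr (- (real (card (verts F)) + \<beta>))" using N1 ge by (intro powr_mono) auto
    also have "\<dots> = real N powr (- \<beta>) * (1 / real N ^ card (verts F))"
    proof -
      have "real N powr (- (real (card (verts F)) + \<beta>)) = real N powr (- \<beta>) * real N powr (- real (card (verts F)))"
        by (subst powr_add[symmetric]) (simp add: algebra_simps)
      thus ?thesis using N1 by (simp add: powr_minus powr_realpow divide_inverse)
    qed
    finally have "L ^ f0 * (real N powr (- real (card F)) * real N powr (- c * real (card J)))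
        \<le> L ^ f0 * (real N powr (- \<beta>) * (1 / real N ^ card (verts F)))"
      by (rule mult_left_mono) (use L in simp)
    with 2 show "?M (P i) \<le> L ^ f0 * real N powr (- \<beta>) * (1 / real N ^ card (verts (fst i)))"
      by (simp only: FJ mult.assoc fst_conv)
  qed
  also have "\<dots> = L ^ f0 * real N powr (- \<beta>) * (\<Sum>i\<in>I. 1 / real N ^ card (verts (fst i)))"
    by (simp only: sum_distrib_left)
  finally have main: "?M {A. \<exists>F J. dense_cluster f0 c \<beta> (gset n m A) (tiltset n m \<theta> \<kappa> A) F J}
     \<le> L ^ f0 * real N powr (- \<beta>) * (\<Sum>i\<in>I. 1 / real N ^ card (verts (fst i)))" .
  \<comment> \<open>Configurations are sorted by their vertex set \<open>V\<close>: at most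
    \<open>2 ^ (w\<^sup>2 + w)\<close> pairs of an edge set within \<open>V \<times> V\<close> and a
    subset of \<open>V\<close> share it.\<close>
  have "(\<Sum>i\<in>I. 1 / real N ^ card (verts (fst i))) \<le> (real w + 1) * 2 ^ (w\<^sup>2 + w)"
  proof -
    define VV where "VV = {V. V \<subseteq> {..<N} \<and> card V \<le> w}"
    have fVV: "finite VV" unfolding VV_def by (rule finite_subset[of _ "Pow {..<N}"]) auto
    have VVf: "finite V" if "V \<in> VV" for V using that finite_subset by (auto simp: VV_def)
    define T where "T = (\<lambda>i :: (nat \<times> nat) set \<times> nat set. (verts (fst i), i))"
    have TI: "T ` I \<subseteq> (SIGMA V : VV. Pow (V \<times> V) \<times> Pow V)"
    proof
      fix t assume "t \<in> T ` I"
      then obtain F J where t: "t = (verts F, (F, J))" and FJ: "(F, J) \<in> I" by (auto simp: T_def)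
      have fF: "finite F" by (rule finite_subset[of _ "pot_edges n m"]) (use FJ in \<open>auto simp: I_def\<close>)
      have "card (verts F) \<le> w" using card_verts_le[OF fF] FJ by (auto simp: w_def I_def)
      moreover have "F \<subseteq> verts F \<times> verts F" by (force simp: verts_def)
      ultimately show "t \<in> (SIGMA V : VV. Pow (V \<times> V) \<times> Pow V)"
        using FJ verts_pot_edges[of F n m] by (auto simp: t VV_def I_def N_def)
    qed
    have "(\<Sum>i\<in>I. 1 / real N ^ card (verts (fst i))) = (\<Sum>t\<in>T ` I. 1 / real N ^ card (fst t))"
      by (subst sum.reindex) (auto simp: T_def inj_on_def)
    also have "\<dots> \<le> (\<Sum>t\<in>(SIGMA V : VV. Pow (V \<times> V) \<times> Pow V). 1 / real N ^ card (fst t))"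
      using fVV VVf by (intro sum_mono2[OF _ TI]) (auto intro!: finite_SigmaI)
    also have "\<dots> = (\<Sum>V\<in>VV. \<Sum>i\<in>Pow (V \<times> V) \<times> Pow V. 1 / real N ^ card V)"
      using fVV VVf by (subst sum.Sigma) (auto simp: case_prod_unfold)
    also have "\<dots> \<le> (\<Sum>V\<in>VV. 2 ^ (w\<^sup>2 + w) * (1 / real N ^ card V))"
    proof (rule sum_mono)
      fix V assume V: "V \<in> VV"
      have "card (Pow (V \<times> V) \<times> Pow V) = 2 ^ (card V * card V + card V)"
        using VVf[OF V] by (simp add: card_cartesian_product card_Pow power_add)
      also have "\<dots> \<le> 2 ^ (w\<^sup>2 + w)"
        using V by (intro power_increasing) (auto simp: VV_def power2_eq_square intro!: add_mono mult_le_mono)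
      finally have "real (card (Pow (V \<times> V) \<times> Pow V)) \<le> 2 ^ (w\<^sup>2 + w)" by (metis of_nat_le_iff of_nat_numeral of_nat_power)
      hence "real (card (Pow (V \<times> V) \<times> Pow V)) * (1 / real N ^ card V) \<le> 2 ^ (w\<^sup>2 + w) * (1 / real N ^ card V)"
        by (rule mult_right_mono) simp
      thus "(\<Sum>i\<in>Pow (V \<times> V) \<times> Pow V. 1 / real N ^ card V) \<le> 2 ^ (w\<^sup>2 + w) * (1 / real N ^ card V)" by simp
    qed
    also have "\<dots> = 2 ^ (w\<^sup>2 + w) * (\<Sum>V\<in>VV. 1 / real N ^ card V)" by (simp add: sum_distrib_left)
    also have "\<dots> \<le> 2 ^ (w\<^sup>2 + w) * (real w + 1)"
      unfolding VV_def using N1 by (intro mult_left_mono sum_small_subsets_le) auto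
    finally show ?thesis by (simp add: mult.commute)
  qed
  hence "L ^ f0 * real N powr (- \<beta>) * (\<Sum>i\<in>I. 1 / real N ^ card (verts (fst i)))
      \<le> L ^ f0 * real N powr (- \<beta>) * ((real w + 1) * 2 ^ (w\<^sup>2 + w))"
    by (rule mult_left_mono) (use L in simp)
  with main have "?M {A. \<exists>F J. dense_cluster f0 c \<beta> (gset n m A) (tiltset n m \<theta> \<kappa> A) F J}
     \<le> L ^ f0 * real N powr (- \<beta>) * ((real w + 1) * 2 ^ (w\<^sup>2 + w))" by (rule order_trans)
  thus ?thesis unfolding N_def w_def by (simp only: mult_ac)
qed

text \<open>Markov's inequality for the number of \<open>k\<close>-element subsets of the
  exceptional set. A high moment makes the probability as small as desired even when the expected
  size is a power of N.\<close>

lemma prob_card_tiltset_ge: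
  assumes p: "0 \<le> p" "p \<le> 1" and N: "n + m \<ge> 1" and k: "k \<ge> 1" "k \<le> w0" "k \<le> t"
    and tilt: "\<And>x. x < n + m \<Longrightarrow>
      exp (p * (exp (\<theta> x) - 1) * opp n m x - \<kappa> x + (\<bar>\<theta> x\<bar> + p) * real w0) \<le> q" and q: "q \<ge> 0"
  shows "measure_pmf.prob (bip_ER n m p) {A. card (tiltset n m \<theta> \<kappa> A) \<ge> t} \<le> (real k * real (n+m) * q / real t) ^ k"
proof -
  define N where "N = n + m"
  let ?M = "measure_pmf.prob (bip_ER n m p)"
  let ?S = "tiltset n m \<theta> \<kappa>"
  define JJ where "JJ = {J. J \<subseteq> {..<N} \<and> card J = k}"
  have fJJ: "finite JJ" unfolding JJ_def by (rule finite_subset[of _ "Pow {..<N}"]) auto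
  have SN: "?S A \<subseteq> {..<N}" for A by (auto simp: tiltset_def N_def)
  have fS: "finite (?S A)" for A using SN finite_subset by blast
  have "real (t choose k) * ?M {A. card (?S A) \<ge> t} = measure_pmf.expectation (bip_ER n m p) (\<lambda>A. real (t choose k) * indicator {A. card (?S A) \<ge> t} A)"
    by simp
  also have "\<dots> \<le> measure_pmf.expectation (bip_ER n m p) (\<lambda>A. \<Sum>J\<in>JJ. indicator {A. J \<subseteq> ?S A} A)"
  proof (intro integral_mono)
    fix A
    have "(\<Sum>J\<in>JJ. indicator {A. J \<subseteq> ?S A} A) = (\<Sum>J\<in>JJ. of_bool (J \<subseteq> ?S A) :: real)" by (simp add: indicator_def)
    also have "\<dots> = real (card {J\<in>JJ. J \<subseteq> ?S A})" by (rule sum_of_bool_card[OF fJJ])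
    also have "{J\<in>JJ. J \<subseteq> ?S A} = {J. J \<subseteq> ?S A \<and> card J = k}" using SN[of A] by (auto simp: JJ_def)
    also have "card \<dots> = card (?S A) choose k" by (rule n_subsets[OF fS])
    finally have *: "(\<Sum>J\<in>JJ. indicator {A. J \<subseteq> ?S A} A) = real (card (?S A) choose k)" .
    show "real (t choose k) * indicator {A. card (?S A) \<ge> t} A \<le> (\<Sum>J\<in>JJ. indicator {A. J \<subseteq> ?S A} A)"
      unfolding * by (auto simp: indicator_def intro: binomial_right_mono)
  qed simp_all
  also have "\<dots> = (\<Sum>J\<in>JJ. ?M {A. J \<subseteq> ?S A})" by (simp add: Bochner_Integration.integral_sum)
  also have "\<dots> \<le> (\<Sum>J\<in>JJ. q ^ k)"
  proof (rule sum_mono)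
    fix J assume J: "J \<in> JJ"
    hence fJ: "finite J" using finite_subset by (auto simp: JJ_def)
    have "?M {A. {} \<subseteq> gset n m A \<and> J \<subseteq> ?S A} \<le> p ^ card ({} :: (nat \<times> nat) set) * q ^ card J"
      by (rule prob_tiltset_le[where W = J, OF p _ _ _ _ fJ _ tilt]) (use J k in \<open>auto simp: verts_def JJ_def N_def\<close>)
    thus "?M {A. J \<subseteq> ?S A} \<le> q ^ k" using J by (simp add: JJ_def)
  qed
  also have "\<dots> = real (N choose k) * q ^ k" using n_subsets[of "{..<N}" k] by (simp add: JJ_def)
  also have "\<dots> \<le> real N ^ k * q ^ k"
  proof (rule mult_right_mono)
    show "real (N choose k) \<le> real N ^ k"
    proof (cases "k \<le> N")
      case True
      hence "N choose k \<le> N ^ k" by (rule binomial_le_pow)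
      thus ?thesis by (metis of_nat_le_iff of_nat_power)
    qed (simp add: binomial_eq_0)
  qed (use q in auto)
  finally have up: "real (t choose k) * ?M {A. card (?S A) \<ge> t} \<le> real N ^ k * q ^ k" .
  have lo: "(real t / real k) ^ k \<le> real (t choose k)"
    using k binomial_ge_n_over_k_pow_k[of k t, where 'a = real] by simp
  have "(real t / real k) ^ k * ?M {A. card (?S A) \<ge> t} \<le> real N ^ k * q ^ k"
    using up lo by (meson mult_right_mono measure_nonneg order_trans)
  moreover have "(real t / real k) ^ k > 0" using k by auto
  ultimately have "?M {A. card (?S A) \<ge> t} \<le> real N ^ k * q ^ k / (real t / real k) ^ k"
    by (simp add: pos_le_divide_eq mult.commute)
  also have "\<dots> = (real k * real N * q / real t) ^ k" by (simp add: power_mult_distrib power_divide mult_ac)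
  finally show ?thesis by (simp add: N_def)
qed

section \<open>Quadratic form bounds\<close>

lemma nb_hs_nonneg: "nb_hs N h l \<ge> 0"
  unfolding nb_hs_def by (intro sum_nonneg) auto

text \<open>\<open>ihara_bass_psd\<close> for r = s h bounds the form with entries r / (1 - r^2).
  Returning to the entries r costs another \<rho> r^2 / (1 - r^2) each, by the arithmetic-geometric
  mean inequality, and (1 + \<rho>) / (1 - \<rho>^2) = 1 / (1 - \<rho>) collects both
  contributions.\<close>

theorem nonbacktracking_quadratic_bound:
  assumes sym: "symm_upto N h" and h: "\<And>x y. x < N \<Longrightarrow> y < N \<Longrightarrow> \<bar>h x y\<bar> \<le> \<rho>" and \<rho>: "0 \<le> \<rho>" "\<rho> < 1"
    and s: "0 < s" "s \<le> 1" and hs: "s ^ (2 * l) * nb_hs N h l < 1"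
  shows "s * qform N h v \<le> (\<Sum>x<N. (v x)\<^sup>2 * (1 + s\<^sup>2 / (1 - \<rho>) * (\<Sum>y<N. (h x y)\<^sup>2)))"
proof -
  define r where "r = (\<lambda>x y. s * h x y)"
  define k where "k = (\<lambda>x y. (r x y)\<^sup>2 / (1 - (r x y)\<^sup>2))"
  have r: "\<bar>r x y\<bar> \<le> \<rho>" if "x < N" "y < N" for x y
  proof -
    have "\<bar>s\<bar> * \<bar>h x y\<bar> \<le> 1 * \<rho>" using s h[OF that] by (intro mult_mono) auto
    thus ?thesis by (simp add: r_def abs_mult)
  qed
  have r2: "(r x y)\<^sup>2 \<le> \<rho>\<^sup>2" if "x < N" "y < N" for x y
    using power_mono[OF r[OF that] abs_ge_zero, of 2] by simp
  have \<rho>2: "\<rho>\<^sup>2 < 1" using \<rho> by (simp add: abs_square_less_1)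
  have pos: "1 - (r x y)\<^sup>2 > 0" if "x < N" "y < N" for x y using r2[OF that] \<rho>2 by linarith
  have k0: "k x y \<ge> 0" if "x < N" "y < N" for x y using pos[OF that] by (simp add: k_def)
  have symr: "symm_upto N r" using sym by (simp add: symm_upto_def r_def)
  have psd: "qform N (ib_matrix N r) v \<ge> 0"
  proof (rule ihara_bass_psd[OF symr])
    show "\<bar>r x y\<bar> < 1" if "x < N" "y < N" for x y using r[OF that] \<rho> by linarith
    fix t g assume t: "0 < t" "t \<le> 1" and fp: "nb_fixpoint N (\<lambda>x y. t * r x y) g"
    have "(t * s) ^ (2 * l) \<le> s ^ (2 * l)" using t s by (intro power_mono) (auto simp: mult_left_le_one_le)
    hence "(t * s) ^ (2 * l) * nb_hs N h l \<le> s ^ (2 * l) * nb_hs N h l"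
      by (rule mult_right_mono) (rule nb_hs_nonneg)
    moreover have "nb_fixpoint N (\<lambda>x y. (t * s) * h x y) g" using fp by (simp add: r_def mult.assoc)
    ultimately show "\<forall>x<N. \<forall>y<N. g x y = 0" using nb_no_fixpoint[of N "t * s" h g l] hs t s by auto
  qed
  have "s * qform N h v = (\<Sum>x<N. \<Sum>y<N. r x y * (v x * v y))"
    unfolding bil_def sum_distrib_left r_def by (intro sum.cong refl) (simp only: mult_ac)
  also have "\<dots> = (\<Sum>x<N. \<Sum>y<N. r x y / (1 - (r x y)\<^sup>2) * (v x * v y)) - (\<Sum>x<N. \<Sum>y<N. r x y * k x y * (v x * v y))"
    unfolding sum_subtractf[symmetric]
  proof (intro sum.cong refl)
    fix x y assume "x \<in> {..<N}" "y \<in> {..<N}"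
    hence "1 - (r x y)\<^sup>2 \<noteq> 0" using pos[of x y] by auto
    hence "r x y / (1 - (r x y)\<^sup>2) - r x y * k x y = r x y"
      by (simp add: k_def divide_simps power2_eq_square) (simp add: algebra_simps)
    thus "r x y * (v x * v y) = r x y / (1 - (r x y)\<^sup>2) * (v x * v y) - r x y * k x y * (v x * v y)"
      by (metis left_diff_distrib)
  qed
  also have "\<dots> \<le> (\<Sum>x<N. (v x)\<^sup>2 * (1 + (\<Sum>y<N. k x y))) + (\<Sum>x<N. \<Sum>y<N. \<rho> * k x y * (((v x)\<^sup>2 + (v y)\<^sup>2) / 2))"
  proof -
    have "(\<Sum>x<N. \<Sum>y<N. r x y / (1 - (r x y)\<^sup>2) * (v x * v y)) \<le> (\<Sum>x<N. (v x)\<^sup>2 * (1 + (\<Sum>y<N. k x y)))"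
      using psd unfolding qform_ib_matrix k_def by linarith
    moreover have "- (\<Sum>x<N. \<Sum>y<N. r x y * k x y * (v x * v y)) \<le> (\<Sum>x<N. \<Sum>y<N. \<rho> * k x y * (((v x)\<^sup>2 + (v y)\<^sup>2) / 2))"
      unfolding sum_negf[symmetric]
    proof (intro sum_mono)
      fix x y assume "x \<in> {..<N}" "y \<in> {..<N}"
      hence xy: "x < N" "y < N" by auto
      have am: "\<bar>v x * v y\<bar> \<le> ((v x)\<^sup>2 + (v y)\<^sup>2) / 2"
        using sum_squares_bound[of "\<bar>v x\<bar>" "\<bar>v y\<bar>"] by (simp add: abs_mult)
      have "- (r x y * k x y * (v x * v y)) \<le> \<bar>r x y\<bar> * k x y * \<bar>v x * v y\<bar>"
        using abs_ge_minus_self[of "r x y * k x y * (v x * v y)"] k0[OF xy] by (simp add: abs_mult)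
      also have "\<dots> \<le> \<rho> * k x y * (((v x)\<^sup>2 + (v y)\<^sup>2) / 2)"
        using r[OF xy] k0[OF xy] am \<rho> by (intro mult_mono mult_nonneg_nonneg) auto
      finally show "- (r x y * k x y * (v x * v y)) \<le> \<rho> * k x y * (((v x)\<^sup>2 + (v y)\<^sup>2) / 2)" .
    qed
    ultimately show ?thesis by linarith
  qed
  also have "(\<Sum>x<N. \<Sum>y<N. \<rho> * k x y * (((v x)\<^sup>2 + (v y)\<^sup>2) / 2)) = (\<Sum>x<N. (v x)\<^sup>2 * (\<rho> * (\<Sum>y<N. k x y)))"
  proof -
    have "(\<Sum>x<N. \<Sum>y<N. \<rho> * k x y * (((v x)\<^sup>2 + (v y)\<^sup>2) / 2))
       = (\<Sum>x<N. \<Sum>y<N. \<rho> * k x y * (v x)\<^sup>2 / 2) + (\<Sum>x<N. \<Sum>y<N. \<rho> * k x y * (v y)\<^sup>2 / 2)"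
      unfolding sum.distrib[symmetric] by (intro sum.cong refl) (simp add: algebra_simps)
    also have "(\<Sum>x<N. \<Sum>y<N. \<rho> * k x y * (v y)\<^sup>2 / 2) = (\<Sum>x<N. \<Sum>y<N. \<rho> * k x y * (v x)\<^sup>2 / 2)"
      by (subst sum.swap) (use symr in \<open>auto simp: symm_upto_def k_def intro!: sum.cong\<close>)
    finally show ?thesis by (simp add: sum_distrib_left algebra_simps)
  qed
  also have "(\<Sum>x<N. (v x)\<^sup>2 * (1 + (\<Sum>y<N. k x y))) + (\<Sum>x<N. (v x)\<^sup>2 * (\<rho> * (\<Sum>y<N. k x y)))
      = (\<Sum>x<N. (v x)\<^sup>2 * (1 + (1 + \<rho>) * (\<Sum>y<N. k x y)))"
    unfolding sum.distrib[symmetric] by (intro sum.cong refl) (simp add: algebra_simps)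
  also have "\<dots> \<le> (\<Sum>x<N. (v x)\<^sup>2 * (1 + s\<^sup>2 / (1 - \<rho>) * (\<Sum>y<N. (h x y)\<^sup>2)))"
  proof (intro sum_mono mult_left_mono add_left_mono)
    fix x assume x: "x \<in> {..<N}"
    have "(1 + \<rho>) * (\<Sum>y<N. k x y) \<le> (1 + \<rho>) * (\<Sum>y<N. (r x y)\<^sup>2 / (1 - \<rho>\<^sup>2))"
      using x r2 \<rho> \<rho>2 pos unfolding k_def by (intro mult_left_mono sum_mono divide_left_mono mult_pos_pos) auto
    also have "\<dots> = ((1 + \<rho>) / (1 - \<rho>\<^sup>2)) * s\<^sup>2 * (\<Sum>y<N. (h x y)\<^sup>2)"
      by (simp add: r_def power_mult_distrib sum_distrib_left sum_divide_distrib mult_ac)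
    also have "(1 + \<rho>) / (1 - \<rho>\<^sup>2) = 1 / (1 - \<rho>)"
    proof -
      have "1 - \<rho>\<^sup>2 = (1 - \<rho>) * (1 + \<rho>)" by (simp add: power2_eq_square algebra_simps)
      thus ?thesis using \<rho> by simp
    qed
    finally show "(1 + \<rho>) * (\<Sum>y<N. k x y) \<le> s\<^sup>2 / (1 - \<rho>) * (\<Sum>y<N. (h x y)\<^sup>2)" by simp
  qed auto
  finally show ?thesis .
qed

lemma ed_in_pot_edges: "x < n + m \<Longrightarrow> y < n + m \<Longrightarrow> ed x y \<in> pot_edges n m \<longleftrightarrow> cross n x y"
  by (auto simp: ed_def pot_edges_def cross_def min_def max_def)

lemma gset_cross: "ed x y \<in> gset n m A \<Longrightarrow> cross n x y"
  by (auto simp: ed_def gset_def pot_edges_def cross_def min_def max_def split: if_splits)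

lemma centH_gset:
  assumes "x < n + m" "y < n + m"
  shows "centH n p d A x y = of_bool (cross n x y) * ((of_bool (ed x y \<in> gset n m A) - p) / sqrt d)"
  unfolding centH_ed using ed_in_pot_edges[OF assms] by (auto simp: centX_def gset_def)

lemma symm_upto_centH: "symm_upto N (centH n p d A)"
  unfolding symm_upto_def using centH_commute by blast

lemma dg_gset:
  assumes "x < n + m"
  shows "real (dg (gset n m A) x) = (\<Sum>y<n+m. of_bool (ed x y \<in> gset n m A))"
proof -
  let ?G = "gset n m A"
  have "bij_betw (ed x) {y\<in>{..<n+m}. ed x y \<in> ?G} (inc ?G x)"
  proof (rule bij_betwI')
    fix f assume f: "f \<in> inc ?G x"
    hence p: "f \<in> pot_edges n m" "f \<in> ?G" "fst f = x \<or> snd f = x" using gset_subset by (auto simp: inc_def)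
    have "fst f \<le> snd f" "fst f < n + m" "snd f < n + m" using p(1) by (auto simp: pot_edges_def)
    hence "\<exists>y<n+m. f = ed x y" using p(3)
      by (intro exI[of _ "if fst f = x then snd f else fst f"]) (auto simp: ed_def prod_eq_iff)
    thus "\<exists>y\<in>{y\<in>{..<n+m}. ed x y \<in> ?G}. f = ed x y" using p(2) by auto
  qed auto
  hence "card {y\<in>{..<n+m}. ed x y \<in> ?G} = dg ?G x" unfolding dg_def by (rule bij_betw_same_card)
  thus ?thesis by (subst sum_of_bool_card) simp_all
qed

lemma sum_centH_sq_le:
  assumes p: "0 \<le> p" "p \<le> 1" and d: "d > 0" and x: "x < n + m"
  shows "(\<Sum>y<n+m. (centH n p d A x y)\<^sup>2) \<le> (real (dg (gset n m A) x) + real (n+m) * p\<^sup>2) / d"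
proof -
  have "(\<Sum>y<n+m. (centH n p d A x y)\<^sup>2) \<le> (\<Sum>y<n+m. (of_bool (ed x y \<in> gset n m A) + p\<^sup>2) / d)"
  proof (rule sum_mono)
    fix y assume "y \<in> {..<n+m}"
    have "(1 - p)\<^sup>2 \<le> 1 + p\<^sup>2" using p by (simp add: power2_diff)
    thus "(centH n p d A x y)\<^sup>2 \<le> (of_bool (ed x y \<in> gset n m A) + p\<^sup>2) / d"
      using centH_gset[OF x, of y p d A] \<open>y \<in> {..<n+m}\<close> d
      by (auto simp: power_divide of_bool_def intro!: divide_right_mono)
  qed
  also have "\<dots> = (real (dg (gset n m A) x) + real (n+m) * p\<^sup>2) / d"
    unfolding dg_gset[OF x] by (simp only: sum_divide_distrib[symmetric] sum.distrib) simp
  finally show ?thesis .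
qed

text \<open>Rescaling the two sides by \<open>sqrt q\<close> and \<open>1 / sqrt q\<close> leaves the quadratic form invariant and balances
  the two typical degrees.\<close>

definition side_weight :: "nat \<Rightarrow> real \<Rightarrow> nat \<Rightarrow> real" where
  "side_weight n q x = (if x < n then q else 1 / q)"

lemma bulk_bound:
  assumes p: "0 \<le> p" "p \<le> 1" and d: "d > 1" and q: "q > 0"
    and s: "0 < s" "s \<le> 1" and hs: "s ^ (2 * l) * nb_hs (n+m) (centH n p d A) l < 1"
  shows "s * qform (n+m) (centH n p d A) v
    \<le> (\<Sum>x<n+m. (v x)\<^sup>2 * (side_weight n q x *
        (1 + s\<^sup>2 / (1 - 1 / sqrt d) * ((real (dg (gset n m A) x) + real (n+m) * p\<^sup>2) / d))))"
proof -
  let ?h = "centH n p d A"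
  define w where "w = (\<lambda>x. (if x < n then sqrt q else 1 / sqrt q) * v x)"
  have "qform (n+m) ?h v = qform (n+m) ?h w"
    unfolding bil_def
  proof (intro sum.cong refl)
    fix i j assume "i \<in> {..<n+m}" "j \<in> {..<n+m}"
    thus "v i * ?h i j * v j = w i * ?h i j * w j"
      using q by (auto simp: centH_gset w_def cross_def)
  qed
  moreover have "s * qform (n+m) ?h w \<le> (\<Sum>x<n+m. (w x)\<^sup>2 * (1 + s\<^sup>2 / (1 - 1 / sqrt d) * (\<Sum>y<n+m. (?h x y)\<^sup>2)))"
  proof (rule nonbacktracking_quadratic_bound[OF symm_upto_centH _ _ _ s hs])
    show "\<bar>?h x y\<bar> \<le> 1 / sqrt d" if "x < n+m" "y < n+m" for x y
      using p d by (auto simp: centH_gset[OF that] of_bool_def intro!: divide_right_mono)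
  qed (use d in auto)
  moreover have "\<dots> \<le> (\<Sum>x<n+m. (w x)\<^sup>2 * (1 + s\<^sup>2 / (1 - 1 / sqrt d) * ((real (dg (gset n m A) x) + real (n+m) * p\<^sup>2) / d)))"
    using d p by (intro sum_mono mult_left_mono add_left_mono sum_centH_sq_le) auto
  moreover have "(w x)\<^sup>2 = (v x)\<^sup>2 * side_weight n q x" for x
    using q by (simp add: w_def side_weight_def power_mult_distrib power_divide)
  ultimately show ?thesis by (simp add: mult.assoc)
qed

text \<open>Each edge is split by 2 c |v_y v_z| <= \<phi>_y v_y^2 + c^2 v_z^2 / \<phi>_y with
  \<open>y\<close> the endpoint of larger level: a vertex pays its weight once per parent and the
  reciprocal weight of each child. Edges within a level are charged from both ends, and the
  reciprocals are in the end summed over all neighbours.\<close>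

lemma cluster_certificate:
  fixes v \<phi> :: "nat \<Rightarrow> real" and lev :: "nat \<Rightarrow> nat" and G :: "(nat \<times> nat) set"
  assumes U: "finite U" and \<phi>: "\<And>y. y \<in> U \<Longrightarrow> \<phi> y > 0" and c: "c \<ge> 0"
  defines "up \<equiv> \<lambda>y. {z\<in>U. ed y z \<in> G \<and> lev z \<le> lev y}"
  shows "(\<Sum>y\<in>U. \<Sum>z\<in>U. of_bool (ed y z \<in> G) * (c * (\<bar>v y\<bar> * \<bar>v z\<bar>)))
    \<le> (\<Sum>y\<in>U. (v y)\<^sup>2 * (\<phi> y * real (card (up y)) + c\<^sup>2 * (\<Sum>z | z \<in> U \<and> ed y z \<in> G. 1 / \<phi> z)))"
proof -
  define a where "a = (\<lambda>y z. c * (\<bar>v y\<bar> * \<bar>v z\<bar>))"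
  have a0: "a y z \<ge> 0" for y z using c by (simp add: a_def)
  have asym: "a y z = a z y" for y z by (simp add: a_def mult_ac)
  have "(\<Sum>y\<in>U. \<Sum>z\<in>U. of_bool (ed y z \<in> G) * a y z)
      \<le> (\<Sum>y\<in>U. \<Sum>z\<in>U. of_bool (z \<in> up y) * a y z + of_bool (y \<in> up z) * a y z)"
  proof (intro sum_mono)
    fix y z assume "y \<in> U" "z \<in> U"
    thus "of_bool (ed y z \<in> G) * a y z \<le> of_bool (z \<in> up y) * a y z + of_bool (y \<in> up z) * a y z"
      using a0[of y z] by (auto simp: up_def of_bool_def ed_commute[of z y])
  qed
  also have "\<dots> = (\<Sum>y\<in>U. \<Sum>z\<in>U. of_bool (z \<in> up y) * a y z) + (\<Sum>y\<in>U. \<Sum>z\<in>U. of_bool (y \<in> up z) * a y z)"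
    by (simp only: sum.distrib)
  also have "(\<Sum>y\<in>U. \<Sum>z\<in>U. of_bool (y \<in> up z) * a y z) = (\<Sum>y\<in>U. \<Sum>z\<in>U. of_bool (z \<in> up y) * a y z)"
    by (subst sum.swap) (simp only: asym[of _ _] mult.commute)
  finally have "(\<Sum>y\<in>U. \<Sum>z\<in>U. of_bool (ed y z \<in> G) * a y z) \<le> (\<Sum>y\<in>U. \<Sum>z\<in>U. of_bool (z \<in> up y) * (2 * a y z))"
    by (simp add: sum_distrib_left mult.left_commute)
  also have "\<dots> \<le> (\<Sum>y\<in>U. \<Sum>z\<in>U. of_bool (z \<in> up y) * (\<phi> y * (v y)\<^sup>2 + c\<^sup>2 * (v z)\<^sup>2 / \<phi> y))"
  proof (intro sum_mono mult_left_mono)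
    fix y z assume y: "y \<in> U"
    have "0 \<le> (sqrt (\<phi> y) * \<bar>v y\<bar> - c * \<bar>v z\<bar> / sqrt (\<phi> y))\<^sup>2" by simp
    also have "\<dots> = \<phi> y * (v y)\<^sup>2 + c\<^sup>2 * (v z)\<^sup>2 / \<phi> y - 2 * a y z"
      using \<phi>[OF y] by (simp add: power2_diff power_mult_distrib power_divide a_def)
    finally show "2 * a y z \<le> \<phi> y * (v y)\<^sup>2 + c\<^sup>2 * (v z)\<^sup>2 / \<phi> y" by simp
  qed auto
  also have "\<dots> = (\<Sum>y\<in>U. \<Sum>z\<in>U. of_bool (z \<in> up y) * (\<phi> y * (v y)\<^sup>2)) + (\<Sum>y\<in>U. \<Sum>z\<in>U. of_bool (z \<in> up y) * (c\<^sup>2 * (v z)\<^sup>2 / \<phi> y))"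
    by (simp only: distrib_left sum.distrib)
  also have "(\<Sum>y\<in>U. \<Sum>z\<in>U. of_bool (z \<in> up y) * (\<phi> y * (v y)\<^sup>2)) = (\<Sum>y\<in>U. (v y)\<^sup>2 * (\<phi> y * real (card (up y))))"
  proof (intro sum.cong refl)
    fix y
    have "(\<Sum>z\<in>U. of_bool (z \<in> up y) * (\<phi> y * (v y)\<^sup>2)) = (\<Sum>z\<in>U. of_bool (z \<in> up y)) * (\<phi> y * (v y)\<^sup>2)"
      by (simp only: sum_distrib_right)
    also have "(\<Sum>z\<in>U. of_bool (z \<in> up y)) = real (card {z\<in>U. z \<in> up y})" by (rule sum_of_bool_card[OF U])
    also have "{z\<in>U. z \<in> up y} = up y" by (auto simp: up_def)
    finally show "(\<Sum>z\<in>U. of_bool (z \<in> up y) * (\<phi> y * (v y)\<^sup>2)) = (v y)\<^sup>2 * (\<phi> y * real (card (up y)))"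
      by (simp add: mult_ac)
  qed
  also have "(\<Sum>y\<in>U. \<Sum>z\<in>U. of_bool (z \<in> up y) * (c\<^sup>2 * (v z)\<^sup>2 / \<phi> y))
      = (\<Sum>z\<in>U. \<Sum>y\<in>U. of_bool (z \<in> up y) * (c\<^sup>2 * (v z)\<^sup>2 / \<phi> y))"
    by (rule sum.swap)
  finally have 1: "(\<Sum>y\<in>U. \<Sum>z\<in>U. of_bool (ed y z \<in> G) * a y z) \<le> (\<Sum>y\<in>U. (v y)\<^sup>2 * (\<phi> y * real (card (up y))))
      + (\<Sum>z\<in>U. \<Sum>y\<in>U. of_bool (z \<in> up y) * (c\<^sup>2 * (v z)\<^sup>2 / \<phi> y))" .
  have "(\<Sum>z\<in>U. \<Sum>y\<in>U. of_bool (z \<in> up y) * (c\<^sup>2 * (v z)\<^sup>2 / \<phi> y))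
      \<le> (\<Sum>z\<in>U. (v z)\<^sup>2 * (c\<^sup>2 * (\<Sum>y | y \<in> U \<and> ed z y \<in> G. 1 / \<phi> y)))"
  proof (rule sum_mono)
    fix z assume z: "z \<in> U"
    have "(\<Sum>y\<in>U. of_bool (z \<in> up y) * (c\<^sup>2 * (v z)\<^sup>2 / \<phi> y)) \<le> (\<Sum>y\<in>U. if ed z y \<in> G then c\<^sup>2 * (v z)\<^sup>2 / \<phi> y else 0)"
    proof (rule sum_mono)
      fix y assume "y \<in> U"
      hence "c\<^sup>2 * (v z)\<^sup>2 / \<phi> y \<ge> 0" using \<phi>[of y] by auto
      thus "of_bool (z \<in> up y) * (c\<^sup>2 * (v z)\<^sup>2 / \<phi> y) \<le> (if ed z y \<in> G then c\<^sup>2 * (v z)\<^sup>2 / \<phi> y else 0)"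
        by (auto simp: up_def ed_commute[of z y])
    qed
    also have "\<dots> = (\<Sum>y | y \<in> U \<and> ed z y \<in> G. c\<^sup>2 * (v z)\<^sup>2 / \<phi> y)"
      using U by (simp add: sum.If_cases Int_def)
    also have "\<dots> = (v z)\<^sup>2 * (c\<^sup>2 * (\<Sum>y | y \<in> U \<and> ed z y \<in> G. 1 / \<phi> y))"
      by (simp add: sum_distrib_left mult_ac)
    finally show "(\<Sum>y\<in>U. of_bool (z \<in> up y) * (c\<^sup>2 * (v z)\<^sup>2 / \<phi> y)) \<le> (v z)\<^sup>2 * (c\<^sup>2 * (\<Sum>y | y \<in> U \<and> ed z y \<in> G. 1 / \<phi> y))" .
  qed
  with 1 have "(\<Sum>y\<in>U. \<Sum>z\<in>U. of_bool (ed y z \<in> G) * a y z) \<le> (\<Sum>y\<in>U. (v y)\<^sup>2 * (\<phi> y * real (card (up y))))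
      + (\<Sum>z\<in>U. (v z)\<^sup>2 * (c\<^sup>2 * (\<Sum>y | y \<in> U \<and> ed z y \<in> G. 1 / \<phi> y)))" by linarith
  thus ?thesis by (simp only: a_def distrib_left sum.distrib)
qed

section \<open>Neighbourhoods of the exceptional vertices\<close>

lemma handshake:
  assumes "F \<subseteq> pot_edges n m"
  shows "(\<Sum>u\<in>verts F. dg F u) = 2 * card F"
proof -
  have fF: "finite F" by (rule finite_subset[OF assms]) simp
  let ?A = "{u\<in>verts F. u < n}" and ?B = "{u\<in>verts F. \<not> u < n}"
  have F: "fst f < n \<and> \<not> snd f < n" if "f \<in> F" for f using that assms by (auto simp: pot_edges_def)
  have "(\<Sum>u\<in>?A. dg F u) = card (\<Union>u\<in>?A. inc F u)" unfolding dg_def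
    by (rule card_UN_disjoint[symmetric]) (use F fF in \<open>auto simp: inc_def\<close>)
  also have "(\<Union>u\<in>?A. inc F u) = F" using F by (auto simp: inc_def verts_def)
  finally have a: "(\<Sum>u\<in>?A. dg F u) = card F" .
  have "(\<Sum>u\<in>?B. dg F u) = card (\<Union>u\<in>?B. inc F u)" unfolding dg_def
    by (rule card_UN_disjoint[symmetric]) (use F fF in \<open>auto simp: inc_def\<close>)
  also have "(\<Union>u\<in>?B. inc F u) = F" using F by (auto simp: inc_def verts_def)
  finally have b: "(\<Sum>u\<in>?B. dg F u) = card F" .
  have "verts F = ?A \<union> ?B" by auto
  hence "(\<Sum>u\<in>verts F. dg F u) = (\<Sum>u\<in>?A \<union> ?B. dg F u)" by simp
  also have "\<dots> = (\<Sum>u\<in>?A. dg F u) + (\<Sum>u\<in>?B. dg F u)"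
    by (rule sum.union_disjoint) (use fF in auto)
  finally show ?thesis by (simp add: a b)
qed

lemma verts_wed: "verts (wed c) \<subseteq> set c"
  using wed_subset[of _ c] by (auto simp: verts_def)

lemma dg_verts_pos: "finite F \<Longrightarrow> u \<in> verts F \<Longrightarrow> dg F u \<ge> 1"
proof -
  assume fF: "finite F" and u: "u \<in> verts F"
  then obtain f where "f \<in> F" "u = fst f \<or> u = snd f" by (auto simp: verts_def)
  hence "f \<in> inc F u" by (auto simp: inc_def)
  hence "inc F u \<noteq> {}" by blast
  thus ?thesis using fF by (simp add: dg_def Suc_le_eq card_gt_0_iff)
qed

text \<open>The walk is followed from the last entry of the list, which lies in \<open>W\<close>:
  every new vertex brings a new edge.\<close>

lemma extend_walk:
  assumes "finite W" "finite F" "verts F \<subseteq> W" "card W \<le> card F + 1"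
  shows "c \<noteq> [] \<Longrightarrow> last c \<in> W \<Longrightarrow> card (W \<union> set c) \<le> card (F \<union> wed c) + 1"
proof (induction c rule: wsteps.induct)
  case (1 w u c)
  hence IH: "card (W \<union> set (u # c)) \<le> card (F \<union> wed (u # c)) + 1" by simp
  have e: "F \<union> wed (w # u # c) = insert (ed w u) (F \<union> wed (u # c))" by simp
  have v: "W \<union> set (w # u # c) = insert w (W \<union> set (u # c))" by auto
  have new: "ed w u \<notin> F \<union> wed (u # c)" if "w \<notin> W \<union> set (u # c)"
    using wed_subset[of "ed w u" "u # c"] ed_incident[of w u] that assms(3) by (auto simp: verts_def)
  show ?case using IH new assms(1,2) unfolding e v by (simp only: card_insert_if finite_Un List.finite_set) auto
next
  case ("2_2" v)
  thus ?case using assms by (simp add: insert_absorb)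
qed auto

lemma nobt_iff_nth: "nobt p \<longleftrightarrow> (\<forall>k. Suc (Suc k) < length p \<longrightarrow> p ! k \<noteq> p ! Suc (Suc k))"
proof
  show "nobt p \<Longrightarrow> \<forall>k. Suc (Suc k) < length p \<longrightarrow> p ! k \<noteq> p ! Suc (Suc k)" using nobt_nth by blast
  show "\<forall>k. Suc (Suc k) < length p \<longrightarrow> p ! k \<noteq> p ! Suc (Suc k) \<Longrightarrow> nobt p"
  proof (induction p rule: nobt.induct)
    case (1 a b c p)
    have "a \<noteq> c" using spec[OF 1(2), of 0] by simp
    moreover have "nobt (b # c # p)"
    proof (rule 1(1), intro allI impI)
      fix k assume "Suc (Suc k) < length (b # c # p)"
      thus "(b # c # p) ! k \<noteq> (b # c # p) ! Suc (Suc k)" using spec[OF 1(2), of "Suc k"] by simp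
    qed
    ultimately show ?case by simp
  qed auto
qed

lemma nobt_interior_dg:
  assumes "nobt p" "u = p ! k" "0 < k" "Suc k < length p" "wed p \<subseteq> F" "finite F"
  shows "dg F u \<ge> 2"
proof -
  obtain j where j: "k = Suc j" using assms(3) by (cases k) auto
  have ne: "p ! j \<noteq> p ! Suc (Suc j)" using assms(1,4) j by (simp add: nobt_iff_nth)
  have "ed (p ! j) (p ! Suc j) \<in> wed p" "ed (p ! Suc j) (p ! Suc (Suc j)) \<in> wed p"
    using assms(4) j by (intro wsteps_nth; simp)+
  hence sub: "{ed u (p ! j), ed u (p ! Suc (Suc j))} \<subseteq> inc F u"
    using assms(2,5) j by (auto simp: ed_commute)
  have "2 = card {ed u (p ! j), ed u (p ! Suc (Suc j))}" using ne by simp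
  also have "\<dots> \<le> dg F u" unfolding dg_def by (rule card_mono[OF _ sub]) (use assms(6) in simp)
  finally show ?thesis .
qed

text \<open>An escape from \<open>x\<close> via its neighbour \<open>y\<close>: a short nonbacktracking walk from \<open>x\<close> through \<open>y\<close> to \<open>S\<close>, listed
  backwards.\<close>

definition escape :: "(nat \<times> nat) set \<Rightarrow> nat set \<Rightarrow> nat \<Rightarrow> nat \<Rightarrow> nat \<Rightarrow> nat list \<Rightarrow> bool" where
  "escape G S R x y p \<longleftrightarrow> nobt p \<and> wed p \<subseteq> G \<and> 2 \<le> length p \<and> length p \<le> R + 4 \<and> last p = x
     \<and> p ! (length p - 2) = y \<and> hd p \<in> S"

text \<open>Suppose k + 1 neighbours admit an escape. The union \<open>F\<close> of the walks is
  connected, so \<open>card V \<le> card F + 1\<close>, and without dense clusters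
  \<open>card F \<le> card V\<close> and \<open>c * real (card J) < 3/2\<close>. But
  \<open>x\<close> has degree at least k + 1 in \<open>F\<close> and the other vertices outside
  \<open>S\<close> have degree at least 2, so the handshake identity gives
  \<open>k \<le> card J + 1\<close>, which is too small.\<close>

lemma escapes_bounded:
  assumes G: "G \<subseteq> pot_edges n m" and c: "c > 0"
    and nodense: "\<And>F J. \<not> dense_cluster f0 c (1/2) G S F J"
    and Y: "\<And>y. y \<in> Y \<Longrightarrow> \<exists>p. escape G S R x y p"
    and k: "real k \<ge> 3 / (2 * c) + 2" and f0: "f0 \<ge> (k + 1) * (R + 3)"
  shows "finite Y \<and> card Y \<le> k"
proof (rule ccontr)
  assume neg: "\<not> (finite Y \<and> card Y \<le> k)"
  obtain Y' where Y': "Y' \<subseteq> Y" "finite Y'" "card Y' = k + 1"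
  proof (cases "finite Y")
    case True
    hence "k + 1 \<le> card Y" using neg by simp
    then obtain Z where "Z \<subseteq> Y" "card Z = k + 1" by (rule obtain_subset_with_card_n)
    thus ?thesis using that True finite_subset by blast
  next
    case False
    thus ?thesis using that infinite_arbitrarily_large by blast
  qed
  have "\<forall>y\<in>Y'. \<exists>p. escape G S R x y p" using Y Y'(1) by blast
  then obtain P where P: "\<And>y. y \<in> Y' \<Longrightarrow> escape G S R x y (P y)" by metis
  define F where "F = (\<Union>y\<in>Y'. wed (P y))"
  define V where "V = verts F"
  define J where "J = V \<inter> S"
  have fG: "finite G" by (rule finite_subset[OF G]) simp
  have FG: "F \<subseteq> G" using P by (auto simp: F_def escape_def)
  hence fF: "finite F" using fG finite_subset by blast
  have fV: "finite V" using fF by (simp add: V_def)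
  have cF: "card F \<le> f0"
  proof -
    have "card F \<le> (\<Sum>y\<in>Y'. card (wed (P y)))" unfolding F_def by (rule card_UN_le[OF Y'(2)])
    also have "\<dots> \<le> (\<Sum>y\<in>Y'. R + 3)"
    proof (rule sum_mono)
      fix y assume "y \<in> Y'"
      hence "length (P y) \<le> R + 4" using P[of y] by (simp add: escape_def)
      hence "length (wsteps (P y)) \<le> R + 3" unfolding length_wsteps by linarith
      thus "card (wed (P y)) \<le> R + 3" using card_length le_trans by blast
    qed
    also have "\<dots> \<le> f0" using Y' f0 by simp
    finally show ?thesis .
  qed
  have nd: "real (card F) + c * real (card J) < real (card V) + 1/2"
    using nodense[of F J] FG cF by (auto simp: dense_cluster_def J_def V_def)
  have conn: "card V \<le> card F + 1"
  proof -
    have "finite ({x} \<union> (\<Union>y\<in>Z. set (P y))) \<and> card ({x} \<union> (\<Union>y\<in>Z. set (P y))) \<le> card (\<Union>y\<in>Z. wed (P y)) + 1"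
      if "finite Z" "Z \<subseteq> Y'" for Z
      using that
    proof (induction Z rule: finite_induct)
      case (insert y Z)
      have py: "P y \<noteq> []" "last (P y) = x" using P[of y] insert by (auto simp: escape_def)
      let ?W = "{x} \<union> (\<Union>y\<in>Z. set (P y))" and ?F = "\<Union>y\<in>Z. wed (P y)"
      have "verts ?F \<subseteq> ?W" using wed_subset by (fastforce simp: verts_def)
      hence "card (?W \<union> set (P y)) \<le> card (?F \<union> wed (P y)) + 1"
        using insert py by (intro extend_walk) auto
      moreover have "{x} \<union> (\<Union>y\<in>insert y Z. set (P y)) = ?W \<union> set (P y)" by auto
      moreover have "(\<Union>y\<in>insert y Z. wed (P y)) = ?F \<union> wed (P y)" by auto
      ultimately show ?case using insert by simp
    qed simp
    from this[OF Y'(2) order_refl] have W: "finite ({x} \<union> (\<Union>y\<in>Y'. set (P y)))"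
      "card ({x} \<union> (\<Union>y\<in>Y'. set (P y))) \<le> card F + 1" by (auto simp: F_def)
    have "V \<subseteq> {x} \<union> (\<Union>y\<in>Y'. set (P y))" using wed_subset by (fastforce simp: V_def F_def verts_def)
    hence "card V \<le> card ({x} \<union> (\<Union>y\<in>Y'. set (P y)))" using W(1) by (rule card_mono[rotated])
    thus ?thesis using W(2) by linarith
  qed
  have cJ: "c * real (card J) < 3/2" using nd conn by linarith
  have xe: "ed x y \<in> F" if "y \<in> Y'" for y
  proof -
    have e: "nobt (P y)" "2 \<le> length (P y)" "last (P y) = x" "P y ! (length (P y) - 2) = y"
      using P[OF that] by (auto simp: escape_def)
    have "ed (P y ! (length (P y) - 2)) (P y ! Suc (length (P y) - 2)) \<in> wed (P y)"
      using e(2) by (intro wsteps_nth) simp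
    moreover have "Suc (length (P y) - 2) = length (P y) - 1" using e(2) by simp
    moreover have "P y ! (length (P y) - 1) = x" using e(2,3) by (metis last_conv_nth list.size(3) not_numeral_le_zero)
    ultimately have "ed y x \<in> wed (P y)" using e(4) by simp
    thus ?thesis using that by (auto simp: F_def ed_commute)
  qed
  have dx: "dg F x \<ge> k + 1"
  proof -
    have "card (ed x ` Y') = k + 1" using Y'(3) by (subst card_image) (auto simp: inj_on_def)
    moreover have "ed x ` Y' \<subseteq> inc F x" using xe by auto
    ultimately show ?thesis unfolding dg_def using fF by (metis card_mono finite_inc)
  qed
  have d2: "dg F u \<ge> 2" if u: "u \<in> V" "u \<noteq> x" "u \<notin> S" for u
  proof -
    obtain y where y: "y \<in> Y'" "u \<in> set (P y)"
      using u(1) wed_subset by (fastforce simp: V_def F_def verts_def)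
    note e = P[OF y(1), unfolded escape_def]
    obtain i where i: "i < length (P y)" "u = P y ! i" using y(2) by (metis in_set_conv_nth)
    have "i \<noteq> 0"
    proof
      assume "i = 0"
      hence "u = hd (P y)" using i e by (simp add: hd_conv_nth)
      thus False using u e by simp
    qed
    moreover have "i \<noteq> length (P y) - 1"
    proof
      assume "i = length (P y) - 1"
      moreover have "P y \<noteq> []" using i(1) by auto
      ultimately have "u = last (P y)" using i(2) by (simp add: last_conv_nth)
      thus False using u e by simp
    qed
    ultimately show ?thesis
      using e i y(1) fF by (intro nobt_interior_dg[of "P y" u i]) (auto simp: F_def)
  qed
  have xV: "x \<in> V" 
  proof -
    obtain y where "y \<in> Y'" using Y'(3) by fastforce
    hence "ed x y \<in> F" by (rule xe)
    thus ?thesis using ed_incident(1)[of x y] by (force simp: V_def verts_def)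
  qed
  have "2 * card (V - {x}) \<le> (\<Sum>u\<in>V - {x}. dg F u + of_bool (u \<in> S))"
  proof -
    have "2 * card (V - {x}) = (\<Sum>u\<in>V - {x}. 2)" by simp
    also have "\<dots> \<le> (\<Sum>u\<in>V - {x}. dg F u + of_bool (u \<in> S))"
    proof (rule sum_mono)
      fix u assume u: "u \<in> V - {x}"
      show "2 \<le> dg F u + of_bool (u \<in> S)"
        using d2[of u] dg_verts_pos[OF fF, of u] u by (cases "u \<in> S") (auto simp: V_def)
    qed
    finally show ?thesis .
  qed
  also have "\<dots> = (\<Sum>u\<in>V - {x}. dg F u) + card {u\<in>V - {x}. u \<in> S}"
    using fV by (simp add: sum.distrib of_bool_def sum.If_cases Int_def)
  finally have A: "2 * card (V - {x}) \<le> (\<Sum>u\<in>V - {x}. dg F u) + card {u\<in>V - {x}. u \<in> S}" .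
  have B: "card {u\<in>V - {x}. u \<in> S} \<le> card J" using fV by (intro card_mono) (auto simp: J_def)
  have "dg F x + (\<Sum>u\<in>V - {x}. dg F u) = 2 * card F"
    using handshake[of F n m] FG G xV fV by (simp add: V_def sum.remove[of "verts F" x])
  hence "2 * card (V - {x}) + (k + 1) \<le> 2 * card F + card J" using A B dx by linarith
  moreover have "card V = card (V - {x}) + 1" using card.remove[OF fV xV] by simp
  moreover have "card V \<ge> card F"
  proof -
    have "c * real (card J) \<ge> 0" using c by simp
    thus ?thesis using nd by linarith
  qed
  ultimately have "k \<le> card J + 1" by linarith
  hence "real k \<le> real (card J) + 1" by linarith
  moreover have "real (card J) < 3 / (2 * c)" using cJ c by (simp add: field_simps)
  ultimately show False using k by linarith
qed

section \<open>Levels around the exceptional set\<close>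

primrec nbh :: "(nat \<times> nat) set \<Rightarrow> nat set \<Rightarrow> nat \<Rightarrow> nat set" where
  "nbh G S 0 = S"
| "nbh G S (Suc i) = nbh G S i \<union> {y. \<exists>x\<in>nbh G S i. ed x y \<in> G}"

text \<open>The distance from \<open>S\<close>, meaningful for vertices that occur in some
  \<open>nbh G S i\<close>.\<close>

definition lev :: "(nat \<times> nat) set \<Rightarrow> nat set \<Rightarrow> nat \<Rightarrow> nat" where
  "lev G S x = (LEAST i. x \<in> nbh G S i)"

lemma lev_props:
  assumes "x \<in> nbh G S i"
  shows "x \<in> nbh G S (lev G S x)" "lev G S x \<le> i"
  unfolding lev_def using assms by (rule LeastI, rule Least_le)

lemma nbh_mono: "i \<le> j \<Longrightarrow> nbh G S i \<subseteq> nbh G S j"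
  by (rule lift_Suc_mono_le[of "nbh G S"]) auto

text \<open>Passing repeatedly to a neighbour of smaller level ends in \<open>S\<close>. The strict
  increase of levels makes the chain nonbacktracking.\<close>

lemma lev_chain:
  assumes "x \<in> nbh G S i"
  shows "\<exists>p. p \<noteq> [] \<and> hd p \<in> S \<and> last p = x \<and> wed p \<subseteq> G \<and> length p \<le> Suc (lev G S x)
     \<and> sorted_wrt (\<lambda>a b. lev G S a < lev G S b) p"
  using assms
proof (induction "lev G S x" arbitrary: x i rule: less_induct)
  case less
  show ?case
  proof (cases "lev G S x")
    case 0
    hence "x \<in> S" using lev_props(1)[OF less(2)] by simp
    thus ?thesis by (intro exI[of _ "[x]"]) auto
  next
    case (Suc j)
    have "x \<in> nbh G S (Suc j)" using lev_props(1)[OF less(2)] Suc by simp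
    moreover have "x \<notin> nbh G S j" using lev_props(2)[of x G S j] Suc by auto
    ultimately obtain z where z: "z \<in> nbh G S j" "ed z x \<in> G" by auto
    have lz: "lev G S z < lev G S x" using lev_props(2)[OF z(1)] Suc by simp
    from less(1)[OF lz z(1)] obtain p where p: "p \<noteq> []" "hd p \<in> S" "last p = z" "wed p \<subseteq> G"
      "length p \<le> Suc (lev G S z)" "sorted_wrt (\<lambda>a b. lev G S a < lev G S b) p" by blast
    have le: "lev G S a \<le> lev G S z" if "a \<in> set p" for a
    proof -
      have "p = butlast p @ [z]" using p(1,3) by (metis append_butlast_last_id)
      hence "sorted_wrt (\<lambda>a b. lev G S a < lev G S b) (butlast p @ [z])" "a \<in> set (butlast p @ [z])"
        using p(6) that by simp_all
      thus ?thesis by (auto simp: sorted_wrt_append)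
    qed
    have "wed (p @ [x]) \<subseteq> insert (ed (last p) x) (wed p)"
      using p(1) by (induction p rule: wsteps.induct) auto
    hence "wed (p @ [x]) \<subseteq> G" using p(3,4) z(2) by auto
    moreover have "sorted_wrt (\<lambda>a b. lev G S a < lev G S b) (p @ [x])"
      using p(6) le lz by (auto simp: sorted_wrt_append intro: le_less_trans)
    ultimately show ?thesis using p lz
      by (intro exI[of _ "p @ [x]"]) auto
  qed
qed

lemma wed_snoc: "p \<noteq> [] \<Longrightarrow> wed (p @ [x]) = insert (ed (last p) x) (wed p)"
  by (induction p rule: wsteps.induct) auto

lemma nobt_snoc:
  assumes "nobt p" "length p \<ge> 2 \<Longrightarrow> p ! (length p - 2) \<noteq> x"
  shows "nobt (p @ [x])"
  unfolding nobt_iff_nth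
proof (intro allI impI)
  fix k assume k: "Suc (Suc k) < length (p @ [x])"
  show "(p @ [x]) ! k \<noteq> (p @ [x]) ! Suc (Suc k)"
  proof (cases "Suc (Suc k) = length p")
    case True
    hence "length p - 2 = k" by simp
    thus ?thesis using assms(2) True by (simp add: nth_append)
  next
    case False
    thus ?thesis using k assms(1) by (simp add: nth_append nobt_iff_nth)
  qed
qed

lemma chain_nobt: "sorted_wrt (\<lambda>a b. f a < (f b :: nat)) p \<Longrightarrow> nobt p"
  by (auto simp: nobt_iff_nth sorted_wrt_iff_nth_less) (metis lessI less_SucI less_irrefl)

text \<open>Appending \<open>x\<close> to the chain of \<open>y\<close> cannot backtrack: the vertex
  before \<open>y\<close> has a level below that of \<open>y\<close>, hence below that of
  \<open>x\<close>.\<close>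

lemma up_escape:
  assumes y: "y \<in> nbh G S i" "i \<le> R + 1" and e: "ed x y \<in> G" "lev G S y \<le> lev G S x"
  shows "\<exists>p. escape G S R x y p \<and> length p \<le> R + 3"
proof -
  obtain p where p: "p \<noteq> []" "hd p \<in> S" "last p = y" "wed p \<subseteq> G"
      "length p \<le> Suc (lev G S y)" "sorted_wrt (\<lambda>a b. lev G S a < lev G S b) p"
    using lev_chain[OF y(1)] by blast
  have "nobt (p @ [x])"
  proof (rule nobt_snoc[OF chain_nobt[OF p(6)]])
    assume l: "length p \<ge> 2"
    have "lev G S (p ! (length p - 2)) < lev G S (p ! (length p - 1))"
      using p(6) l by (intro sorted_wrt_nth_less[OF p(6)]) auto
    also have "p ! (length p - 1) = y" using p(1,3) by (simp add: last_conv_nth)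
    finally show "p ! (length p - 2) \<noteq> x" using e(2) by auto
  qed
  moreover have "(p @ [x]) ! (length (p @ [x]) - 2) = y"
    using p(1,3) by (cases p rule: rev_cases) (auto simp: nth_append)
  ultimately have "escape G S R x y (p @ [x])"
    using p e lev_props(2)[OF y(1)] y(2) by (auto simp: escape_def wed_snoc ed_commute Suc_le_eq)
  moreover have "length (p @ [x]) \<le> R + 3" using p(5) lev_props(2)[OF y(1)] y(2) by simp
  ultimately show ?thesis by blast
qed

text \<open>One step beyond \<open>up_escape\<close>: a neighbour of \<open>x\<close> that lies in
  \<open>S\<close> or has a parent other than \<open>x\<close> admits an escape, so there are few
  such neighbours.\<close>

lemma special_escape:
  assumes y: "y \<in> S \<or> (\<exists>z. z \<in> nbh G S i \<and> i \<le> R + 1 \<and> z \<noteq> x \<and> ed y z \<in> G \<and> lev G S z \<le> lev G S y)" and e: "ed x y \<in> G"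
  shows "\<exists>p. escape G S R x y p"
  using y
proof
  assume "y \<in> S"
  hence "escape G S R x y [y, x]" using e by (auto simp: escape_def ed_commute)
  thus ?thesis by blast
next
  assume "\<exists>z. z \<in> nbh G S i \<and> i \<le> R + 1 \<and> z \<noteq> x \<and> ed y z \<in> G \<and> lev G S z \<le> lev G S y"
  then obtain z where z: "z \<in> nbh G S i" "i \<le> R + 1" "z \<noteq> x" "ed y z \<in> G" "lev G S z \<le> lev G S y" by blast
  obtain p where p: "escape G S R y z p" "length p \<le> R + 3" using up_escape[OF z(1,2,4,5)] by blast
  have "escape G S R x y (p @ [x])" unfolding escape_def
  proof (intro conjI)
    show "nobt (p @ [x])" using p z by (intro nobt_snoc) (auto simp: escape_def)
    have pn: "p \<noteq> []" using p by (auto simp: escape_def)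
    show "wed (p @ [x]) \<subseteq> G" using p e pn by (auto simp: escape_def wed_snoc ed_commute)
    show "2 \<le> length (p @ [x])" "length (p @ [x]) \<le> R + 4" "last (p @ [x]) = x" "hd (p @ [x]) \<in> S"
      using p pn by (auto simp: escape_def)
    show "(p @ [x]) ! (length (p @ [x]) - 2) = y"
      using p(1) pn by (cases p rule: rev_cases) (auto simp: nth_append escape_def)
  qed
  thus ?thesis by blast
qed

lemma nbh_subset: "S \<subseteq> {..<n+m} \<Longrightarrow> G \<subseteq> pot_edges n m \<Longrightarrow> nbh G S i \<subseteq> {..<n+m}"
proof (induction i)
  case (Suc i)
  have "y < n + m" if "ed x y \<in> G" for x y
    using that Suc.prems(2) verts_pot_edges[of "pot_edges n m" n m] ed_incident(2)[of x y] by (fastforce simp: verts_def)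
  thus ?case using Suc by auto
qed auto

lemma card_nbh_le:
  assumes G: "G \<subseteq> pot_edges n m" and S: "S \<subseteq> {..<n+m}"
    and D: "\<And>x. x < n + m \<Longrightarrow> real (dg G x) \<le> D" and D0: "D \<ge> 0"
  shows "real (card (nbh G S i)) \<le> real (card S) * (1 + D) ^ i"
proof (induction i)
  case (Suc i)
  have fG: "finite G" by (rule finite_subset[OF G]) simp
  have sub: "nbh G S i \<subseteq> {..<n+m}" by (rule nbh_subset[OF S G])
  have fU: "finite (nbh G S i)" using sub finite_subset by blast
  have inj: "inj_on (ed x) A" for x A by (auto simp: inj_on_def)
  have nb: "card {y. ed x y \<in> G} \<le> dg G x" "finite {y. ed x y \<in> G}" for x
  proof -
    have s: "ed x ` {y. ed x y \<in> G} \<subseteq> inc G x" by auto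
    show "finite {y. ed x y \<in> G}" using inj_on_finite[OF inj s] fG by simp
    show "card {y. ed x y \<in> G} \<le> dg G x" unfolding dg_def using card_inj_on_le[OF inj s] fG by simp
  qed
  have "{y. \<exists>x\<in>nbh G S i. ed x y \<in> G} = (\<Union>x\<in>nbh G S i. {y. ed x y \<in> G})" by auto
  hence "card {y. \<exists>x\<in>nbh G S i. ed x y \<in> G} \<le> (\<Sum>x\<in>nbh G S i. card {y. ed x y \<in> G})"
    using card_UN_le[OF fU] by metis
  also have "\<dots> \<le> (\<Sum>x\<in>nbh G S i. dg G x)" by (intro sum_mono nb)
  finally have "real (card {y. \<exists>x\<in>nbh G S i. ed x y \<in> G}) \<le> real (\<Sum>x\<in>nbh G S i. dg G x)" by linarith
  also have "\<dots> \<le> (\<Sum>x\<in>nbh G S i. D)" unfolding of_nat_sum using sub D by (intro sum_mono) auto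
  finally have "real (card {y. \<exists>x\<in>nbh G S i. ed x y \<in> G}) \<le> real (card (nbh G S i)) * D" by simp
  moreover have "card (nbh G S (Suc i)) \<le> card (nbh G S i) + card {y. \<exists>x\<in>nbh G S i. ed x y \<in> G}"
    by (simp add: card_Un_le)
  ultimately have "real (card (nbh G S (Suc i))) \<le> real (card (nbh G S i)) * (1 + D)"
    by (simp add: algebra_simps)
  also have "\<dots> \<le> real (card S) * (1 + D) ^ i * (1 + D)" using Suc D0 by (intro mult_right_mono) auto
  finally show ?case by (simp add: mult_ac)
qed simp

text \<open>Near \<open>S\<close> the graph is almost a forest rooted in \<open>S\<close>: giving every vertex other than \<open>S\<close> and the few
  vertices with two parents the weight \<open>side_weight\<close>, and the others a small weight \<open>\<eta>\<close>, in
  \<open>cluster_certificate\<close> costs a vertex of \<open>S\<close> only its degree.\<close>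

lemma cluster_bound:
  fixes v :: "nat \<Rightarrow> real"
  assumes G: "G \<subseteq> pot_edges n m" and S: "S \<subseteq> {..<n+m}" and c: "c > 0"
    and nodense: "\<And>F J. \<not> dense_cluster f0 c (1/2) G S F J"
    and k: "real k \<ge> 3 / (2 * c) + 2" and f0: "f0 \<ge> (k + 1) * (R + 3)"
    and d: "d > 0" and q: "q \<ge> 1" and \<eta>: "\<eta> > 0" "\<eta> * real k \<le> \<delta> / q" and i: "i \<le> R + 1"
    and maxdeg: "\<And>x. x < n + m \<Longrightarrow> real (dg G x) \<le> (1 + 1 / (side_weight n q x)\<^sup>2 - \<delta>) * d"
    and typical: "\<And>x. x < n + m \<Longrightarrow> x \<notin> S \<Longrightarrow> real (dg G x) \<le> (1 + \<tau>) / (side_weight n q x)\<^sup>2 * d" and \<tau>: "\<tau> \<ge> 0" and \<delta>: "\<delta> \<ge> 0"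
  defines "U \<equiv> nbh G S i"
  shows "(\<Sum>y\<in>U. \<Sum>z\<in>U. of_bool (ed y z \<in> G) * (1 / sqrt d * (\<bar>v y\<bar> * \<bar>v z\<bar>)))
    \<le> (q + 1 / q + \<tau> * q + real k / (\<eta> * d)) * (\<Sum>y\<in>U. (v y)\<^sup>2)"
proof -
  have sub: "U \<subseteq> {..<n+m}" unfolding U_def by (rule nbh_subset[OF S G])
  have fU: "finite U" using sub finite_subset by blast
  define L where "L = lev G S"
  \<comment> \<open>Parents, i.e. neighbours not farther from \<open>S\<close>. In a forest rooted
    in \<open>S\<close> there would be at most one.\<close>
  define up where "up = (\<lambda>y. {z\<in>U. ed y z \<in> G \<and> L z \<le> L y})"
  have fup: "finite (up y)" for y using fU by (simp add: up_def)
  define Z where "Z = {y\<in>U. y \<in> S \<or> card (up y) \<ge> 2}"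
  define b where "b = side_weight n q"
  have b0: "b x > 0" for x using q by (simp add: b_def side_weight_def)
  have bq: "1 / b x \<le> q" "b x \<ge> 1 / q" "b x + 1 / b x = q + 1 / q" for x
    using q by (auto simp: b_def side_weight_def field_simps) (metis mult_mono' zero_le_one mult_1 le_numeral_extra(1))+
  define \<phi> where "\<phi> = (\<lambda>y. if y \<in> Z then \<eta> else b y)"
  have \<phi>0: "\<phi> y > 0" for y using \<eta> b0 by (simp add: \<phi>_def)
  have upk: "card (up x) \<le> k" for x
  proof -
    have "\<exists>p. escape G S R x z p" if "z \<in> up x" for z
      using up_escape[of z G S i R x] that i by (auto simp: up_def U_def L_def)
    from escapes_bounded[OF G c nodense this k f0] show ?thesis by simp
  qed
  \<comment> \<open>A neighbour with two parents has one other than \<open>x\<close> and therefore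
    escapes. So the large reciprocal \<open>1 / \<eta>\<close> occurs at most \<open>k\<close> times
    around any vertex.\<close>
  have spk: "card {z. z \<in> U \<and> ed x z \<in> G \<and> z \<in> Z} \<le> k" for x
  proof -
    have "\<exists>p. escape G S R x y p" if y: "y \<in> {z. z \<in> U \<and> ed x z \<in> G \<and> z \<in> Z}" for y
    proof (rule special_escape[of _ _ _ i])
      show "ed x y \<in> G" using y by simp
      show "y \<in> S \<or> (\<exists>z. z \<in> nbh G S i \<and> i \<le> R + 1 \<and> z \<noteq> x \<and> ed y z \<in> G \<and> lev G S z \<le> lev G S y)"
      proof (cases "y \<in> S")
        case False
        hence "card (up y) \<ge> 2" using y by (simp add: Z_def)
        hence "\<not> up y \<subseteq> {x}" using card_mono[of "{x}" "up y"] by auto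
        thus ?thesis using i by (auto simp: up_def U_def L_def)
      qed simp
    qed
    from escapes_bounded[OF G c nodense this k f0] show ?thesis by (rule conjunct2)
  qed
  have fG: "finite G" by (rule finite_subset[OF G]) simp
  have coef: "\<phi> y * real (card (up y)) + (1 / sqrt d)\<^sup>2 * (\<Sum>z | z \<in> U \<and> ed y z \<in> G. 1 / \<phi> z)
      \<le> q + 1 / q + \<tau> * q + real k / (\<eta> * d)" if y: "y \<in> U" for y
  proof -
    have yN: "y < n + m" using y sub by auto
    let ?N = "{z. z \<in> U \<and> ed y z \<in> G}"
    have fN: "finite ?N" using fU by simp
    have "card ?N \<le> dg G y"
    proof -
      have "ed y ` ?N \<subseteq> inc G y" by auto
      moreover have "inj_on (ed y) ?N" by (auto simp: inj_on_def)
      ultimately show ?thesis unfolding dg_def using card_inj_on_le fG finite_inc by blast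
    qed
    hence dN: "real (card ?N) \<le> real (dg G y)" by simp
    have "(\<Sum>z\<in>?N. 1 / \<phi> z) \<le> (\<Sum>z\<in>?N. b y + of_bool (z \<in> Z) * (1 / \<eta>))"
    proof (rule sum_mono)
      fix z assume z: "z \<in> ?N"
      \<comment> \<open>Neighbours lie on opposite sides, where the weights are reciprocal to each
        other.\<close>
      have "cross n y z" using z G ed_in_pot_edges[of y n m z] yN sub by auto
      hence "1 / b z = b y" using q by (auto simp: b_def side_weight_def cross_def)
      thus "1 / \<phi> z \<le> b y + of_bool (z \<in> Z) * (1 / \<eta>)" using b0[of y] by (auto simp: \<phi>_def)
    qed
    also have "\<dots> = real (card ?N) * b y + real (card {z\<in>?N. z \<in> Z}) * (1 / \<eta>)"
      using sum_of_bool_card[OF fN, of "\<lambda>z. z \<in> Z"] by (simp only: sum.distrib sum_distrib_right[symmetric]) simp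
    also have "\<dots> \<le> real (dg G y) * b y + real k * (1 / \<eta>)"
    proof -
      have "card {z\<in>?N. z \<in> Z} \<le> k" using spk[of y] by (simp add: conj_assoc)
      thus ?thesis using dN b0[of y] \<eta>(1) by (intro add_mono mult_right_mono) auto
    qed
    finally have "(1 / sqrt d)\<^sup>2 * (\<Sum>z\<in>?N. 1 / \<phi> z) \<le> (1 / sqrt d)\<^sup>2 * (real (dg G y) * b y + real k * (1 / \<eta>))"
      by (rule mult_left_mono) simp
    also have "\<dots> = real (dg G y) / d * b y + real k / (\<eta> * d)" using d by (simp add: power_divide algebra_simps)
    finally have sm: "(1 / sqrt d)\<^sup>2 * (\<Sum>z\<in>?N. 1 / \<phi> z) \<le> real (dg G y) / d * b y + real k / (\<eta> * d)" .
    show ?thesis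
    proof (cases "y \<in> Z")
      case False
      hence "card (up y) \<le> 1" "y \<notin> S" using y by (auto simp: Z_def)
      \<comment> \<open>One parent costs \<open>b y\<close> and a typical number of children about
        \<open>1 / b y\<close>, together \<open>q + 1 / q\<close>.\<close>
      hence "\<phi> y * real (card (up y)) \<le> b y * 1" unfolding \<phi>_def using False b0[of y] by (intro mult_mono) auto
      moreover have "real (dg G y) / d * b y \<le> (1 + \<tau>) / (b y)\<^sup>2 * b y"
        using typical[OF yN \<open>y \<notin> S\<close>] d b0[of y] by (intro mult_right_mono) (auto simp: b_def pos_divide_le_eq)
      moreover have "(1 + \<tau>) / (b y)\<^sup>2 * b y = 1 / b y + \<tau> * (1 / b y)"
        using b0[of y] by (simp add: power2_eq_square field_simps)
      moreover have "\<tau> * (1 / b y) \<le> \<tau> * q" using bq(1)[of y] \<tau> by (rule mult_left_mono)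
      ultimately show ?thesis using sm bq(3)[of y] by linarith
    next
      case True
      \<comment> \<open>Parents cost almost nothing here, so the whole budget
        \<open>b y + 1 / b y\<close> is left for the children. This admits degrees up to
        \<open>(1 + 1 / (b y)\<^sup>2) * d\<close>; the margin \<open>\<delta>\<close> absorbs
        \<open>\<eta> * real k\<close>.\<close>
      have "\<phi> y * real (card (up y)) \<le> \<eta> * real k" unfolding \<phi>_def using True \<eta>(1) upk[of y] by (intro mult_mono) auto
      moreover have "real (dg G y) / d * b y \<le> (1 + 1 / (b y)\<^sup>2 - \<delta>) * b y"
        using maxdeg[OF yN] d b0[of y] by (intro mult_right_mono) (auto simp: b_def pos_divide_le_eq)
      moreover have "(1 + 1 / (b y)\<^sup>2 - \<delta>) * b y = b y + 1 / b y - \<delta> * b y"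
        using b0[of y] by (simp add: power2_eq_square field_simps)
      moreover have "\<delta> * (1 / q) \<le> \<delta> * b y" using bq(2)[of y] \<delta> by (rule mult_left_mono)
      moreover have "\<tau> * q \<ge> 0" using \<tau> q by simp
      ultimately show ?thesis using sm bq(3)[of y] \<eta>(2) by simp
    qed
  qed
  have "(\<Sum>y\<in>U. \<Sum>z\<in>U. of_bool (ed y z \<in> G) * (1 / sqrt d * (\<bar>v y\<bar> * \<bar>v z\<bar>)))
    \<le> (\<Sum>y\<in>U. (v y)\<^sup>2 * (\<phi> y * real (card (up y)) + (1 / sqrt d)\<^sup>2 * (\<Sum>z | z \<in> U \<and> ed y z \<in> G. 1 / \<phi> z)))"
    unfolding up_def by (rule cluster_certificate[OF fU \<phi>0]) (use d in simp)
  also have "\<dots> \<le> (\<Sum>y\<in>U. (v y)\<^sup>2 * (q + 1 / q + \<tau> * q + real k / (\<eta> * d)))"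
    by (intro sum_mono mult_left_mono coef) auto
  also have "\<dots> = (q + 1 / q + \<tau> * q + real k / (\<eta> * d)) * (\<Sum>y\<in>U. (v y)\<^sup>2)"
    by (subst mult.commute) (simp only: sum_distrib_right)
  finally show ?thesis .
qed

section \<open>Cutting at a light shell\<close>

text \<open>Every vertex lies in at most two of the shells, so the masses of all shells add up to at
  most twice the total.\<close>

lemma shell_pigeonhole:
  fixes v :: "nat \<Rightarrow> real"
  assumes fin: "\<And>i. nbh G S i \<subseteq> {..<N}" and R: "R \<ge> 1"
  obtains i where "1 \<le> i" "i \<le> R" "(\<Sum>x\<in>nbh G S (i + 1) - nbh G S (i - 1). (v x)\<^sup>2) \<le> 2 / real R * sqn N v"
proof -
  define M where "M = (\<lambda>i. \<Sum>x\<in>nbh G S i. (v x)\<^sup>2)"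
  define s where "s = (\<lambda>i. \<Sum>x\<in>nbh G S (i + 1) - nbh G S (i - 1). (v x)\<^sup>2)"
  have ff: "finite (nbh G S i)" for i using fin[of i] finite_subset by blast
  have M: "0 \<le> M i" "M i \<le> sqn N v" for i
    unfolding M_def sqn_def using fin[of i] by (auto intro!: sum_nonneg sum_mono2)
  have s: "s i = M (i + 1) - M (i - 1)" for i
    unfolding s_def M_def by (rule sum_diff[OF ff nbh_mono]) simp
  have tel: "(\<Sum>i\<in>{1..r}. s i) = M (r + 1) + M r - M 1 - M 0" for r
    by (induction r) (auto simp: s)
  have "(\<Sum>i\<in>{1..R}. s i) \<le> 2 * sqn N v" unfolding tel using M[of "R + 1"] M[of R] M[of 1] M[of 0] by linarith
  have "\<exists>i\<in>{1..R}. s i \<le> 2 / real R * sqn N v"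
  proof (rule ccontr)
    assume "\<not> ?thesis"
    hence "(\<Sum>i\<in>{1..R}. 2 / real R * sqn N v) < (\<Sum>i\<in>{1..R}. s i)" using R by (intro sum_strict_mono) (auto simp: not_le)
    moreover have "(\<Sum>i\<in>{1..R}. 2 / real R * sqn N v) = 2 * sqn N v" using R by simp
    ultimately show False using \<open>(\<Sum>i\<in>{1..R}. s i) \<le> 2 * sqn N v\<close> by linarith
  qed
  thus ?thesis using that by (auto simp: s_def)
qed

lemma sum_abs_le_sqrt:
  assumes "finite U" "U \<subseteq> {..<N}"
  shows "(\<Sum>x\<in>U. \<bar>v x\<bar>) \<le> sqrt (real (card U)) * sqrt (sqn N v)"
proof -
  have "(\<Sum>x\<in>U. \<bar>v x\<bar>)\<^sup>2 \<le> (\<Sum>x\<in>U. 1\<^sup>2) * (\<Sum>x\<in>U. \<bar>v x\<bar>\<^sup>2)"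
    using Cauchy_Schwarz_ineq_sum[of "\<lambda>_. 1" "\<lambda>x. \<bar>v x\<bar>" U] by simp
  also have "\<dots> \<le> real (card U) * sqn N v"
    unfolding sqn_def using assms by (auto intro!: mult_left_mono sum_mono2)
  finally have "sqrt ((\<Sum>x\<in>U. \<bar>v x\<bar>)\<^sup>2) \<le> sqrt (real (card U) * sqn N v)" by (rule real_sqrt_le_mono)
  thus ?thesis by (simp add: real_sqrt_mult sum_nonneg)
qed

text \<open>The vector is cut at a radius whose shell carries little mass. The inner part falls
  under \<open>cluster\<close>, the outer part vanishes on \<open>S\<close> and falls under
  \<open>bulk\<close>, and the cross term lives on the shell. Where \<open>cluster\<close> is used,
  the mean of the entries is split off and paid by Cauchy-Schwarz, using that the ball has at most
  \<open>M\<close> vertices.\<close>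

theorem quadratic_upper_bound:
  fixes v :: "nat \<Rightarrow> real"
  assumes S: "S \<subseteq> {..<n+m}" and p: "0 \<le> p" "p \<le> 1" and d: "d > 1" and q: "q > 0"
    and s: "0 < s" "s \<le> 1" and hs: "s ^ (2 * l) * nb_hs (n+m) (centH n p d A) l < 1"
    and bulk: "\<And>x. x < n + m \<Longrightarrow> x \<notin> S \<Longrightarrow> side_weight n q x *
        (1 + s\<^sup>2 / (1 - 1 / sqrt d) * ((real (dg (gset n m A) x) + real (n+m) * p\<^sup>2) / d)) \<le> s * \<Lambda>"
    and cluster: "\<And>i w. i \<le> R + 1 \<Longrightarrow> (\<Sum>y\<in>nbh (gset n m A) S i. \<Sum>z\<in>nbh (gset n m A) S i.
        of_bool (ed y z \<in> gset n m A) * (1 / sqrt d * (\<bar>w y\<bar> * \<bar>w z\<bar>))) \<le> \<Lambda> * (\<Sum>y\<in>nbh (gset n m A) S i. (w y)\<^sup>2)"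
    and R: "R \<ge> 1" and M: "real (card (nbh (gset n m A) S R)) \<le> M" and \<Lambda>: "\<Lambda> \<ge> 0"
  shows "qform (n+m) (centH n p d A) v \<le> (\<Lambda> + 2 * \<Lambda> / real R + 3 * p / sqrt d * sqrt M * sqrt (real (n+m))) * sqn (n+m) v"
proof -
  define N where "N = n + m"
  define G where "G = gset n m A"
  define h where "h = centH n p d A"
  have GE: "G \<subseteq> pot_edges n m" unfolding G_def by (rule gset_subset)
  have nbN: "nbh G S i \<subseteq> {..<N}" for i unfolding N_def by (rule nbh_subset[OF S GE])
  obtain i where i: "1 \<le> i" "i \<le> R"
    and mass: "(\<Sum>x\<in>nbh G S (i + 1) - nbh G S (i - 1). (v x)\<^sup>2) \<le> 2 / real R * sqn N v"
    using shell_pigeonhole[OF nbN R] by blast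
  define U where "U = nbh G S i"
  define U' where "U' = nbh G S (i + 1)"
  define sh where "sh = U' - nbh G S (i - 1)"
  have UN: "U \<subseteq> {..<N}" "U' \<subseteq> {..<N}" by (simp_all only: U_def U'_def nbN)
  hence fU: "finite U" "finite U'" using finite_subset by blast+
  define v1 where "v1 = (\<lambda>x. if x \<in> U then v x else 0)"
  define v2 where "v2 = (\<lambda>x. if x \<in> U then 0 else v x)"
  have v12: "v = (\<lambda>x. v1 x + v2 x)" by (auto simp: v1_def v2_def)
  define P where "P = p / sqrt d"
  have P0: "P \<ge> 0" using p d by (simp add: P_def)
  define a1 where "a1 = (\<Sum>x\<in>U. \<bar>v x\<bar>)"
  define a where "a = (\<Sum>x<N. \<bar>v x\<bar>)"
  have a1a: "0 \<le> a1" "a1 \<le> a" unfolding a1_def a_def using UN(1) by (auto intro!: sum_nonneg sum_mono2)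
  have hle: "h x y * (b * c) \<le> of_bool (ed x y \<in> G) * (1 / sqrt d * (\<bar>b\<bar> * \<bar>c\<bar>)) + P * (\<bar>b\<bar> * \<bar>c\<bar>)"
    if "x < N" "y < N" for x y b c
  proof -
    have "\<bar>h x y\<bar> \<le> of_bool (ed x y \<in> G) * (1 / sqrt d) + P"
      using that p d gset_cross[of x y n m A] unfolding h_def N_def
      by (auto simp: centH_gset G_def P_def of_bool_def divide_simps)
    hence "\<bar>h x y\<bar> * \<bar>b * c\<bar> \<le> (of_bool (ed x y \<in> G) * (1 / sqrt d) + P) * \<bar>b * c\<bar>" by (rule mult_right_mono) simp
    moreover have "h x y * (b * c) \<le> \<bar>h x y\<bar> * \<bar>b * c\<bar>" by (metis abs_ge_self abs_mult)
    ultimately show ?thesis by (simp add: abs_mult algebra_simps)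
  qed
  have restr: "(\<Sum>x<N. f x * of_bool (x \<in> B)) = (\<Sum>x\<in>B. f x)" if "B \<subseteq> {..<N}" for f :: "nat \<Rightarrow> real" and B
    by (rule sum.mono_neutral_cong_right) (use that in auto)
  have T2: "qform N h v2 \<le> \<Lambda> * sqn N v2"
  proof -
    have "s * qform N h v2 \<le> (\<Sum>x<N. (v2 x)\<^sup>2 * (side_weight n q x *
        (1 + s\<^sup>2 / (1 - 1 / sqrt d) * ((real (dg (gset n m A) x) + real (n+m) * p\<^sup>2) / d))))"
      unfolding h_def N_def by (rule bulk_bound[OF p d q s hs])
    also have "\<dots> \<le> (\<Sum>x<N. (v2 x)\<^sup>2 * (s * \<Lambda>))"
    proof (rule sum_mono)
      fix x assume x: "x \<in> {..<N}"
      show "(v2 x)\<^sup>2 * (side_weight n q x *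
        (1 + s\<^sup>2 / (1 - 1 / sqrt d) * ((real (dg (gset n m A) x) + real (n+m) * p\<^sup>2) / d))) \<le> (v2 x)\<^sup>2 * (s * \<Lambda>)"
      proof (cases "x \<in> S")
        case True
        hence "x \<in> U" using nbh_mono[of 0 i G S] by (auto simp: U_def)
        thus ?thesis by (simp add: v2_def)
      next
        case False
        thus ?thesis using bulk[of x] x by (intro mult_left_mono) (auto simp: N_def)
      qed
    qed
    also have "\<dots> = s * (\<Lambda> * sqn N v2)" by (simp add: sqn_def mult_ac sum_distrib_left)
    finally show ?thesis using s by simp
  qed
  have T1: "qform N h v1 \<le> \<Lambda> * sqn N v1 + P * (a1 * a1)"
  proof -
    have "qform N h v1 = (\<Sum>x<N. (\<Sum>y<N. h x y * (v x * v y) * of_bool (y \<in> U)) * of_bool (x \<in> U))"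
      unfolding bil_def sum_distrib_right by (intro sum.cong refl) (simp add: v1_def)
    also have "\<dots> = (\<Sum>x\<in>U. \<Sum>y\<in>U. h x y * (v x * v y))"
      by (simp only: restr[OF UN(1)])
    also have "\<dots> \<le> (\<Sum>x\<in>U. \<Sum>y\<in>U. of_bool (ed x y \<in> G) * (1 / sqrt d * (\<bar>v x\<bar> * \<bar>v y\<bar>)) + P * (\<bar>v x\<bar> * \<bar>v y\<bar>))"
      using UN(1) by (intro sum_mono hle) auto
    also have "\<dots> = (\<Sum>x\<in>U. \<Sum>y\<in>U. of_bool (ed x y \<in> G) * (1 / sqrt d * (\<bar>v x\<bar> * \<bar>v y\<bar>))) + P * (a1 * a1)"
      unfolding sum.distrib a1_def sum_product by (simp only: sum_distrib_left)
    also have "\<dots> \<le> \<Lambda> * (\<Sum>x\<in>U. (v x)\<^sup>2) + P * (a1 * a1)"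
      using cluster[of i v] i by (simp add: U_def G_def)
    also have "(\<Sum>x\<in>U. (v x)\<^sup>2) = sqn N v1"
    proof -
      have "sqn N v1 = (\<Sum>x<N. (v x)\<^sup>2 * of_bool (x \<in> U))" unfolding sqn_def by (intro sum.cong refl) (simp add: v1_def)
      thus ?thesis by (simp only: restr[OF UN(1)])
    qed
    finally show ?thesis .
  qed
  have T3: "2 * bil N h v1 v2 \<le> \<Lambda> * (2 / real R * sqn N v) + 2 * (P * (a1 * a))"
  proof -
    define w where "w = (\<lambda>x. if x \<in> sh then v x else 0)"
    define e where "e = (\<lambda>x y. of_bool (ed x y \<in> G) * (1 / sqrt d * (\<bar>w x\<bar> * \<bar>w y\<bar>)))"
    have e0: "e x y \<ge> 0" "e x y = e y x" for x y using d by (simp_all add: e_def ed_commute[of x y] mult_ac)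
    have "bil N h v1 v2 = (\<Sum>x<N. (\<Sum>y<N. h x y * (v x * v2 y)) * of_bool (x \<in> U))"
      unfolding bil_def sum_distrib_right by (intro sum.cong refl) (simp add: v1_def)
    also have "\<dots> = (\<Sum>x\<in>U. \<Sum>y<N. h x y * (v x * v2 y))" by (simp only: restr[OF UN(1)])
    also have "\<dots> \<le> (\<Sum>x\<in>U. \<Sum>y<N. e x y * of_bool (y \<in> U' - U) + P * (\<bar>v x\<bar> * \<bar>v y\<bar>))"
    proof (intro sum_mono)
      fix x y assume x: "x \<in> U" and y: "y \<in> {..<N}"
      have P1: "P * (\<bar>v x\<bar> * \<bar>v2 y\<bar>) \<le> P * (\<bar>v x\<bar> * \<bar>v y\<bar>)" using P0 by (intro mult_left_mono) (auto simp: v2_def)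
      have "of_bool (ed x y \<in> G) * (1 / sqrt d * (\<bar>v x\<bar> * \<bar>v2 y\<bar>)) \<le> e x y * of_bool (y \<in> U' - U)"
      proof (cases "ed x y \<in> G \<and> y \<notin> U")
        case True
        \<comment> \<open>An edge leaving the ball joins its outermost layer to the next one, so
          both ends belong to the shell.\<close>
        have yU: "y \<in> U'" using True x by (auto simp: U'_def U_def)
        obtain j where j: "i = Suc j" using i(1) by (cases i) auto
        have "x \<notin> nbh G S (i - 1)" using True by (auto simp: U_def j)
        moreover have "x \<in> U'" using x nbh_mono[of i "i + 1" G S] by (auto simp: U_def U'_def)
        moreover have "y \<notin> nbh G S (i - 1)" using True nbh_mono[of "i - 1" i G S] by (auto simp: U_def)
        ultimately have "x \<in> sh" "y \<in> sh" using yU by (auto simp: sh_def)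
        thus ?thesis using True yU by (simp add: e_def w_def v2_def)
      next
        case False
        thus ?thesis using e0(1)[of x y] by (auto simp: v2_def)
      qed
      moreover have "h x y * (v x * v2 y) \<le> of_bool (ed x y \<in> G) * (1 / sqrt d * (\<bar>v x\<bar> * \<bar>v2 y\<bar>)) + P * (\<bar>v x\<bar> * \<bar>v2 y\<bar>)"
        using x y UN(1) by (intro hle) auto
      ultimately show "h x y * (v x * v2 y) \<le> e x y * of_bool (y \<in> U' - U) + P * (\<bar>v x\<bar> * \<bar>v y\<bar>)"
        using P1 by linarith
    qed
    also have "\<dots> = (\<Sum>x\<in>U. \<Sum>y\<in>U' - U. e x y) + P * (a1 * a)"
    proof -
      have "U' - U \<subseteq> {..<N}" using UN by auto
      thus ?thesis unfolding sum.distrib a1_def a_def sum_product by (simp only: sum_distrib_left restr)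
    qed
    finally have 1: "bil N h v1 v2 \<le> (\<Sum>x\<in>U. \<Sum>y\<in>U' - U. e x y) + P * (a1 * a)" .
    have UU: "U \<subseteq> U'" using nbh_mono[of i "i + 1" G S] by (simp add: U_def U'_def)
    have "(\<Sum>x\<in>U. \<Sum>y\<in>U' - U. e x y) = (\<Sum>x\<in>U' - U. \<Sum>y\<in>U. e x y)"
      by (subst sum.swap) (simp only: e0(2))
    hence "2 * (\<Sum>x\<in>U. \<Sum>y\<in>U' - U. e x y) = (\<Sum>x\<in>U. \<Sum>y\<in>U' - U. e x y) + (\<Sum>x\<in>U' - U. \<Sum>y\<in>U. e x y)" by simp
    also have "\<dots> \<le> (\<Sum>x\<in>U. \<Sum>y\<in>U'. e x y) + (\<Sum>x\<in>U' - U. \<Sum>y\<in>U'. e x y)"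
      using fU UU e0(1) by (intro add_mono sum_mono sum_mono2) auto
    also have "\<dots> = (\<Sum>x\<in>U'. \<Sum>y\<in>U'. e x y)" using sum.subset_diff[OF UU fU(2), of "\<lambda>x. \<Sum>y\<in>U'. e x y"] by linarith
    also have "\<dots> \<le> \<Lambda> * (\<Sum>y\<in>U'. (w y)\<^sup>2)"
      unfolding e_def U'_def G_def using i by (intro cluster) simp
    also have "(\<Sum>y\<in>U'. (w y)\<^sup>2) = (\<Sum>y\<in>sh. (v y)\<^sup>2)"
      by (rule sum.mono_neutral_cong_right) (use fU in \<open>auto simp: w_def sh_def\<close>)
    also have "\<Lambda> * (\<Sum>y\<in>sh. (v y)\<^sup>2) \<le> \<Lambda> * (2 / real R * sqn N v)"
      using mass \<Lambda> unfolding sh_def U'_def by (rule mult_left_mono)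
    finally show ?thesis using 1 by linarith
  qed
  have sq: "sqn N v1 + sqn N v2 = sqn N v"
    unfolding sqn_def sum.distrib[symmetric] by (intro sum.cong refl) (simp add: v1_def v2_def)
  have "qform N h v = qform N h v1 + qform N h v2 + 2 * bil N h v1 v2"
    using bil_commute[OF symm_upto_centH, of N n p d A v2 v1] by (subst (1 2) v12) (simp add: bil_add h_def)
  also have "\<dots> \<le> \<Lambda> * sqn N v + 2 * \<Lambda> / real R * sqn N v + P * (a1 * a1) + 2 * (P * (a1 * a))"
  proof -
    have "\<Lambda> * sqn N v1 + \<Lambda> * sqn N v2 = \<Lambda> * sqn N v" unfolding sq[symmetric] by (rule distrib_left[symmetric])
    moreover have "\<Lambda> * (2 / real R * sqn N v) = 2 * \<Lambda> / real R * sqn N v" by simp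
    ultimately show ?thesis using T1 T2 T3 by linarith
  qed
  finally have "qform N h v \<le> \<Lambda> * sqn N v + 2 * \<Lambda> / real R * sqn N v + P * (a1 * a1) + 2 * (P * (a1 * a))" .
  moreover have "P * (a1 * a1) \<le> P * (a1 * a)" using a1a P0 by (intro mult_left_mono) auto
  ultimately have fin: "qform N h v \<le> \<Lambda> * sqn N v + 2 * \<Lambda> / real R * sqn N v + 3 * (P * (a1 * a))" by linarith
  have "a1 \<le> sqrt M * sqrt (sqn N v)"
  proof -
    have "U \<subseteq> nbh G S R" using nbh_mono[OF i(2)] by (simp add: U_def)
    hence "card U \<le> card (nbh G S R)" using nbN[of R] finite_subset by (intro card_mono) blast+
    hence "sqrt (real (card U)) \<le> sqrt M" using M by (simp add: G_def)
    moreover have "a1 \<le> sqrt (real (card U)) * sqrt (sqn N v)" unfolding a1_def by (rule sum_abs_le_sqrt[OF fU(1) UN(1)])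
    ultimately show ?thesis by (meson mult_right_mono order_trans real_sqrt_ge_zero sqn_nonneg)
  qed
  moreover have "a \<le> sqrt (real N) * sqrt (sqn N v)" unfolding a_def using sum_abs_le_sqrt[of "{..<N}" N v] by simp
  ultimately have "a1 * a \<le> (sqrt M * sqrt (sqn N v)) * (sqrt (real N) * sqrt (sqn N v))"
    using a1a by (intro mult_mono) auto
  also have "\<dots> = sqrt M * sqrt (real N) * (sqrt (sqn N v) * sqrt (sqn N v))" by (simp only: mult_ac)
  also have "\<dots> = sqrt M * sqrt (real N) * sqn N v" by simp
  finally have "3 * (P * (a1 * a)) \<le> 3 * (P * (sqrt M * sqrt (real N) * sqn N v))" using P0 by (simp add: mult_left_mono)
  with fin show ?thesis by (simp add: N_def h_def P_def algebra_simps)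
qed

section \<open>Trees around a heavy vertex\<close>

text \<open>Common first vertices are dropped until the paths diverge. Their union then has degree
  at least 2 everywhere except possibly at \<open>x\<close>, hence at least as many edges as
  vertices, against \<open>acyclic\<close>. If one path is exhausted, the other is a closed walk at
  \<open>x\<close> with the same defect.\<close>

lemma unique_nb_path:
  assumes G: "G \<subseteq> pot_edges n m"
    and acyclic: "\<And>F. F \<subseteq> G \<Longrightarrow> card F \<le> f0 \<Longrightarrow> x \<in> verts F \<Longrightarrow> card F < card (verts F)"
    and f0: "f0 \<ge> 2 * K"
  shows "\<lbrakk>nobt p; nobt p'; wed p \<subseteq> G; wed p' \<subseteq> G; p \<noteq> []; p' \<noteq> []; last p = x; last p' = x;
    length p \<le> K + 1; length p' \<le> K + 1; hd p = hd p'\<rbrakk> \<Longrightarrow> p = p'"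
proof (induction "length p + length p'" arbitrary: p p' rule: less_induct)
  case less
  have fG: "finite G" by (rule finite_subset[OF G]) simp
  have no_cyc: False if F: "F \<subseteq> G" "card F \<le> f0" "x \<in> verts F" and d2: "\<And>u. u \<in> verts F \<Longrightarrow> u \<noteq> x \<Longrightarrow> dg F u \<ge> 2" for F
  proof -
    have fF: "finite F" using F(1) fG finite_subset by blast
    have "2 * card (verts F - {x}) = (\<Sum>u\<in>verts F - {x}. 2)" by simp
    also have "\<dots> \<le> (\<Sum>u\<in>verts F - {x}. dg F u)" using d2 by (intro sum_mono) auto
    finally have "2 * card (verts F - {x}) + 1 \<le> dg F x + (\<Sum>u\<in>verts F - {x}. dg F u)"
      using dg_verts_pos[OF fF F(3)] by linarith
    also have "\<dots> = 2 * card F"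
      using handshake[of F n m] F(1,3) G fF by (simp add: sum.remove[of "verts F" x])
    finally have "card F > card (verts F - {x})" by linarith
    moreover have "card (verts F) = Suc (card (verts F - {x}))" using card.remove[of "verts F" x] F(3) fF by simp
    ultimately show False using acyclic[OF F] by linarith
  qed
  have cw: "card (wed c) \<le> K" if "length c \<le> K + 1" for c
    using card_length[of "wsteps c"] that by (simp add: length_wsteps)
  have loop: False if c: "nobt c" "wed c \<subseteq> G" "last c = x" "hd c = x" "length c \<ge> 2" "length c \<le> K + 1" for c
  proof (rule no_cyc[of "wed c"])
    show "card (wed c) \<le> f0" using cw[OF c(6)] f0 by simp
    have cn: "c \<noteq> []" using c(5) by auto
    have "ed (c ! 0) (c ! Suc 0) \<in> wed c" using c(5) by (intro wsteps_nth) simp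
    moreover have "c ! 0 = x" using c(4) cn by (simp add: hd_conv_nth)
    ultimately show "x \<in> verts (wed c)" using ed_incident(1)[of x "c ! Suc 0"] by (force simp: verts_def)
    fix u assume u: "u \<in> verts (wed c)" "u \<noteq> x"
    then obtain i where i: "i < length c" "u = c ! i" using verts_wed[of c] by (metis in_set_conv_nth subsetD)
    have "i \<noteq> 0"
    proof
      assume "i = 0"
      hence "u = hd c" using i(2) cn by (simp add: hd_conv_nth)
      thus False using u(2) c(4) by simp
    qed
    moreover have "i \<noteq> length c - 1"
    proof
      assume "i = length c - 1"
      hence "u = last c" using i(2) cn by (simp add: last_conv_nth)
      thus False using u(2) c(3) by simp
    qed
    ultimately show "dg (wed c) u \<ge> 2" using i c(1) by (intro nobt_interior_dg[of c u i]) auto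
  qed (use c in auto)
  note hyps = less(2-12)
  show ?case
  proof (rule ccontr)
    assume ne: "p \<noteq> p'"
    obtain z r where p: "p = z # r" using less(6) by (cases p) auto
    obtain r' where p': "p' = z # r'" using less(7,12) p by (cases p') auto
    show False
    proof (cases "r = [] \<or> r' = []")
      case True
      thus False
      proof
        assume r: "r = []"
        hence "z = x" "r' \<noteq> []" using less(8) ne p p' by auto
        thus False using loop[of p'] hyps p' by (cases r') auto
      next
        assume r: "r' = []"
        hence "z = x" "r \<noteq> []" using less(9) ne p p' by auto
        thus False using loop[of p] hyps p by (cases r) auto
      qed
    next
      case False
      then obtain y s y' s' where r: "r = y # s" and r': "r' = y' # s'" by (metis neq_Nil_conv)
      show False
      proof (cases "y = y'")
        case True
        have "r = r'"
        proof (rule less(1))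
          show "nobt r" using less(2) p r by (cases s) auto
          show "nobt r'" using less(3) p' r' by (cases s') auto
        qed (use hyps p p' r r' True in auto)
        thus False using ne p p' by simp
      next
        case neq: False
        let ?F = "wed p \<union> wed p'"
        show False
        proof (rule no_cyc[of ?F])
          show "?F \<subseteq> G" using hyps by simp
          show "card ?F \<le> f0" using card_Un_le[of "wed p" "wed p'"] cw[OF less(10)] cw[OF less(11)] f0 by linarith
          have fF: "finite ?F" by simp
          have lx: "\<exists>j. Suc j < length p \<and> p ! Suc j = x"
            using less(6,8) p r by (intro exI[of _ "length p - 2"]) (auto simp: last_conv_nth)
          then obtain j where j: "Suc j < length p" "p ! Suc j = x" by blast
          hence "ed (p ! j) x \<in> wed p" using wsteps_nth[of j p] by simp
          thus "x \<in> verts ?F" using ed_incident(2)[of "p ! j" x] by (force simp: verts_def)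
          fix u assume u: "u \<in> verts ?F" "u \<noteq> x"
          show "dg ?F u \<ge> 2"
          proof (cases "u = z")
            case True
            have sub: "{ed z y, ed z y'} \<subseteq> inc ?F z" by (simp add: p p' r r')
            have "2 = card {ed z y, ed z y'}" using neq by simp
            also have "\<dots> \<le> dg ?F z" unfolding dg_def by (rule card_mono[OF _ sub]) simp
            finally show ?thesis using True by simp
          next
            case uz: False
            have "\<exists>c\<in>{p, p'}. u \<in> set c" using u(1) verts_wed[of p] verts_wed[of p'] by (auto simp: verts_def)
            then obtain c where c: "c \<in> {p, p'}" "u \<in> set c" by blast
            have cp: "nobt c" "c \<noteq> []" "last c = x" "hd c = z" "wed c \<subseteq> ?F" using c(1) hyps p p' by auto
            obtain i where i: "i < length c" "u = c ! i" using c(2) by (metis in_set_conv_nth)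
            have "i \<noteq> 0"
            proof
              assume "i = 0"
              hence "u = hd c" using i(2) cp(2) by (simp add: hd_conv_nth)
              thus False using uz cp(4) by simp
            qed
            moreover have "i \<noteq> length c - 1"
            proof
              assume "i = length c - 1"
              hence "u = last c" using i(2) cp(2) by (simp add: last_conv_nth)
              thus False using u(2) cp(3) by simp
            qed
            ultimately show ?thesis using i cp fF by (intro nobt_interior_dg[of c u i]) auto
          qed
        qed
      qed
    qed
  qed
qed

text \<open>The nodes of a tree are encoded by their paths to the root, listed from the node.\<close>

definition tree_path :: "(nat \<times> nat) set \<Rightarrow> nat set \<Rightarrow> nat \<Rightarrow> nat \<Rightarrow> nat list \<Rightarrow> bool" where
  "tree_path G B x i p \<longleftrightarrow> length p = Suc i \<and> last p = x \<and> nobt p \<and> wed p \<subseteq> G \<and> set (butlast p) \<inter> B = {}"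

primrec tnodes :: "(nat list \<Rightarrow> nat set) \<Rightarrow> nat \<Rightarrow> nat \<Rightarrow> nat list set" where
  "tnodes C x 0 = {[x]}"
| "tnodes C x (Suc i) = (\<Union>p\<in>tnodes C x i. (\<lambda>y. y # p) ` C p)"

lemma tnodes_length: "p \<in> tnodes C x i \<Longrightarrow> length p = Suc i"
  by (induction i arbitrary: p) auto

text \<open>Each node keeps exactly \<open>ks i\<close> of its available children, so that the level
  sizes are exact products.\<close>

lemma tree_embedding:
  assumes children: "\<And>i p. i < K \<Longrightarrow> tree_path G B x i p \<Longrightarrow>
      ks i \<le> card {y. ed (hd p) y \<in> G \<and> y \<notin> B \<and> (i > 0 \<longrightarrow> y \<noteq> p ! 1)}"
  obtains C where "\<And>i p. i \<le> K \<Longrightarrow> p \<in> tnodes C x i \<Longrightarrow> tree_path G B x i p"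
    "\<And>i. i \<le> K \<Longrightarrow> finite (tnodes C x i)"
    "\<And>i. i \<le> K \<Longrightarrow> card (tnodes C x i) = (\<Prod>j<i. ks j)"
proof -
  let ?N = "\<lambda>i p. {y. ed (hd p) y \<in> G \<and> y \<notin> B \<and> (i > 0 \<longrightarrow> y \<noteq> p ! 1)}"
  have "\<exists>D. D \<subseteq> ?N (length p - 1) p \<and> finite D \<and> card D = ks (length p - 1)" if tp: "tree_path G B x i p" and iK: "i < K" for i p
  proof -
    have li: "length p - 1 = i" using tp by (simp add: tree_path_def)
    obtain D where "D \<subseteq> ?N i p" "card D = ks i" "finite D"
      using children[OF iK tp] by (rule obtain_subset_with_card_n)
    thus ?thesis unfolding li by blast
  qed
  hence "\<forall>p. \<exists>D. (\<exists>i<K. tree_path G B x i p) \<longrightarrow> D \<subseteq> ?N (length p - 1) p \<and> finite D \<and> card D = ks (length p - 1)" by blast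
  from choice[OF this] obtain C where C0: "\<forall>p. (\<exists>i<K. tree_path G B x i p) \<longrightarrow>
      C p \<subseteq> ?N (length p - 1) p \<and> finite (C p) \<and> card (C p) = ks (length p - 1)" by blast
  have C: "C p \<subseteq> ?N (length p - 1) p \<and> finite (C p) \<and> card (C p) = ks (length p - 1)"
    if "i < K" "tree_path G B x i p" for p i
    using C0 that by blast
  have main: "(\<forall>p\<in>tnodes C x i. tree_path G B x i p) \<and> finite (tnodes C x i) \<and> card (tnodes C x i) = (\<Prod>j<i. ks j)" if "i \<le> K" for i
    using that
  proof (induction i)
    case 0 show ?case by (auto simp: tree_path_def)
  next
    case (Suc i)
    hence IH: "\<And>p. p \<in> tnodes C x i \<Longrightarrow> tree_path G B x i p" "finite (tnodes C x i)" "card (tnodes C x i) = (\<Prod>j<i. ks j)"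
      and iK: "i < K" by auto
    have li: "length p - 1 = i" if "p \<in> tnodes C x i" for p using tnodes_length[OF that] by simp
    have Cp: "C p \<subseteq> ?N i p" "finite (C p)" "card (C p) = ks i" if "p \<in> tnodes C x i" for p
      using C[OF iK IH(1)[OF that]] li[OF that] by auto
    have "tree_path G B x (Suc i) (y # p)" if p: "p \<in> tnodes C x i" and y: "y \<in> C p" for p y
    proof -
      have tp: "length p = Suc i" "last p = x" "nobt p" "wed p \<subseteq> G" "set (butlast p) \<inter> B = {}"
        using IH(1)[OF p] by (auto simp: tree_path_def)
      have yy: "ed (hd p) y \<in> G" "y \<notin> B" "i > 0 \<longrightarrow> y \<noteq> p ! 1" using Cp(1)[OF p] y by auto
      obtain z r where pz: "p = z # r" using tp(1) by (cases p) auto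
      have "nobt (y # p)" using tp(1,3) yy(3) pz by (cases r) auto
      thus ?thesis using tp yy pz by (auto simp: tree_path_def ed_commute)
    qed
    hence 1: "\<forall>p\<in>tnodes C x (Suc i). tree_path G B x (Suc i) p" by auto
    have 2: "finite (tnodes C x (Suc i))" using IH(2) Cp(2) by simp
    have "card (tnodes C x (Suc i)) = (\<Sum>p\<in>tnodes C x i. card ((\<lambda>y. y # p) ` C p))"
      unfolding tnodes.simps by (rule card_UN_disjoint) (use IH(2) Cp(2) in auto)
    also have "\<dots> = (\<Sum>p\<in>tnodes C x i. ks i)"
      by (intro sum.cong refl) (subst card_image, auto simp: inj_on_def Cp(3))
    finally show ?case using 1 2 IH(3) by simp
  qed
  show ?thesis by (rule that[of C]) (use main in auto)
qed

text \<open>The radial test vector takes the value \<open>a i\<close> divided by the square root of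
  the size of level \<open>i\<close>; then its squared norm is the sum of the
  \<open>(a i)\<^sup>2\<close>, and consecutive levels interact with weight
  \<open>sqrt (real (ks i))\<close>. Graph edges outside the tree can only increase the form of this
  nonnegative vector, and the mean of the entries is paid by Cauchy-Schwarz.\<close>

theorem rayleigh_tree_bound:
  fixes a :: "nat \<Rightarrow> real"
  assumes nm: "n + m \<ge> 1" and x: "x < n + m" and p: "0 \<le> p" "p \<le> 1" and d: "d > 0"
    and acyclic: "\<And>F. F \<subseteq> gset n m A \<Longrightarrow> card F \<le> f0 \<Longrightarrow> x \<in> verts F \<Longrightarrow> card F < card (verts F)"
    and f0: "f0 \<ge> 2 * K"
    and children: "\<And>i p. i < K \<Longrightarrow> tree_path (gset n m A) B x i p \<Longrightarrow>
      ks i \<le> card {y. ed (hd p) y \<in> gset n m A \<and> y \<notin> B \<and> (i > 0 \<longrightarrow> y \<noteq> p ! 1)}"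
    and ks: "\<And>i. i < K \<Longrightarrow> ks i \<ge> 1" and a: "\<And>i. a i \<ge> 0"
  shows "2 * (\<Sum>i<K. a i * a (Suc i) * sqrt (real (ks i) / d)) - p / sqrt d * real (\<Sum>i\<le>K. \<Prod>j<i. ks j) * (\<Sum>i\<le>K. (a i)\<^sup>2)
    \<le> lambda1 (n+m) (centH n p d A) * (\<Sum>i\<le>K. (a i)\<^sup>2)"
proof -
  define N where "N = n + m"
  define G where "G = gset n m A"
  have GE: "G \<subseteq> pot_edges n m" unfolding G_def by (rule gset_subset)
  have "\<exists>C. (\<forall>i p. i \<le> K \<longrightarrow> p \<in> tnodes C x i \<longrightarrow> tree_path G B x i p) \<and> (\<forall>i\<le>K. finite (tnodes C x i))
      \<and> (\<forall>i\<le>K. card (tnodes C x i) = (\<Prod>j<i. ks j))"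
    by (rule tree_embedding[of K G B x ks, OF children[folded G_def]]) blast+
  then obtain C where T1: "\<And>i p. i \<le> K \<Longrightarrow> p \<in> tnodes C x i \<Longrightarrow> tree_path G B x i p"
    and T2: "\<And>i. i \<le> K \<Longrightarrow> finite (tnodes C x i)"
    and T3: "\<And>i. i \<le> K \<Longrightarrow> card (tnodes C x i) = (\<Prod>j<i. ks j)" by blast
  define \<nu> where "\<nu> = (\<lambda>i. \<Prod>j<i. ks j)"
  have \<nu>: "\<nu> i \<ge> 1" if "i \<le> K" for i unfolding \<nu>_def by (rule prod_ge_1) (use that ks in auto)
  define \<alpha> where "\<alpha> = (\<lambda>i. a i / sqrt (real (\<nu> i)))"
  have \<alpha>0: "\<alpha> i \<ge> 0" for i using a by (simp add: \<alpha>_def)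
  define PP where "PP = (\<Union>i\<le>K. tnodes C x i)"
  have fPP: "finite PP" unfolding PP_def using T2 by auto
  have PPi: "tree_path G B x (length r - 1) r \<and> length r \<le> K + 1 \<and> r \<noteq> [] \<and> r \<in> tnodes C x (length r - 1)" if "r \<in> PP" for r
  proof -
    obtain i where i: "i \<le> K" "r \<in> tnodes C x i" using \<open>r \<in> PP\<close> by (auto simp: PP_def)
    have "length r = Suc i" using tnodes_length[OF i(2)] .
    thus ?thesis using T1[OF i] i by auto
  qed
  \<comment> \<open>Different nodes are different vertices, since a vertex has at most one short
    nonbacktracking path to \<open>x\<close>.\<close>
  have inj: "inj_on hd PP"
  proof (rule inj_onI)
    fix r r' assume "r \<in> PP" "r' \<in> PP" "hd r = hd r'"
    thus "r = r'" using unique_nb_path[OF GE acyclic[folded G_def] f0, where p = r and p' = r'] PPi[of r] PPi[of r']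
      by (auto simp: tree_path_def)
  qed
  have hdN: "hd r < N" if "r \<in> PP" for r
  proof -
    have "set r \<subseteq> {..<N}"
    proof (cases "length r = 1")
      case True
      thus ?thesis using PPi[OF that] x by (cases r) (auto simp: tree_path_def N_def)
    next
      case False
      have "u < N" if u: "u \<in> set r" for u
      proof -
        have "dg (wed r) u \<ge> 1" using PPi[OF \<open>r \<in> PP\<close>] False u by (intro dg_pos) (cases r, auto simp: neq_Nil_conv Suc_le_eq)
        hence "inc (wed r) u \<noteq> {}" by (auto simp: dg_def)
        then obtain f where "f \<in> wed r" "fst f = u \<or> snd f = u" by (auto simp: inc_def)
        moreover have "wed r \<subseteq> pot_edges n m" using PPi[OF \<open>r \<in> PP\<close>] GE by (auto simp: tree_path_def)
        ultimately show ?thesis by (auto simp: pot_edges_def N_def)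
      qed
      thus ?thesis by auto
    qed
    moreover have "hd r \<in> set r" using PPi[OF that] by simp
    ultimately show ?thesis by blast
  qed
  define v where "v = (\<lambda>y. if y \<in> hd ` PP then \<alpha> (length (the_inv_into PP hd y) - 1) else 0)"
  have vhd: "v (hd r) = \<alpha> (length r - 1)" if "r \<in> PP" for r
    using that by (simp add: v_def the_inv_into_f_f[OF inj])
  have v0: "v y \<ge> 0" for y by (simp add: v_def \<alpha>0)
  have level_sum: "(\<Sum>r\<in>PP. f (length r - 1)) = (\<Sum>i\<le>K. real (\<nu> i) * f i)" for f :: "nat \<Rightarrow> real"
  proof -
    have "(\<Sum>r\<in>PP. f (length r - 1)) = (\<Sum>i\<le>K. \<Sum>r\<in>tnodes C x i. f (length r - 1))"
    proof -
      have "tnodes C x i \<inter> tnodes C x j = {}" if "i \<noteq> j" for i j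
        using that by (auto dest!: tnodes_length)
      thus ?thesis unfolding PP_def by (intro sum.UNION_disjoint) (use T2 in auto)
    qed
    also have "\<dots> = (\<Sum>i\<le>K. \<Sum>r\<in>tnodes C x i. f i)" by (intro sum.cong refl) (simp add: tnodes_length)
    finally show ?thesis using T3 by (simp add: \<nu>_def)
  qed
  have sqv: "sqn N v = (\<Sum>i\<le>K. (a i)\<^sup>2)"
  proof -
    have "sqn N v = (\<Sum>y\<in>hd ` PP. (v y)\<^sup>2)"
      unfolding sqn_def by (rule sum.mono_neutral_right) (use hdN in \<open>auto simp: v_def\<close>)
    also have "\<dots> = (\<Sum>r\<in>PP. (\<alpha> (length r - 1))\<^sup>2)" by (subst sum.reindex[OF inj]) (simp add: vhd)
    also have "\<dots> = (\<Sum>i\<le>K. real (\<nu> i) * (\<alpha> i)\<^sup>2)" by (rule level_sum)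
    also have "\<dots> = (\<Sum>i\<le>K. (a i)\<^sup>2)"
    proof (intro sum.cong refl)
      fix i assume "i \<in> {..K}"
      thus "real (\<nu> i) * (\<alpha> i)\<^sup>2 = (a i)\<^sup>2" using \<nu>[of i] by (simp add: \<alpha>_def power_divide)
    qed
    finally show ?thesis .
  qed
  define sv where "sv = (\<Sum>y<N. v y)"
  have svle: "sv\<^sup>2 \<le> real (\<Sum>i\<le>K. \<nu> i) * sqn N v"
  proof -
    have "sv = (\<Sum>y\<in>hd ` PP. v y)"
      unfolding sv_def by (rule sum.mono_neutral_right) (use hdN in \<open>auto simp: v_def\<close>)
    hence "sv\<^sup>2 = (\<Sum>y\<in>hd ` PP. 1 * v y)\<^sup>2" by simp
    also have "\<dots> \<le> (\<Sum>y\<in>hd ` PP. 1\<^sup>2) * (\<Sum>y\<in>hd ` PP. (v y)\<^sup>2)" by (rule Cauchy_Schwarz_ineq_sum)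
    also have "(\<Sum>y\<in>hd ` PP. (v y)\<^sup>2) = sqn N v"
      unfolding sqn_def by (rule sum.mono_neutral_left) (use hdN in \<open>auto simp: v_def\<close>)
    also have "(\<Sum>y\<in>hd ` PP. 1\<^sup>2) = real (\<Sum>i\<le>K. \<nu> i)"
      using level_sum[of "\<lambda>_. 1"] by (simp add: card_image[OF inj])
    finally show ?thesis .
  qed
  define e where "e = (\<lambda>y z. of_bool (ed y z \<in> G) * (v y * v z))"
  have e0: "e y z \<ge> 0" for y z by (simp add: e_def v0)
  have adj: "2 * (\<Sum>i<K. a i * a (Suc i) * sqrt (real (ks i))) \<le> (\<Sum>y<N. \<Sum>z<N. e y z)"
  proof -
    define P2 where "P2 = {r\<in>PP. length r \<ge> 2}"
    have fP2: "finite P2" using fPP by (simp add: P2_def)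
    have tlP: "tl r \<in> PP" if r2: "r \<in> P2" for r
    proof -
      obtain i where i: "i \<le> K" "r \<in> tnodes C x i" using r2 by (auto simp: P2_def PP_def)
      then obtain j where j: "i = Suc j" using r2 by (cases i) (auto simp: P2_def)
      have "tl r \<in> tnodes C x j" using i(2) by (auto simp: j)
      thus ?thesis using i(1) j by (auto simp: PP_def intro!: bexI[of _ j])
    qed
    define f1 where "f1 = (\<lambda>r :: nat list. (hd r, hd (tl r)))"
    define f2 where "f2 = (\<lambda>r :: nat list. (hd (tl r), hd r))"
    have inj1: "inj_on f1 P2" using inj by (auto simp: inj_on_def f1_def P2_def)
    have inj2: "inj_on f2 P2" using inj by (auto simp: inj_on_def f2_def P2_def)
    have disj: "f1 ` P2 \<inter> f2 ` P2 = {}"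
    proof (rule ccontr)
      assume "f1 ` P2 \<inter> f2 ` P2 \<noteq> {}"
      then obtain t where t: "t \<in> f1 ` P2" "t \<in> f2 ` P2" by blast
      then obtain r r' where r: "r \<in> P2" "r' \<in> P2" "t = f1 r" "t = f2 r'" by blast
      hence eq: "hd r = hd (tl r')" "hd (tl r) = hd r'" by (auto simp: f1_def f2_def)
      have "r = tl r'" using inj_onD[OF inj eq(1)] r tlP by (auto simp: P2_def)
      moreover have "tl r = r'" using inj_onD[OF inj eq(2)] r tlP by (auto simp: P2_def)
      ultimately have "length r' = length r' - 1 - 1" by (metis length_tl)
      thus False using r(2) by (auto simp: P2_def)
    qed
    have er: "e (hd r) (hd (tl r)) = \<alpha> (length r - 1) * \<alpha> (length r - 2)" "e (hd (tl r)) (hd r) = \<alpha> (length r - 1) * \<alpha> (length r - 2)"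
      if r: "r \<in> P2" for r
    proof -
      have rP: "r \<in> PP" "length r \<ge> 2" using r by (auto simp: P2_def)
      obtain y z q where q: "r = y # z # q" using rP(2) by (metis One_nat_def Suc_1 Suc_le_length_iff)
      have "ed y z \<in> G" using PPi[OF rP(1)] q by (auto simp: tree_path_def)
      thus "e (hd r) (hd (tl r)) = \<alpha> (length r - 1) * \<alpha> (length r - 2)" "e (hd (tl r)) (hd r) = \<alpha> (length r - 1) * \<alpha> (length r - 2)"
        using vhd[OF rP(1)] vhd[OF tlP[OF r]] q by (auto simp: e_def ed_commute mult.commute numeral_2_eq_2)
    qed
    have "(\<Sum>r\<in>P2. \<alpha> (length r - 1) * \<alpha> (length r - 2)) = (\<Sum>r\<in>PP. (\<lambda>i. if i \<ge> 1 then \<alpha> i * \<alpha> (i - 1) else 0) (length r - 1))"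
      by (rule sum.mono_neutral_cong_left) (use fPP in \<open>auto simp: P2_def diff_diff_eq numeral_2_eq_2\<close>)
    also have "\<dots> = (\<Sum>i\<le>K. real (\<nu> i) * (if i \<ge> 1 then \<alpha> i * \<alpha> (i - 1) else 0))" by (rule level_sum)
    also have "\<dots> = (\<Sum>i<K. real (\<nu> (Suc i)) * (\<alpha> (Suc i) * \<alpha> i))"
      by (simp add: sum.atMost_shift)
    also have "\<dots> = (\<Sum>i<K. a i * a (Suc i) * sqrt (real (ks i)))"
    proof (intro sum.cong refl)
      fix i assume "i \<in> {..<K}"
      hence pos: "\<nu> i \<ge> 1" "ks i \<ge> 1" using \<nu>[of i] ks by auto
      have n1: "\<nu> (Suc i) = \<nu> i * ks i" by (simp add: \<nu>_def)
      define s where "s = sqrt (real (\<nu> i))"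
      define t where "t = sqrt (real (ks i))"
      have st: "s > 0" "t > 0" using pos by (auto simp: s_def t_def)
      have "real (\<nu> (Suc i)) = (s * s) * (t * t)" by (simp add: n1 s_def t_def)
      moreover have "\<alpha> (Suc i) = a (Suc i) / (s * t)" "\<alpha> i = a i / s"
        by (simp_all add: \<alpha>_def n1 real_sqrt_mult s_def t_def)
      ultimately show "real (\<nu> (Suc i)) * (\<alpha> (Suc i) * \<alpha> i) = a i * a (Suc i) * sqrt (real (ks i))"
        using st by (simp flip: t_def)
    qed
    finally have S: "(\<Sum>r\<in>P2. \<alpha> (length r - 1) * \<alpha> (length r - 2)) = (\<Sum>i<K. a i * a (Suc i) * sqrt (real (ks i)))" .
    have "2 * (\<Sum>r\<in>P2. \<alpha> (length r - 1) * \<alpha> (length r - 2))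
      = (\<Sum>t\<in>f1 ` P2. e (fst t) (snd t)) + (\<Sum>t\<in>f2 ` P2. e (fst t) (snd t))"
      unfolding sum.reindex[OF inj1] sum.reindex[OF inj2] using er by (simp add: f1_def f2_def)
    also have "\<dots> = (\<Sum>t\<in>f1 ` P2 \<union> f2 ` P2. e (fst t) (snd t))"
      by (rule sum.union_disjoint[symmetric]) (use fP2 disj in auto)
    also have "\<dots> \<le> (\<Sum>t\<in>{..<N} \<times> {..<N}. e (fst t) (snd t))"
    proof (rule sum_mono2)
      have "hd r < N \<and> hd (tl r) < N" if "r \<in> P2" for r
        using hdN[of r] hdN[OF tlP[OF that]] that by (simp add: P2_def)
      thus "f1 ` P2 \<union> f2 ` P2 \<subseteq> {..<N} \<times> {..<N}" by (auto simp: f1_def f2_def)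
    qed (auto simp: e0)
    finally show ?thesis unfolding S by (simp add: sum.cartesian_product case_prod_unfold)
  qed
  have "(1 / sqrt d) * (\<Sum>y<N. \<Sum>z<N. e y z) - p / sqrt d * sv\<^sup>2 \<le> qform N (centH n p d A) v"
  proof -
    have "(1 / sqrt d) * (\<Sum>y<N. \<Sum>z<N. e y z) - p / sqrt d * sv\<^sup>2
      = (\<Sum>y<N. \<Sum>z<N. 1 / sqrt d * e y z - p / sqrt d * (v y * v z))"
      unfolding sum_subtractf sv_def power2_eq_square sum_product by (simp only: sum_distrib_left)
    also have "\<dots> \<le> (\<Sum>y<N. \<Sum>z<N. v y * centH n p d A y z * v z)"
    proof (intro sum_mono)
      fix y z assume "y \<in> {..<N}" "z \<in> {..<N}"
      hence yz: "y < n + m" "z < n + m" by (auto simp: N_def)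
      have vv: "v y * v z \<ge> 0" using v0 by simp
      have "1 / sqrt d * e y z - p / sqrt d * (v y * v z) = ((of_bool (ed y z \<in> G) - p) / sqrt d) * (v y * v z)"
        by (simp add: e_def diff_divide_distrib left_diff_distrib)
      also have "\<dots> \<le> centH n p d A y z * (v y * v z)"
        using vv p d gset_cross[of y z n m A] unfolding centH_gset[OF yz] G_def
        by (intro mult_right_mono) (auto simp: of_bool_def divide_simps)
      finally show "1 / sqrt d * e y z - p / sqrt d * (v y * v z) \<le> v y * centH n p d A y z * v z" by (simp add: mult_ac)
    qed
    finally show ?thesis by (simp add: bil_def)
  qed
  also have "\<dots> \<le> lambda1 N (centH n p d A) * sqn N v"
    by (rule qform_le_lambda1[OF symm_upto_centH]) (use nm in \<open>unfold N_def, linarith\<close>)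
  finally have main: "(1 / sqrt d) * (\<Sum>y<N. \<Sum>z<N. e y z) - p / sqrt d * sv\<^sup>2 \<le> lambda1 N (centH n p d A) * sqn N v" .
  have "(1 / sqrt d) * (2 * (\<Sum>i<K. a i * a (Suc i) * sqrt (real (ks i)))) \<le> (1 / sqrt d) * (\<Sum>y<N. \<Sum>z<N. e y z)"
    using adj d by (intro mult_left_mono) auto
  moreover have "(1 / sqrt d) * (2 * (\<Sum>i<K. a i * a (Suc i) * sqrt (real (ks i)))) = 2 * (\<Sum>i<K. a i * a (Suc i) * sqrt (real (ks i) / d))"
    by (simp add: sum_distrib_left real_sqrt_divide mult_ac)
  moreover have "p / sqrt d * sv\<^sup>2 \<le> p / sqrt d * (real (\<Sum>i\<le>K. \<nu> i) * sqn N v)"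
    using svle p d by (intro mult_left_mono) auto
  ultimately show ?thesis using main unfolding sqv by (simp add: N_def \<nu>_def mult.assoc)
qed

section \<open>Vertices of large degree\<close>

text \<open>The entries with second index \<open>j\<close> are the edges at one vertex of the second
  part, so its degrees are independent.\<close>

lemma prob_columns:
  fixes Q :: "(nat \<Rightarrow> bool) \<Rightarrow> bool" and p :: real
  shows "measure_pmf.prob (bip_ER n m p) {A. \<forall>j<m. Q (\<lambda>i. A (i, j))}
    = (measure_pmf.prob (Pi_pmf {..<n} False (\<lambda>_. bernoulli_pmf p)) {f. Q f}) ^ m"
proof (induction m)
  case 0 show ?case by simp
next
  case (Suc m)
  let ?b = "\<lambda>_ :: nat \<times> nat. bernoulli_pmf p"
  let ?A = "{..<n} \<times> {..<m}" and ?B = "{..<n} \<times> {m}"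
  let ?MA = "Pi_pmf ?A False ?b" and ?MB = "Pi_pmf ?B False ?b"
  define h where "h = (\<lambda>(f :: nat \<times> nat \<Rightarrow> bool, g :: nat \<times> nat \<Rightarrow> bool) x. if x \<in> ?A then f x else g x)"
  let ?S = "{A. \<forall>j<Suc m. Q (\<lambda>i. A (i, j))}"
  have AB: "{..<n} \<times> {..<Suc m} = ?A \<union> ?B" by auto
  have un: "bip_ER n (Suc m) p = map_pmf h (pair_pmf ?MA ?MB)"
    unfolding bip_ER_def AB h_def by (rule Pi_pmf_union) auto
  have sA: "f x = False" if "f \<in> set_pmf ?MA" "x \<notin> ?A" for f x using that set_Pi_pmf_subset[of ?A False ?b] by (cases x) auto
  have sB: "g x = False" if "g \<in> set_pmf ?MB" "x \<notin> ?B" for g x using that set_Pi_pmf_subset[of ?B False ?b] by (cases x) auto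
  define SA where "SA = {A. \<forall>j<m. Q (\<lambda>i. A (i, j))} \<inter> set_pmf ?MA"
  define SB where "SB = {A. Q (\<lambda>i. A (i, m))} \<inter> set_pmf ?MB"
  have pre: "(h -` ?S) \<inter> set_pmf (pair_pmf ?MA ?MB) = SA \<times> SB"
  proof -
    have "(f, g) \<in> h -` ?S \<longleftrightarrow> (\<forall>j<m. Q (\<lambda>i. f (i, j))) \<and> Q (\<lambda>i. g (i, m))" if f: "f \<in> set_pmf ?MA" and g: "g \<in> set_pmf ?MB" for f g
    proof -
      have 1: "(\<lambda>i. h (f, g) (i, j)) = (\<lambda>i. f (i, j))" if "j < m" for j
      proof
        fix i show "h (f, g) (i, j) = f (i, j)"
          using sA[OF f, of "(i, j)"] sB[OF g, of "(i, j)"] that by (auto simp: h_def)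
      qed
      have 2: "(\<lambda>i. h (f, g) (i, m)) = (\<lambda>i. g (i, m))" by (auto simp: h_def)
      show ?thesis using 1 2 by (auto simp: less_Suc_eq)
    qed
    thus ?thesis by (auto simp: SA_def SB_def)
  qed
  have fin: "finite (set_pmf ?MA)" "finite (set_pmf ?MB)" by (auto intro!: finite_set_Pi_pmf_bool)
  have "measure_pmf.prob (bip_ER n (Suc m) p) ?S = measure_pmf.prob (pair_pmf ?MA ?MB) (h -` ?S)"
    unfolding un by simp
  also have "\<dots> = measure_pmf.prob (pair_pmf ?MA ?MB) ((h -` ?S) \<inter> set_pmf (pair_pmf ?MA ?MB))"
    by (rule measure_Int_set_pmf[symmetric])
  also have "\<dots> = measure_pmf.prob ?MA SA * measure_pmf.prob ?MB SB"
    unfolding pre by (rule measure_pmf_prob_product) (use fin in \<open>auto simp: SA_def SB_def intro: countable_finite\<close>)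
  also have "measure_pmf.prob ?MA SA = measure_pmf.prob (bip_ER n m p) {A. \<forall>j<m. Q (\<lambda>i. A (i, j))}"
    unfolding SA_def bip_ER_def by (rule measure_Int_set_pmf)
  also have "measure_pmf.prob ?MB SB = measure_pmf.prob (Pi_pmf {..<n} False (\<lambda>_. bernoulli_pmf p)) {f. Q f}"
  proof -
    have bij: "bij_betw (\<lambda>i. (i, m)) {..<n} ?B" by (rule bij_betwI[where g = fst]) auto
    have "Pi_pmf {..<n} False (\<lambda>_. bernoulli_pmf p) = map_pmf (\<lambda>g. g \<circ> (\<lambda>i. (i, m))) ?MB"
      by (rule Pi_pmf_bij_betw[OF _ bij]) auto
    hence "measure_pmf.prob (Pi_pmf {..<n} False (\<lambda>_. bernoulli_pmf p)) {f. Q f} = measure_pmf.prob ?MB {A. Q (\<lambda>i. A (i, m))}"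
      by (simp add: vimage_def comp_def)
    thus ?thesis unfolding SB_def by (simp add: measure_Int_set_pmf)
  qed
  finally show ?case using Suc by simp
qed

lemma dg_right:
  assumes "j < m"
  shows "dg (gset n m A) (n + j) = card {i\<in>{..<n}. A (i, j)}"
proof -
  have "bij_betw (\<lambda>i. (i, n + j)) {i\<in>{..<n}. A (i, j)} (inc (gset n m A) (n + j))"
    by (rule bij_betwI[where g = fst]) (use assms in \<open>auto simp: inc_def gset_def pot_edges_def\<close>)
  thus ?thesis unfolding dg_def by (simp add: bij_betw_same_card)
qed

text \<open>Each of the \<open>m\<close> independent factors is bounded by the probability of
  avoiding the degree \<open>k\<close> exactly.\<close>

lemma prob_no_heavy_le:
  assumes p: "0 \<le> p" "p \<le> 1"
  shows "measure_pmf.prob (bip_ER n m p) {A. \<forall>j<m. dg (gset n m A) (n + j) < k} \<le> exp (- real m * pmf (binomial_pmf n p) k)"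
proof -
  let ?M = "Pi_pmf {..<n} False (\<lambda>_. bernoulli_pmf p)"
  have "{A. \<forall>j<m. dg (gset n m A) (n + j) < k} = {A. \<forall>j<m. card {i\<in>{..<n}. A (i, j)} < k}"
    by (auto simp: dg_right)
  hence "measure_pmf.prob (bip_ER n m p) {A. \<forall>j<m. dg (gset n m A) (n + j) < k}
      = (measure_pmf.prob ?M {f. card {i\<in>{..<n}. f i} < k}) ^ m"
    using prob_columns[of n m p "\<lambda>f. card {i\<in>{..<n}. f i} < k"] by simp
  also have "measure_pmf.prob ?M {f. card {i\<in>{..<n}. f i} < k} = measure_pmf.prob (binomial_pmf n p) {..<k}"
  proof -
    have "binomial_pmf n p = map_pmf (\<lambda>f. card {i\<in>{..<n}. f i}) ?M"
      by (rule binomial_pmf_altdef') (use p in auto)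
    thus ?thesis by (simp add: vimage_def)
  qed
  also have "(measure_pmf.prob (binomial_pmf n p) {..<k}) ^ m \<le> (1 - pmf (binomial_pmf n p) k) ^ m"
  proof (rule power_mono)
    have "measure_pmf.prob (binomial_pmf n p) {..<k} + measure_pmf.prob (binomial_pmf n p) {k}
        = measure_pmf.prob (binomial_pmf n p) ({..<k} \<union> {k})"
      by (rule measure_pmf.finite_measure_Union[symmetric]) auto
    also have "\<dots> \<le> 1" by (rule measure_pmf.prob_le_1)
    finally show "measure_pmf.prob (binomial_pmf n p) {..<k} \<le> 1 - pmf (binomial_pmf n p) k"
      by (simp add: measure_pmf_single)
  qed auto
  also have "\<dots> \<le> (exp (- pmf (binomial_pmf n p) k)) ^ m"
    using pmf_le_1[of "binomial_pmf n p" k] exp_ge_add_one_self[of "- pmf (binomial_pmf n p) k"]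
    by (intro power_mono) auto
  also have "\<dots> = exp (- real m * pmf (binomial_pmf n p) k)" by (simp flip: exp_of_nat_mult)
  finally show ?thesis .
qed

text \<open>Stirling's formula up to a factor of order sqrt k; the induction step is e <= (1 +
  1/k)^(k+1).\<close>

lemma fact_upper:
  assumes "k \<ge> 1"
  shows "fact k \<le> exp 1 * real k * (real k / exp 1) ^ k"
  using assms
proof (induction k rule: dec_induct)
  case base show ?case by simp
next
  case (step k)
  have k: "real k > 0" using step by simp
  have "1 / real (Suc k) \<le> ln (1 + 1 / real k)"
    using ln_add_one_self_le_self2[of "- 1 / (real k + 1)"] k ln_inverse[of "1 + 1 / real k"]
    by (simp add: field_simps)
  hence "1 \<le> real (Suc k) * ln (1 + 1 / real k)" by (simp add: field_simps)
  hence "exp 1 \<le> exp (real (Suc k) * ln (1 + 1 / real k))" by simp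
  also have "\<dots> = (1 + 1 / real k) ^ Suc k"
  proof -
    have "1 + 1 / real k > 0" using k by (intro add_pos_pos) auto
    thus ?thesis by (subst exp_of_nat_mult) (simp only: exp_ln)
  qed
  also have "\<dots> = (real (Suc k) / real k) ^ Suc k" using k by (simp add: field_simps)
  finally have e: "exp 1 * real k ^ Suc k \<le> real (Suc k) ^ Suc k"
    using k by (simp add: power_divide pos_le_divide_eq del: power_Suc)
  have "fact (Suc k) = real (Suc k) * fact k" by simp
  also have "\<dots> \<le> real (Suc k) * (exp 1 * real k * (real k / exp 1) ^ k)"
    using step by (intro mult_left_mono) auto
  also have "\<dots> = exp 1 * real (Suc k) * (exp 1 * real k ^ Suc k / exp 1 ^ Suc k)" by (simp add: power_divide)
  also have "\<dots> \<le> exp 1 * real (Suc k) * (real (Suc k) ^ Suc k / exp 1 ^ Suc k)"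
    using e by (intro mult_left_mono divide_right_mono) auto
  finally show ?case by (simp add: power_divide)
qed

text \<open>Rests on (n - k)^k / k! as a lower bound for the binomial coefficient and on
  \<open>fact_upper\<close>. For k = a d and n p = \<mu> d the leading part of the exponent is - d
  times \<open>rate a \<mu>\<close>.\<close>

lemma binomial_pmf_lower:
  assumes p: "0 < p" "p \<le> 1/2" and k: "1 \<le> k" "k < n"
  shows "pmf (binomial_pmf n p) k \<ge>
    exp (real k * (ln (real n * p / real k) + ln (1 - real k / real n) + 1) - 1 - ln (real k) - real n * p - 2 * real n * p\<^sup>2)"
proof -
  have k0: "real k > 0" and n0: "real n > 0" and kn: "real k < real n" using k by auto
  have ch: "(real n - real k) ^ k / fact k \<le> real (n choose k)"
  proof -
    have "real (n choose k) = (\<Prod>i<k. real n - real i) / fact k"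
      using binomial_gbinomial[of n k, where 'a = real] by (simp add: gbinomial_prod_rev atLeast0LessThan)
    moreover have "(real n - real k) ^ k \<le> (\<Prod>i<k. real n - real i)"
    proof -
      have "(real n - real k) ^ k = (\<Prod>i<k. real n - real k)" by simp
      also have "\<dots> \<le> (\<Prod>i<k. real n - real i)" using kn by (intro prod_mono) auto
      finally show ?thesis .
    qed
    ultimately show ?thesis by (simp add: divide_right_mono)
  qed
  have l: "ln (1 - p) \<ge> - p - 2 * p\<^sup>2"
    using ln_one_minus_pos_lower_bound[of p] p by (simp add: power2_eq_square)
  have "exp (- (real n * p) - 2 * real n * p\<^sup>2) \<le> exp (real n * ln (1 - p))"
    using mult_left_mono[OF l, of "real n"] by (simp add: algebra_simps)
  also have "\<dots> = (1 - p) ^ n" using p by (subst exp_of_nat_mult) simp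
  also have "\<dots> \<le> (1 - p) ^ (n - k)" using p by (intro power_decreasing) auto
  finally have q: "exp (- (real n * p) - 2 * real n * p\<^sup>2) \<le> (1 - p) ^ (n - k)" .
  have "exp (real k * (ln (real n * p / real k) + ln (1 - real k / real n) + 1) - 1 - ln (real k))
      = (real n * p / real k) ^ k * (1 - real k / real n) ^ k * exp 1 ^ k / (exp 1 * real k)"
  proof -
    have "1 - real k / real n > 0" "real n * p / real k > 0" using kn n0 k0 p by (auto simp: field_simps)
    thus ?thesis using k0
      by (simp add: exp_diff distrib_left exp_add exp_of_nat_mult) (simp flip: exp_of_nat_mult)
  qed
  also have "\<dots> = (real n - real k) ^ k / (exp 1 * real k * (real k / exp 1) ^ k) * p ^ k"
  proof -
    have "1 - real k / real n = (real n - real k) / real n" using n0 by (simp add: field_simps)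
    thus ?thesis using n0 k0 by (simp add: power_divide power_mult_distrib mult_ac)
  qed
  also have "\<dots> \<le> (real n - real k) ^ k / fact k * p ^ k"
    using fact_upper[OF k(1)] kn p k0
    by (intro mult_right_mono divide_left_mono) (auto intro!: mult_pos_pos zero_less_power)
  also have "\<dots> \<le> real (n choose k) * p ^ k" using ch p by (intro mult_right_mono) auto
  finally have r: "exp (real k * (ln (real n * p / real k) + ln (1 - real k / real n) + 1) - 1 - ln (real k)) \<le> real (n choose k) * p ^ k" .
  have "exp (real k * (ln (real n * p / real k) + ln (1 - real k / real n) + 1) - 1 - ln (real k) - real n * p - 2 * real n * p\<^sup>2)
    = exp (real k * (ln (real n * p / real k) + ln (1 - real k / real n) + 1) - 1 - ln (real k)) * exp (- (real n * p) - 2 * real n * p\<^sup>2)"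
    by (simp flip: exp_add)
  also have "\<dots> \<le> real (n choose k) * p ^ k * (1 - p) ^ (n - k)"
    using r q p by (intro mult_mono) auto
  also have "\<dots> = pmf (binomial_pmf n p) k" using p by simp
  finally show ?thesis .
qed

section \<open>Asymptotics of the model\<close>

text \<open>The large deviation rate of a Poisson variable of mean \<open>\<mu>\<close> at \<open>a\<close>.\<close>

definition rate :: "real \<Rightarrow> real \<Rightarrow> real" where
  "rate a \<mu> = a * ln (a / \<mu>) - a + \<mu>"

locale bip_model =
  fixes \<gamma> b :: real
  assumes \<gamma>: "\<gamma> \<ge> 1" and b: "b > 0"
begin

definition q :: real where "q = \<gamma> powr (1/4)"
definition nn :: "nat \<Rightarrow> nat" where "nn m = nat \<lfloor>\<gamma> * real m\<rfloor>"
definition NN :: "nat \<Rightarrow> nat" where "NN m = nn m + m"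
definition dd :: "nat \<Rightarrow> real" where "dd m = b * ln (real (NN m))"
definition pp :: "nat \<Rightarrow> real" where "pp m = dd m / sqrt (real m * real (nn m))"

abbreviation MM :: "nat \<Rightarrow> (nat \<times> nat \<Rightarrow> bool) set \<Rightarrow> real" where
  "MM m \<equiv> measure_pmf.prob (bip_ER (nn m) m (pp m))"

lemma q_ge1: "q \<ge> 1" using \<gamma> by (simp add: q_def ge_one_powr_ge_zero)

lemma q_sq: "q\<^sup>2 = sqrt \<gamma>"
proof -
  have "q\<^sup>2 = q powr 2" using q_ge1 by (simp add: powr_numeral)
  also have "\<dots> = (\<gamma> powr (1/4)) powr 2" by (simp add: q_def)
  also have "\<dots> = sqrt \<gamma>" using \<gamma> by (simp add: powr_powr powr_half_sqrt)
  finally show ?thesis .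
qed

lemma nn_bounds: "real (nn m) \<le> \<gamma> * real m" "real (nn m) \<ge> \<gamma> * real m - 1" "nn m \<ge> m"
proof -
  have g: "\<gamma> * real m \<ge> real m" using \<gamma> by (simp add: mult_le_cancel_right1)
  hence f: "\<lfloor>\<gamma> * real m\<rfloor> \<ge> int m" by (simp add: le_floor_iff)
  hence r: "real (nn m) = of_int \<lfloor>\<gamma> * real m\<rfloor>" by (simp add: nn_def)
  show "real (nn m) \<le> \<gamma> * real m" "real (nn m) \<ge> \<gamma> * real m - 1" unfolding r by linarith+
  show "nn m \<ge> m" using f by (simp add: nn_def)
qed

lemma NN_bounds: "real (NN m) \<le> (\<gamma> + 1) * real m" "NN m \<ge> m"
  using nn_bounds(1)[of m] by (auto simp: NN_def algebra_simps)

lemma NN_at_top: "filterlim (\<lambda>m. real (NN m)) at_top sequentially"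
  by (rule filterlim_at_top_mono[OF filterlim_real_sequentially]) (use NN_bounds(2) in auto)

lemma ev_NN: "eventually P at_top \<Longrightarrow> eventually (\<lambda>m. P (real (NN m))) sequentially"
  by (rule eventually_compose_filterlim[OF _ NN_at_top])

lemma lim_NN: "(f \<longlongrightarrow> c) at_top \<Longrightarrow> (\<lambda>m. f (real (NN m))) \<longlonglongrightarrow> c"
  using NN_at_top by (rule filterlim_compose[rotated])

lemma nn_ratio: "(\<lambda>m. real (nn m) / real m) \<longlonglongrightarrow> \<gamma>"
proof (rule tendsto_sandwich)
  show "\<forall>\<^sub>F m in sequentially. \<gamma> - 1 / real m \<le> real (nn m) / real m"
    using eventually_gt_at_top[of 0]
  proof eventually_elim
    case (elim m)
    have "(\<gamma> * real m - 1) / real m \<le> real (nn m) / real m" using nn_bounds(2)[of m] by (rule divide_right_mono) simp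
    thus ?case using elim by (simp add: diff_divide_distrib)
  qed
  show "\<forall>\<^sub>F m in sequentially. real (nn m) / real m \<le> \<gamma>"
    using eventually_gt_at_top[of 0]
  proof eventually_elim
    case (elim m) thus ?case using nn_bounds(1)[of m] by (simp add: field_simps)
  qed
  show "(\<lambda>m. \<gamma> - 1 / real m) \<longlonglongrightarrow> \<gamma>" by real_asymp
qed simp

lemma dd_at_top: "filterlim dd at_top sequentially"
proof -
  have "filterlim (\<lambda>x. b * ln x) at_top at_top" using b by real_asymp
  from filterlim_compose[OF this NN_at_top] show ?thesis by (simp add: dd_def[abs_def])
qed

lemma lim_over_dd: "(\<lambda>m. c / dd m) \<longlonglongrightarrow> 0"
  by (rule tendsto_divide_0[OF tendsto_const filterlim_at_top_imp_at_infinity[OF dd_at_top]])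

text \<open>In units of \<open>d\<close>, the expected degree is asymptotically
  \<open>q\<^sup>2\<close> in the second part and, by \<open>mean_left\<close>,
  \<open>1 / q\<^sup>2\<close> in the first.\<close>

lemma mean_right: "(\<lambda>m. pp m * real (nn m) / dd m) \<longlonglongrightarrow> q\<^sup>2"
proof -
  have "(\<lambda>m. sqrt (real (nn m) / real m)) \<longlonglongrightarrow> sqrt \<gamma>" by (intro tendsto_real_sqrt nn_ratio)
  moreover have "\<forall>\<^sub>F m in sequentially. sqrt (real (nn m) / real m) = pp m * real (nn m) / dd m"
    using eventually_gt_at_top[of 0] filterlim_at_top_dense[THEN iffD1, OF dd_at_top, rule_format, of 0]
  proof eventually_elim
    case (elim m)
    hence n: "real (nn m) > 0" using nn_bounds(3)[of m] by simp
    have "pp m * real (nn m) / dd m = real (nn m) / (sqrt (real m) * sqrt (real (nn m)))"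
      using elim by (simp add: pp_def real_sqrt_mult)
    also have "\<dots> = sqrt (real (nn m)) * sqrt (real (nn m)) / (sqrt (real m) * sqrt (real (nn m)))" by simp
    also have "\<dots> = sqrt (real (nn m)) / sqrt (real m)" using n by (simp del: real_sqrt_mult_self)
    finally show ?case by (simp add: real_sqrt_divide)
  qed
  ultimately show ?thesis unfolding q_sq by (rule Lim_transform_eventually)
qed

lemma mean_left: "(\<lambda>m. pp m * real m / dd m) \<longlonglongrightarrow> 1 / q\<^sup>2"
proof -
  have "(\<lambda>m. (pp m * real (nn m) / dd m) / (real (nn m) / real m)) \<longlonglongrightarrow> q\<^sup>2 / \<gamma>"
    by (intro tendsto_divide mean_right nn_ratio) (use \<gamma> in simp)
  moreover have "\<forall>\<^sub>F m in sequentially. (pp m * real (nn m) / dd m) / (real (nn m) / real m) = pp m * real m / dd m"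
    using eventually_gt_at_top[of 0]
  proof eventually_elim
    case (elim m)
    hence "real (nn m) > 0" using nn_bounds(3)[of m] by simp
    thus ?case by simp
  qed
  ultimately have "(\<lambda>m. pp m * real m / dd m) \<longlonglongrightarrow> q\<^sup>2 / \<gamma>" by (rule Lim_transform_eventually)
  moreover have "q\<^sup>2 / \<gamma> = 1 / q\<^sup>2"
  proof -
    have "q\<^sup>2 * q\<^sup>2 = \<gamma>" unfolding q_sq using \<gamma> by simp
    moreover have "q\<^sup>2 > 0" using q_ge1 by simp
    ultimately show ?thesis using \<gamma> by (simp add: field_simps)
  qed
  ultimately show ?thesis by simp
qed

text \<open>The logarithmic factor in the edge probability: eventually
  \<open>pp m \<le> LL m / real (NN m)\<close>, the form that the first moment bounds take.\<close>

definition LL :: "nat \<Rightarrow> real" where "LL m = (\<gamma> + 1) * dd m"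

lemma ev_basic: "\<forall>\<^sub>F m in sequentially. m \<ge> 1 \<and> nn m \<ge> 1 \<and> dd m > 4 \<and> pp m > 0 \<and> pp m \<le> 1/2 \<and> pp m \<le> LL m / real (NN m) \<and> LL m \<ge> 1
    \<and> real (NN m) \<ge> 2"
proof -
  have "((\<lambda>x. (\<gamma> + 1) * (b * ln x) / x) \<longlongrightarrow> 0) at_top" by real_asymp
  hence "\<forall>\<^sub>F x in at_top. (\<gamma> + 1) * (b * ln x) / x < (1/2 :: real)" by (rule order_tendstoD) simp
  from ev_NN[OF this] have "\<forall>\<^sub>F m in sequentially. LL m / real (NN m) < 1/2" by (simp add: LL_def dd_def)
  moreover have "\<forall>\<^sub>F m in sequentially. dd m > 4" using dd_at_top by (simp add: filterlim_at_top_dense)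
  ultimately show ?thesis using eventually_ge_at_top[of 1]
  proof eventually_elim
    case (elim m)
    have n: "nn m \<ge> m" by (rule nn_bounds(3))
    have "real m * real m \<le> real m * real (nn m)" using n by (intro mult_left_mono) auto
    hence "sqrt (real m * real m) \<le> sqrt (real m * real (nn m))" by (rule real_sqrt_le_mono)
    hence s: "real m \<le> sqrt (real m * real (nn m))" by simp
    have "pp m \<le> dd m / real m" unfolding pp_def using s elim n by (intro divide_left_mono) auto
    also have "\<dots> \<le> LL m / real (NN m)"
    proof -
      have "dd m * real (NN m) \<le> dd m * ((\<gamma> + 1) * real m)"
        using NN_bounds(1)[of m] elim by (intro mult_left_mono) auto
      thus ?thesis using NN_bounds(2)[of m] elim by (simp add: LL_def field_simps)
    qed
    finally have pl: "pp m \<le> LL m / real (NN m)" .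
    moreover have "pp m > 0" unfolding pp_def using elim n by (intro divide_pos_pos) auto
    moreover have "LL m \<ge> 1 * 1" unfolding LL_def using elim \<gamma> by (intro mult_mono) auto
    moreover have "real (NN m) \<ge> 2" using elim n by (simp add: NN_def)
    ultimately show ?case using elim n by linarith
  qed
qed

lemma pp_lim: "pp \<longlonglongrightarrow> 0"
proof (rule tendsto_sandwich)
  show "(\<lambda>_. 0 :: real) \<longlonglongrightarrow> 0" by simp
  have "((\<lambda>x. (\<gamma> + 1) * (b * ln x) / x) \<longlongrightarrow> 0) at_top" by real_asymp
  from lim_NN[OF this] show "(\<lambda>m. LL m / real (NN m)) \<longlonglongrightarrow> 0" by (simp add: LL_def dd_def)
  show "\<forall>\<^sub>F m in sequentially. 0 \<le> pp m" "\<forall>\<^sub>F m in sequentially. pp m \<le> LL m / real (NN m)"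
    using ev_basic by (eventually_elim, simp)+
qed

section \<open>Chernoff bounds for exceptional degrees\<close>

definition side :: "nat \<Rightarrow> real \<Rightarrow> real \<Rightarrow> nat \<Rightarrow> real" where
  "side m a1 a2 x = (if x < nn m then a1 else a2)"

text \<open>On each side the optimal Chernoff exponent ln (a / \<mu>) for a Poisson degree of mean
  \<mu>, in units of \<open>d\<close>.\<close>

definition tilt :: "nat \<Rightarrow> real \<Rightarrow> real \<Rightarrow> nat \<Rightarrow> real" where
  "tilt m a1 a2 x = side m (ln (a1 / (1 / q\<^sup>2))) (ln (a2 / q\<^sup>2)) x"

definition thr :: "nat \<Rightarrow> real \<Rightarrow> real \<Rightarrow> nat \<Rightarrow> real" where
  "thr m a1 a2 x = tilt m a1 a2 x * (side m a1 a2 x * dd m)"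

text \<open>One set for both tails: the sign of the tilt decides whether the degree has to exceed the threshold or to
  stay below it.\<close>

definition tset :: "nat \<Rightarrow> real \<Rightarrow> real \<Rightarrow> (nat \<times> nat \<Rightarrow> bool) \<Rightarrow> nat set" where
  "tset m a1 a2 = tiltset (nn m) m (tilt m a1 a2) (thr m a1 a2)"

lemma tset_subset: "tset m a1 a2 A \<subseteq> {..<NN m}"
  by (auto simp: tset_def tiltset_def NN_def)

lemma tset_heavy:
  assumes "a1 > 1 / q\<^sup>2" "a2 > q\<^sup>2"
  shows "x \<in> tset m a1 a2 A \<longleftrightarrow> x < NN m \<and> real (dg (gset (nn m) m A) x) \<ge> side m a1 a2 x * dd m"
proof -
  have q: "q\<^sup>2 > 0" using q_ge1 by simp
  have "a1 / (1 / q\<^sup>2) > 1" "a2 / q\<^sup>2 > 1" using assms q by (auto simp: field_simps)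
  hence "ln (a1 / (1 / q\<^sup>2)) > 0" "ln (a2 / q\<^sup>2) > 0" by (simp_all only: ln_gt_zero)
  hence "tilt m a1 a2 x > 0" by (simp add: tilt_def side_def)
  thus ?thesis by (simp add: tset_def tiltset_def thr_def NN_def)
qed

lemma tset_light:
  assumes "0 < a1" "a1 < 1 / q\<^sup>2" "0 < a2" "a2 < q\<^sup>2"
  shows "x \<in> tset m a1 a2 A \<longleftrightarrow> x < NN m \<and> real (dg (gset (nn m) m A) x) \<le> side m a1 a2 x * dd m"
proof -
  have q: "q\<^sup>2 > 0" using q_ge1 by simp
  have "ln (a1 / (1 / q\<^sup>2)) < 0" "ln (a2 / q\<^sup>2) < 0"
    using assms q by (auto simp: ln_less_zero_iff field_simps)
  hence "tilt m a1 a2 x < 0" by (simp add: tilt_def side_def)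
  thus ?thesis by (simp add: tset_def tiltset_def thr_def NN_def)
qed

text \<open>With the optimal tilt the exponent is \<open>- rate a \<mu> * dd m\<close> up to lower
  order, and \<open>dd m\<close> is \<open>b\<close> times the logarithm of \<open>NN m\<close>; so
  any \<open>c\<close> below \<open>b * rate a \<mu>\<close> is reached.\<close>

lemma tilt_side_aux:
  assumes a: "a > 0" and \<mu>: "\<mu> > 0" and c: "c < b * rate a \<mu>" and lim: "(\<lambda>m. pp m * M m / dd m) \<longlonglongrightarrow> \<mu>"
  shows "\<forall>\<^sub>F m in sequentially. exp (pp m * (exp (ln (a / \<mu>)) - 1) * M m - ln (a / \<mu>) * (a * dd m) + (\<bar>ln (a / \<mu>)\<bar> + pp m) * w)
      \<le> real (NN m) powr (- c)"
proof -
  let ?t = "ln (a / \<mu>)"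
  have "(\<lambda>m. (exp ?t - 1) * (pp m * M m / dd m) - ?t * a + (\<bar>?t\<bar> * w / dd m + pp m * (w / dd m)))
     \<longlonglongrightarrow> (exp ?t - 1) * \<mu> - ?t * a + (0 + 0 * 0)"
    by (intro tendsto_add tendsto_diff tendsto_mult tendsto_const lim lim_over_dd pp_lim)
  moreover have "(exp ?t - 1) * \<mu> - ?t * a + (0 + 0 * 0) < - c / b"
  proof -
    have "exp ?t = a / \<mu>" using a \<mu> by simp
    hence "(exp ?t - 1) * \<mu> = a - \<mu>" using \<mu> by (simp add: left_diff_distrib)
    moreover have "c / b < rate a \<mu>" using c b by (simp add: pos_divide_less_eq mult.commute)
    moreover have "rate a \<mu> = ?t * a - a + \<mu>" by (simp add: rate_def)
    moreover have "- c / b = - (c / b)" by simp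
    ultimately show ?thesis by linarith
  qed
  ultimately have "\<forall>\<^sub>F m in sequentially. (exp ?t - 1) * (pp m * M m / dd m) - ?t * a + (\<bar>?t\<bar> * w / dd m + pp m * (w / dd m)) < - c / b"
    by (rule order_tendstoD(2))
  thus ?thesis using ev_basic
  proof eventually_elim
    case (elim m)
    hence d: "dd m > 0" by simp
    have "pp m * (exp ?t - 1) * M m - ?t * (a * dd m) + (\<bar>?t\<bar> + pp m) * w
      = ((exp ?t - 1) * (pp m * M m / dd m) - ?t * a + (\<bar>?t\<bar> * w / dd m + pp m * (w / dd m))) * dd m"
      using d by (simp add: field_simps)
    also have "\<dots> \<le> (- c / b) * dd m" using elim d by (intro mult_right_mono) auto
    also have "\<dots> = - c * ln (real (NN m))" using b by (simp add: dd_def)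
    finally have "exp (pp m * (exp ?t - 1) * M m - ?t * (a * dd m) + (\<bar>?t\<bar> + pp m) * w) \<le> exp (- c * ln (real (NN m)))" by simp
    also have "\<dots> = real (NN m) powr (- c)" using elim by (auto simp: powr_def)
    finally show ?case .
  qed
qed

lemma ev_tilt:
  assumes a: "a1 > 0" "a2 > 0" and c: "c < b * rate a1 (1 / q\<^sup>2)" "c < b * rate a2 (q\<^sup>2)"
  shows "\<forall>\<^sub>F m in sequentially. \<forall>x<NN m. exp (pp m * (exp (tilt m a1 a2 x) - 1) * opp (nn m) m x - thr m a1 a2 x
      + (\<bar>tilt m a1 a2 x\<bar> + pp m) * w) \<le> real (NN m) powr (- c)"
proof -
  have q: "q\<^sup>2 > 0" using q_ge1 by simp
  have "1 / q\<^sup>2 > 0" using q by simp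
  from tilt_side_aux[OF a(1) this c(1) mean_left, of w] tilt_side_aux[OF a(2) q c(2) mean_right, of w]
  show ?thesis
    by eventually_elim (auto simp: tilt_def thr_def side_def opp_def)
qed

text \<open>A small loss in the exponent absorbs all logarithmic factors and, for
  \<open>k = 0\<close>, the constants from unions of finitely many events.\<close>

lemma ev_powr_cmp:
  assumes "\<alpha> > \<beta>"
  shows "\<forall>\<^sub>F m in sequentially. C * LL m ^ k * real (NN m) powr (- \<alpha>) \<le> real (NN m) powr (- \<beta>)"
proof -
  define e where "e = \<alpha> - \<beta>"
  have "e > 0" using assms by (simp add: e_def)
  hence "((\<lambda>x. (ln x) ^ k * x powr (- e)) \<longlongrightarrow> 0) at_top" by real_asymp
  from tendsto_mult_right_zero[OF this, of "C * ((\<gamma> + 1) * b) ^ k"]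
  have "((\<lambda>x. C * ((\<gamma> + 1) * (b * ln x)) ^ k * x powr (- (\<alpha> - \<beta>))) \<longlongrightarrow> 0) at_top"
    by (simp add: power_mult_distrib e_def mult_ac)
  hence "\<forall>\<^sub>F x in at_top. C * ((\<gamma> + 1) * (b * ln x)) ^ k * x powr (- (\<alpha> - \<beta>)) < 1"
    by (rule order_tendstoD) simp
  from ev_NN[OF this] have "\<forall>\<^sub>F m in sequentially. C * LL m ^ k * real (NN m) powr (- (\<alpha> - \<beta>)) < 1" by (simp add: LL_def dd_def)
  thus ?thesis
  proof eventually_elim
    case (elim m)
    have "real (NN m) powr (- \<alpha>) = real (NN m) powr (- (\<alpha> - \<beta>)) * real (NN m) powr (- \<beta>)"
      by (simp flip: powr_add)
    hence "C * LL m ^ k * real (NN m) powr (- \<alpha>) = (C * LL m ^ k * real (NN m) powr (- (\<alpha> - \<beta>))) * real (NN m) powr (- \<beta>)"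
      by simp
    also have "\<dots> \<le> 1 * real (NN m) powr (- \<beta>)" using elim by (intro mult_right_mono) auto
    finally show ?case by simp
  qed
qed

lemma ev_dense:
  assumes a: "a1 > 0" "a2 > 0" and c: "c < b * rate a1 (1 / q\<^sup>2)" "c < b * rate a2 (q\<^sup>2)" and \<beta>: "\<beta> > 0"
  shows "\<forall>\<^sub>F m in sequentially. MM m {A. \<exists>F J. dense_cluster f0 c \<beta> (gset (nn m) m A) (tset m a1 a2 A) F J}
      \<le> real (NN m) powr (- (\<beta> / 2))"
proof -
  have "\<beta> / 2 < \<beta>" using \<beta> by simp
  from ev_tilt[OF a c, of "real (2 * f0)"] ev_basic
    ev_powr_cmp[OF this, of "(real (2 * f0) + 1) * 2 ^ ((2 * f0)\<^sup>2 + 2 * f0)" f0]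
  show ?thesis
proof (eventually_elim)
  case (elim m)
  have "MM m {A. \<exists>F J. dense_cluster f0 c \<beta> (gset (nn m) m A) (tset m a1 a2 A) F J}
      \<le> (real (2 * f0) + 1) * 2 ^ ((2 * f0)\<^sup>2 + 2 * f0) * LL m ^ f0 * real (nn m + m) powr (- \<beta>)"
    unfolding tset_def
  proof (rule prob_dense_cluster_le)
    show "0 \<le> pp m" "pp m \<le> 1" "1 \<le> LL m" "1 \<le> nn m + m" using elim(2) by linarith+
    show "pp m \<le> LL m / real (nn m + m)" using elim(2) unfolding NN_def by blast
    show "exp (pp m * (exp (tilt m a1 a2 x) - 1) * opp (nn m) m x - thr m a1 a2 x + (\<bar>tilt m a1 a2 x\<bar> + pp m) * real (2 * f0))
        \<le> real (nn m + m) powr - c" if "x < nn m + m" for x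
      using elim(1) that unfolding NN_def by blast
  qed
  also have "\<dots> \<le> real (NN m) powr (- (\<beta> / 2))" using elim(3) unfolding NN_def .
  finally show ?case .
qed
qed

lemma ev_card_tset:
  assumes a: "a1 > 0" "a2 > 0" and c: "0 < c" "c < 1" "c < b * rate a1 (1 / q\<^sup>2)" "c < b * rate a2 (q\<^sup>2)"
  shows "\<forall>\<^sub>F m in sequentially. MM m {A. real (card (tset m a1 a2 A)) \<ge> real (NN m) powr (1 - c / 2)} \<le> real (NN m) powr (- (1/2))"
proof -
  \<comment> \<open>Each of the \<open>k\<close> elements gains a factor N^(- c/2) against the
    threshold, and \<open>k * (c / 2) \<ge> 1\<close> makes the total gain at least N.\<close>
  define k where "k = nat \<lceil>2 / c\<rceil>"
  have k: "real k \<ge> 2 / c" unfolding k_def by (rule real_nat_ceiling_ge)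
  moreover have "2 / c > 0" using c by simp
  ultimately have k1: "k \<ge> 1" by linarith
  have kc: "real k * (c / 2) \<ge> 1" using k c(1) by (simp add: field_simps)
  have "filterlim (\<lambda>x :: real. x powr (1 - c / 2)) at_top at_top" using c by real_asymp
  hence "\<forall>\<^sub>F x in at_top. (x :: real) powr (1 - c / 2) \<ge> real k" by (simp add: filterlim_at_top)
  from ev_NN[OF this] have evk: "\<forall>\<^sub>F m in sequentially. real (NN m) powr (1 - c / 2) \<ge> real k" .
  have "1 / 2 < (1 :: real)" by simp
  from ev_tilt[OF a c(3,4), of "real k"] ev_basic evk ev_powr_cmp[OF this, of "real k ^ k" 0]
  show ?thesis
  proof eventually_elim
    case (elim m)
    define t where "t = nat \<lceil>real (NN m) powr (1 - c / 2)\<rceil>"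
    have t: "real t \<ge> real (NN m) powr (1 - c / 2)" unfolding t_def by (rule real_nat_ceiling_ge)
    have tk: "k \<le> t" using elim(3) t by linarith
    have N1: "real (NN m) \<ge> 1" using elim(2) by linarith
    have "{A. real (card (tset m a1 a2 A)) \<ge> real (NN m) powr (1 - c / 2)} \<subseteq> {A. card (tset m a1 a2 A) \<ge> t}"
      by (auto simp: t_def nat_le_iff ceiling_le_iff)
    hence "MM m {A. real (card (tset m a1 a2 A)) \<ge> real (NN m) powr (1 - c / 2)} \<le> MM m {A. card (tset m a1 a2 A) \<ge> t}"
      by (rule measure_pmf.finite_measure_mono) simp
    also have "\<dots> \<le> (real k * real (nn m + m) * real (NN m) powr (- c) / real t) ^ k"
      unfolding tset_def
    proof (rule prob_card_tiltset_ge[where ?w0.0 = k])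
      show "0 \<le> pp m" "pp m \<le> 1" "1 \<le> nn m + m" using elim(2) by linarith+
      show "exp (pp m * (exp (tilt m a1 a2 x) - 1) * opp (nn m) m x - thr m a1 a2 x + (\<bar>tilt m a1 a2 x\<bar> + pp m) * real k)
          \<le> real (NN m) powr - c" if "x < nn m + m" for x
        using elim(1) that unfolding NN_def by blast
    qed (use k1 tk in auto)
    also have "\<dots> \<le> (real k * real (NN m) powr (- (c / 2))) ^ k"
    proof (rule power_mono)
      have "real k * real (nn m + m) * real (NN m) powr (- c) / real t
          \<le> real k * real (NN m) * real (NN m) powr (- c) / real (NN m) powr (1 - c / 2)"
        unfolding NN_def[symmetric] using t N1 by (intro divide_left_mono) (auto intro!: mult_pos_pos less_le_trans[OF _ t])
      also have "\<dots> = real k * (real (NN m) powr 1 * real (NN m) powr (- c) / real (NN m) powr (1 - c / 2))" using N1 by simp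
      also have "real (NN m) powr 1 * real (NN m) powr (- c) / real (NN m) powr (1 - c / 2) = real (NN m) powr (- (c / 2))"
        unfolding powr_add[symmetric] powr_diff[symmetric] by (simp add: field_simps)
      finally show "real k * real (nn m + m) * real (NN m) powr (- c) / real t \<le> real k * real (NN m) powr (- (c / 2))" .
    qed auto
    also have "\<dots> = real k ^ k * real (NN m) powr (- (real k * (c / 2)))"
      using N1 by (simp add: power_mult_distrib powr_powr mult_ac flip: powr_realpow)
    also have "\<dots> \<le> real k ^ k * real (NN m) powr (- 1)"
      using kc N1 by (intro mult_left_mono powr_mono) auto
    also have "\<dots> \<le> real (NN m) powr (- (1/2))" using elim(4) by simp
    finally show ?case .
  qed
qed

lemma ev_tset_empty:
  assumes a: "a1 > 0" "a2 > 0" and c: "c < b * rate a1 (1 / q\<^sup>2)" "c < b * rate a2 (q\<^sup>2)"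
  shows "\<forall>\<^sub>F m in sequentially. MM m {A. tset m a1 a2 A \<noteq> {}} \<le> real (NN m) powr (1 - c)"
  using ev_tilt[OF a c, of 1] ev_basic
proof eventually_elim
  case (elim m)
  have fin: "finite (tset m a1 a2 A)" for A by (rule finite_subset[OF tset_subset]) simp
  have "{A. tset m a1 a2 A \<noteq> {}} \<subseteq> {A. card (tset m a1 a2 A) \<ge> 1}"
    using fin by (auto simp: Suc_le_eq card_gt_0_iff)
  hence "MM m {A. tset m a1 a2 A \<noteq> {}} \<le> MM m {A. card (tset m a1 a2 A) \<ge> 1}"
    by (rule measure_pmf.finite_measure_mono) simp
  also have "\<dots> \<le> (real 1 * real (nn m + m) * real (NN m) powr (- c) / real 1) ^ 1"
    unfolding tset_def
  proof (rule prob_card_tiltset_ge[where ?w0.0 = 1])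
    show "0 \<le> pp m" "pp m \<le> 1" "1 \<le> nn m + m" using elim(2) by linarith+
    show "exp (pp m * (exp (tilt m a1 a2 x) - 1) * opp (nn m) m x - thr m a1 a2 x + (\<bar>tilt m a1 a2 x\<bar> + pp m) * real 1)
        \<le> real (NN m) powr - c" if "x < nn m + m" for x
      using elim(1) that unfolding NN_def of_nat_1 by blast
  qed auto
  also have "\<dots> = real (NN m) powr 1 * real (NN m) powr (- c)" unfolding NN_def[symmetric] by simp
  also have "\<dots> = real (NN m) powr (1 - c)" unfolding powr_add[symmetric] by simp
  finally show ?case .
qed

lemma NN_le_m: "real (NN m) / (\<gamma> + 1) \<le> real m"
  using NN_bounds(1)[of m] \<gamma> by (simp add: field_simps)

text \<open>Markov's inequality at a length of order log N: up to exponential factors close to 1 per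
  step the expected norm is polynomial in N, and \<open>s ^ (2 * l m)\<close> beats it.\<close>

lemma ev_trace:
  assumes s: "0 < s" "s < 1"
  obtains l where "\<forall>\<^sub>F m in sequentially. MM m {A. s ^ (2 * l m) * nb_hs (NN m) (centH (nn m) (pp m) (dd m) A) (l m) \<ge> 1}
    \<le> real (NN m) powr (- 1)"
proof -
  \<comment> \<open>Ensures \<open>1 - 2 * \<delta> \<ge> sqrt s\<close>, so that half of the decay
    of \<open>s ^ (2 * l m)\<close> survives.\<close>
  define \<delta> where "\<delta> = min (1/3) ((1 - sqrt s) / 2)"
  have ss: "0 < sqrt s" "sqrt s < 1" using s by auto
  have \<delta>: "0 < \<delta>" "\<delta> \<le> 1/3" and \<delta>s: "1 - 2 * \<delta> \<ge> sqrt s" using ss by (auto simp: \<delta>_def min_def field_simps)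
  \<comment> \<open>The surviving decay \<open>s ^ l m\<close> becomes N^(-7), which against N^2 and
    logarithms leaves at most 1 / N.\<close>
  define C where "C = 7 / (- ln s)"
  have lns: "ln s < 0" using s by simp
  have C: "C > 0" using lns by (simp add: C_def divide_pos_neg)
  define l where "l = (\<lambda>m. nat \<lceil>C * ln (real (NN m))\<rceil>)"
  define K where "K = sqrt \<gamma> ^ 3"
  have b': "b > 0" and g': "\<gamma> + 1 > 0" using b \<gamma> by auto
  have "((\<lambda>x. 2 * K * x^2 * (((2 * (C * ln x + 1) + 1) / \<delta>)\<^sup>2 * (12 * (C * ln x + 1) + 9) ^ 6) * x powr (- 7) * x) \<longlongrightarrow> 0) at_top"
    using C \<delta>(1) by real_asymp
  hence "\<forall>\<^sub>F x in at_top. 2 * K * x^2 * (((2 * (C * ln x + 1) + 1) / \<delta>)\<^sup>2 * (12 * (C * ln x + 1) + 9) ^ 6) * x powr (- 7) * x < 1"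
    by (rule order_tendstoD) simp
  note e1 = ev_NN[OF this]
  have "((\<lambda>x. ((2 * (C * ln x + 1) + 1) / \<delta>) ^ 3 * (12 * (C * ln x + 1) + 9) ^ 12 / sqrt (x / (\<gamma> + 1))) \<longlongrightarrow> 0) at_top"
    using C \<delta>(1) g' by real_asymp
  hence "\<forall>\<^sub>F x in at_top. ((2 * (C * ln x + 1) + 1) / \<delta>) ^ 3 * (12 * (C * ln x + 1) + 9) ^ 12 / sqrt (x / (\<gamma> + 1)) < 1"
    by (rule order_tendstoD) simp
  note e2 = ev_NN[OF this]
  \<comment> \<open>Here \<open>d\<close> of order log N suffices: the choices at branching vertices
    have logarithm of order log N log log N, the gain from large excess one of order (log
    N)^(3/2).\<close>
  have "\<forall>\<^sub>F x in at_top. 2 * (C * ln x + 1) * ln (12 * (C * ln x + 1) + 9) \<le> (sqrt (b * ln x) - 15) / 12 * ln (x / (\<gamma> + 1))"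
    using C b' g' by real_asymp
  note e3 = ev_NN[OF this]
  have "\<forall>\<^sub>F x in at_top. x / (\<gamma> + 1) \<ge> 1" using g' by real_asymp
  note e4 = ev_NN[OF this]
  have "\<forall>\<^sub>F x in at_top. sqrt (b * ln x) > 15" using b' by real_asymp
  note e5 = ev_NN[OF this]
  have "\<forall>\<^sub>F m in sequentially. MM m {A. s ^ (2 * l m) * nb_hs (NN m) (centH (nn m) (pp m) (dd m) A) (l m) \<ge> 1} \<le> real (NN m) powr (- 1)"
    using e1 e2 e3 e4 e5 ev_basic
  proof eventually_elim
    case (elim m)
    define x where "x = real (NN m)"
    define Z where "Z = C * ln x + 1"
    note el = elim[folded x_def, folded Z_def]
    have x2: "x \<ge> 2" using elim(6) by (simp add: x_def)
    have lnx: "ln x > 0" using x2 by simp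
    have Cl: "C * ln x > 0" using C lnx by simp
    have l1: "l m \<ge> 1" using Cl by (simp add: l_def x_def Suc_le_eq)
    have lge: "real (l m) \<ge> C * ln x" unfolding l_def x_def by (rule real_nat_ceiling_ge)
    have lle: "real (l m) \<le> Z" using Cl unfolding l_def x_def Z_def by linarith
    have Z0: "Z \<ge> 1" using Cl by (simp add: Z_def)
    have mx: "x / (\<gamma> + 1) \<le> real m" using NN_le_m[of m] by (simp add: x_def)
    have m0: "real m \<ge> 1" using elim(6) by simp
    have mlx: "real m \<le> x" using NN_bounds(2)[of m] by (simp add: x_def)
    have Q: "real (2 * l m + 1) \<le> 2 * Z + 1" using lle by simp
    have Y: "12 * real (l m) + 9 \<le> 12 * Z + 9" using lle by simp
    \<comment> \<open>The largest value with
      \<open>6 * real g0 + 9 \<le> sqrt (dd m)\<close>.\<close>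
    define g0 where "g0 = nat \<lfloor>(sqrt (dd m) - 9) / 6\<rfloor>"
    have sd: "sqrt (dd m) > 15" using el(5) by (simp add: dd_def x_def)
    have g0: "real g0 \<le> (sqrt (dd m) - 9) / 6" "real g0 \<ge> (sqrt (dd m) - 15) / 6"
    proof -
      define y where "y = (sqrt (dd m) - 9) / 6"
      have "y > 0" "(sqrt (dd m) - 15) / 6 = y - 1" using sd by (simp_all add: y_def field_simps)
      thus "real g0 \<le> (sqrt (dd m) - 9) / 6" "real g0 \<ge> (sqrt (dd m) - 15) / 6"
        unfolding g0_def y_def[symmetric] by linarith+
    qed
    have h1: "(real (2 * l m + 1) / \<delta>) ^ 3 * (12 * real (l m) + 9) ^ 12 \<le> sqrt m"
    proof -
      have "(real (2 * l m + 1) / \<delta>) ^ 3 * (12 * real (l m) + 9) ^ 12 \<le> ((2 * Z + 1) / \<delta>) ^ 3 * (12 * Z + 9) ^ 12"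
        using Q Y \<delta>(1) Z0 by (intro mult_mono power_mono divide_right_mono) auto
      also have "\<dots> \<le> sqrt (x / (\<gamma> + 1))"
      proof -
        have "sqrt (x / (\<gamma> + 1)) > 0" using x2 g' by simp
        thus ?thesis using el(2) by (simp add: divide_less_eq)
      qed
      also have "\<dots> \<le> sqrt m" using mx by simp
      finally show ?thesis .
    qed
    have h2: "(12 * real (l m) + 9) ^ (2 * l m) \<le> sqrt m ^ g0"
    proof -
      have "real (2 * l m) * ln (12 * real (l m) + 9) \<le> 2 * Z * ln (12 * Z + 9)"
        using lle Z0 by (intro mult_mono) auto
      also have "\<dots> \<le> (sqrt (dd m) - 15) / 12 * ln (x / (\<gamma> + 1))" using el(3) by (simp add: dd_def x_def)
      also have "\<dots> \<le> (sqrt (dd m) - 15) / 12 * ln (real m)"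
        using sd mx el(4) by (intro mult_left_mono) (auto intro!: ln_mono)
      also have "\<dots> = (sqrt (dd m) - 15) / 6 * ln (sqrt m)" using m0 by (simp add: ln_sqrt)
      also have "\<dots> \<le> real g0 * ln (sqrt m)" using g0(2) m0 by (intro mult_right_mono) auto
      finally have "exp (real (2 * l m) * ln (12 * real (l m) + 9)) \<le> exp (real g0 * ln (sqrt m))" by simp
      moreover have "exp (real (2 * l m) * ln (12 * real (l m) + 9)) = (12 * real (l m) + 9) ^ (2 * l m)"
        by (subst exp_of_nat_mult) (simp add: add_nonneg_pos)
      moreover have "exp (real g0 * ln (sqrt m)) = sqrt m ^ g0"
        using m0 by (subst exp_of_nat_mult) simp
      ultimately show ?thesis by simp
    qed
    have ex: "measure_pmf.expectation (bip_ER (nn m) m (pp m)) (\<lambda>A. nb_hs (nn m + m) (centH (nn m) (pp m) (dd m) A) (l m))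
      \<le> real (nn m + m) * (2 * ((sqrt (nn m) / sqrt m) ^ 3 * m * ((real (2 * l m + 1) / \<delta>)\<^sup>2 * (12 * real (l m) + 9) ^ 6)
        * (1 / (1 - 2 * \<delta>)) ^ (2 * l m)))"
    proof (rule expected_nb_hs[OF _ nn_bounds(3) _ _ _ \<delta> l1 h1 h2])
      show "6 * real g0 + 9 \<le> sqrt (dd m)" using g0(1) by simp
      show "pp m = dd m / sqrt (real m * real (nn m))" by (simp add: pp_def)
    qed (use elim(6) in linarith)+
    have spow: "s ^ (2 * l m) * (1 / (1 - 2 * \<delta>)) ^ (2 * l m) \<le> x powr (- 7)"
    proof -
      have pos: "1 - 2 * \<delta> > 0" using \<delta>s ss by linarith
      have "s / (1 - 2 * \<delta>) \<le> s / sqrt s" using \<delta>s ss s pos by (intro divide_left_mono mult_pos_pos) auto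
      also have "\<dots> = sqrt s" using s by (simp add: real_div_sqrt)
      finally have "(s / (1 - 2 * \<delta>)) ^ (2 * l m) \<le> sqrt s ^ (2 * l m)"
        using s pos by (intro power_mono) auto
      also have "\<dots> = s ^ l m" using s by (simp add: power_mult)
      also have "\<dots> = exp (real (l m) * ln s)" using s by (subst exp_of_nat_mult) simp
      also have "\<dots> \<le> exp (C * ln x * ln s)" using lge lns by (simp add: mult_right_mono_neg)
      also have "C * ln x * ln s = - 7 * ln x" using lns by (simp add: C_def)
      also have "exp (- 7 * ln x) = x powr (- 7)" using x2 by (simp add: powr_def)
      finally show ?thesis by (simp add: power_divide)
    qed
    have nr: "sqrt (nn m) / sqrt m \<le> sqrt \<gamma>"
    proof -
      have "sqrt (nn m) \<le> sqrt (\<gamma> * m)" using nn_bounds(1)[of m] by simp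
      thus ?thesis using m0 by (simp add: real_sqrt_mult divide_le_eq)
    qed
    let ?hs = "\<lambda>A. nb_hs (NN m) (centH (nn m) (pp m) (dd m) A) (l m)"
    have hs0: "?hs A \<ge> 0" for A unfolding nb_hs_def by (intro sum_nonneg) auto
    have "MM m {A. s ^ (2 * l m) * ?hs A \<ge> 1} \<le> measure_pmf.expectation (bip_ER (nn m) m (pp m)) (\<lambda>A. s ^ (2 * l m) * ?hs A) / 1"
      using integral_Markov_inequality_measure[of "measure_pmf (bip_ER (nn m) m (pp m))" "\<lambda>A. s ^ (2 * l m) * ?hs A" "{}" 1] s hs0
      by (simp add: AE_pmfI)
    also have "\<dots> = s ^ (2 * l m) * measure_pmf.expectation (bip_ER (nn m) m (pp m)) ?hs" by simp
    also have "\<dots> \<le> s ^ (2 * l m) * (x * (2 * ((sqrt (nn m) / sqrt m) ^ 3 * m * ((real (2 * l m + 1) / \<delta>)\<^sup>2 * (12 * real (l m) + 9) ^ 6)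
        * (1 / (1 - 2 * \<delta>)) ^ (2 * l m))))"
      using ex s unfolding NN_def[symmetric] x_def by (intro mult_left_mono) auto
    also have "\<dots> = (x * (2 * ((sqrt (nn m) / sqrt m) ^ 3 * m * ((real (2 * l m + 1) / \<delta>)\<^sup>2 * (12 * real (l m) + 9) ^ 6))))
        * (s ^ (2 * l m) * (1 / (1 - 2 * \<delta>)) ^ (2 * l m))"
      by (simp only: mult.assoc mult.commute mult.left_commute)
    also have "\<dots> \<le> (x * (2 * (K * x * (((2 * Z + 1) / \<delta>)\<^sup>2 * (12 * Z + 9) ^ 6)))) * x powr (- 7)"
      unfolding K_def using nr mlx Q Y spow \<delta> ss \<delta>s s \<gamma> x2 Z0
      by (intro mult_mono power_mono divide_right_mono mult_nonneg_nonneg zero_le_power divide_nonneg_nonneg) auto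
    also have "\<dots> = 2 * K * x\<^sup>2 * (((2 * Z + 1) / \<delta>)\<^sup>2 * (12 * Z + 9) ^ 6) * x powr (- 7)"
      by (simp add: power2_eq_square)
    also have "\<dots> \<le> x powr (- 1)"
      using el(1) x2 by (simp add: powr_minus field_simps)
    finally show ?case by (simp add: x_def)
  qed
  thus ?thesis by (rule that)
qed

text \<open>The expected number of vertices of this degree in the second part is at least a positive
  power of N, and by independence the probability of finding none is at most exponential in minus
  that number.\<close>

lemma ev_heavy:
  assumes \<beta>: "\<beta> > 0" "b * rate \<beta> (q\<^sup>2) < 1"
  shows "\<forall>\<^sub>F m in sequentially. MM m {A. \<forall>j<m. real (dg (gset (nn m) m A) (nn m + j)) < \<beta> * dd m} \<le> real (NN m) powr (- 1)"
proof -
  define \<mu> where "\<mu> = q\<^sup>2"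
  have \<mu>: "\<mu> > 0" using q_ge1 by (simp add: \<mu>_def)
  define k where "k = (\<lambda>m. nat \<lceil>\<beta> * dd m\<rceil>)"
  define u where "u = (\<lambda>m. real (k m) / dd m)"
  define w where "w = (\<lambda>m. pp m * real (nn m) / dd m)"
  have wl: "w \<longlonglongrightarrow> \<mu>" unfolding w_def \<mu>_def by (rule mean_right)
  have dd0: "\<forall>\<^sub>F m in sequentially. dd m > 0" using dd_at_top by (simp add: filterlim_at_top_dense)
  have ul: "u \<longlonglongrightarrow> \<beta>"
  proof (rule tendsto_sandwich)
    show "\<forall>\<^sub>F m in sequentially. \<beta> \<le> u m" using dd0
    proof eventually_elim
      case (elim m)
      have "real (k m) \<ge> \<beta> * dd m" unfolding k_def by (rule real_nat_ceiling_ge)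
      thus ?case using elim by (simp add: u_def field_simps)
    qed
    show "\<forall>\<^sub>F m in sequentially. u m \<le> \<beta> + 1 / dd m" using dd0
    proof eventually_elim
      case (elim m)
      have "\<beta> * dd m > 0" using elim \<beta> by simp
      hence "real (k m) \<le> \<beta> * dd m + 1" unfolding k_def by linarith
      thus ?case using elim by (simp add: u_def field_simps)
    qed
    show "(\<lambda>m. \<beta> + 1 / dd m) \<longlonglongrightarrow> \<beta>" using tendsto_add[OF tendsto_const lim_over_dd, of \<beta> 1] by simp
  qed simp
  have kd: "\<forall>\<^sub>F m in sequentially. real (k m) = u m * dd m" using dd0 by eventually_elim (simp add: u_def)
  have ktop: "filterlim (\<lambda>m. real (k m)) at_top sequentially"
  proof (rule filterlim_at_top_mono)
    show "filterlim (\<lambda>m. \<beta> * dd m) at_top sequentially"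
      by (rule filterlim_tendsto_pos_mult_at_top[OF tendsto_const \<beta>(1) dd_at_top])
    show "\<forall>\<^sub>F m in sequentially. \<beta> * dd m \<le> real (k m)" unfolding k_def by (intro always_eventually allI real_nat_ceiling_ge)
  qed
  have lnk: "(\<lambda>m. ln (real (k m)) / real (k m)) \<longlonglongrightarrow> 0"
    by (rule filterlim_compose[OF _ ktop]) real_asymp
  have kn: "(\<lambda>m. real (k m) / real (nn m)) \<longlonglongrightarrow> 0"
  proof -
    have "(\<lambda>m. u m / w m * pp m) \<longlonglongrightarrow> \<beta> / \<mu> * 0"
      using \<mu> by (intro tendsto_mult tendsto_divide ul wl pp_lim) auto
    moreover have "\<forall>\<^sub>F m in sequentially. u m / w m * pp m = real (k m) / real (nn m)"
      using ev_basic by eventually_elim (simp add: u_def w_def)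
    ultimately show ?thesis by (simp add: Lim_transform_eventually)
  qed
  have lim: "(\<lambda>m. u m * (ln (w m / u m) + ln (1 - real (k m) / real (nn m)) + 1) - 1 / dd m - ln (real (k m)) / real (k m) * u m - w m - 2 * (w m * pp m))
    \<longlonglongrightarrow> \<beta> * (ln (\<mu> / \<beta>) + ln (1 - 0) + 1) - 0 - 0 * \<beta> - \<mu> - 2 * (\<mu> * 0)"
    using \<mu> \<beta> by (intro tendsto_diff tendsto_mult tendsto_add tendsto_ln tendsto_divide tendsto_const ul wl pp_lim lnk kn lim_over_dd) auto
  have val: "\<beta> * (ln (\<mu> / \<beta>) + ln (1 - 0) + 1) - 0 - 0 * \<beta> - \<mu> - 2 * (\<mu> * 0) = - rate \<beta> \<mu>"
  proof -
    have "ln (\<mu> / \<beta>) = - ln (\<beta> / \<mu>)" using \<mu> \<beta> by (simp add: ln_div)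
    thus ?thesis by (simp add: rate_def algebra_simps)
  qed
  have gt: "- rate \<beta> \<mu> > - ((1 + b * rate \<beta> \<mu>) / 2 / b)" using \<beta>(2) b by (simp add: \<mu>_def field_simps)
  have e1: "\<forall>\<^sub>F m in sequentially. u m * (ln (w m / u m) + ln (1 - real (k m) / real (nn m)) + 1) - 1 / dd m
      - ln (real (k m)) / real (k m) * u m - w m - 2 * (w m * pp m) > - ((1 + b * rate \<beta> \<mu>) / 2 / b)"
    by (rule order_tendstoD(1)[OF lim[unfolded val] gt])
  \<comment> \<open>Midway between \<open>b * rate \<beta> \<mu>\<close> and 1: one half of the gap
    absorbs the error terms, the other leaves a positive power of N.\<close>
  define \<rho> where "\<rho> = (1 + b * rate \<beta> \<mu>) / 2"
  have \<rho>: "\<rho> < 1" using \<beta>(2) by (simp add: \<rho>_def \<mu>_def)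
  have g': "\<gamma> + 1 > 0" using \<gamma> by simp
  define e where "e = 1 - \<rho>"
  have e: "e > 0" using \<rho> by (simp add: e_def)
  have "\<forall>\<^sub>F x in at_top. x powr e / (\<gamma> + 1) \<ge> ln x" using e g' by real_asymp
  note e2 = ev_NN[OF this]
  have e3: "\<forall>\<^sub>F m in sequentially. real (k m) / real (nn m) < 1" using kn by (rule order_tendstoD) simp
  have e4: "\<forall>\<^sub>F m in sequentially. real (k m) \<ge> 1" using ktop unfolding filterlim_at_top by blast
  show ?thesis using e1 e2 e3 e4 ev_basic
  proof eventually_elim
    case (elim m)
    have d: "dd m > 0" and nn0: "real (nn m) > 0" and N0: "real (NN m) > 0" using elim(5) by linarith+
    have k0: "real (k m) > 0" using elim(4) by linarith
    have kud: "real (k m) = u m * dd m" using d by (simp add: u_def)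
    have npd: "real (nn m) * pp m = w m * dd m" using d by (simp add: w_def)
    have wu: "real (nn m) * pp m / real (k m) = w m / u m" unfolding kud npd using d by simp
    have eq: "real (k m) * (ln (real (nn m) * pp m / real (k m)) + ln (1 - real (k m) / real (nn m)) + 1) - 1 - ln (real (k m)) - real (nn m) * pp m - 2 * real (nn m) * (pp m)\<^sup>2
       = (u m * (ln (w m / u m) + ln (1 - real (k m) / real (nn m)) + 1) - 1 / dd m - ln (real (k m)) / real (k m) * u m - w m - 2 * (w m * pp m)) * dd m"
    proof -
      have "ln (real (k m)) / real (k m) * u m * dd m = ln (real (k m))" using k0 by (simp add: mult.assoc flip: kud)
      moreover have "2 * real (nn m) * (pp m)\<^sup>2 = 2 * (w m * pp m) * dd m"
      proof -
        have "2 * real (nn m) * (pp m)\<^sup>2 = 2 * ((real (nn m) * pp m) * pp m)" by (simp add: power2_eq_square)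
        thus ?thesis unfolding npd by simp
      qed
      moreover have "1 / dd m * dd m = 1" using d by simp
      moreover have "real (k m) * (ln (w m / u m) + ln (1 - real (k m) / real (nn m)) + 1)
        = (u m * (ln (w m / u m) + ln (1 - real (k m) / real (nn m)) + 1)) * dd m" unfolding kud by simp
      ultimately show ?thesis unfolding wu unfolding npd by (simp only: left_diff_distrib)
    qed
    have ex: "real (k m) * (ln (real (nn m) * pp m / real (k m)) + ln (1 - real (k m) / real (nn m)) + 1) - 1 - ln (real (k m)) - real (nn m) * pp m - 2 * real (nn m) * (pp m)\<^sup>2
       \<ge> - (\<rho> / b) * dd m" unfolding eq using elim(1) d by (intro mult_right_mono) (auto simp: \<rho>_def)
    have Np: "real (NN m) powr (- \<rho>) = exp (- (\<rho> / b) * dd m)" using b N0 by (simp add: dd_def powr_def)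
    have "real (NN m) powr (- \<rho>) \<le> exp (real (k m) * (ln (real (nn m) * pp m / real (k m)) + ln (1 - real (k m) / real (nn m)) + 1) - 1 - ln (real (k m)) - real (nn m) * pp m - 2 * real (nn m) * (pp m)\<^sup>2)"
      unfolding Np exp_le_cancel_iff by (rule ex)
    also have "\<dots> \<le> pmf (binomial_pmf (nn m) (pp m)) (k m)"
    proof (rule binomial_pmf_lower)
      show "0 < pp m" "pp m \<le> 1/2" using elim(5) by linarith+
      show "1 \<le> k m" using elim(4) by simp
      show "k m < nn m" using elim(3) nn0 by simp
    qed
    finally have pl: "real (NN m) powr (- \<rho>) \<le> pmf (binomial_pmf (nn m) (pp m)) (k m)" .
    have "ln (real (NN m)) \<le> real (NN m) powr e / (\<gamma> + 1)" using elim(2) .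
    also have "\<dots> = real (NN m) / (\<gamma> + 1) * real (NN m) powr (- \<rho>)"
    proof -
      have "real (NN m) powr e = real (NN m) powr 1 * real (NN m) powr (- \<rho>)" unfolding powr_add[symmetric] by (simp add: e_def)
      thus ?thesis using N0 by simp
    qed
    also have "\<dots> \<le> real m * pmf (binomial_pmf (nn m) (pp m)) (k m)" using NN_le_m[of m] pl by (intro mult_mono) auto
    finally have "exp (- real m * pmf (binomial_pmf (nn m) (pp m)) (k m)) \<le> exp (- ln (real (NN m)))" by simp
    also have "\<dots> = real (NN m) powr (- 1)" using N0 by (simp add: powr_def)
    finally have A1: "exp (- real m * pmf (binomial_pmf (nn m) (pp m)) (k m)) \<le> real (NN m) powr (- 1)" .
    have "{A. \<forall>j<m. real (dg (gset (nn m) m A) (nn m + j)) < \<beta> * dd m} \<subseteq> {A. \<forall>j<m. dg (gset (nn m) m A) (nn m + j) < k m}"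
      by (auto simp: k_def less_ceiling_iff zless_nat_eq_int_zless)
    hence "MM m {A. \<forall>j<m. real (dg (gset (nn m) m A) (nn m + j)) < \<beta> * dd m} \<le> MM m {A. \<forall>j<m. dg (gset (nn m) m A) (nn m + j) < k m}"
      by (rule measure_pmf.finite_measure_mono) simp
    also have "\<dots> \<le> exp (- real m * pmf (binomial_pmf (nn m) (pp m)) (k m))"
      using elim(5) by (intro prob_no_heavy_le) linarith+
    finally show ?case using A1 by linarith
  qed
qed

end

section \<open>The upper tail\<close>

lemma rate_pos:
  assumes "a > 0" "\<mu> > 0" "a \<noteq> \<mu>"
  shows "rate a \<mu> > 0"
proof -
  have x: "\<mu> / a > 0" "\<mu> / a \<noteq> 1" using assms by auto
  have "ln (\<mu> / a) < \<mu> / a - 1" using ln_le_minus_one[OF x(1)] ln_eq_minus_one[OF x(1)] x(2) by fastforce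
  hence "a * ln (\<mu> / a) < a * (\<mu> / a - 1)" using assms(1) by simp
  also have "a * (\<mu> / a - 1) = \<mu> - a" using assms(1) by (simp add: right_diff_distrib)
  finally have "a * ln (\<mu> / a) < \<mu> - a" .
  moreover have "ln (a / \<mu>) = - ln (\<mu> / a)" using assms by (simp add: ln_div)
  ultimately show ?thesis by (simp add: rate_def)
qed

lemma prob_Un_le: "measure_pmf.prob P (A \<union> B) \<le> measure_pmf.prob P A + measure_pmf.prob P B"
  by (rule measure_Un_le) auto

text \<open>With x = q^2 this says that the second part is at least as likely as the first to reach
  its critical degree. Concavity of the logarithm is applied to \<open>x\<close> as the mean of 1
  and \<open>1 + x\<close> with weight \<open>1 - 1 / x\<close> on the latter.\<close>

lemma rate_side_mono:
  assumes "x \<ge> 1"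
  shows "rate (1 + x) x \<le> rate (1 + 1 / x) (1 / x)"
proof -
  have x: "x > 0" using assms by simp
  have "(1 - (1 - 1 / x)) * ln 1 + (1 - 1 / x) * ln (1 + x) \<le> ln ((1 - (1 - 1 / x)) *\<^sub>R 1 + (1 - 1 / x) *\<^sub>R (1 + x))"
    by (rule concave_onD[OF ln_concave]) (use assms in auto)
  also have "(1 - (1 - 1 / x)) *\<^sub>R 1 + (1 - 1 / x) *\<^sub>R (1 + x) = x" using x by (simp add: field_simps)
  finally have j: "(1 - 1 / x) * ln (1 + x) \<le> ln x" by simp
  have "1 + 1 / x = (1 + x) / x" using x by (simp add: field_simps)
  hence l1: "ln ((1 + x) / x) = ln (1 + x) - ln x" using x by (simp add: ln_div)
  have "rate (1 + 1 / x) (1 / x) - rate (1 + x) x = (1 + 1 / x) * ln (1 + x) - (1 + x) * (ln (1 + x) - ln x)"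
  proof -
    have "(1 + 1 / x) / (1 / x) = 1 + x" using x by (simp add: field_simps)
    thus ?thesis unfolding rate_def l1 by simp
  qed
  also have "\<dots> = (1 + x) * (ln x - (1 - 1 / x) * ln (1 + x))"
    using x by (simp add: field_simps)
  also have "\<dots> \<ge> 0" using j x by (intro mult_nonneg_nonneg) auto
  finally show ?thesis by simp
qed

context bip_model
begin

lemma side_of_weight: "side m (f (1 / q\<^sup>2)) (f (q\<^sup>2)) x = f (1 / (side_weight (nn m) q x)\<^sup>2)"
  by (simp add: side_def side_weight_def power_one_over)

text \<open>The squared means of the entries are negligible in the row sums of squares.\<close>

lemma drift_lim: "(\<lambda>m. real (NN m) * (pp m)\<^sup>2 / dd m) \<longlonglongrightarrow> 0"
proof -
  have "(\<lambda>m. (pp m * real (nn m) / dd m + pp m * real m / dd m) * pp m) \<longlonglongrightarrow> (q\<^sup>2 + 1 / q\<^sup>2) * 0"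
    by (intro tendsto_mult tendsto_add mean_left mean_right pp_lim)
  moreover have "(pp m * real (nn m) / dd m + pp m * real m / dd m) * pp m = real (NN m) * (pp m)\<^sup>2 / dd m" for m
    by (simp add: NN_def power2_eq_square add_divide_distrib algebra_simps)
  ultimately show ?thesis by simp
qed

text \<open>The rate is continuous, so the strict inequality survives a decrease of both degree
  bounds by \<open>\<delta>\<close> and leaves an exponent above 1 for the union over all
  vertices.\<close>

lemma max_degree_margin:
  assumes "b * rate (1 + q\<^sup>2) (q\<^sup>2) > 1"
  obtains c \<delta> where "c > 1" "0 < \<delta>" "\<delta> < 1" "c < b * rate (1 + 1 / q\<^sup>2 - \<delta>) (1 / q\<^sup>2)" "c < b * rate (1 + q\<^sup>2 - \<delta>) (q\<^sup>2)"
proof -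
  have q2: "q\<^sup>2 \<ge> 1" using q_ge1 by simp
  define c where "c = (1 + b * rate (1 + q\<^sup>2) (q\<^sup>2)) / 2"
  have c: "c > 1" "c < b * rate (1 + q\<^sup>2) (q\<^sup>2)" using assms by (auto simp: c_def)
  have "b * rate (1 + q\<^sup>2) (q\<^sup>2) \<le> b * rate (1 + 1 / q\<^sup>2) (1 / q\<^sup>2)" using rate_side_mono[OF q2] b by simp
  hence c': "c < b * rate (1 + 1 / q\<^sup>2) (1 / q\<^sup>2)" using c(2) by linarith
  have lim: "((\<lambda>\<delta>. b * rate (a - \<delta>) \<mu>) \<longlongrightarrow> b * rate a \<mu>) (at_right 0)" if "a > 0" "\<mu> > 0" for a \<mu>
  proof -
    have "((\<lambda>\<delta>. b * ((a - \<delta>) * ln ((a - \<delta>) / \<mu>) - (a - \<delta>) + \<mu>)) \<longlongrightarrow> b * ((a - 0) * ln ((a - 0) / \<mu>) - (a - 0) + \<mu>)) (at_right 0)"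
      using that by (intro tendsto_intros) auto
    thus ?thesis by (simp add: rate_def)
  qed
  have "\<forall>\<^sub>F \<delta> in at_right 0. c < b * rate (1 + 1 / q\<^sup>2 - \<delta>) (1 / q\<^sup>2)"
    by (rule order_tendstoD(1)[OF lim c']) (use q2 in \<open>auto intro: add_pos_nonneg\<close>)
  moreover have "\<forall>\<^sub>F \<delta> in at_right 0. c < b * rate (1 + q\<^sup>2 - \<delta>) (q\<^sup>2)"
    by (rule order_tendstoD(1)[OF lim c(2)]) (use q2 in \<open>auto intro: add_pos_nonneg\<close>)
  moreover have "\<forall>\<^sub>F \<delta> in at_right (0::real). \<delta> < 1"
    unfolding eventually_at_right_field by (intro exI[of _ 1]) auto
  moreover have "\<forall>\<^sub>F \<delta> in at_right (0::real). \<delta> > 0" by (rule eventually_at_right_less)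
  ultimately have "\<forall>\<^sub>F \<delta> in at_right 0. c < b * rate (1 + 1 / q\<^sup>2 - \<delta>) (1 / q\<^sup>2) \<and> c < b * rate (1 + q\<^sup>2 - \<delta>) (q\<^sup>2) \<and> \<delta> < 1 \<and> \<delta> > 0"
    by eventually_elim simp
  then obtain \<delta> where "c < b * rate (1 + 1 / q\<^sup>2 - \<delta>) (1 / q\<^sup>2) \<and> c < b * rate (1 + q\<^sup>2 - \<delta>) (q\<^sup>2) \<and> \<delta> < 1 \<and> \<delta> > 0"
    using eventually_happens'[OF trivial_limit_at_right_real] by blast
  thus ?thesis using that c(1) by blast
qed

lemma upper_tail:
  assumes "b * rate (1 + q\<^sup>2) (q\<^sup>2) > 1"
  shows "\<exists>\<nu>>0. \<forall>\<epsilon>>0. \<forall>\<^sub>F m in sequentially.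
    MM m {A. lambda1 (NN m) (centH (nn m) (pp m) (dd m) A) > q + 1 / q + \<epsilon>} \<le> real (NN m) powr (- \<nu>)"
proof -
  obtain c1 \<delta> where c1: "c1 > 1" and \<delta>: "0 < \<delta>" "\<delta> < 1"
    and r1: "c1 < b * rate (1 + 1 / q\<^sup>2 - \<delta>) (1 / q\<^sup>2)" and r2: "c1 < b * rate (1 + q\<^sup>2 - \<delta>) (q\<^sup>2)"
    using max_degree_margin[OF assms] by blast
  \<comment> \<open>Fixed before \<epsilon>: the four events below fail with exponents
    \<open>c1 - 1\<close>, 1/4, 1/2 and 1, none of which depends on \<epsilon>.\<close>
  define \<nu>0 where "\<nu>0 = min (c1 - 1) (1/4)"
  have \<nu>0: "\<nu>0 > 0" "\<nu>0 \<le> c1 - 1" "\<nu>0 \<le> 1/4" using c1 unfolding \<nu>0_def min_def by auto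
  have q: "q \<ge> 1" "q > 0" and q2: "q\<^sup>2 \<ge> 1" "q\<^sup>2 > 0" using q_ge1 by (auto simp: zero_less_power2)
  let ?H = "\<lambda>m. centH (nn m) (pp m) (dd m)"
  let ?G = "\<lambda>m. gset (nn m) m"
  have "\<forall>\<^sub>F m in sequentially. MM m {A. lambda1 (NN m) (?H m A) > q + 1 / q + \<epsilon>} \<le> real (NN m) powr (- (\<nu>0 / 2))" if \<epsilon>: "\<epsilon> > 0" for \<epsilon>
  proof -
    \<comment> \<open>The budget: one third of \<epsilon> goes into \<open>\<Lambda>\<close>, one
      into the shell, one into the mean of the entries. Within \<open>\<Lambda>\<close>,
      \<open>\<tau>\<close> is the tolerance for typical degrees, and \<open>s\<close> is kept below
      1 so that the trace bound can decay.\<close>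
    define \<tau> where "\<tau> = \<epsilon> / (12 * q)"
    have \<tau>: "\<tau> > 0" "\<tau> * q = \<epsilon> / 12" using \<epsilon> q by (auto simp: \<tau>_def)
    define \<Lambda> where "\<Lambda> = q + 1 / q + \<epsilon> / 3"
    have \<Lambda>: "\<Lambda> > 0" using q \<epsilon> by (simp add: \<Lambda>_def add_pos_pos)
    define s where "s = (q + 1 / q + \<epsilon> / 6) / \<Lambda>"
    have s: "0 < s" "s < 1" "s * \<Lambda> = q + 1 / q + \<epsilon> / 6" using q \<epsilon> \<Lambda> by (auto simp: s_def add_pos_pos) (simp add: \<Lambda>_def)
    define R where "R = nat \<lceil>6 * \<Lambda> / \<epsilon>\<rceil>"
    have "6 * \<Lambda> / \<epsilon> > 0" using \<Lambda> \<epsilon> by simp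
    moreover have Rge: "real R \<ge> 6 * \<Lambda> / \<epsilon>" unfolding R_def by (rule real_nat_ceiling_ge)
    ultimately have R: "R \<ge> 1" by linarith
    have R2: "2 * \<Lambda> / real R \<le> \<epsilon> / 3" using Rge R \<epsilon> by (simp add: field_simps)
    define a1 where "a1 = (1 + \<tau>) * (1 / q\<^sup>2)"
    define a2 where "a2 = (1 + \<tau>) * q\<^sup>2"
    have a: "a1 > 1 / q\<^sup>2" "a2 > q\<^sup>2" using \<tau>(1) q2 by (auto simp: a1_def a2_def distrib_right divide_strict_right_mono)
    have a0: "a1 > 0" "a2 > 0" using a q2 by (auto intro: less_trans[rotated])
    have rp: "rate a1 (1 / q\<^sup>2) > 0" "rate a2 (q\<^sup>2) > 0" using a a0 q2 by (auto intro!: rate_pos)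
    define c where "c = min (1/2) (b * min (rate a1 (1 / q\<^sup>2)) (rate a2 (q\<^sup>2)) / 2)"
    have c: "c > 0" "c < 1" using rp b by (auto simp: c_def)
    have cr: "c < b * rate a1 (1 / q\<^sup>2)" "c < b * rate a2 (q\<^sup>2)"
    proof -
      have "c \<le> b * min (rate a1 (1 / q\<^sup>2)) (rate a2 (q\<^sup>2)) / 2" by (simp add: c_def)
      also have "\<dots> < b * min (rate a1 (1 / q\<^sup>2)) (rate a2 (q\<^sup>2))" using rp b by simp
      finally have "c < b * min (rate a1 (1 / q\<^sup>2)) (rate a2 (q\<^sup>2))" .
      moreover have "b * min (rate a1 (1 / q\<^sup>2)) (rate a2 (q\<^sup>2)) \<le> b * rate a1 (1 / q\<^sup>2)"
        "b * min (rate a1 (1 / q\<^sup>2)) (rate a2 (q\<^sup>2)) \<le> b * rate a2 (q\<^sup>2)" using b by (auto intro!: mult_left_mono)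
      ultimately show "c < b * rate a1 (1 / q\<^sup>2)" "c < b * rate a2 (q\<^sup>2)" by linarith+
    qed
    define k where "k = nat \<lceil>3 / (2 * c) + 2\<rceil>"
    have k: "real k \<ge> 3 / (2 * c) + 2" unfolding k_def by (rule real_nat_ceiling_ge)
    have "3 / (2 * c) > 0" using c by simp
    hence k0: "real k > 0" using k by linarith
    define f0 where "f0 = (k + 1) * (R + 3)"
    define \<eta> where "\<eta> = \<delta> / (q * real k)"
    have \<eta>: "\<eta> > 0" "\<eta> * real k \<le> \<delta> / q" using \<delta> q k0 by (auto simp: \<eta>_def)
    obtain l where E4: "\<forall>\<^sub>F m in sequentially. MM m {A. s ^ (2 * l m) * nb_hs (NN m) (?H m A) (l m) \<ge> 1} \<le> real (NN m) powr (- 1)"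
      using ev_trace[OF s(1,2)] by blast
    have b1: "0 < 1 + 1 / q\<^sup>2 - \<delta>" "0 < 1 + q\<^sup>2 - \<delta>" "1 / q\<^sup>2 < 1 + 1 / q\<^sup>2 - \<delta>" "q\<^sup>2 < 1 + q\<^sup>2 - \<delta>"
      using \<delta> q2 by (auto intro: add_pos_nonneg simp: algebra_simps) (smt (verit) divide_nonneg_nonneg)+
    define X where "X = (\<lambda>m A. tset m (1 + 1 / q\<^sup>2 - \<delta>) (1 + q\<^sup>2 - \<delta>) A)"
    define S where "S = (\<lambda>m A. tset m a1 a2 A)"
    \<comment> \<open>Bound for the \<open>R\<close>-neighbourhood of the exceptional set: N^(1 -
      c/2) up to logarithms, small enough for p sqrt M sqrt N to vanish.\<close>
    define M where "M = (\<lambda>m. real (NN m) powr (1 - c / 2) * (1 + (1 + q\<^sup>2) * dd m) ^ R)"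
    have E1: "\<forall>\<^sub>F m in sequentially. MM m {A. X m A \<noteq> {}} \<le> real (NN m) powr (1 - c1)"
      unfolding X_def by (rule ev_tset_empty[OF b1(1,2) r1 r2])
    have E2: "\<forall>\<^sub>F m in sequentially. MM m {A. \<exists>F J. dense_cluster f0 c (1/2) (?G m A) (S m A) F J} \<le> real (NN m) powr (- (1/2/2))"
      unfolding S_def by (rule ev_dense[OF a0 cr]) simp
    have E3: "\<forall>\<^sub>F m in sequentially. MM m {A. real (card (S m A)) \<ge> real (NN m) powr (1 - c / 2)} \<le> real (NN m) powr (- (1/2))"
      unfolding S_def by (rule ev_card_tset[OF a0 c cr])
    have P1: "\<forall>\<^sub>F m in sequentially. q + 1 / q + \<tau> * q + real k / (\<eta> * dd m) < \<Lambda>"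
    proof -
      have "(\<lambda>m. q + 1 / q + \<tau> * q + (real k / \<eta>) / dd m) \<longlonglongrightarrow> q + 1 / q + \<tau> * q + 0"
        by (intro tendsto_add tendsto_const lim_over_dd)
      moreover have "q + 1 / q + \<tau> * q + 0 < \<Lambda>" using \<tau> \<epsilon> by (simp add: \<Lambda>_def)
      ultimately show ?thesis by (auto dest: order_tendstoD(2))
    qed
    have P2: "\<forall>\<^sub>F m in sequentially. w * (1 + s\<^sup>2 / (1 - 1 / sqrt (dd m)) * ((1 + \<tau>) / w\<^sup>2 + real (NN m) * (pp m)\<^sup>2 / dd m)) < s * \<Lambda>"
      if w: "w = q \<or> w = 1 / q" for w
    proof -
      have w0: "w > 0" using w q by auto
      have "filterlim (\<lambda>m. sqrt (dd m)) at_top sequentially"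
        using filterlim_compose[OF sqrt_at_top dd_at_top] .
      hence sq: "(\<lambda>m. 1 / sqrt (dd m)) \<longlonglongrightarrow> 0"
        by (intro tendsto_divide_0[OF tendsto_const] filterlim_at_top_imp_at_infinity)
      have "(\<lambda>m. w * (1 + s\<^sup>2 / (1 - 1 / sqrt (dd m)) * ((1 + \<tau>) / w\<^sup>2 + real (NN m) * (pp m)\<^sup>2 / dd m)))
        \<longlonglongrightarrow> w * (1 + s\<^sup>2 / (1 - 0) * ((1 + \<tau>) / w\<^sup>2 + 0))"
        by (intro tendsto_intros sq drift_lim) simp
      moreover have "w * (1 + s\<^sup>2 / (1 - 0) * ((1 + \<tau>) / w\<^sup>2 + 0)) < s * \<Lambda>"
      proof -
        have "w * (1 + s\<^sup>2 / (1 - 0) * ((1 + \<tau>) / w\<^sup>2 + 0)) = w + s\<^sup>2 * ((1 + \<tau>) / w)"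
          using w0 by (simp add: field_simps power2_eq_square)
        also have "\<dots> \<le> w + 1 * ((1 + \<tau>) / w)" using s(1,2) w0 \<tau> by (intro add_left_mono mult_right_mono) (auto simp: power_le_one)
        also have "\<dots> = w + 1 / w + \<tau> / w" by (simp add: add_divide_distrib)
        also have "\<dots> \<le> q + 1 / q + \<tau> * q"
        proof -
          have "\<tau> / w \<le> \<tau> * q"
          proof -
            have "1 / q \<le> q" using q by (simp add: divide_le_eq) (metis mult_mono' mult_1 zero_le_one)
            hence "1 / w \<le> q" using w by auto
            hence "\<tau> * (1 / w) \<le> \<tau> * q" by (rule mult_left_mono) (use \<tau>(1) in simp)
            thus ?thesis by (simp only: times_divide_eq_right mult_1_right)
          qed
          moreover have "w + 1 / w = q + 1 / q" using w by auto
          ultimately show ?thesis by simp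
        qed
        also have "\<dots> < s * \<Lambda>" unfolding s(3) using \<tau>(2) \<epsilon> by simp
        finally show ?thesis .
      qed
      ultimately show ?thesis by (rule order_tendstoD(2))
    qed
    have P3: "\<forall>\<^sub>F m in sequentially. 3 * (LL m / real (NN m)) * sqrt (M m) * sqrt (real (NN m)) < \<epsilon> / 3"
    proof -
      have c2: "c / 2 > 0" and q3: "1 + q\<^sup>2 > 0" using c q2 by auto
      have "((\<lambda>x. 3 * ((\<gamma> + 1) * (b * ln x) / x) * sqrt (x powr (1 - c / 2) * (1 + (1 + q\<^sup>2) * (b * ln x)) ^ R) * sqrt x) \<longlongrightarrow> 0) at_top"
        using c2 q3 b \<gamma> by real_asymp
      hence "\<forall>\<^sub>F x in at_top. 3 * ((\<gamma> + 1) * (b * ln x) / x) * sqrt (x powr (1 - c / 2) * (1 + (1 + q\<^sup>2) * (b * ln x)) ^ R) * sqrt x < \<epsilon> / 3"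
        by (rule order_tendstoD) (use \<epsilon> in simp)
      from ev_NN[OF this] show ?thesis by (simp add: M_def LL_def dd_def)
    qed
    have "\<nu>0 / 2 < \<nu>0" using \<nu>0 by simp
    note P4 = ev_powr_cmp[OF this, of 4 0]
    show ?thesis using E1 E2 E3 E4 P1 P2[OF disjI1[OF refl]] P2[OF disjI2[OF refl]] P3 P4 ev_basic
    proof eventually_elim
      case (elim m)
      note ba = elim(10)
      \<comment> \<open>The bad events: a degree beyond the critical one, a dense cluster, too many
        exceptional vertices, a large trace.\<close>
      define B1 where "B1 = {A. X m A \<noteq> {}}"
      define B2 where "B2 = {A. \<exists>F J. dense_cluster f0 c (1/2) (?G m A) (S m A) F J}"
      define B3 where "B3 = {A. real (card (S m A)) \<ge> real (NN m) powr (1 - c / 2)}"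
      define B4 where "B4 = {A. s ^ (2 * l m) * nb_hs (NN m) (?H m A) (l m) \<ge> 1}"
      have d: "dd m > 4" and pp: "0 \<le> pp m" "pp m \<le> 1" and N1: "real (NN m) \<ge> 1" using ba by linarith+
      have good: "lambda1 (NN m) (?H m A) \<le> q + 1 / q + \<epsilon>" if A: "A \<notin> B1" "A \<notin> B2" "A \<notin> B3" "A \<notin> B4" for A
      proof -
        let ?w = "side_weight (nn m) q"
        have w: "?w x = q \<or> ?w x = 1 / q" for x by (simp add: side_weight_def)
        have w0: "?w x > 0" for x using w[of x] q by auto
        have maxdeg: "real (dg (?G m A) x) \<le> (1 + 1 / (?w x)\<^sup>2 - \<delta>) * dd m" if x: "x < nn m + m" for x
        proof -
          have "x \<notin> X m A" using A(1) by (simp add: B1_def)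
          hence "real (dg (?G m A) x) < side m (1 + 1 / q\<^sup>2 - \<delta>) (1 + q\<^sup>2 - \<delta>) x * dd m"
            unfolding X_def tset_heavy[OF b1(3,4)] using x by (simp add: NN_def)
          thus ?thesis using side_of_weight[of m "\<lambda>u. 1 + u - \<delta>" x] by simp
        qed
        have typical: "real (dg (?G m A) x) \<le> (1 + \<tau>) / (?w x)\<^sup>2 * dd m" if x: "x < nn m + m" "x \<notin> S m A" for x
        proof -
          have "real (dg (?G m A) x) < side m a1 a2 x * dd m"
            using x(2) unfolding S_def tset_heavy[OF a] using x(1) by (simp add: NN_def)
          thus ?thesis using side_of_weight[of m "\<lambda>u. (1 + \<tau>) * u" x] by (simp add: a1_def a2_def)
        qed
        have SN: "S m A \<subseteq> {..<nn m + m}" using tset_subset[of m a1 a2 A] by (simp add: S_def NN_def)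
        have cl: "(\<Sum>y\<in>nbh (?G m A) (S m A) i. \<Sum>z\<in>nbh (?G m A) (S m A) i.
            of_bool (ed y z \<in> ?G m A) * (1 / sqrt (dd m) * (\<bar>v y\<bar> * \<bar>v z\<bar>))) \<le> \<Lambda> * (\<Sum>y\<in>nbh (?G m A) (S m A) i. (v y)\<^sup>2)"
          if i: "i \<le> R + 1" for i v
        proof -
          have "(\<Sum>y\<in>nbh (?G m A) (S m A) i. \<Sum>z\<in>nbh (?G m A) (S m A) i.
            of_bool (ed y z \<in> ?G m A) * (1 / sqrt (dd m) * (\<bar>v y\<bar> * \<bar>v z\<bar>)))
            \<le> (q + 1 / q + \<tau> * q + real k / (\<eta> * dd m)) * (\<Sum>y\<in>nbh (?G m A) (S m A) i. (v y)\<^sup>2)"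
          proof (rule cluster_bound[OF gset_subset SN c(1) _ k _ _ q(1) \<eta> i maxdeg typical])
            show "\<not> dense_cluster f0 c (1/2) (?G m A) (S m A) F J" for F J using A(2) by (auto simp: B2_def)
            show "(k + 1) * (R + 3) \<le> f0" by (simp add: f0_def)
          qed (use d \<tau> \<delta> in auto)
          also have "\<dots> \<le> \<Lambda> * (\<Sum>y\<in>nbh (?G m A) (S m A) i. (v y)\<^sup>2)"
            using elim(5) by (intro mult_right_mono sum_nonneg) auto
          finally show ?thesis .
        qed
        have bulk: "?w x * (1 + s\<^sup>2 / (1 - 1 / sqrt (dd m)) * ((real (dg (?G m A) x) + real (nn m + m) * (pp m)\<^sup>2) / dd m)) \<le> s * \<Lambda>"
          if x: "x < nn m + m" "x \<notin> S m A" for x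
        proof -
          have sd: "sqrt (dd m) > 1" using d by simp
          have "(real (dg (?G m A) x) + real (nn m + m) * (pp m)\<^sup>2) / dd m \<le> ((1 + \<tau>) / (?w x)\<^sup>2 * dd m + real (NN m) * (pp m)\<^sup>2) / dd m"
            using typical[OF x] d by (intro divide_right_mono) (auto simp: NN_def)
          also have "\<dots> = (1 + \<tau>) / (?w x)\<^sup>2 + real (NN m) * (pp m)\<^sup>2 / dd m" using d by (simp add: add_divide_distrib)
          finally have "?w x * (1 + s\<^sup>2 / (1 - 1 / sqrt (dd m)) * ((real (dg (?G m A) x) + real (nn m + m) * (pp m)\<^sup>2) / dd m))
              \<le> ?w x * (1 + s\<^sup>2 / (1 - 1 / sqrt (dd m)) * ((1 + \<tau>) / (?w x)\<^sup>2 + real (NN m) * (pp m)\<^sup>2 / dd m))"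
            using w0[of x] sd by (intro mult_left_mono add_left_mono) (auto simp: field_simps)
          also have "\<dots> \<le> s * \<Lambda>" using w[of x] elim(6,7) by (elim disjE) simp_all
          finally show ?thesis .
        qed
        have D: "real (dg (?G m A) x) \<le> (1 + q\<^sup>2) * dd m" if x: "x < nn m + m" for x
        proof -
          have "1 / q\<^sup>2 \<le> q\<^sup>2" using q2 by (smt (verit) divide_le_eq_1 )
          hence "1 / (?w x)\<^sup>2 \<le> q\<^sup>2" by (simp add: side_weight_def power_one_over)
          hence "(1 + 1 / (?w x)\<^sup>2 - \<delta>) * dd m \<le> (1 + q\<^sup>2) * dd m" using d \<delta> by (intro mult_right_mono) auto
          thus ?thesis using maxdeg[OF x] by linarith
        qed
        have cM: "real (card (nbh (?G m A) (S m A) R)) \<le> M m"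
        proof -
          have D0: "(1 + q\<^sup>2) * dd m \<ge> 0" using q2 d by simp
          have "real (card (nbh (?G m A) (S m A) R)) \<le> real (card (S m A)) * (1 + (1 + q\<^sup>2) * dd m) ^ R"
            by (rule card_nbh_le[OF gset_subset SN D D0])
          also have "\<dots> \<le> M m" unfolding M_def using A(3) D0 by (intro mult_right_mono) (auto simp: B3_def)
          finally show ?thesis .
        qed
        have hs: "s ^ (2 * l m) * nb_hs (nn m + m) (?H m A) (l m) < 1" using A(4) by (simp add: B4_def NN_def)
        have err: "3 * pp m / sqrt (dd m) * sqrt (M m) * sqrt (real (nn m + m)) \<le> \<epsilon> / 3"
        proof -
          have sd: "sqrt (dd m) \<ge> 1" using d by simp
          have M0: "M m \<ge> 0" using d q2 by (simp add: M_def)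
          have "pp m / sqrt (dd m) \<le> pp m / 1" using sd pp by (intro divide_left_mono) auto
          also have "\<dots> \<le> LL m / real (NN m)" using ba by linarith
          finally have "3 * pp m / sqrt (dd m) \<le> 3 * (LL m / real (NN m))" by simp
          hence "3 * pp m / sqrt (dd m) * sqrt (M m) * sqrt (real (NN m)) \<le> 3 * (LL m / real (NN m)) * sqrt (M m) * sqrt (real (NN m))"
            by (intro mult_right_mono) (use M0 in auto)
          thus ?thesis using elim(8) unfolding NN_def by linarith
        qed
        have "qform (nn m + m) (?H m A) v \<le> (q + 1 / q + \<epsilon>) * sqn (nn m + m) v" for v
        proof -
          have "qform (nn m + m) (?H m A) v
             \<le> (\<Lambda> + 2 * \<Lambda> / real R + 3 * pp m / sqrt (dd m) * sqrt (M m) * sqrt (real (nn m + m))) * sqn (nn m + m) v"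
            by (rule quadratic_upper_bound[OF SN pp _ q(2) s(1) _ hs bulk cl R cM]) (use d s \<Lambda> in auto)
          also have "\<dots> \<le> (q + 1 / q + \<epsilon>) * sqn (nn m + m) v"
          proof (rule mult_right_mono)
            show "\<Lambda> + 2 * \<Lambda> / real R + 3 * pp m / sqrt (dd m) * sqrt (M m) * sqrt (real (nn m + m)) \<le> q + 1 / q + \<epsilon>"
              using R2 err \<Lambda>_def by linarith
            show "0 \<le> sqn (nn m + m) v" unfolding sqn_def by (intro sum_nonneg) simp
          qed
          finally show ?thesis .
        qed
        thus ?thesis unfolding NN_def
          by (intro lambda1_le symm_upto_centH) (use ba in auto)
      qed
      have "{A. lambda1 (NN m) (?H m A) > q + 1 / q + \<epsilon>} \<subseteq> B1 \<union> B2 \<union> B3 \<union> B4"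
        using good by (auto simp: not_less[symmetric])
      hence "MM m {A. lambda1 (NN m) (?H m A) > q + 1 / q + \<epsilon>} \<le> MM m (B1 \<union> B2 \<union> B3 \<union> B4)"
        by (rule measure_pmf.finite_measure_mono) simp
      also have "\<dots> \<le> MM m B1 + MM m B2 + MM m B3 + MM m B4"
        using prob_Un_le[of _ "B1 \<union> B2 \<union> B3" B4] prob_Un_le[of _ "B1 \<union> B2" B3] prob_Un_le[of _ B1 B2] by (smt (verit))
      also have "\<dots> \<le> real (NN m) powr (- \<nu>0) + real (NN m) powr (- \<nu>0) + real (NN m) powr (- \<nu>0) + real (NN m) powr (- \<nu>0)"
      proof -
        have "real (NN m) powr (1 - c1) \<le> real (NN m) powr (- \<nu>0)" "real (NN m) powr (- (1/2/2)) \<le> real (NN m) powr (- \<nu>0)"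
          "real (NN m) powr (- (1/2)) \<le> real (NN m) powr (- \<nu>0)" "real (NN m) powr (- 1) \<le> real (NN m) powr (- \<nu>0)"
          by (rule powr_mono[OF _ N1], use \<nu>0 in linarith)+
        thus ?thesis using elim(1-4) unfolding B1_def B2_def B3_def B4_def by linarith
      qed
      also have "\<dots> \<le> real (NN m) powr (- (\<nu>0 / 2))" using elim(9) by simp
      finally show ?case .
    qed
  qed
  thus ?thesis using \<nu>0(1) by (intro exI[of _ "\<nu>0 / 2"]) auto
qed

end

section \<open>The lower tail\<close>

text \<open>Edges change sides, so the level of a tree node decides its side and with it its typical
  arity.\<close>

lemma path_parity:
  assumes G: "G \<subseteq> pot_edges n m"
  shows "p \<noteq> [] \<Longrightarrow> wed p \<subseteq> G \<Longrightarrow> last p = x \<Longrightarrow> n \<le> x \<Longrightarrow> x < n + m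
    \<Longrightarrow> hd p < n + m \<and> (hd p < n \<longleftrightarrow> even (length p))"
proof (induction p rule: wsteps.induct)
  case (1 a b c)
  have ih: "b < n + m \<and> (b < n \<longleftrightarrow> even (length (b # c)))" using 1 by simp
  have "ed a b \<in> pot_edges n m" using 1(3) G by auto
  hence "a < n + m \<and> (a < n \<longleftrightarrow> \<not> b < n)" by (auto simp: ed_def pot_edges_def min_def max_def split: if_splits)
  thus ?case using ih by simp
qed auto

lemma card_neighbours:
  assumes "v < n + m"
  shows "finite {y. ed v y \<in> gset n m A}" "card {y. ed v y \<in> gset n m A} = dg (gset n m A) v"
proof -
  have e: "{y. ed v y \<in> gset n m A} = {y\<in>{..<n+m}. ed v y \<in> gset n m A}"
    using gset_subset[of n m A] by (auto simp: ed_def pot_edges_def min_def max_def split: if_splits)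
  show "finite {y. ed v y \<in> gset n m A}" unfolding e by simp
  have "real (dg (gset n m A) v) = real (card {y\<in>{..<n+m}. ed v y \<in> gset n m A})"
    unfolding dg_gset[OF assms] by (subst sum_of_bool_card) simp_all
  thus "card {y. ed v y \<in> gset n m A} = dg (gset n m A) v" unfolding e by simp
qed

text \<open>\<open>k\<close> such neighbours would form with \<open>v\<close> a star of
  \<open>k\<close> edges and \<open>k + 1\<close> vertices, and \<open>c * real k \<ge> 3/2\<close>
  makes it a dense cluster.\<close>

lemma few_exceptional_neighbours:
  assumes v: "v < n + m" and nodense: "\<And>F J. \<not> dense_cluster f0 c (1/2) (gset n m A) B F J"
    and k: "k \<le> f0" "c * real k \<ge> 3/2"
  shows "card {y. ed v y \<in> gset n m A \<and> y \<in> B} < k"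
proof (rule ccontr)
  let ?G = "gset n m A"
  assume "\<not> card {y. ed v y \<in> ?G \<and> y \<in> B} < k"
  hence "k \<le> card {y. ed v y \<in> ?G \<and> y \<in> B}" by simp
  from obtain_subset_with_card_n[OF this] obtain T
    where T: "T \<subseteq> {y. ed v y \<in> ?G \<and> y \<in> B}" "card T = k" "finite T" by blast
  have k0: "k \<noteq> 0" using k(2) by (cases "k = 0") auto
  define F where "F = ed v ` T"
  have vT: "v \<notin> T" using T(1) gset_subset[of n m A] by (auto simp: ed_def pot_edges_def)
  have cF: "card F = k" unfolding F_def using T(2) by (subst card_image) (auto simp: inj_on_def)
  have vF: "verts F = insert v T"
  proof -
    have "{fst (ed v y), snd (ed v y)} = {v, y}" for y by (auto simp: ed_def min_def max_def)
    hence "verts F = (\<Union>y\<in>T. {v, y})" unfolding verts_def F_def by blast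
    moreover have "T \<noteq> {}" using T(2) k0 by auto
    ultimately show ?thesis by auto
  qed
  have "dense_cluster f0 c (1/2) ?G B F T" unfolding dense_cluster_def
  proof (intro conjI)
    show "F \<subseteq> ?G" "T \<subseteq> B" using T(1) by (auto simp: F_def)
    show "card F \<le> f0" using cF k(1) by simp
    show "T \<subseteq> verts F" using vF by auto
    show "real (card (verts F)) + 1/2 \<le> real (card F) + c * real (card T)"
      unfolding vF using vT T(2,3) cF k(2) by simp
  qed
  thus False using nodense by blast
qed

text \<open>Twice the product of consecutive values is the sum of their squares minus
  \<open>h\<^sup>2\<close>, and the two edges at an inner level have weights \<open>q\<close> and
  \<open>1 / q\<close>. The losses are the missing edges at both ends and the slope.\<close>

lemma alternating_profile:
  fixes q h :: real and w :: "nat \<Rightarrow> real"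
  assumes q: "q \<ge> 1" and sg: "\<And>i. sg i = (if odd i then 1 / q else q)"
    and w: "\<And>i. i < k \<Longrightarrow> w i - w (Suc i) = h"
  shows "2 * (\<Sum>i<k. w i * w (Suc i) * sg (Suc i)) \<ge>
    (q + 1 / q) * (\<Sum>i\<le>k. (w i)\<^sup>2) - q * (w 0)\<^sup>2 - sg (Suc k) * (w k)\<^sup>2 - h\<^sup>2 * q * real k"
  using w
proof (induction k)
  case 0
  show ?case by (simp add: sg algebra_simps)
next
  case (Suc k)
  have ih: "2 * (\<Sum>i<k. w i * w (Suc i) * sg (Suc i)) \<ge>
    (q + 1 / q) * (\<Sum>i\<le>k. (w i)\<^sup>2) - q * (w 0)\<^sup>2 - sg (Suc k) * (w k)\<^sup>2 - h\<^sup>2 * q * real k"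
    using Suc by simp
  have hh: "h = w k - w (Suc k)" using Suc.prems[of k] by simp
  have "1 / q \<le> 1" using q by simp
  hence "1 / q \<le> q" using q by linarith
  hence sq: "sg (Suc k) \<le> q" unfolding sg by (cases "odd (Suc k)") simp_all
  have two: "2 * (w k * w (Suc k) * sg (Suc k)) = sg (Suc k) * (w k)\<^sup>2 + sg (Suc k) * (w (Suc k))\<^sup>2 - h\<^sup>2 * sg (Suc k)"
    unfolding hh by (simp add: power2_eq_square algebra_simps)
  have l: "(q + 1 / q) * (w (Suc k))\<^sup>2 = sg (Suc k) * (w (Suc k))\<^sup>2 + sg (Suc (Suc k)) * (w (Suc k))\<^sup>2"
    by (simp add: sg algebra_simps)
  have "h\<^sup>2 * sg (Suc k) \<le> h\<^sup>2 * q" using sq by (intro mult_left_mono) auto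
  moreover have "h\<^sup>2 * q * real (Suc k) = h\<^sup>2 * q * real k + h\<^sup>2 * q" by (simp add: algebra_simps)
  moreover have "(q + 1 / q) * (\<Sum>i\<le>Suc k. (w i)\<^sup>2) = (q + 1 / q) * (\<Sum>i\<le>k. (w i)\<^sup>2) + (q + 1 / q) * (w (Suc k))\<^sup>2"
    by (simp add: distrib_left)
  moreover have "2 * (\<Sum>i<Suc k. w i * w (Suc i) * sg (Suc i)) = 2 * (\<Sum>i<k. w i * w (Suc i) * sg (Suc i)) + 2 * (w k * w (Suc k) * sg (Suc k))"
    by simp
  ultimately show ?case using ih two l by linarith
qed

context bip_model
begin

lemma pp_dd_power: "(\<lambda>m. pp m / sqrt (dd m) * dd m ^ i) \<longlonglongrightarrow> 0"
proof (rule tendsto_sandwich)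
  show "\<forall>\<^sub>F m in sequentially. 0 \<le> pp m / sqrt (dd m) * dd m ^ i"
    using ev_basic by eventually_elim auto
  show "\<forall>\<^sub>F m in sequentially. pp m / sqrt (dd m) * dd m ^ i \<le> LL m / real (NN m) * dd m ^ i"
    using ev_basic
  proof eventually_elim
    case (elim m)
    have d: "dd m > 4" and pp: "0 \<le> pp m" using elim by linarith+
    have "sqrt (dd m) \<ge> 1" using d by simp
    hence "pp m / sqrt (dd m) \<le> pp m / 1" using pp by (intro divide_left_mono) auto
    also have "\<dots> \<le> LL m / real (NN m)" using elim by linarith
    finally show ?case using d by (intro mult_right_mono) auto
  qed
  have "((\<lambda>x. (\<gamma> + 1) * (b * ln x) / x * (b * ln x) ^ i) \<longlongrightarrow> 0) at_top" using b \<gamma> by real_asymp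
  from lim_NN[OF this] show "(\<lambda>m. LL m / real (NN m) * dd m ^ i) \<longlonglongrightarrow> 0" by (simp add: LL_def dd_def)
qed simp

lemma floor_ratio_lim:
  assumes "\<mu> > 0"
  shows "(\<lambda>m. real (nat \<lfloor>\<mu> * dd m\<rfloor> - K) / dd m) \<longlonglongrightarrow> \<mu>"
proof (rule tendsto_sandwich)
  have d0: "\<forall>\<^sub>F m in sequentially. dd m > 0" using dd_at_top by (simp add: filterlim_at_top_dense)
  show "\<forall>\<^sub>F m in sequentially. \<mu> - real (K + 1) / dd m \<le> real (nat \<lfloor>\<mu> * dd m\<rfloor> - K) / dd m" using d0
  proof eventually_elim
    case (elim m)
    have "\<mu> * dd m - real (K + 1) \<le> real (nat \<lfloor>\<mu> * dd m\<rfloor> - K)" using assms elim by linarith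
    hence "(\<mu> * dd m - real (K + 1)) / dd m \<le> real (nat \<lfloor>\<mu> * dd m\<rfloor> - K) / dd m" using elim by (intro divide_right_mono) auto
    thus ?case using elim by (simp add: diff_divide_distrib)
  qed
  show "\<forall>\<^sub>F m in sequentially. real (nat \<lfloor>\<mu> * dd m\<rfloor> - K) / dd m \<le> \<mu>" using d0
  proof eventually_elim
    case (elim m)
    have "\<mu> * dd m > 0" using assms elim by simp
    hence "real (nat \<lfloor>\<mu> * dd m\<rfloor> - K) \<le> \<mu> * dd m" by linarith
    thus ?case using elim by (simp add: divide_le_eq)
  qed
  show "(\<lambda>m. \<mu> - real (K + 1) / dd m) \<longlonglongrightarrow> \<mu>" using tendsto_diff[OF tendsto_const lim_over_dd, of \<mu> "real (K + 1)"] by simp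
qed simp

text \<open>Square roots of the limiting arities in units of \<open>d\<close>:
  \<open>\<beta>\<close> at the root, \<open>1 / q\<^sup>2\<close> on odd levels (first part),
  \<open>q\<^sup>2\<close> on the remaining even ones (second part).\<close>

definition sg :: "real \<Rightarrow> nat \<Rightarrow> real" where
  "sg \<beta> i = (if i = 0 then sqrt \<beta> else if odd i then 1 / q else q)"

text \<open>\<open>\<nu>\<close> precedes \<open>K\<close>, \<open>a\<close> and
  \<open>\<epsilon>\<close>, as one exponent has to serve every accuracy. The surroundings of a
  heavy vertex are a tree because a cycle near it would be a dense cluster; vertices of too small
  degree are pruned, at the price of boundedly many children per node.\<close>

lemma heavy_tree:
  assumes \<beta>: "\<beta> > q\<^sup>2" "b * rate \<beta> (q\<^sup>2) < 1"
  shows "\<exists>\<nu>>0. \<forall>K a \<epsilon>. (\<forall>i. a i \<ge> 0) \<longrightarrow> \<epsilon> > 0 \<longrightarrow> (\<forall>\<^sub>F m in sequentially.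
    MM m {A. lambda1 (NN m) (centH (nn m) (pp m) (dd m) A) * (\<Sum>i\<le>K. (a i)\<^sup>2) < 2 * (\<Sum>i<K. a i * a (Suc i) * sg \<beta> i) - \<epsilon>}
      \<le> real (NN m) powr (- \<nu>))"
proof -
  have q: "q \<ge> 1" "q > 0" and q2: "q\<^sup>2 \<ge> 1" "q\<^sup>2 > 0" using q_ge1 by (auto simp: zero_less_power2)
  have iq: "1 / q\<^sup>2 > 0" "1 / q\<^sup>2 \<le> 1" using q2 by auto
  have \<beta>1: "\<beta> > 1 / q\<^sup>2" "\<beta> > 0" using \<beta>(1) q2 iq by linarith+
  let ?H = "\<lambda>m. centH (nn m) (pp m) (dd m)"
  let ?G = "\<lambda>m. gset (nn m) m"
  have rp: "rate \<beta> (1 / q\<^sup>2) > 0" "rate \<beta> (q\<^sup>2) > 0" using \<beta> \<beta>1 q2 by (auto intro!: rate_pos)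
  \<comment> \<open>The price of one heavy vertex, positive on both sides as \<open>\<beta>\<close>
    exceeds both means. A subgraph that contains one and has no fewer edges than vertices is a dense
    cluster with margin \<open>c0\<close>.\<close>
  define c0 where "c0 = b * min (rate \<beta> (1 / q\<^sup>2)) (rate \<beta> (q\<^sup>2)) / 2"
  have c0: "c0 > 0" using rp b by (simp add: c0_def)
  have c0r: "c0 < b * rate \<beta> (1 / q\<^sup>2)" "c0 < b * rate \<beta> (q\<^sup>2)"
  proof -
    have "b * min (rate \<beta> (1 / q\<^sup>2)) (rate \<beta> (q\<^sup>2)) \<le> b * rate \<beta> (1 / q\<^sup>2)"
      "b * min (rate \<beta> (1 / q\<^sup>2)) (rate \<beta> (q\<^sup>2)) \<le> b * rate \<beta> (q\<^sup>2)" using b by (auto intro!: mult_left_mono)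
    moreover have "b * min (rate \<beta> (1 / q\<^sup>2)) (rate \<beta> (q\<^sup>2)) = 2 * c0" by (simp add: c0_def)
    ultimately show "c0 < b * rate \<beta> (1 / q\<^sup>2)" "c0 < b * rate \<beta> (q\<^sup>2)" using c0 by linarith+
  qed
  define \<nu>0 where "\<nu>0 = min (c0 / 2) (1/4)"
  have \<nu>0: "\<nu>0 > 0" "\<nu>0 \<le> c0 / 2" "\<nu>0 \<le> 1/4" using c0 unfolding \<nu>0_def min_def by auto
  have "\<forall>\<^sub>F m in sequentially.
    MM m {A. lambda1 (NN m) (?H m A) * (\<Sum>i\<le>K. (a i)\<^sup>2) < 2 * (\<Sum>i<K. a i * a (Suc i) * sg \<beta> i) - \<epsilon>} \<le> real (NN m) powr (- (\<nu>0 / 2))"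
    if a: "\<forall>i. a i \<ge> 0" and \<epsilon>: "\<epsilon> > 0" for K a and \<epsilon> :: real
  proof -
    define Z where "Z = 2 * (\<Sum>i<K. a i * a (Suc i) * sg \<beta> i)"
    define M where "M = (\<lambda>(t :: real) (i :: nat). if i = 0 then \<beta> else if odd i then (1 - t) * (1 / q\<^sup>2) else (1 - t) * q\<^sup>2)"
    \<comment> \<open>Pruning guarantees degrees only up to a factor \<open>1 - t\<close>; by
      continuity at \<open>t = 0\<close> the loss stays below \<epsilon>.\<close>
    obtain t where t: "0 < t" "t < 1" and Zt: "2 * (\<Sum>i<K. a i * a (Suc i) * sqrt (M t i)) > Z - \<epsilon>"
    proof -
      have M0: "((\<lambda>t. M t i) \<longlongrightarrow> M 0 i) (at_right 0)" for i
        unfolding M_def by (cases "i = 0"; cases "odd i") (use q in \<open>auto intro!: tendsto_eq_intros\<close>)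
      have sM: "sqrt (M 0 i) = sg \<beta> i" for i using q by (simp add: M_def sg_def real_sqrt_divide)
      have "((\<lambda>t. 2 * (\<Sum>i<K. a i * a (Suc i) * sqrt (M t i))) \<longlongrightarrow> 2 * (\<Sum>i<K. a i * a (Suc i) * sqrt (M 0 i))) (at_right 0)"
        by (intro tendsto_intros M0)
      hence "((\<lambda>t. 2 * (\<Sum>i<K. a i * a (Suc i) * sqrt (M t i))) \<longlongrightarrow> Z) (at_right 0)" by (simp only: sM Z_def)
      hence "\<forall>\<^sub>F t in at_right 0. 2 * (\<Sum>i<K. a i * a (Suc i) * sqrt (M t i)) > Z - \<epsilon>"
        by (rule order_tendstoD(1)) (use \<epsilon> in simp)
      moreover have "\<forall>\<^sub>F t in at_right (0::real). t < 1"
        unfolding eventually_at_right_field by (intro exI[of _ 1]) auto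
      moreover have "\<forall>\<^sub>F t in at_right (0::real). t > 0" by (rule eventually_at_right_less)
      ultimately have "\<forall>\<^sub>F t in at_right 0. 2 * (\<Sum>i<K. a i * a (Suc i) * sqrt (M t i)) > Z - \<epsilon> \<and> t < 1 \<and> t > 0"
        by eventually_elim simp
      thus ?thesis using that eventually_happens'[OF trivial_limit_at_right_real] by blast
    qed
    define a1 where "a1 = (1 - t) * (1 / q\<^sup>2)"
    define a2 where "a2 = (1 - t) * q\<^sup>2"
    have a12: "0 < a1" "0 < a2" using t q2 by (auto simp: a1_def a2_def)
    have a12': "a1 < 1 / q\<^sup>2" "a2 < q\<^sup>2"
    proof -
      have "(1 - t) * (1 / q\<^sup>2) < 1 * (1 / q\<^sup>2)" "(1 - t) * q\<^sup>2 < 1 * q\<^sup>2" using t iq q2 by (intro mult_strict_right_mono; simp)+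
      thus "a1 < 1 / q\<^sup>2" "a2 < q\<^sup>2" by (auto simp: a1_def a2_def)
    qed
    have rp': "rate a1 (1 / q\<^sup>2) > 0" "rate a2 (q\<^sup>2) > 0" using a12 a12' iq q2 by (auto intro!: rate_pos)
    define c where "c = b * min (rate a1 (1 / q\<^sup>2)) (rate a2 (q\<^sup>2)) / 2"
    have c: "c > 0" using rp' b by (simp add: c_def)
    have cr: "c < b * rate a1 (1 / q\<^sup>2)" "c < b * rate a2 (q\<^sup>2)"
    proof -
      have "b * min (rate a1 (1 / q\<^sup>2)) (rate a2 (q\<^sup>2)) \<le> b * rate a1 (1 / q\<^sup>2)"
        "b * min (rate a1 (1 / q\<^sup>2)) (rate a2 (q\<^sup>2)) \<le> b * rate a2 (q\<^sup>2)" using b by (auto intro!: mult_left_mono)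
      moreover have "b * min (rate a1 (1 / q\<^sup>2)) (rate a2 (q\<^sup>2)) = 2 * c" by (simp add: c_def)
      ultimately show "c < b * rate a1 (1 / q\<^sup>2)" "c < b * rate a2 (q\<^sup>2)" using c by linarith+
    qed
    define k where "k = nat \<lceil>3 / (2 * c)\<rceil>"
    have "real k \<ge> 3 / (2 * c)" unfolding k_def by (rule real_nat_ceiling_ge)
    hence k: "c * real k \<ge> 3 / 2" using c by (simp add: field_simps)
    define f0 where "f0 = 2 * K + k"
    \<comment> \<open>One neighbour is the parent and fewer than \<open>k\<close> are
      pruned.\<close>
    define ks where "ks = (\<lambda>m i. nat \<lfloor>M t i * dd m\<rfloor> - (k + 1))"
    have Mpos: "M t i > 0" for i using t q2 \<beta>1 by (simp add: M_def)
    have kl: "(\<lambda>m. real (ks m i) / dd m) \<longlonglongrightarrow> M t i" for i unfolding ks_def by (rule floor_ratio_lim[OF Mpos])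
    define B where "B = (\<lambda>m. tset m a1 a2)"
    define S where "S = (\<lambda>m. tset m \<beta> \<beta>)"
    have E1: "\<forall>\<^sub>F m in sequentially. MM m {A. \<forall>j<m. real (dg (?G m A) (nn m + j)) < \<beta> * dd m} \<le> real (NN m) powr (- 1)"
      by (rule ev_heavy[OF \<beta>1(2) \<beta>(2)])
    have E2: "\<forall>\<^sub>F m in sequentially. MM m {A. \<exists>F J. dense_cluster f0 c0 c0 (?G m A) (S m A) F J} \<le> real (NN m) powr (- (c0 / 2))"
      unfolding S_def by (rule ev_dense[OF \<beta>1(2) \<beta>1(2) c0r c0])
    have E3: "\<forall>\<^sub>F m in sequentially. MM m {A. \<exists>F J. dense_cluster f0 c (1/2) (?G m A) (B m A) F J} \<le> real (NN m) powr (- (1/2/2))"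
      unfolding B_def by (rule ev_dense[OF a12 cr]) simp
    have P1: "\<forall>\<^sub>F m in sequentially. \<forall>i\<in>{..<K}. real (ks m i) / dd m > 0"
      by (intro eventually_ball_finite ballI order_tendstoD(1)[OF kl Mpos]) simp
    define err where "err = (\<lambda>m. pp m / sqrt (dd m) * real (\<Sum>i\<le>K. \<Prod>j<i. ks m j))"
    \<comment> \<open>The tree has at most a power of \<open>dd m\<close> many nodes, while
      \<open>pp m\<close> decays like log N / N.\<close>
    have errl: "err \<longlonglongrightarrow> 0"
    proof -
      have "(\<lambda>m. \<Sum>i\<le>K. (\<Prod>j<i. real (ks m j) / dd m) * (pp m / sqrt (dd m) * dd m ^ i)) \<longlonglongrightarrow> (\<Sum>i\<le>K. (\<Prod>j<i. M t j) * 0)"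
        by (intro tendsto_sum tendsto_mult tendsto_prod kl pp_dd_power)
      moreover have "\<forall>\<^sub>F m in sequentially. (\<Sum>i\<le>K. (\<Prod>j<i. real (ks m j) / dd m) * (pp m / sqrt (dd m) * dd m ^ i)) = err m"
        using ev_basic
      proof eventually_elim
        case (elim m)
        have d: "dd m > 0" using elim by linarith
        have "(\<Prod>j<i. real (ks m j) / dd m) * (pp m / sqrt (dd m) * dd m ^ i) = pp m / sqrt (dd m) * (\<Prod>j<i. real (ks m j))" for i
          using d by (simp add: prod_dividef)
        hence "(\<Sum>i\<le>K. (\<Prod>j<i. real (ks m j) / dd m) * (pp m / sqrt (dd m) * dd m ^ i))
            = (\<Sum>i\<le>K. pp m / sqrt (dd m) * (\<Prod>j<i. real (ks m j)))" by (simp only:)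
        thus ?case unfolding err_def of_nat_sum of_nat_prod sum_distrib_left .
      qed
      ultimately show ?thesis by (simp add: Lim_transform_eventually)
    qed
    have "(\<lambda>m. 2 * (\<Sum>i<K. a i * a (Suc i) * sqrt (real (ks m i) / dd m)) - err m * (\<Sum>i\<le>K. (a i)\<^sup>2))
      \<longlonglongrightarrow> 2 * (\<Sum>i<K. a i * a (Suc i) * sqrt (M t i)) - 0 * (\<Sum>i\<le>K. (a i)\<^sup>2)"
      by (intro tendsto_intros kl errl)
    hence P2: "\<forall>\<^sub>F m in sequentially. 2 * (\<Sum>i<K. a i * a (Suc i) * sqrt (real (ks m i) / dd m)) - err m * (\<Sum>i\<le>K. (a i)\<^sup>2) > Z - \<epsilon>"
      by (rule order_tendstoD(1)) (use Zt in simp)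
    have "\<nu>0 / 2 < \<nu>0" using \<nu>0 by simp
    note P3 = ev_powr_cmp[OF this, of 3 0]
    show ?thesis unfolding Z_def[symmetric] using E1 E2 E3 P1 P2 P3 ev_basic
    proof eventually_elim
      case (elim m)
      note ba = elim(7)
      define B1 where "B1 = {A. \<forall>j<m. real (dg (?G m A) (nn m + j)) < \<beta> * dd m}"
      define B2 where "B2 = {A. \<exists>F J. dense_cluster f0 c0 c0 (?G m A) (S m A) F J}"
      define B3 where "B3 = {A. \<exists>F J. dense_cluster f0 c (1/2) (?G m A) (B m A) F J}"
      have d: "dd m > 4" and pp: "0 \<le> pp m" "pp m \<le> 1" and N1: "real (NN m) \<ge> 1" using ba by linarith+
      have good: "lambda1 (NN m) (?H m A) * (\<Sum>i\<le>K. (a i)\<^sup>2) \<ge> Z - \<epsilon>" if A: "A \<notin> B1" "A \<notin> B2" "A \<notin> B3" for A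
      proof -
        obtain j where j: "j < m" "real (dg (?G m A) (nn m + j)) \<ge> \<beta> * dd m" using A(1) by (auto simp: B1_def not_less)
        define x where "x = nn m + j"
        have x: "nn m \<le> x" "x < nn m + m" using j by (auto simp: x_def)
        have xS: "x \<in> S m A" unfolding S_def tset_heavy[OF \<beta>1(1) \<beta>(1)] using x j(2) by (simp add: NN_def side_def x_def)
        have acyclic: "card F < card (verts F)" if F: "F \<subseteq> ?G m A" "card F \<le> f0" "x \<in> verts F" for F
        proof (rule ccontr)
          assume "\<not> card F < card (verts F)"
          hence "dense_cluster f0 c0 c0 (?G m A) (S m A) F {x}" using F xS by (simp add: dense_cluster_def)
          thus False using A(2) by (auto simp: B2_def)
        qed
        have kids: "ks m i \<le> card {y. ed (hd p) y \<in> ?G m A \<and> y \<notin> B m A \<and> (i > 0 \<longrightarrow> y \<noteq> p ! 1)}"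
          if i: "i < K" and p: "tree_path (?G m A) (B m A) x i p" for i p
        proof -
          let ?v = "hd p"
          have p': "length p = Suc i" "last p = x" "wed p \<subseteq> ?G m A" "set (butlast p) \<inter> B m A = {}" using p by (auto simp: tree_path_def)
          have pne: "p \<noteq> []" using p'(1) by auto
          have v: "?v < nn m + m" "?v < nn m \<longleftrightarrow> even (Suc i)"
            using path_parity[OF gset_subset pne p'(3,2) x] p'(1) by auto
          have deg: "M t i * dd m \<le> real (dg (?G m A) ?v)"
          proof (cases "i = 0")
            case True
            hence "?v = x" using p'(1,2) by (cases p) auto
            thus ?thesis using True j(2) by (simp add: M_def x_def)
          next
            case False
            have "?v \<in> set (butlast p)" using p'(1) False by (cases p) auto
            hence "?v \<notin> B m A" using p'(4) by blast
            hence "real (dg (?G m A) ?v) > side m a1 a2 ?v * dd m"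
              unfolding B_def tset_light[OF a12(1) a12'(1) a12(2) a12'(2)] using v(1) by (simp add: NN_def)
            moreover have "side m a1 a2 ?v = M t i" using False v(2) by (simp add: side_def M_def a1_def a2_def)
            ultimately show ?thesis by simp
          qed
          have star: "card {y. ed ?v y \<in> ?G m A \<and> y \<in> B m A} < k"
          proof (rule few_exceptional_neighbours[OF v(1) _ _ k])
            show "\<not> dense_cluster f0 c (1/2) (?G m A) (B m A) F J" for F J using A(3) by (auto simp: B3_def)
          qed (simp add: f0_def)
          have fin: "finite {y. ed ?v y \<in> ?G m A \<and> y \<in> B m A}"
            by (rule finite_subset[OF _ card_neighbours(1)[OF v(1)]]) auto
          let ?X = "insert (p ! 1) {y. ed ?v y \<in> ?G m A \<and> y \<in> B m A}"
          have "card ?X \<le> k + 1" using star fin by (simp add: card_insert_if)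
          moreover have "nat \<lfloor>M t i * dd m\<rfloor> \<le> card {y. ed ?v y \<in> ?G m A}"
            unfolding card_neighbours(2)[OF v(1)] using deg by linarith
          ultimately have "ks m i \<le> card {y. ed ?v y \<in> ?G m A} - card ?X" unfolding ks_def by linarith
          also have "\<dots> \<le> card ({y. ed ?v y \<in> ?G m A} - ?X)" by (rule diff_card_le_card_Diff) (use fin in simp)
          also have "\<dots> \<le> card {y. ed ?v y \<in> ?G m A \<and> y \<notin> B m A \<and> (i > 0 \<longrightarrow> y \<noteq> p ! 1)}"
            by (rule card_mono) (auto intro: finite_subset[OF _ card_neighbours(1)[OF v(1)]])
          finally show ?thesis .
        qed
        have "2 * (\<Sum>i<K. a i * a (Suc i) * sqrt (real (ks m i) / dd m)) - pp m / sqrt (dd m) * real (\<Sum>i\<le>K. \<Prod>j<i. ks m j) * (\<Sum>i\<le>K. (a i)\<^sup>2)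
          \<le> lambda1 (nn m + m) (?H m A) * (\<Sum>i\<le>K. (a i)\<^sup>2)"
        proof (rule rayleigh_tree_bound[OF _ x(2) pp _ acyclic _ kids])
          show "ks m i \<ge> 1" if "i < K" for i
          proof (rule ccontr)
            assume "\<not> 1 \<le> ks m i"
            hence "ks m i = 0" by simp
            moreover have "real (ks m i) / dd m > 0" using elim(4) that by simp
            ultimately show False by simp
          qed
          show "2 * K \<le> f0" by (simp add: f0_def)
        qed (use d a ba in auto)
        thus ?thesis using elim(5) by (simp add: err_def NN_def)
      qed
      have "{A. lambda1 (NN m) (?H m A) * (\<Sum>i\<le>K. (a i)\<^sup>2) < Z - \<epsilon>} \<subseteq> B1 \<union> B2 \<union> B3"
        using good by (auto simp: not_less[symmetric])
      hence "MM m {A. lambda1 (NN m) (?H m A) * (\<Sum>i\<le>K. (a i)\<^sup>2) < Z - \<epsilon>} \<le> MM m (B1 \<union> B2 \<union> B3)"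
        by (rule measure_pmf.finite_measure_mono) simp
      also have "\<dots> \<le> MM m B1 + MM m B2 + MM m B3"
        using prob_Un_le[of _ "B1 \<union> B2" B3] prob_Un_le[of _ B1 B2] by (smt (verit))
      also have "\<dots> \<le> real (NN m) powr (- \<nu>0) + real (NN m) powr (- \<nu>0) + real (NN m) powr (- \<nu>0)"
      proof -
        have "real (NN m) powr (- 1) \<le> real (NN m) powr (- \<nu>0)" "real (NN m) powr (- (1/2/2)) \<le> real (NN m) powr (- \<nu>0)"
          "real (NN m) powr (- (c0 / 2)) \<le> real (NN m) powr (- \<nu>0)"
          by (rule powr_mono[OF _ N1], use \<nu>0 in linarith)+
        thus ?thesis using elim(1-3) unfolding B1_def B2_def B3_def by linarith
      qed
      also have "\<dots> \<le> real (NN m) powr (- (\<nu>0 / 2))" using elim(6) by simp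
      finally show ?case .
    qed
  qed
  thus ?thesis using \<nu>0(1) by (intro exI[of _ "\<nu>0 / 2"]) auto
qed

section \<open>Test profiles on the tree\<close>

lemma heavier_root:
  assumes "a > 0" "b * rate a (q\<^sup>2) < 1"
  obtains \<beta> where "\<beta> > a" "b * rate \<beta> (q\<^sup>2) < 1"
proof -
  have q2: "q\<^sup>2 > 0" using q_ge1 by simp
  have "((\<lambda>\<beta>. b * (\<beta> * ln (\<beta> / q\<^sup>2) - \<beta> + q\<^sup>2)) \<longlongrightarrow> b * (a * ln (a / q\<^sup>2) - a + q\<^sup>2)) (at_right a)"
    using assms(1) q2 by (intro tendsto_intros) auto
  hence "((\<lambda>\<beta>. b * rate \<beta> (q\<^sup>2)) \<longlongrightarrow> b * rate a (q\<^sup>2)) (at_right a)" by (simp add: rate_def)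
  hence "\<forall>\<^sub>F \<beta> in at_right a. b * rate \<beta> (q\<^sup>2) < 1" using assms(2) by (rule order_tendstoD(2))
  moreover have "\<forall>\<^sub>F \<beta> in at_right a. \<beta> > a" by (rule eventually_at_right_less)
  ultimately have "\<forall>\<^sub>F \<beta> in at_right a. b * rate \<beta> (q\<^sup>2) < 1 \<and> \<beta> > a" by eventually_elim simp
  thus ?thesis using that eventually_happens'[OF trivial_limit_at_right_real] by blast
qed

text \<open>A root of amplitude \<open>\<alpha>\<close> is put above an
  \<open>alternating_profile\<close>. Its contribution
  \<open>2 * \<alpha> * w 0 * sqrt \<beta>\<close> competes with the loss
  \<open>q * (w 0)\<^sup>2\<close> at the first level.\<close>

lemma root_profile:
  fixes \<alpha> h :: real and w a :: "nat \<Rightarrow> real"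
  assumes "\<And>i. i < k \<Longrightarrow> w i - w (Suc i) = h"
  defines "a \<equiv> \<lambda>i. case i of 0 \<Rightarrow> \<alpha> | Suc i \<Rightarrow> w i"
  shows "2 * (\<Sum>i<Suc k. a i * a (Suc i) * sg \<beta> i) \<ge> 2 * \<alpha> * w 0 * sqrt \<beta>
    + (q + 1 / q) * ((\<Sum>i\<le>Suc k. (a i)\<^sup>2) - \<alpha>\<^sup>2) - q * (w 0)\<^sup>2 - q * (w k)\<^sup>2 - h\<^sup>2 * q * real k"
proof -
  define s where "s = (\<lambda>i :: nat. if odd i then 1 / q else q)"
  have "2 * (\<Sum>i<k. w i * w (Suc i) * s (Suc i)) \<ge>
    (q + 1 / q) * (\<Sum>i\<le>k. (w i)\<^sup>2) - q * (w 0)\<^sup>2 - s (Suc k) * (w k)\<^sup>2 - h\<^sup>2 * q * real k"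
    by (rule alternating_profile[of q s k w h, OF q_ge1 _ assms(1)]) (simp_all add: s_def)
  moreover have "s (Suc k) * (w k)\<^sup>2 \<le> q * (w k)\<^sup>2"
  proof (rule mult_right_mono)
    have "1 / q \<le> 1" using q_ge1 by simp
    hence "1 / q \<le> q" using q_ge1 by linarith
    thus "s (Suc k) \<le> q" unfolding s_def by (cases "odd (Suc k)") simp_all
  qed simp
  moreover have "2 * (\<Sum>i<Suc k. a i * a (Suc i) * sg \<beta> i) = 2 * \<alpha> * w 0 * sqrt \<beta> + 2 * (\<Sum>i<k. w i * w (Suc i) * s (Suc i))"
    unfolding sum.lessThan_Suc_shift by (simp add: a_def sg_def s_def)
  moreover have "(\<Sum>i\<le>Suc k. (a i)\<^sup>2) - \<alpha>\<^sup>2 = (\<Sum>i\<le>k. (w i)\<^sup>2)"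
    unfolding sum.atMost_Suc_shift by (simp add: a_def)
  ultimately show ?thesis by (simp only:)
qed

lemma lower_tail:
  "\<exists>\<nu>>0. \<forall>\<epsilon>>0. \<forall>\<^sub>F m in sequentially.
    MM m {A. lambda1 (NN m) (centH (nn m) (pp m) (dd m) A) < q + 1 / q - \<epsilon>} \<le> real (NN m) powr (- \<nu>)"
proof -
  have q2: "q\<^sup>2 > 0" using q_ge1 by simp
  \<comment> \<open>The rate vanishes at the mean, so a root slightly above it is available for
    every \<open>b\<close>. The root itself gets amplitude 0.\<close>
  have "b * rate (q\<^sup>2) (q\<^sup>2) < 1" using q2 by (simp add: rate_def)
  then obtain \<beta> where \<beta>: "\<beta> > q\<^sup>2" "b * rate \<beta> (q\<^sup>2) < 1" using heavier_root[OF q2] by blast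
  obtain \<nu> where \<nu>: "\<nu> > 0" and main: "\<And>K a \<epsilon>. \<forall>i. a i \<ge> 0 \<Longrightarrow> \<epsilon> > 0 \<Longrightarrow> \<forall>\<^sub>F m in sequentially.
    MM m {A. lambda1 (NN m) (centH (nn m) (pp m) (dd m) A) * (\<Sum>i\<le>K. (a i)\<^sup>2) < 2 * (\<Sum>i<K. a i * a (Suc i) * sg \<beta> i) - \<epsilon>}
      \<le> real (NN m) powr (- \<nu>)" using heavy_tree[OF \<beta>] by blast
  have "\<forall>\<^sub>F m in sequentially. MM m {A. lambda1 (NN m) (centH (nn m) (pp m) (dd m) A) < q + 1 / q - \<epsilon>} \<le> real (NN m) powr (- \<nu>)"
    if \<epsilon>: "\<epsilon> > 0" for \<epsilon>
  proof -
    \<comment> \<open>The two ends lose \<open>2 * q\<close> and \<open>heavy_tree\<close> loses 1;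
      spread over \<open>k + 1\<close> levels this is at most \<epsilon>.\<close>
    define k where "k = nat \<lceil>(2 * q + 1) / \<epsilon>\<rceil>"
    have "real k \<ge> (2 * q + 1) / \<epsilon>" unfolding k_def by (rule real_nat_ceiling_ge)
    hence k: "\<epsilon> * real (k + 1) \<ge> 2 * q + 1" using \<epsilon> by (simp add: field_simps)
    define a :: "nat \<Rightarrow> real" where "a = (\<lambda>i. case i of 0 \<Rightarrow> 0 | Suc i \<Rightarrow> 1)"
    have S: "(\<Sum>i\<le>Suc k. (a i)\<^sup>2) = real (k + 1)" unfolding sum.atMost_Suc_shift by (simp add: a_def)
    have "2 * (\<Sum>i<Suc k. a i * a (Suc i) * sg \<beta> i) \<ge> 2 * 0 * 1 * sqrt \<beta>
      + (q + 1 / q) * ((\<Sum>i\<le>Suc k. (a i)\<^sup>2) - 0\<^sup>2) - q * 1\<^sup>2 - q * 1\<^sup>2 - 0\<^sup>2 * q * real k"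
      unfolding a_def by (rule root_profile) simp
    hence L: "2 * (\<Sum>i<Suc k. a i * a (Suc i) * sg \<beta> i) \<ge> (q + 1 / q) * real (k + 1) - 2 * q" unfolding S by simp
    have "\<forall>i. a i \<ge> 0" by (auto simp: a_def split: nat.split)
    from main[OF this zero_less_one, of "Suc k"] show ?thesis
    proof eventually_elim
      case (elim m)
      have "MM m {A. lambda1 (NN m) (centH (nn m) (pp m) (dd m) A) < q + 1 / q - \<epsilon>}
         \<le> MM m {A. lambda1 (NN m) (centH (nn m) (pp m) (dd m) A) * (\<Sum>i\<le>Suc k. (a i)\<^sup>2) < 2 * (\<Sum>i<Suc k. a i * a (Suc i) * sg \<beta> i) - 1}"
      proof (rule measure_pmf.finite_measure_mono)
        show "{A. lambda1 (NN m) (centH (nn m) (pp m) (dd m) A) < q + 1 / q - \<epsilon>}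
          \<subseteq> {A. lambda1 (NN m) (centH (nn m) (pp m) (dd m) A) * (\<Sum>i\<le>Suc k. (a i)\<^sup>2) < 2 * (\<Sum>i<Suc k. a i * a (Suc i) * sg \<beta> i) - 1}"
        proof clarify
          fix A assume "lambda1 (NN m) (centH (nn m) (pp m) (dd m) A) < q + 1 / q - \<epsilon>"
          hence "lambda1 (NN m) (centH (nn m) (pp m) (dd m) A) * real (k + 1) < (q + 1 / q - \<epsilon>) * real (k + 1)"
            by (intro mult_strict_right_mono) auto
          also have "\<dots> = (q + 1 / q) * real (k + 1) - \<epsilon> * real (k + 1)" by (rule left_diff_distrib)
          also have "\<dots> \<le> 2 * (\<Sum>i<Suc k. a i * a (Suc i) * sg \<beta> i) - 1" using L k by linarith
          finally show "lambda1 (NN m) (centH (nn m) (pp m) (dd m) A) * (\<Sum>i\<le>Suc k. (a i)\<^sup>2) < 2 * (\<Sum>i<Suc k. a i * a (Suc i) * sg \<beta> i) - 1"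
            unfolding S .
        qed
      qed simp
      thus ?case using elim by linarith
    qed
  qed
  thus ?thesis using \<nu> by blast
qed

lemma outlier:
  assumes "b * rate (1 + q\<^sup>2) (q\<^sup>2) < 1"
  shows "\<exists>\<nu>>0. \<exists>\<epsilon>>0. \<forall>\<^sub>F m in sequentially.
    MM m {A. lambda1 (NN m) (centH (nn m) (pp m) (dd m) A) \<le> q + 1 / q + \<epsilon>} \<le> real (NN m) powr (- \<nu>)"
proof -
  have q: "q \<ge> 1" "q > 0" and q2: "q\<^sup>2 > 0" using q_ge1 by auto
  have "1 + q\<^sup>2 > 0" using q2 by linarith
  then obtain \<beta> where \<beta>: "\<beta> > 1 + q\<^sup>2" "b * rate \<beta> (q\<^sup>2) < 1" using heavier_root assms by blast
  have \<beta>q: "\<beta> > q\<^sup>2" "\<beta> > 0" using \<beta>(1) q2 by linarith+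
  obtain \<nu> where \<nu>: "\<nu> > 0" and main: "\<And>K a \<epsilon>. \<forall>i. a i \<ge> 0 \<Longrightarrow> \<epsilon> > 0 \<Longrightarrow> \<forall>\<^sub>F m in sequentially.
    MM m {A. lambda1 (NN m) (centH (nn m) (pp m) (dd m) A) * (\<Sum>i\<le>K. (a i)\<^sup>2) < 2 * (\<Sum>i<K. a i * a (Suc i) * sg \<beta> i) - \<epsilon>}
      \<le> real (NN m) powr (- \<nu>)" using heavy_tree[OF \<beta>q(1) \<beta>(2)] by blast
  define lam where "lam = q + 1 / q"
  have lam: "lam > 0" using q by (simp add: lam_def add_pos_pos)
  \<comment> \<open>\<open>\<beta> / lam\<close> is the maximum of
    \<open>2 * \<alpha> * sqrt \<beta> - lam * \<alpha>\<^sup>2\<close>, attained at the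
    \<open>\<alpha>\<close> below. It exceeds the loss \<open>q\<close> because
    \<open>q * lam = 1 + q\<^sup>2\<close>.\<close>
  define g where "g = \<beta> / lam - q"
  have g: "g > 0"
  proof -
    have "q * lam = q\<^sup>2 + 1" using q by (simp add: lam_def distrib_left power2_eq_square)
    hence "q * lam < \<beta>" using \<beta>(1) by simp
    thus ?thesis using lam by (simp add: g_def pos_less_divide_eq)
  qed
  \<comment> \<open>The linear decay of the profile and its far end lose
    \<open>q / real (Suc k)\<close> together, at most half of the gain.\<close>
  define k where "k = nat \<lceil>2 * q / g\<rceil>"
  have "real k \<ge> 2 * q / g" unfolding k_def by (rule real_nat_ceiling_ge)
  hence "g * real (Suc k) \<ge> 2 * q" using g by (simp add: field_simps)
  hence kg: "q / real (Suc k) \<le> g / 2" by (simp add: field_simps)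
  define \<alpha> where "\<alpha> = sqrt \<beta> / lam"
  define h where "h = 1 / real (Suc k)"
  define w where "w = (\<lambda>i. (real (Suc k) - real i) * h)"
  \<comment> \<open>\<open>heavy_tree\<close> asks for nonnegative values at all indices;
    \<open>max 0\<close> acts only beyond the levels in use.\<close>
  define a where "a = (\<lambda>i. case i of 0 \<Rightarrow> \<alpha> | Suc i \<Rightarrow> max 0 (w i))"
  have wpos: "i \<le> k \<Longrightarrow> max 0 (w i) = w i" for i by (simp add: w_def h_def)
  have w0: "max 0 (w 0) = 1" unfolding wpos[OF le0] by (simp add: w_def h_def)
  have wk: "max 0 (w k) = h" unfolding wpos[OF order_refl] by (simp add: w_def)
  define s where "s = (\<Sum>i\<le>Suc k. (a i)\<^sup>2)"
  have s1: "s \<ge> 1"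
  proof -
    have "(a 1)\<^sup>2 \<le> s" unfolding s_def by (rule member_le_sum) auto
    thus ?thesis using w0 by (simp add: a_def)
  qed
  have "2 * (\<Sum>i<Suc k. a i * a (Suc i) * sg \<beta> i) \<ge> 2 * \<alpha> * max 0 (w 0) * sqrt \<beta>
    + (q + 1 / q) * ((\<Sum>i\<le>Suc k. (a i)\<^sup>2) - \<alpha>\<^sup>2) - q * (max 0 (w 0))\<^sup>2 - q * (max 0 (w k))\<^sup>2 - h\<^sup>2 * q * real k"
    unfolding a_def
  proof (rule root_profile)
    fix i assume "i < k"
    hence "max 0 (w i) = w i" "max 0 (w (Suc i)) = w (Suc i)" by (auto intro: wpos)
    thus "max 0 (w i) - max 0 (w (Suc i)) = h" by (simp add: w_def algebra_simps)
  qed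
  hence "2 * (\<Sum>i<Suc k. a i * a (Suc i) * sg \<beta> i) \<ge> 2 * \<alpha> * sqrt \<beta> + lam * (s - \<alpha>\<^sup>2) - q - q * h\<^sup>2 - h\<^sup>2 * q * real k"
    unfolding w0 wk lam_def[symmetric] s_def[symmetric] by simp
  moreover have "2 * \<alpha> * sqrt \<beta> + lam * (s - \<alpha>\<^sup>2) - q = lam * s + g"
    using \<beta>q(2) lam by (simp add: \<alpha>_def g_def power2_eq_square field_simps)
  moreover have "q * h\<^sup>2 + h\<^sup>2 * q * real k = q / real (Suc k)"
  proof -
    have "q * h\<^sup>2 + h\<^sup>2 * q * real k = q * h * (h * real (Suc k))" by (simp add: power2_eq_square algebra_simps)
    also have "h * real (Suc k) = 1" by (simp add: h_def)
    finally show ?thesis by (simp add: h_def)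
  qed
  ultimately have L: "2 * (\<Sum>i<Suc k. a i * a (Suc i) * sg \<beta> i) \<ge> lam * s + g / 2" using kg by linarith
  \<comment> \<open>Of the surplus \<open>g / 2\<close> the error of \<open>heavy_tree\<close> takes
    \<open>g / 4\<close>, which leaves room for \<open>g / 8\<close>.\<close>
  define \<epsilon> where "\<epsilon> = g / (8 * s)"
  have \<epsilon>: "\<epsilon> > 0" "\<epsilon> * s = g / 8" using g s1 by (auto simp: \<epsilon>_def)
  have a0: "\<forall>i. a i \<ge> 0" using lam \<beta>q by (auto simp: a_def \<alpha>_def split: nat.split)
  have "g / 4 > 0" using g by simp
  from main[OF a0 this, of "Suc k"] have "\<forall>\<^sub>F m in sequentially.
    MM m {A. lambda1 (NN m) (centH (nn m) (pp m) (dd m) A) \<le> q + 1 / q + \<epsilon>} \<le> real (NN m) powr (- \<nu>)"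
  proof eventually_elim
    case (elim m)
    have "MM m {A. lambda1 (NN m) (centH (nn m) (pp m) (dd m) A) \<le> q + 1 / q + \<epsilon>}
       \<le> MM m {A. lambda1 (NN m) (centH (nn m) (pp m) (dd m) A) * s < 2 * (\<Sum>i<Suc k. a i * a (Suc i) * sg \<beta> i) - g / 4}"
    proof (rule measure_pmf.finite_measure_mono)
      show "{A. lambda1 (NN m) (centH (nn m) (pp m) (dd m) A) \<le> q + 1 / q + \<epsilon>}
        \<subseteq> {A. lambda1 (NN m) (centH (nn m) (pp m) (dd m) A) * s < 2 * (\<Sum>i<Suc k. a i * a (Suc i) * sg \<beta> i) - g / 4}"
      proof clarify
        fix A assume "lambda1 (NN m) (centH (nn m) (pp m) (dd m) A) \<le> q + 1 / q + \<epsilon>"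
        hence "lambda1 (NN m) (centH (nn m) (pp m) (dd m) A) * s \<le> (lam + \<epsilon>) * s"
          using s1 by (intro mult_right_mono) (auto simp: lam_def)
        also have "\<dots> = lam * s + g / 8" using \<epsilon>(2) by (simp add: distrib_right)
        also have "\<dots> < 2 * (\<Sum>i<Suc k. a i * a (Suc i) * sg \<beta> i) - g / 4" using L g by linarith
        finally show "lambda1 (NN m) (centH (nn m) (pp m) (dd m) A) * s < 2 * (\<Sum>i<Suc k. a i * a (Suc i) * sg \<beta> i) - g / 4" .
      qed
    qed simp
    also have "\<dots> \<le> real (NN m) powr (- \<nu>)" using elim unfolding s_def .
    finally show ?case .
  qed
  thus ?thesis using \<nu> \<epsilon>(1) by blast
qed

end

section \<open>The transition\<close>

text \<open>\<open>e m\<close> belongs to the largest \<open>j \<le> m\<close> that is admissible at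
  \<open>m\<close>. Every fixed \<open>j\<close> is eventually admissible, so this largest one tends
  to infinity.\<close>

lemma diagonal_epsilon:
  assumes "\<And>j. \<forall>\<^sub>F m in sequentially. Q m (1 / (real j + 1))"
  shows "\<exists>e. e \<longlonglongrightarrow> (0 :: real) \<and> (\<forall>\<^sub>F m in sequentially. Q m (e m))"
proof -
  define J where "J = (\<lambda>m. {j. j \<le> m \<and> Q m (1 / (real j + 1))})"
  have fin: "finite (J m)" for m unfolding J_def by (rule finite_subset[of _ "{..m}"]) auto
  define e where "e = (\<lambda>m. 1 / (real (Max (J m)) + 1))"
  have mem: "\<forall>\<^sub>F m in sequentially. j \<in> J m" for j
    using assms[of j] eventually_ge_at_top[of j] by eventually_elim (simp add: J_def)
  have "\<forall>\<^sub>F m in sequentially. Q m (e m)"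
    using mem[of 0]
  proof eventually_elim
    case (elim m)
    have "Max (J m) \<in> J m" using fin elim by (intro Max_in) auto
    thus ?case by (simp add: J_def e_def)
  qed
  moreover have "e \<longlonglongrightarrow> 0"
  proof (rule order_tendstoI)
    fix a :: real assume "a < 0"
    moreover have "e m > 0" for m by (simp add: e_def add_nonneg_pos)
    ultimately show "\<forall>\<^sub>F m in sequentially. a < e m" using less_trans by (intro always_eventually) blast
  next
    fix a :: real assume a: "0 < a"
    obtain j where j: "inverse (real (Suc j)) < a" using reals_Archimedean[OF a] by blast
    show "\<forall>\<^sub>F m in sequentially. e m < a" using mem[of j]
    proof eventually_elim
      case (elim m)
      have "j \<le> Max (J m)" using fin elim by (rule Max_ge)
      hence "e m \<le> 1 / (real j + 1)" unfolding e_def by (intro divide_left_mono) auto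
      also have "\<dots> = inverse (real (Suc j))" by (simp add: inverse_eq_divide add.commute)
      finally show ?case using j by linarith
    qed
  qed
  ultimately show ?thesis by blast
qed

context bip_model
begin

lemma lambda1_concentrates:
  assumes "b * rate (1 + q\<^sup>2) (q\<^sup>2) > 1"
  shows "\<exists>\<nu>>0. \<exists>e. e \<longlonglongrightarrow> 0 \<and> (\<forall>\<^sub>F m in sequentially.
    MM m {A. \<bar>lambda1 (NN m) (centH (nn m) (pp m) (dd m) A) - (q + 1 / q)\<bar> \<le> e m} \<ge> 1 - real (NN m) powr (- \<nu>))"
proof -
  let ?\<mu> = "\<lambda>m A. lambda1 (NN m) (centH (nn m) (pp m) (dd m) A)"
  obtain \<nu>1 where \<nu>1: "\<nu>1 > 0" and up: "\<And>\<epsilon>. \<epsilon> > 0 \<Longrightarrow> \<forall>\<^sub>F m in sequentially.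
      MM m {A. ?\<mu> m A > q + 1 / q + \<epsilon>} \<le> real (NN m) powr (- \<nu>1)" using upper_tail[OF assms] by blast
  obtain \<nu>2 where \<nu>2: "\<nu>2 > 0" and lo: "\<And>\<epsilon>. \<epsilon> > 0 \<Longrightarrow> \<forall>\<^sub>F m in sequentially.
      MM m {A. ?\<mu> m A < q + 1 / q - \<epsilon>} \<le> real (NN m) powr (- \<nu>2)" using lower_tail by blast
  define \<nu>0 where "\<nu>0 = min \<nu>1 \<nu>2"
  have \<nu>0: "\<nu>0 > 0" "\<nu>0 \<le> \<nu>1" "\<nu>0 \<le> \<nu>2" using \<nu>1 \<nu>2 by (auto simp: \<nu>0_def)
  have "\<nu>0 / 2 < \<nu>0" using \<nu>0 by simp
  note cmp = ev_powr_cmp[OF this, of 2 0]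
  have "\<forall>\<^sub>F m in sequentially. MM m {A. \<bar>?\<mu> m A - (q + 1 / q)\<bar> \<le> 1 / (real j + 1)} \<ge> 1 - real (NN m) powr (- (\<nu>0 / 2))" for j
  proof -
    define \<epsilon> where "\<epsilon> = 1 / (real j + 1)"
    have \<epsilon>: "\<epsilon> > 0" by (simp add: \<epsilon>_def add_nonneg_pos)
    show ?thesis unfolding \<epsilon>_def[symmetric] using up[OF \<epsilon>] lo[OF \<epsilon>] cmp ev_basic
    proof eventually_elim
      case (elim m)
      have N1: "real (NN m) \<ge> 1" using elim(4) by linarith
      have "- {A. \<bar>?\<mu> m A - (q + 1 / q)\<bar> \<le> \<epsilon>} \<subseteq> {A. ?\<mu> m A > q + 1 / q + \<epsilon>} \<union> {A. ?\<mu> m A < q + 1 / q - \<epsilon>}"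
        by (auto simp: abs_le_iff)
      hence "MM m (- {A. \<bar>?\<mu> m A - (q + 1 / q)\<bar> \<le> \<epsilon>}) \<le> MM m ({A. ?\<mu> m A > q + 1 / q + \<epsilon>} \<union> {A. ?\<mu> m A < q + 1 / q - \<epsilon>})"
        by (rule measure_pmf.finite_measure_mono) simp
      also have "\<dots> \<le> MM m {A. ?\<mu> m A > q + 1 / q + \<epsilon>} + MM m {A. ?\<mu> m A < q + 1 / q - \<epsilon>}" by (rule prob_Un_le)
      also have "\<dots> \<le> real (NN m) powr (- \<nu>0) + real (NN m) powr (- \<nu>0)"
      proof -
        have "real (NN m) powr (- \<nu>1) \<le> real (NN m) powr (- \<nu>0)" "real (NN m) powr (- \<nu>2) \<le> real (NN m) powr (- \<nu>0)"
          by (rule powr_mono[OF _ N1], use \<nu>0 in linarith)+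
        thus ?thesis using elim(1,2) by linarith
      qed
      also have "\<dots> \<le> real (NN m) powr (- (\<nu>0 / 2))" using elim(3) by simp
      finally show ?case
        using measure_pmf.prob_compl[of "{A. \<bar>?\<mu> m A - (q + 1 / q)\<bar> \<le> \<epsilon>}" "bip_ER (nn m) m (pp m)"]
        unfolding Compl_eq_Diff_UNIV by simp
    qed
  qed
  from diagonal_epsilon[where Q = "\<lambda>m x. MM m {A. \<bar>?\<mu> m A - (q + 1 / q)\<bar> \<le> x} \<ge> 1 - real (NN m) powr (- (\<nu>0 / 2))", OF this]
  show ?thesis using \<nu>0(1) by (intro exI[of _ "\<nu>0 / 2"]) auto
qed

lemma lambda1_outlier:
  assumes "b * rate (1 + q\<^sup>2) (q\<^sup>2) < 1"
  shows "\<exists>\<nu>>0. \<exists>\<epsilon>>0. \<forall>\<^sub>F m in sequentially.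
    MM m {A. lambda1 (NN m) (centH (nn m) (pp m) (dd m) A) > q + 1 / q + \<epsilon>} \<ge> 1 - real (NN m) powr (- \<nu>)"
proof -
  let ?\<mu> = "\<lambda>m A. lambda1 (NN m) (centH (nn m) (pp m) (dd m) A)"
  obtain \<nu> \<epsilon> where \<nu>: "\<nu> > 0" and \<epsilon>: "\<epsilon> > 0" and ev: "\<forall>\<^sub>F m in sequentially.
    MM m {A. ?\<mu> m A \<le> q + 1 / q + \<epsilon>} \<le> real (NN m) powr (- \<nu>)" using outlier[OF assms] by blast
  have "\<forall>\<^sub>F m in sequentially. MM m {A. ?\<mu> m A > q + 1 / q + \<epsilon>} \<ge> 1 - real (NN m) powr (- \<nu>)" using ev
  proof eventually_elim
    case (elim m)
    have "- {A. ?\<mu> m A > q + 1 / q + \<epsilon>} = {A. ?\<mu> m A \<le> q + 1 / q + \<epsilon>}" by auto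
    hence "1 - MM m {A. ?\<mu> m A > q + 1 / q + \<epsilon>} = MM m {A. ?\<mu> m A \<le> q + 1 / q + \<epsilon>}"
      using measure_pmf.prob_compl[of "{A. ?\<mu> m A > q + 1 / q + \<epsilon>}" "bip_ER (nn m) m (pp m)"] by (simp add: Compl_eq_Diff_UNIV)
    thus ?case using elim by linarith
  qed
  thus ?thesis using \<nu> \<epsilon> by blast
qed

end

theorem theorem1p3:
  fixes \<gamma> b q r2 :: real and nn NN :: "nat \<Rightarrow> nat" and d p :: "nat \<Rightarrow> real"
  assumes "\<gamma> \<ge> 1" and "b > 0"
  defines "q \<equiv> \<gamma> powr (1/4)"
      and "r2 \<equiv> 1 / ((q^2 + 1) * ln (1 + q powr (-2)) - 1)"
      and "nn \<equiv> (\<lambda>m. nat \<lfloor>\<gamma> * real m\<rfloor>)"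
      and "NN \<equiv> (\<lambda>m. nn m + m)"
      and "d \<equiv> (\<lambda>m. b * ln (real (NN m)))"
      and "p \<equiv> (\<lambda>m. d m / sqrt (real m * real (nn m)))"
  shows
    "(b > r2 \<longrightarrow>
        (\<exists>\<nu>>0. \<exists>e :: nat \<Rightarrow> real. e \<longlonglongrightarrow> 0 \<and>
          (\<forall>\<^sub>F m in sequentially.
             measure_pmf.prob (bip_ER (nn m) m (p m))
               {A. \<bar>lambda1 (NN m) (centH (nn m) (p m) (d m) A) - (q + 1/q)\<bar> \<le> e m}
             \<ge> 1 - real (NN m) powr (-\<nu>))))
     \<and> (b < r2 \<longrightarrow>
        (\<exists>\<nu>>0. \<exists>\<epsilon>>0.
          (\<forall>\<^sub>F m in sequentially.
             measure_pmf.prob (bip_ER (nn m) m (p m))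
               {A. lambda1 (NN m) (centH (nn m) (p m) (d m) A) > q + 1/q + \<epsilon>}
             \<ge> 1 - real (NN m) powr (-\<nu>))))"
proof -
  interpret M: bip_model \<gamma> b using assms(1,2) by unfold_locales
  have nn: "M.nn = nn" by (simp add: fun_eq_iff M.nn_def nn_def)
  have NN: "M.NN = NN" by (simp add: fun_eq_iff M.NN_def NN_def nn)
  have d: "M.dd = d" by (simp add: fun_eq_iff M.dd_def d_def NN)
  have p: "M.pp = p" by (simp add: fun_eq_iff M.pp_def p_def d nn)
  have q: "M.q = q" by (simp add: M.q_def q_def)
  have q1: "q \<ge> 1" using M.q_ge1 by (simp add: q)
  hence q2: "q\<^sup>2 > 0" by simp
  define \<rho> where "\<rho> = rate (1 + q\<^sup>2) (q\<^sup>2)"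
  have \<rho>0: "\<rho> > 0" unfolding \<rho>_def using q2 by (intro rate_pos) linarith+
  \<comment> \<open>The linear terms of the rate at \<open>1 + q\<^sup>2\<close> with mean
    \<open>q\<^sup>2\<close> add up to -1, which makes \<open>r2\<close> the reciprocal of the
    rate.\<close>
  have "q powr (-2) = 1 / q\<^sup>2" using q1 by (simp add: powr_minus powr_numeral inverse_eq_divide)
  moreover have "(1 + q\<^sup>2) / q\<^sup>2 = 1 + 1 / q\<^sup>2" using q2 by (simp add: add_divide_distrib)
  ultimately have r2: "r2 = 1 / \<rho>" by (simp add: r2_def \<rho>_def rate_def add.commute)
  have c1: "b > r2 \<longleftrightarrow> b * \<rho> > 1" and c2: "b < r2 \<longleftrightarrow> b * \<rho> < 1"
    unfolding r2 using \<rho>0 by (simp_all add: field_simps)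
  show ?thesis
    using M.lambda1_concentrates M.lambda1_outlier unfolding nn NN d p q c1 c2 \<rho>_def by blast
qed

end
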